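(* Let $l=-\frac{d}{dt}\big(P\frac{d}{dt}+Q\big)+Q^{T}\frac{d}{dt}+R$ be a Sturm–Liouville expression on $(a,b)$ as in the context and assume that the quadratic form $u\mapsto\langle lu,u\rangle_{L^2}$ on $C_0^\infty((a,b),\mathbb{R}^n)$ is bounded from below with respect to the $L^2$ norm. Let $L_F$ be the Friedrichs extension of the minimal operator of $l$ on $(a,b)$, and for a subinterval $(c,d)\subset(a,b)$ let $L_{(c,d),F}$ be the Friedrichs extension of the minimal operator of $l$ restricted to $C_0^\infty((c,d),\mathbb{R}^n)$. Let $\Lambda_D=\mathbb{R}^n\times(0)\subset\mathbb{R}^{2n}$. (1) If $l$ is regular at $a$ (so that the Friedrichs extensions carry the Dirichlet condition at $a$), then $$\mathrm{n}_-(L_F)=\lim_{\sigma\to b^-}\mathrm{n}_-(L_{(a,\sigma),F})=\sum_{t\in(a,b)}\dim\big(\gamma(t)\Lambda_D\cap\Lambda_D\big),$$ where $\gamma$ is the fundamental matrix solution with $\gamma(a)=I$. (2) If $l$ is regular at $b$ (so that the Friedrichs extensions carry the Dirichlet condition at $b$), then $$\mathrm{n}_-(L_F)=\lim_{\sigma\to a^+}\mathrm{n}_-(L_{(\sigma,b),F})=\sum_{t\in(a,b)}\dim\big(\gamma(t)\Lambda_D\cap\Lambda_D\big),$$ where $\gamma$ is the fundamental matrix solution with $\gamma(b)=I$. All quantities are in $\mathbb{N}\cup\{+\infty\}$; neither Fredholmness nor finiteness of the Morse index is assumed.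
   Context: $a<b$ in $[-\infty,\infty]$; $P(t)$ invertible with $P^{-1}\in C^1((a,b),\mathrm{Sym}_n(\mathbb{R}))$, $Q\in C^1((a,b),\mathrm{Mat}_n(\mathbb{R}))$, $R\in C^0((a,b),\mathrm{Sym}_n(\mathbb{R}))$. The minimal operator is the closure of $l$ on $C_0^\infty$ in $L^2$. An endpoint is regular if it is finite and $P$ (as a path of invertible matrices), $Q$, $R$ are continuous up to it. $\gamma(t)\in\mathrm{GL}_{2n}(\mathbb{R})$ is the fundamental solution of the first-order (Hamiltonian) system equivalent to $lu=0$ in the variables $(u^{[1]},u)$, $u^{[1]}=Pu'+Qu$, i.e. $u'=P^{-1}(u^{[1]}-Qu)$, $(u^{[1]})'=Q^TP^{-1}(u^{[1]}-Qu)+Ru$. $\Lambda_D=\mathbb{R}^n\times(0)$ is the Dirichlet subspace $\{u=0\}$. $\mathrm{n}_-(\cdot)$ is the Morse index: the maximal dimension (possibly $+\infty$) of the negative spectral subspace. *)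

theory Defs
  imports "HOL-Analysis.Analysis"
begin

section \<open>The space of square integrable vector functions on the line\<close>

definition square_integrable :: "(real \<Rightarrow> 'a::euclidean_space) \<Rightarrow> bool" where
  "square_integrable f \<longleftrightarrow>
     f \<in> borel_measurable lborel \<and> integrable lborel (\<lambda>t. (norm (f t))\<^sup>2)"

lemma square_integrable_zero: "square_integrable (\<lambda>_. 0)"
  by (simp add: square_integrable_def)

lemma square_integrable_add:
  assumes "square_integrable f" "square_integrable g"
  shows "square_integrable (\<lambda>t. f t + g t)"
proof -
  have [measurable]: "f \<in> borel_measurable lborel" "g \<in> borel_measurable lborel"
    using assms by (auto simp: square_integrable_def)
  have "integrable lborel (\<lambda>t. 2 * (norm (f t))\<^sup>2 + 2 * (norm (g t))\<^sup>2)"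
    using assms by (auto simp: square_integrable_def)
  then have "integrable lborel (\<lambda>t. (norm (f t + g t))\<^sup>2)"
  proof (rule Bochner_Integration.integrable_bound)
    show "AE t in lborel. norm ((norm (f t + g t))\<^sup>2)
            \<le> norm (2 * (norm (f t))\<^sup>2 + 2 * (norm (g t))\<^sup>2)"
    proof (rule AE_I2)
      fix t
      have "(norm (f t + g t))\<^sup>2 \<le> (norm (f t) + norm (g t))\<^sup>2"
        by (intro power_mono norm_triangle_ineq) simp
      also have "\<dots> \<le> 2 * (norm (f t))\<^sup>2 + 2 * (norm (g t))\<^sup>2"
        using sum_squares_bound[of "norm (f t)" "norm (g t)"] by (simp add: power2_sum)
      finally show "norm ((norm (f t + g t))\<^sup>2)
          \<le> norm (2 * (norm (f t))\<^sup>2 + 2 * (norm (g t))\<^sup>2)"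
        by simp
    qed
  qed measurable
  then show ?thesis by (simp add: square_integrable_def)
qed

lemma square_integrable_scaleR:
  assumes "square_integrable f"
  shows "square_integrable (\<lambda>t. c *\<^sub>R f t)"
  using assms by (auto simp: square_integrable_def power_mult_distrib)

lemma square_integrable_uminus:
  "square_integrable f \<Longrightarrow> square_integrable (\<lambda>t. - f t)"
  by (auto simp: square_integrable_def)

lemma square_integrable_diff:
  assumes "square_integrable f" "square_integrable g"
  shows "square_integrable (\<lambda>t. f t - g t)"
  using square_integrable_add[OF assms(1) square_integrable_uminus[OF assms(2)]] by simp

lemma square_integrable_inner:
  assumes "square_integrable f" "square_integrable g"
  shows "integrable lborel (\<lambda>t. f t \<bullet> g t)"
proof -
  have [measurable]: "f \<in> borel_measurable lborel" "g \<in> borel_measurable lborel"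
    using assms by (auto simp: square_integrable_def)
  have "integrable lborel (\<lambda>t. (norm (f t))\<^sup>2 + (norm (g t))\<^sup>2)"
    using assms by (auto simp: square_integrable_def)
  then show ?thesis
  proof (rule Bochner_Integration.integrable_bound)
    show "AE t in lborel. norm (f t \<bullet> g t) \<le> norm ((norm (f t))\<^sup>2 + (norm (g t))\<^sup>2)"
    proof (rule AE_I2)
      fix t
      have "\<bar>f t \<bullet> g t\<bar> \<le> norm (f t) * norm (g t)"
        by (rule Cauchy_Schwarz_ineq2)
      also have "\<dots> \<le> (norm (f t))\<^sup>2 + (norm (g t))\<^sup>2"
        using sum_squares_bound[of "norm (f t)" "norm (g t)"]
          mult_nonneg_nonneg[OF norm_ge_zero[of "f t"] norm_ge_zero[of "g t"]] by linarith
      finally show "norm (f t \<bullet> g t) \<le> norm ((norm (f t))\<^sup>2 + (norm (g t))\<^sup>2)"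
        by simp
    qed
  qed measurable
qed

quotient_type (overloaded) 'a l2 = "real \<Rightarrow> 'a::euclidean_space" / partial:
  "\<lambda>f g. square_integrable f \<and> square_integrable g \<and> (AE t in lborel. f t = g t)"
  morphisms rep_l2 l2_class
proof (rule part_equivpI)
  show "\<exists>x::real \<Rightarrow> 'a. square_integrable x \<and> square_integrable x \<and> (AE t in lborel. x t = x t)"
    using square_integrable_zero by auto
  show "symp (\<lambda>f g::real \<Rightarrow> 'a. square_integrable f \<and> square_integrable g \<and> (AE t in lborel. f t = g t))"
    by (rule sympI) auto
  show "transp (\<lambda>f g::real \<Rightarrow> 'a. square_integrable f \<and> square_integrable g \<and> (AE t in lborel. f t = g t))"
    by (rule transpI) (auto elim: AE_mp)
qed

instantiation l2 :: (euclidean_space) real_inner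
begin

lift_definition zero_l2 :: "'a l2" is "\<lambda>_. 0"
  by (simp add: square_integrable_zero)

lift_definition plus_l2 :: "'a l2 \<Rightarrow> 'a l2 \<Rightarrow> 'a l2" is "\<lambda>f g t. f t + g t"
  by (auto intro: square_integrable_add elim: AE_mp)

lift_definition minus_l2 :: "'a l2 \<Rightarrow> 'a l2 \<Rightarrow> 'a l2" is "\<lambda>f g t. f t - g t"
  by (auto intro: square_integrable_diff elim: AE_mp)

lift_definition uminus_l2 :: "'a l2 \<Rightarrow> 'a l2" is "\<lambda>f t. - f t"
  by (auto intro: square_integrable_uminus elim: AE_mp)

lift_definition scaleR_l2 :: "real \<Rightarrow> 'a l2 \<Rightarrow> 'a l2" is "\<lambda>c f t. c *\<^sub>R f t"
  by (auto intro: square_integrable_scaleR elim: AE_mp)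

lift_definition inner_l2 :: "'a l2 \<Rightarrow> 'a l2 \<Rightarrow> real" is "\<lambda>f g. \<integral>t. f t \<bullet> g t \<partial>lborel"
proof -
  fix f f' g g' :: "real \<Rightarrow> 'a"
  assume f: "square_integrable f \<and> square_integrable f' \<and> (AE t in lborel. f t = f' t)"
    and g: "square_integrable g \<and> square_integrable g' \<and> (AE t in lborel. g t = g' t)"
  from f g have [measurable]: "f \<in> borel_measurable lborel" "f' \<in> borel_measurable lborel"
    "g \<in> borel_measurable lborel" "g' \<in> borel_measurable lborel"
    by (auto simp: square_integrable_def)
  from f g have "AE t in lborel. f t \<bullet> g t = f' t \<bullet> g' t"
    by (auto elim: AE_mp)
  then show "(\<integral>t. f t \<bullet> g t \<partial>lborel) = (\<integral>t. f' t \<bullet> g' t \<partial>lborel)"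
    by (intro integral_cong_AE) measurable
qed

definition norm_l2 :: "'a l2 \<Rightarrow> real" where
  "norm_l2 x = sqrt (x \<bullet> x)"

definition sgn_l2 :: "'a l2 \<Rightarrow> 'a l2" where
  "sgn_l2 x = inverse (norm x) *\<^sub>R x"

definition dist_l2 :: "'a l2 \<Rightarrow> 'a l2 \<Rightarrow> real" where
  "dist_l2 x y = norm (x - y)"

definition uniformity_l2 :: "('a l2 \<times> 'a l2) filter" where
  "uniformity_l2 = (INF e\<in>{0<..}. principal {(x, y). dist x y < e})"

definition open_l2 :: "'a l2 set \<Rightarrow> bool" where
  "open_l2 U \<longleftrightarrow> (\<forall>x\<in>U. eventually (\<lambda>(x', y). x' = x \<longrightarrow> y \<in> U) uniformity)"

instance
proof
  fix x y z :: "'a l2" and c d :: real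
  show "x + y + z = x + (y + z)"
    by transfer (auto intro: square_integrable_add simp: add.assoc)
  show "x + y = y + x"
    by transfer (auto intro: square_integrable_add simp: add.commute)
  show "0 + x = x"
    by transfer auto
  show "- x + x = 0"
    by transfer (auto simp: square_integrable_zero)
  show "x - y = x + - y"
    by transfer (auto dest: square_integrable_diff)
  show "c *\<^sub>R (x + y) = c *\<^sub>R x + c *\<^sub>R y"
    by transfer
      (auto intro!: square_integrable_add square_integrable_scaleR simp: scaleR_add_right[symmetric])
  show "(c + d) *\<^sub>R x = c *\<^sub>R x + d *\<^sub>R x"
    by transfer
      (auto intro!: square_integrable_scaleR simp: scaleR_add_left[symmetric])
  show "c *\<^sub>R d *\<^sub>R x = (c * d) *\<^sub>R x"
    by transfer (auto intro!: square_integrable_scaleR)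
  show "1 *\<^sub>R x = x"
    by transfer auto
  show "sgn x = inverse (norm x) *\<^sub>R x"
    by (rule sgn_l2_def)
  show "dist x y = norm (x - y)"
    by (rule dist_l2_def)
  show "uniformity = (INF e\<in>{0<..}. principal {(x, y). dist (x :: 'a l2) y < e})"
    by (rule uniformity_l2_def)
  show "open U \<longleftrightarrow> (\<forall>x\<in>U. eventually (\<lambda>(x', y). x' = x \<longrightarrow> y \<in> U) uniformity)"
    for U :: "'a l2 set"
    by (rule open_l2_def)
  show "x \<bullet> y = y \<bullet> x"
    by transfer (simp add: inner_commute)
  show "(x + y) \<bullet> z = x \<bullet> z + y \<bullet> z"
    by transfer (simp add: inner_add_left square_integrable_inner)
  show "c *\<^sub>R x \<bullet> y = c * (x \<bullet> y)"
    by transfer simp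
  show "0 \<le> x \<bullet> x"
    by transfer simp
  show "x \<bullet> x = 0 \<longleftrightarrow> x = 0"
  proof transfer
    fix f :: "real \<Rightarrow> 'a"
    assume f: "square_integrable f \<and> square_integrable f \<and> (AE t in lborel. f t = f t)"
    then have "(\<integral>t. f t \<bullet> f t \<partial>lborel) = 0 \<longleftrightarrow> (AE t in lborel. f t \<bullet> f t = 0)"
      by (intro integral_nonneg_eq_0_iff_AE square_integrable_inner) auto
    then show "(\<integral>t. f t \<bullet> f t \<partial>lborel) = 0 \<longleftrightarrow>
        square_integrable f \<and> square_integrable (\<lambda>_. 0 :: 'a) \<and> (AE t in lborel. f t = 0)"
      using f by (simp add: square_integrable_zero)
  qed
  show "norm x = sqrt (x \<bullet> x)"
    by (rule norm_l2_def)
qed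

end

text \<open>
  \<open>l2_on I\<close> is \<open>L\<^sup>2(I)\<close>, embedded into \<open>L\<^sup>2\<close> of the line by extension by zero.
\<close>

definition l2_on :: "real set \<Rightarrow> 'a::euclidean_space l2 set" where
  "l2_on I = {l2_class f |f. square_integrable f \<and> (\<forall>t. t \<notin> I \<longrightarrow> f t = 0)}"


section \<open>Unbounded operators in a real Hilbert space\<close>

text \<open>
  Operators are represented by their graphs.  The Hilbert space is a complete subspace \<open>H\<close> of an
  ambient inner product space, so that operators on different intervals live in the same type.
\<close>

text \<open>
  For the symmetric form \<open>q(x, v) = \<langle>S x, v\<rangle>\<close> on the domain of \<open>S\<close>, the sequence \<open>fst \<circ> p\<close> in the
  domain converges to \<open>x\<close> and is Cauchy with respect to \<open>q\<close>.
\<close>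

definition form_converges :: "('h::real_inner \<times> 'h) set \<Rightarrow> (nat \<Rightarrow> 'h \<times> 'h) \<Rightarrow> 'h \<Rightarrow> bool" where
  "form_converges S p x \<longleftrightarrow>
     (\<forall>k. p k \<in> S) \<and> (\<lambda>k. fst (p k)) \<longlonglongrightarrow> x \<and>
     (\<forall>e>0. \<exists>N. \<forall>k\<ge>N. \<forall>m\<ge>N. \<bar>(snd (p k) - snd (p m)) \<bullet> (fst (p k) - fst (p m))\<bar> < e)"

text \<open>
  The operator associated with the closure \<open>q'\<close> of \<open>q\<close>: it maps \<open>x\<close> to \<open>y\<close> iff \<open>x\<close> is in the domain
  of \<open>q'\<close> and \<open>q'(x, v) = \<langle>y, v\<rangle>\<close> for all \<open>v\<close> in the domain of \<open>q'\<close>, where \<open>q'(x, v)\<close> is the limit of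
  \<open>q\<close> along approximating sequences of \<open>x\<close> and \<open>v\<close>.
\<close>

definition friedrichs_extension ::
  "'h::real_inner set \<Rightarrow> ('h \<times> 'h) set \<Rightarrow> ('h \<times> 'h) set" where
  "friedrichs_extension H S = {(x, y). y \<in> H \<and>
     (\<exists>p. form_converges S p x \<and>
       (\<forall>p' v. form_converges S p' v \<longrightarrow> (\<lambda>k. snd (p k) \<bullet> fst (p' k)) \<longlonglongrightarrow> y \<bullet> v))}"

text \<open>
  Projection-valued measures on the Borel sets of the line, acting on \<open>H\<close>.  Each \<open>E S\<close> is defined
  on the ambient space and vanishes on the orthogonal complement of \<open>H\<close>.
\<close>

definition projection_valued_measure ::
  "'h::real_inner set \<Rightarrow> (real set \<Rightarrow> 'h \<Rightarrow> 'h) \<Rightarrow> bool" where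
  "projection_valued_measure H E \<longleftrightarrow>
     (\<forall>S\<in>sets borel. linear (E S) \<and> (\<forall>x. E S (E S x) = E S x) \<and>
        (\<forall>x y. E S x \<bullet> y = x \<bullet> E S y)) \<and>
     range (E UNIV) = H \<and>
     (\<forall>S x. range S \<subseteq> sets borel \<longrightarrow> disjoint_family S \<longrightarrow>
        (\<lambda>i::nat. E (S i) x) sums E (\<Union>i. S i) x)"

definition scalar_measure :: "(real set \<Rightarrow> 'h::real_inner \<Rightarrow> 'h) \<Rightarrow> 'h \<Rightarrow> real measure" where
  "scalar_measure E x = measure_of UNIV (sets borel) (\<lambda>S. ennreal (E S x \<bullet> x))"

text \<open>
  \<open>spectral_integral H E\<close> is the operator \<open>\<integral>s dE(s)\<close> with its maximal domain, all \<open>x\<close> with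
  \<open>\<integral>s\<^sup>2 d\<langle>E(s) x, x\<rangle> < \<infinity>\<close>.  It is given weakly; integration against the signed measure \<open>\<langle>E x, v\<rangle>\<close>
  is written out by polarization.
\<close>

definition spectral_integral ::
  "'h::real_inner set \<Rightarrow> (real set \<Rightarrow> 'h \<Rightarrow> 'h) \<Rightarrow> ('h \<times> 'h) set" where
  "spectral_integral H E = {(x, y). x \<in> H \<and> y \<in> H \<and>
     integrable (scalar_measure E x) (\<lambda>s. s\<^sup>2) \<and>
     (\<forall>v\<in>H. integrable (scalar_measure E v) (\<lambda>s. s\<^sup>2) \<longrightarrow>
        y \<bullet> v = ((\<integral>s. s \<partial>scalar_measure E (x + v)) - (\<integral>s. s \<partial>scalar_measure E (x - v))) / 4)}"

definition spectral_measure ::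
  "'h::real_inner set \<Rightarrow> ('h \<times> 'h) set \<Rightarrow> real set \<Rightarrow> 'h \<Rightarrow> 'h" where
  "spectral_measure H A =
     (SOME E. projection_valued_measure H E \<and> A = spectral_integral H E)"

definition negative_spectral_subspace :: "'h::real_inner set \<Rightarrow> ('h \<times> 'h) set \<Rightarrow> 'h set" where
  "negative_spectral_subspace H A = range (spectral_measure H A {..<0})"

text \<open>The library function \<open>dim\<close> is 0 on infinite-dimensional subspaces.\<close>

definition edim :: "'h::real_vector set \<Rightarrow> enat" where
  "edim V = (SUP B\<in>{B. finite B \<and> B \<subseteq> V \<and> independent B}. enat (card B))"

definition morse_index :: "'h::real_inner set \<Rightarrow> ('h \<times> 'h) set \<Rightarrow> enat" where
  "morse_index H A = edim (negative_spectral_subspace H A)"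


section \<open>Sturm--Liouville expressions\<close>

definition sl_coefficients ::
  "ereal \<Rightarrow> ereal \<Rightarrow> (real \<Rightarrow> real^'n^'n) \<Rightarrow> (real \<Rightarrow> real^'n^'n) \<Rightarrow> (real \<Rightarrow> real^'n^'n) \<Rightarrow> bool" where
  "sl_coefficients a b P Q R \<longleftrightarrow>
     (\<forall>t\<in>einterval a b. invertible (P t) \<and> transpose (matrix_inv (P t)) = matrix_inv (P t)) \<and>
     (\<lambda>t. matrix_inv (P t)) C1_differentiable_on einterval a b \<and>
     Q C1_differentiable_on einterval a b \<and>
     continuous_on (einterval a b) R \<and>
     (\<forall>t\<in>einterval a b. transpose (R t) = R t)"

definition quasi_derivative ::
  "(real \<Rightarrow> real^'n^'n) \<Rightarrow> (real \<Rightarrow> real^'n^'n) \<Rightarrow> (real \<Rightarrow> real^'n) \<Rightarrow> real \<Rightarrow> real^'n" where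
  "quasi_derivative P Q u t = P t *v vector_derivative u (at t) + Q t *v u t"

text \<open>
  For \<open>u\<close> supported in \<open>(a, b)\<close> the values of the coefficients outside \<open>(a, b)\<close> play no role: the
  quasi-derivative and the expression vanish off the support of \<open>u\<close>.
\<close>

definition sl_expression ::
  "(real \<Rightarrow> real^'n^'n) \<Rightarrow> (real \<Rightarrow> real^'n^'n) \<Rightarrow> (real \<Rightarrow> real^'n^'n) \<Rightarrow>
   (real \<Rightarrow> real^'n) \<Rightarrow> real \<Rightarrow> real^'n" where
  "sl_expression P Q R u t =
     - vector_derivative (quasi_derivative P Q u) (at t)
     + transpose (Q t) *v vector_derivative u (at t) + R t *v u t"

definition test_functions :: "ereal \<Rightarrow> ereal \<Rightarrow> (real \<Rightarrow> real^'n) set" where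
  "test_functions c d = {u.
     (\<exists>D. D 0 = u \<and> (\<forall>k t. (D k has_vector_derivative D (Suc k) t) (at t))) \<and>
     compact (closure {t. u t \<noteq> 0}) \<and> closure {t. u t \<noteq> 0} \<subseteq> einterval c d}"

definition minimal_operator ::
  "(real \<Rightarrow> real^'n^'n) \<Rightarrow> (real \<Rightarrow> real^'n^'n) \<Rightarrow> (real \<Rightarrow> real^'n^'n) \<Rightarrow>
   ereal \<Rightarrow> ereal \<Rightarrow> ((real^'n) l2 \<times> (real^'n) l2) set" where
  "minimal_operator P Q R c d =
     closure {(l2_class u, l2_class (sl_expression P Q R u)) |u. u \<in> test_functions c d}"

definition sl_friedrichs ::
  "(real \<Rightarrow> real^'n^'n) \<Rightarrow> (real \<Rightarrow> real^'n^'n) \<Rightarrow> (real \<Rightarrow> real^'n^'n) \<Rightarrow>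
   ereal \<Rightarrow> ereal \<Rightarrow> ((real^'n) l2 \<times> (real^'n) l2) set" where
  "sl_friedrichs P Q R c d =
     friedrichs_extension (l2_on (einterval c d)) (minimal_operator P Q R c d)"

definition sl_morse_index ::
  "(real \<Rightarrow> real^'n^'n) \<Rightarrow> (real \<Rightarrow> real^'n^'n) \<Rightarrow> (real \<Rightarrow> real^'n^'n) \<Rightarrow>
   ereal \<Rightarrow> ereal \<Rightarrow> enat" where
  "sl_morse_index P Q R c d =
     morse_index (l2_on (einterval c d)) (sl_friedrichs P Q R c d)"

definition sl_form_bounded_below ::
  "(real \<Rightarrow> real^'n^'n) \<Rightarrow> (real \<Rightarrow> real^'n^'n) \<Rightarrow> (real \<Rightarrow> real^'n^'n) \<Rightarrow>
   ereal \<Rightarrow> ereal \<Rightarrow> bool" where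
  "sl_form_bounded_below P Q R a b \<longleftrightarrow> (\<exists>C::real. \<forall>u\<in>test_functions a b.
     C * (\<integral>t. (norm (u t))\<^sup>2 \<partial>lborel) \<le> (\<integral>t. sl_expression P Q R u t \<bullet> u t \<partial>lborel))"

definition regular_along ::
  "(real \<Rightarrow> real^'n^'n) \<Rightarrow> (real \<Rightarrow> real^'n^'n) \<Rightarrow> (real \<Rightarrow> real^'n^'n) \<Rightarrow> real filter \<Rightarrow> bool" where
  "regular_along P Q R F \<longleftrightarrow>
     (\<exists>P0 Q0 R0. invertible P0 \<and> (P \<longlongrightarrow> P0) F \<and> (Q \<longlongrightarrow> Q0) F \<and> (R \<longlongrightarrow> R0) F)"

definition regular_left_endpoint ::
  "(real \<Rightarrow> real^'n^'n) \<Rightarrow> (real \<Rightarrow> real^'n^'n) \<Rightarrow> (real \<Rightarrow> real^'n^'n) \<Rightarrow> ereal \<Rightarrow> bool" where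
  "regular_left_endpoint P Q R a \<longleftrightarrow>
     \<bar>a\<bar> \<noteq> \<infinity> \<and> regular_along P Q R (at_right (real_of_ereal a))"

definition regular_right_endpoint ::
  "(real \<Rightarrow> real^'n^'n) \<Rightarrow> (real \<Rightarrow> real^'n^'n) \<Rightarrow> (real \<Rightarrow> real^'n^'n) \<Rightarrow> ereal \<Rightarrow> bool" where
  "regular_right_endpoint P Q R b \<longleftrightarrow>
     \<bar>b\<bar> \<noteq> \<infinity> \<and> regular_along P Q R (at_left (real_of_ereal b))"

text \<open>
  Phase space vectors \<open>(p, u)\<close> are indexed by \<open>'n + 'n\<close>: the components \<open>Inl i\<close> carry the
  quasi-derivative \<open>p = P u' + Q u\<close>, the components \<open>Inr i\<close> carry \<open>u\<close>.
\<close>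

definition block_matrix ::
  "real^'n^'n \<Rightarrow> real^'n^'n \<Rightarrow> real^'n^'n \<Rightarrow> real^'n^'n \<Rightarrow> real^('n + 'n)^('n + 'n)" where
  "block_matrix A B C D = (\<chi> i j. case (i, j) of
     (Inl k, Inl l) \<Rightarrow> A $ k $ l | (Inl k, Inr l) \<Rightarrow> B $ k $ l
   | (Inr k, Inl l) \<Rightarrow> C $ k $ l | (Inr k, Inr l) \<Rightarrow> D $ k $ l)"

text \<open>
  Coefficient matrix of \<open>p' = Q\<^sup>T P\<^sup>-\<^sup>1 (p - Q u) + R u\<close>, \<open>u' = P\<^sup>-\<^sup>1 (p - Q u)\<close>.
\<close>

definition hamiltonian_matrix ::
  "(real \<Rightarrow> real^'n^'n) \<Rightarrow> (real \<Rightarrow> real^'n^'n) \<Rightarrow> (real \<Rightarrow> real^'n^'n) \<Rightarrow>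
   real \<Rightarrow> real^('n + 'n)^('n + 'n)" where
  "hamiltonian_matrix P Q R t = (let Pi = matrix_inv (P t) in
     block_matrix
       (transpose (Q t) ** Pi) (R t - transpose (Q t) ** Pi ** Q t)
       Pi                      (- (Pi ** Q t)))"

definition fundamental_solution ::
  "(real \<Rightarrow> real^'n^'n) \<Rightarrow> (real \<Rightarrow> real^'n^'n) \<Rightarrow> (real \<Rightarrow> real^'n^'n) \<Rightarrow>
   ereal \<Rightarrow> ereal \<Rightarrow> real \<Rightarrow> (real \<Rightarrow> real^('n + 'n)^('n + 'n)) \<Rightarrow> bool" where
  "fundamental_solution P Q R a b t0 \<gamma> \<longleftrightarrow>
     \<gamma> t0 = mat 1 \<and> continuous_on (insert t0 (einterval a b)) \<gamma> \<and>
     (\<forall>t\<in>einterval a b.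
        (\<gamma> has_vector_derivative hamiltonian_matrix P Q R t ** \<gamma> t) (at t))"

definition dirichlet_subspace :: "(real^('n::finite + 'n)) set" where
  "dirichlet_subspace = {v. \<forall>i. v $ Inr i = 0}"

definition crossing_sum ::
  "ereal \<Rightarrow> ereal \<Rightarrow> (real \<Rightarrow> real^('n::finite + 'n)^('n + 'n)) \<Rightarrow> enat" where
  "crossing_sum a b \<gamma> = (\<Sum>\<^sub>\<infinity>t\<in>einterval a b.
     enat (dim ((\<lambda>v. \<gamma> t *v v) ` dirichlet_subspace \<inter> dirichlet_subspace)))"

end

theory Submission
  imports Defs "HOL-Probability.Probability" "HOL-Computational_Algebra.Polynomial"
begin

text \<open>
  The Morse index of the Friedrichs extension is the largest number of test functions on whose span the
  quadratic form of \<open>l\<close> is negative definite (theorem \<open>sl_morse_index_eq\<close>).  To obtain this from the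
  definition by spectral measures, the spectral theorem is proved for the resolvent \<open>T = (A + c)\<^sup>-\<^sup>1\<close> of the
  Friedrichs extension \<open>A\<close>.  It is a positive contraction, and the measures \<open>\<langle>E x, x\<rangle>\<close> solve a Hausdorff
  moment problem.  The substitution \<open>s = 1/t - c\<close> transports the resolution of \<open>T\<close> to \<open>A\<close>, so that a spectral
  resolution of \<open>A\<close> exists.  For any such resolution, the negative spectral subspace and negative families in the
  domain of the minimal operator have the same dimension (\<open>morse_index_friedrichs\<close>): the form is nonnegative on
  the complementary spectral subspace, and negative definiteness is stable under form approximation.

  The limit formula is then immediate.  The index is monotone in the interval, and finitely many test functions
  on \<open>(a, b)\<close> are supported in a common compact subinterval.

  For the crossing formula let \<open>U\<close> and \<open>Y\<close> be the blocks of the fundamental solution \<open>\<gamma>\<close> that give the value and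
  the momentum of the solutions starting in \<open>\<Lambda>\<^sub>D\<close>.  The crossing at \<open>t\<close> is isomorphic to the kernel of \<open>U t\<close>
  (\<open>dim_crossing\<close>).  Semiboundedness of the form forces \<open>P\<close> to be positive definite (Legendre's condition), so
  conjugate points are isolated.  They are finite in number on compact subintervals but may accumulate at
  the other endpoint.

  \<^item> Upper bound (\<open>index_upper_bound\<close>).  A test function that lies in the range of \<open>U\<close> at every
    conjugate point has a nonnegative form value, by Picone's identity.  At each conjugate point this imposes as
    many linear conditions as the dimension of the kernel.

  \<^item> Lower bound (\<open>index_lower_bound\<close>).  A vector \<open>e\<close> in the kernel of \<open>U t\<close> yields the broken solution that
    equals \<open>U e\<close> between the base point and \<open>t\<close> and vanishes beyond.  The form vanishes on the span of all of
    these, but each has a momentum jump \<open>Y t e \<noteq> 0\<close> at \<open>t\<close>, so that a small perturbation in the direction of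
    the jump makes the form negative definite.

  The index and the sum of crossings are thus suprema of the same finite numbers, which includes the case that both
  are infinite.
\<close>

section \<open>Polynomials of a positive contraction\<close>

lemma poly_measurable [measurable]: "poly (p :: real poly) \<in> borel_measurable borel"
  by (intro borel_measurable_continuous_onI continuous_intros)

text \<open>
  The condition \<open>\<parallel>T x\<parallel>\<^sup>2 \<le> \<langle>T x, x\<rangle>\<close> says \<open>0 \<le> T \<le> 1\<close> for the symmetric operator \<open>T\<close>.  It is the form
  in which resolvents of semibounded operators satisfy it.
\<close>

locale positive_contraction =
  fixes T :: "'h::{real_inner, complete_space} \<Rightarrow> 'h"
  assumes linear_T: "linear T"
    and symmetric_T: "T x \<bullet> y = x \<bullet> T y"
    and norm_le_inner_T: "(norm (T x))\<^sup>2 \<le> T x \<bullet> x"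
begin

definition opoly :: "real poly \<Rightarrow> 'h \<Rightarrow> 'h" where
  "opoly p = fold_coeffs (\<lambda>a f x. a *\<^sub>R x + T (f x)) p (\<lambda>_. 0)"

lemma T_simps: "T 0 = 0" "T (x + y) = T x + T y" "T (x - y) = T x - T y" "T (c *\<^sub>R x) = c *\<^sub>R T x"
  using linear_T by (auto simp: linear_0 linear_add linear_diff linear_scale)

lemma opoly_0: "opoly 0 x = 0" by (simp add: opoly_def)

lemma opoly_pCons: "opoly (pCons a p) x = a *\<^sub>R x + T (opoly p x)"
proof (cases "a = 0 \<and> p = 0")
  case True
  then show ?thesis by (simp add: opoly_def T_simps)
next
  case False
  then show ?thesis by (auto simp: opoly_def fold_coeffs_pCons_coeff_not_0_eq fold_coeffs_pCons_not_0_0_eq)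
qed

lemma opoly_add: "opoly (p + q) x = opoly p x + opoly q x"
  by (induction p q rule: poly_induct2) (simp_all add: opoly_0 opoly_pCons T_simps algebra_simps)

lemma opoly_smult: "opoly (smult c p) x = c *\<^sub>R opoly p x"
  by (induction p) (simp_all add: opoly_0 opoly_pCons T_simps algebra_simps)

lemma opoly_diff: "opoly (p - q) x = opoly p x - opoly q x"
proof -
  have "p - q = p + smult (- 1) q" by simp
  then show ?thesis by (simp only: opoly_add opoly_smult) simp
qed

lemma opoly_1: "opoly 1 x = x" by (simp add: one_pCons opoly_pCons opoly_0 T_simps)

lemma opoly_sum: "opoly (sum f I) x = (\<Sum>i\<in>I. opoly (f i) x)"
  by (induction I rule: infinite_finite_induct) (simp_all add: opoly_0 opoly_add)

lemma linear_opoly: "linear (opoly p)"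
proof (rule linearI)
  show "opoly p (x + y) = opoly p x + opoly p y" for x y
    by (induction p) (simp_all add: opoly_0 opoly_pCons T_simps algebra_simps)
  show "opoly p (c *\<^sub>R x) = c *\<^sub>R opoly p x" for c x
    by (induction p) (simp_all add: opoly_0 opoly_pCons T_simps algebra_simps)
qed

lemma opoly_T: "opoly p (T x) = T (opoly p x)" by (induction p) (simp_all add: opoly_0 opoly_pCons T_simps)

lemma opoly_mult: "opoly (p * q) x = opoly p (opoly q x)"
  by (induction p) (simp_all add: opoly_0 opoly_pCons opoly_add opoly_smult)

lemma symmetric_opoly: "opoly p x \<bullet> y = x \<bullet> opoly p y"
proof (induction p arbitrary: y)
  case 0
  then show ?case by (simp add: opoly_0)
next
  case (pCons a p)
  have "T (opoly p x) \<bullet> y = x \<bullet> T (opoly p y)" by (simp only: symmetric_T pCons.IH opoly_T)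
  then show ?case by (simp add: opoly_pCons inner_add_left inner_add_right)
qed

lemma inner_opoly_opoly: "opoly p x \<bullet> opoly q x = opoly (p * q) x \<bullet> x"
proof -
  have "opoly p x \<bullet> opoly q x = x \<bullet> opoly p (opoly q x)" by (rule symmetric_opoly)
  then show ?thesis by (simp only: opoly_mult inner_commute)
qed

lemma norm_opoly: "(norm (opoly p x))\<^sup>2 = opoly (p\<^sup>2) x \<bullet> x"
  unfolding power2_norm_eq_inner inner_opoly_opoly power2_eq_square[of p] ..

lemma inner_T_nonneg: "0 \<le> T x \<bullet> x" using norm_le_inner_T[of x] by (meson order_trans zero_le_power2)

lemma norm_T_le: "norm (T x) \<le> norm x"
proof -
  have "norm (T x) * norm (T x) \<le> norm (T x) * norm x"
    using norm_le_inner_T[of x] norm_cauchy_schwarz[of "T x" x] by (simp add: power2_eq_square)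
  then show ?thesis by (cases "norm (T x) = 0") auto
qed

lemma inner_T_le: "T x \<bullet> x \<le> x \<bullet> x"
proof -
  have "T x \<bullet> x \<le> norm (T x) * norm x" by (rule norm_cauchy_schwarz)
  also have "\<dots> \<le> norm x * norm x" by (intro mult_right_mono norm_T_le norm_ge_zero)
  finally show ?thesis by (simp add: dot_square_norm power2_eq_square)
qed

lemma opoly_X: "opoly [:0, 1:] x = T x" by (simp add: opoly_pCons opoly_0 T_simps)

lemma opoly_1_minus_X: "opoly [:1, - 1:] x = x - T x"
  using linear_neg[OF linear_T] by (simp add: opoly_pCons opoly_0 T_simps)

lemma opoly_square_mult: "opoly (r\<^sup>2 * p) x \<bullet> x = opoly p (opoly r x) \<bullet> opoly r x"
proof -
  have "r\<^sup>2 * p = r * (p * r)" by (simp add: power2_eq_square ac_simps)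
  then have "opoly (r\<^sup>2 * p) x \<bullet> x = opoly r (opoly p (opoly r x)) \<bullet> x" by (simp only: opoly_mult)
  also have "\<dots> = opoly p (opoly r x) \<bullet> opoly r x" by (rule symmetric_opoly)
  finally show ?thesis .
qed

text \<open>
  Even powers are absorbed into a square \<open>r\<^sup>2\<close>, which moves onto \<open>x\<close> by symmetry.  The remaining factor
  is one of \<open>1\<close>, \<open>T\<close>, \<open>1 - T\<close>, \<open>T (1 - T)\<close>, and all of these are nonnegative.
\<close>

lemma bernstein_nonneg: "0 \<le> opoly ([:0, 1:] ^ j * [:1, - 1:] ^ k) x \<bullet> x"
proof -
  define r :: "real poly" where "r = [:0, 1:] ^ (j div 2) * [:1, - 1:] ^ (k div 2)"
  define p :: "real poly" where "p = [:0, 1:] ^ (j mod 2) * [:1, - 1:] ^ (k mod 2)"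
  have eq: "[:0, 1:] ^ j * [:1, - 1:] ^ k = r\<^sup>2 * p"
  proof -
    have "([:0, 1:] :: real poly) ^ j = ([:0, 1:] ^ (j div 2))\<^sup>2 * [:0, 1:] ^ (j mod 2)"
      by (metis div_mult_mod_eq power_add power_mult)
    moreover have "([:1, - 1:] :: real poly) ^ k = ([:1, - 1:] ^ (k div 2))\<^sup>2 * [:1, - 1:] ^ (k mod 2)"
      by (metis div_mult_mod_eq power_add power_mult)
    ultimately show ?thesis unfolding r_def p_def power_mult_distrib by (simp only: ac_simps)
  qed
  have "0 \<le> opoly p z \<bullet> z" for z
  proof -
    have "opoly ([:0, 1:] * [:1, - 1:]) z \<bullet> z = T z \<bullet> z - (norm (T z))\<^sup>2"
      by (simp add: opoly_mult opoly_X opoly_1_minus_X T_simps inner_diff_left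
          power2_norm_eq_inner del: mult_pCons_left mult_pCons_right) (simp add: symmetric_T)
    then have a: "0 \<le> opoly ([:0, 1:] * [:1, - 1:]) z \<bullet> z" using norm_le_inner_T[of z] by linarith
    have "j mod 2 = 0 \<or> j mod 2 = 1" "k mod 2 = 0 \<or> k mod 2 = 1" by auto
    then show ?thesis using a inner_T_nonneg[of z] inner_T_le[of z] unfolding p_def
      by (elim disjE) (simp_all add: opoly_1 opoly_X opoly_1_minus_X inner_diff_left
          del: mult_pCons_left mult_pCons_right)
  qed
  then show ?thesis unfolding eq opoly_square_mult .
qed

end

definition bernstein :: "nat \<Rightarrow> nat \<Rightarrow> real poly" where
  "bernstein n j = smult (real (n choose j)) ([:0, 1:] ^ j * [:1, - 1:] ^ (n - j))"

lemma sum_bernstein: "(\<Sum>j\<le>n. bernstein n j) = 1"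
proof -
  have "[:0, 1:] + [:1, - 1:] = (1 :: real poly)" by (simp add: one_pCons)
  then have "(1 :: real poly) = ([:0, 1:] + [:1, - 1:]) ^ n" by (simp only: power_one)
  also have "\<dots> = (\<Sum>j\<le>n. of_nat (n choose j) * [:0, 1:] ^ j * [:1, - 1:] ^ (n - j))" by (rule binomial_ring)
  also have "\<dots> = (\<Sum>j\<le>n. bernstein n j)"
  proof (intro sum.cong refl)
    fix j
    have "of_nat c * p * q = smult (real c) (p * q)" for c and p q :: "real poly" by (simp add: of_nat_poly)
    then show "of_nat (n choose j) * [:0, 1:] ^ j * [:1, - 1:] ^ (n - j) = bernstein n j" unfolding bernstein_def .
  qed
  finally show ?thesis by simp
qed

lemma X_mult_bernstein:
  assumes "j \<le> n"
  shows "[:0, 1:] * bernstein n j = smult (real (Suc j) / real (Suc n)) (bernstein (Suc n) (Suc j))"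
proof -
  have "real (Suc j) / real (Suc n) * real (Suc n choose Suc j) = real (n choose j)"
  proof -
    have "real (Suc j) * real (Suc n choose Suc j) = real (Suc n) * real (n choose j)"
      by (metis Suc_times_binomial_eq mult.commute of_nat_mult)
    then show ?thesis by (simp add: field_simps)
  qed
  then have "smult (real (Suc j) / real (Suc n)) (bernstein (Suc n) (Suc j)) =
      smult (real (n choose j)) ([:0, 1:] ^ Suc j * [:1, - 1:] ^ (n - j))"
    by (simp only: bernstein_def smult_smult diff_Suc_Suc)
  then show ?thesis by (simp only: bernstein_def power_Suc mult_smult_right mult.assoc)
qed

text \<open>
  Bernstein coefficients of a monomial are its values at the nodes \<open>j/n\<close> up to an error of order \<open>1/n\<close>.
  This exact representation makes the moment argument purely algebraic, so that no continuous functional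
  calculus is needed.
\<close>

lemma X_power_bernstein:
  "\<exists>K. \<forall>n>m. \<exists>h. [:0, 1:] ^ m = (\<Sum>j\<le>n. smult (h j) (bernstein n j)) \<and>
      (\<forall>j\<le>n. \<bar>h j - (real j / real n) ^ m\<bar> \<le> K / real n)"
proof (induction m)
  case 0
  have "\<forall>n>0. \<exists>h. [:0, 1:] ^ 0 = (\<Sum>j\<le>n. smult (h j) (bernstein n j)) \<and>
      (\<forall>j\<le>n. \<bar>h j - (real j / real n) ^ 0\<bar> \<le> 0 / real n)"
    by (intro allI impI exI[of _ "\<lambda>_. 1"]) (simp add: sum_bernstein)
  then show ?case by blast
next
  case (Suc m)
  then obtain K where K: "\<And>n. n > m \<Longrightarrow> \<exists>h. [:0, 1:] ^ m = (\<Sum>j\<le>n. smult (h j) (bernstein n j)) \<and>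
      (\<forall>j\<le>n. \<bar>h j - (real j / real n) ^ m\<bar> \<le> K / real n)" by blast
  show ?case
  proof (intro exI[of _ "2 * K + 2 * real m"] allI impI)
    fix n' assume "n' > Suc m"
    then obtain n where n': "n' = Suc n" and n: "n > m" by (cases n') auto
    from K[OF n] obtain h where h: "[:0, 1:] ^ m = (\<Sum>j\<le>n. smult (h j) (bernstein n j))"
      and hb: "\<And>j. j \<le> n \<Longrightarrow> \<bar>h j - (real j / real n) ^ m\<bar> \<le> K / real n" by blast
    define h' where "h' j = (real j / real n') * h (j - 1)" for j
    have "[:0, 1:] ^ Suc m = (\<Sum>j\<le>n. smult (h j) ([:0, 1:] * bernstein n j))"
      unfolding power_Suc h sum_distrib_left by (simp only: mult_smult_right)
    also have "\<dots> = (\<Sum>j\<le>n. smult (h' (Suc j)) (bernstein (Suc n) (Suc j)))"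
      by (intro sum.cong refl, subst X_mult_bernstein) (simp_all add: h'_def n' mult.commute)
    also have "\<dots> = (\<Sum>j\<le>n'. smult (h' j) (bernstein n' j))"
      unfolding n' by (subst sum.atMost_Suc_shift) (simp add: h'_def)
    finally have 1: "[:0, 1:] ^ Suc m = (\<Sum>j\<le>n'. smult (h' j) (bernstein n' j))" .
    have 2: "\<bar>h' j - (real j / real n') ^ Suc m\<bar> \<le> (2 * K + 2 * real m) / real n'" if "j \<le> n'" for j
    proof (cases j)
      case 0
      have "0 \<le> K / real n" using hb[of 0] abs_ge_zero order_trans by blast
      then have "0 \<le> K" using n by (simp add: zero_le_divide_iff)
      then show ?thesis using 0 by (simp add: h'_def)
    next
      case (Suc i)
      then have i: "i \<le> n" using that n' by simp
      define x where "x = real j / real n'"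
      have x: "0 \<le> x" "x \<le> 1" using that n' by (auto simp: x_def)
      have "\<bar>real i / real n - x\<bar> \<le> 1 / real n"
      proof -
        have "real i / real n - x = (real i - real n) / (real n * (real n + 1))"
          using n unfolding x_def n' Suc by (simp add: divide_simps) (simp add: algebra_simps)
        then have "\<bar>real i / real n - x\<bar> = \<bar>real i - real n\<bar> / (real n * (real n + 1))"
          by (simp only: abs_divide abs_mult)
        also have "\<dots> \<le> (real n + 1) / (real n * (real n + 1))" using n i by (intro divide_right_mono) auto
        also have "\<dots> = 1 / real n"
          by (metis add.commute mult_divide_mult_cancel_right nonzero_mult_divide_mult_cancel_right2 of_nat_Suc of_nat_neq_0 mult_1 semiring_1_class.of_nat_simps(2))
        finally show ?thesis .
      qed
      moreover have "\<bar>(real i / real n) ^ m - x ^ m\<bar> \<le> real m * \<bar>real i / real n - x\<bar>"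
        using norm_power_diff[of "real i / real n" x m] x i n by simp
      ultimately have "\<bar>(real i / real n) ^ m - x ^ m\<bar> \<le> real m * (1 / real n)"
        by (meson mult_left_mono of_nat_0_le_iff order_trans)
      with hb[OF i] have b: "\<bar>h i - x ^ m\<bar> \<le> (K + real m) / real n" by (simp add: add_divide_distrib)
      have "h' j = x * h i" by (simp add: h'_def x_def Suc)
      then have "\<bar>h' j - x ^ Suc m\<bar> = x * \<bar>h i - x ^ m\<bar>" using x by (simp add: right_diff_distrib[symmetric] abs_mult)
      also have "\<dots> \<le> 1 * \<bar>h i - x ^ m\<bar>" using x by (intro mult_right_mono) auto
      also have "\<dots> \<le> (K + real m) / real n" using b by simp
      also have "\<dots> \<le> (2 * K + 2 * real m) / real n'"
      proof -
        have "0 \<le> (K + real m) / real n" using b abs_ge_zero order_trans by blast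
        then have "0 \<le> K + real m" using n by (simp add: zero_le_divide_iff)
        then have "(K + real m) * real n' \<le> (K + real m) * (2 * real n)" using n n' by (intro mult_left_mono) auto
        then show ?thesis using n n' by (simp add: field_simps)
      qed
      finally show ?thesis by (simp add: x_def)
    qed
    show "\<exists>h. [:0, 1:] ^ Suc m = (\<Sum>j\<le>n'. smult (h j) (bernstein n' j)) \<and>
      (\<forall>j\<le>n'. \<bar>h j - (real j / real n') ^ Suc m\<bar> \<le> (2 * K + 2 * real m) / real n')" using 1 2 by blast
  qed
qed

context positive_contraction
begin

section \<open>The spectral measure of a positive contraction\<close>

text \<open>
  The solution of a Hausdorff moment problem: the numbers \<open>\<langle>b\<^sub>j\<^sub>,\<^sub>n(T) x, x\<rangle>\<close> for the Bernstein polynomials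
  \<open>b\<^sub>j\<^sub>,\<^sub>n\<close> are nonnegative with sum \<open>\<parallel>x\<parallel>\<^sup>2\<close>, so they define measures at the nodes \<open>j/n\<close>.  A weak limit
  as \<open>n \<rightarrow> \<infinity>\<close> has the moments \<open>\<langle>T\<^sup>m x, x\<rangle>\<close>.
\<close>

lemma moment_measure_unit:
  assumes x: "norm x = 1"
  shows "\<exists>M. prob_space M \<and> sets M = sets borel \<and> (AE t in M. 0 \<le> t \<and> t \<le> 1) \<and>
    (\<forall>p. (LINT t|M. poly p t) = opoly p x \<bullet> x)"
proof -
  define L where "L p = opoly p x \<bullet> x" for p
  have L_sum: "L (\<Sum>i\<in>I. smult (h i) (q i)) = (\<Sum>i\<in>I. h i * L (q i))" for I :: "nat set" and h q
    by (simp add: L_def opoly_sum opoly_smult inner_sum_left)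
  have nonneg: "0 \<le> L (bernstein n j)" for n j
    unfolding L_def bernstein_def opoly_smult by (simp add: bernstein_nonneg del: mult_pCons_left)
  define \<nu> where "\<nu> n = point_measure {..Suc n} (\<lambda>j. ennreal (L (bernstein (Suc n) j)))" for n
  define \<mu> where "\<mu> n = distr (\<nu> n) borel (\<lambda>j. real j / real (Suc n))" for n
  have tot: "(\<Sum>j\<le>n. L (bernstein n j)) = 1" for n using L_sum[of "\<lambda>_. 1" "bernstein n" "{..n}"] x
    by (simp add: sum_bernstein L_def opoly_1 norm_eq_1)
  have prob: "prob_space (\<nu> n)" for n unfolding \<nu>_def by (rule prob_spaceI)
      (simp add: space_point_measure emeasure_point_measure_finite nonneg tot sum_ennreal del: sum.atMost_Suc)
  have meas: "(\<lambda>j. real j / real (Suc n)) \<in> measurable (\<nu> n) borel" for n by (simp add: \<nu>_def point_measure_def)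
  have int_mu: "(LINT t|\<mu> n. f t) = (\<Sum>j\<le>Suc n. L (bernstein (Suc n) j) * f (real j / real (Suc n)))"
    if "f \<in> borel_measurable borel" for n and f :: "real \<Rightarrow> real" unfolding \<mu>_def using meas[of n] that nonneg
    by (subst integral_distr) (auto simp: \<nu>_def lebesgue_integral_point_measure_finite simp del: sum.atMost_Suc)
  have rd: "real_distribution (\<mu> n)" for n unfolding \<mu>_def using prob_space.real_distribution_distr[OF prob meas] .
  have "tight \<mu>" unfolding tight_def
  proof (intro conjI allI impI)
    show "real_distribution (\<mu> n)" for n by (rule rd)
    fix \<epsilon> :: real assume \<epsilon>: "0 < \<epsilon>"
    have "measure (\<mu> n) {-1<..1} = 1" for n
    proof -
      have "measure (\<mu> n) {-1<..1} = (LINT t|\<mu> n. indicator {-1<..1} t)"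
        using rd[of n] by (simp add: real_distribution_def real_distribution_axioms_def)
      also have "\<dots> = (\<Sum>j\<le>Suc n. L (bernstein (Suc n) j))"
        by (subst int_mu) (auto intro!: sum.cong simp: indicator_def divide_simps simp del: sum.atMost_Suc)
      finally show ?thesis using tot by simp
    qed
    then show "\<exists>a b. a < b \<and> (\<forall>n. 1 - \<epsilon> < measure (\<mu> n) {a<..b})" using \<epsilon> by (intro exI[of _ "-1"] exI[of _ 1]) auto
  qed
  then obtain r M where r: "strict_mono (r :: nat \<Rightarrow> nat)" and M: "real_distribution M"
    and wc: "weak_conv_m (\<mu> \<circ> id \<circ> r) M"
    using tight_imp_convergent_subsubsequence[of \<mu> id] strict_mono_id by (auto simp: id_def)
  define cl where "cl t = max 0 (min 1 t)" for t :: real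
  have cl: "isCont cl t" "0 \<le> cl t" "cl t \<le> 1" for t unfolding cl_def by (auto intro!: continuous_intros)
  have cl_meas[measurable]: "cl \<in> borel_measurable borel" unfolding cl_def by measurable
  interpret M: real_distribution M by (rule M)
  define N where "N = distr M borel cl"
  have mom: "(LINT t|N. t ^ m) = L ([:0, 1:] ^ m)" for m
  proof -
    have "(\<lambda>n. LINT t|(\<mu> \<circ> id \<circ> r) n. cl t ^ m) \<longlonglongrightarrow> (LINT t|M. cl t ^ m)"
    proof (rule weak_conv_imp_integral_bdd_continuous_conv[where B = 1])
      show "real_distribution ((\<mu> \<circ> id \<circ> r) n)" for n using rd by simp
      show "isCont (\<lambda>t. cl t ^ m) t" for t using cl by (intro continuous_intros) auto
      show "norm (cl t ^ m) \<le> 1" for t using cl[of t] by (simp add: power_le_one)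
    qed (use M wc in \<open>simp_all only:\<close>)
    moreover have "(\<lambda>n. LINT t|\<mu> n. cl t ^ m) \<longlonglongrightarrow> L ([:0, 1:] ^ m)"
    proof -
      obtain K where K: "\<And>n. n > m \<Longrightarrow> \<exists>h. [:0, 1:] ^ m = (\<Sum>j\<le>n. smult (h j) (bernstein n j)) \<and>
        (\<forall>j\<le>n. \<bar>h j - (real j / real n) ^ m\<bar> \<le> K / real n)" using X_power_bernstein by blast
      have "\<bar>(LINT t|\<mu> n. cl t ^ m) - L ([:0, 1:] ^ m)\<bar> \<le> K / real (Suc n)" if "n \<ge> m" for n
      proof -
        from K[of "Suc n"] that obtain h
          where h: "[:0, 1:] ^ m = (\<Sum>j\<le>Suc n. smult (h j) (bernstein (Suc n) j))"
          and hb: "\<And>j. j \<le> Suc n \<Longrightarrow> \<bar>h j - (real j / real (Suc n)) ^ m\<bar> \<le> K / real (Suc n)"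
          by (auto simp del: sum.atMost_Suc)
        have "(LINT t|\<mu> n. cl t ^ m) =
            (\<Sum>j\<le>Suc n. L (bernstein (Suc n) j) * cl (real j / real (Suc n)) ^ m)"
          by (subst int_mu) (auto simp del: sum.atMost_Suc)
        also have "\<dots> = (\<Sum>j\<le>Suc n. L (bernstein (Suc n) j) * (real j / real (Suc n)) ^ m)"
          by (intro sum.cong refl arg_cong2[where f = "(*)"] arg_cong2[where f = "(^)"])
            (auto simp: cl_def divide_simps simp del: of_nat_Suc)
        finally have "(LINT t|\<mu> n. cl t ^ m) - L ([:0, 1:] ^ m) =
            (\<Sum>j\<le>Suc n. L (bernstein (Suc n) j) * ((real j / real (Suc n)) ^ m - h j))"
          unfolding h L_sum by (simp add: sum_subtractf algebra_simps del: sum.atMost_Suc of_nat_Suc)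
        also have "\<bar>\<dots>\<bar> \<le> (\<Sum>j\<le>Suc n. L (bernstein (Suc n) j) * (K / real (Suc n)))"
        proof (rule order_trans[OF sum_abs], rule sum_mono)
          fix j assume "j \<in> {..Suc n}"
          then show "\<bar>L (bernstein (Suc n) j) * ((real j / real (Suc n)) ^ m - h j)\<bar>
              \<le> L (bernstein (Suc n) j) * (K / real (Suc n))" using hb[of j] nonneg[of "Suc n" j] unfolding abs_mult
            by (intro mult_mono) (auto simp: abs_minus_commute simp del: of_nat_Suc)
        qed
        also have "\<dots> = K / real (Suc n)" using tot[of "Suc n"] by (simp only: sum_distrib_right[symmetric] mult_1)
        finally show ?thesis .
      qed
      then have ev: "\<forall>\<^sub>F n in sequentially. norm ((LINT t|\<mu> n. cl t ^ m) - L ([:0, 1:] ^ m)) \<le> K / real (Suc n)"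
        by (intro eventually_sequentiallyI[of m]) simp
      have "(\<lambda>n. K / real (Suc n)) \<longlonglongrightarrow> 0"
        using tendsto_mult_right_zero[OF LIMSEQ_inverse_real_of_nat, of K] by (simp add: field_simps)
      from Lim_null_comparison[OF ev this] show ?thesis by (simp add: LIM_zero_iff)
    qed
    then have "(\<lambda>n. LINT t|\<mu> (r n). cl t ^ m) \<longlonglongrightarrow> L ([:0, 1:] ^ m)"
      using LIMSEQ_subseq_LIMSEQ[OF _ r] by (simp add: o_def)
    ultimately have "(LINT t|M. cl t ^ m) = L ([:0, 1:] ^ m)" by (intro LIMSEQ_unique) (auto simp: o_def)
    then show ?thesis unfolding N_def by (subst integral_distr) auto
  qed
  have N01: "AE t in N. 0 \<le> t \<and> t \<le> 1" unfolding N_def by (subst AE_distr_iff) (auto simp: cl)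
  interpret N: prob_space N unfolding N_def by (rule M.prob_space_distr) simp
  have intpow: "integrable N (\<lambda>t. t ^ m)" for m
  proof (rule N.integrable_const_bound[where B = 1])
    show "AE t in N. norm (t ^ m) \<le> 1" using N01 by eventually_elim (simp add: power_le_one)
  qed (simp add: N_def)
  have "(LINT t|N. poly p t) = L p" for p
  proof -
    have "(LINT t|N. poly p t) = (\<Sum>i\<le>degree p. coeff p i * L ([:0, 1:] ^ i))"
      unfolding poly_altdef by (subst Bochner_Integration.integral_sum) (auto simp: intpow mom)
    also have "\<dots> = L (\<Sum>i\<le>degree p. smult (coeff p i) ([:0, 1:] ^ i))" by (rule L_sum[symmetric])
    also have "(\<Sum>i\<le>degree p. smult (coeff p i) ([:0, 1:] ^ i)) = p"
      by (metis (no_types, lifting) poly_as_sum_of_monoms monom_altdef sum.cong)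
    finally show ?thesis .
  qed
  then show ?thesis using N01 N.prob_space_axioms by (intro exI[of _ N]) (auto simp: L_def N_def)
qed

definition moment_measure :: "'h \<Rightarrow> real measure" where
  "moment_measure x = (SOME M. finite_measure M \<and> sets M = sets borel \<and>
     (AE t in M. 0 \<le> t \<and> t \<le> 1) \<and> (\<forall>p. (LINT t|M. poly p t) = opoly p x \<bullet> x))"

lemma moment_measure:
  shows finite_moment_measure: "finite_measure (moment_measure x)"
    and sets_moment_measure [simp, measurable_cong]: "sets (moment_measure x) = sets borel"
    and AE_moment_measure: "AE t in moment_measure x. 0 \<le> t \<and> t \<le> 1"
    and integral_moment_measure: "(LINT t|moment_measure x. poly p t) = opoly p x \<bullet> x"
proof -
  have "\<exists>M. finite_measure M \<and> sets M = sets borel \<and> (AE t in M. 0 \<le> t \<and> t \<le> 1) \<and>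
     (\<forall>p. (LINT t|M. poly p t) = opoly p x \<bullet> x)"
  proof (cases "x = 0")
    case True
    have "opoly p 0 = 0" for p using linear_0[OF linear_opoly] .
    moreover have "finite_measure (null_measure (borel :: real measure))" by (rule finite_measureI) simp
    moreover have "AE t in null_measure (borel :: real measure). 0 \<le> t \<and> t \<le> 1"
      by (rule AE_I[where N = UNIV]) simp_all
    ultimately show ?thesis using True by (intro exI[of _ "null_measure borel"]) simp
  next
    case False
    define y where "y = x /\<^sub>R norm x"
    have y: "norm y = 1" "x = norm x *\<^sub>R y" using False by (auto simp: y_def)
    obtain M where M: "prob_space M" "sets M = sets borel" "AE t in M. 0 \<le> t \<and> t \<le> 1"
      "\<And>p. (LINT t|M. poly p t) = opoly p y \<bullet> y" using moment_measure_unit[OF y(1)] by blast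
    interpret prob_space M by fact
    let ?N = "density M (\<lambda>_. ennreal ((norm x)\<^sup>2))"
    have "(LINT t|?N. poly p t) = opoly p x \<bullet> x" for p
    proof -
      have "(LINT t|?N. poly p t) = (norm x)\<^sup>2 * (LINT t|M. poly p t)"
        using M(2) poly_measurable[of p] by (subst integral_density) (auto cong: measurable_cong_sets)
      also have "\<dots> = opoly p (norm x *\<^sub>R y) \<bullet> (norm x *\<^sub>R y)"
        by (simp add: M(4) linear_scale[OF linear_opoly] power2_eq_square)
      finally show ?thesis using y(2) by simp
    qed
    moreover have "finite_measure ?N" by (rule finite_measureI) (simp add: emeasure_density ennreal_mult_eq_top_iff)
    ultimately show ?thesis using M(2,3) by (intro exI[of _ ?N]) (auto simp: AE_density)
  qed
  from someI_ex[OF this] show "finite_measure (moment_measure x)"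
    "sets (moment_measure x) = sets borel" "AE t in moment_measure x. 0 \<le> t \<and> t \<le> 1"
    "(LINT t|moment_measure x. poly p t) = opoly p x \<bullet> x" unfolding moment_measure_def by auto
qed

end

context positive_contraction
begin

lemma poly_measurable_moment [measurable]: "poly p \<in> borel_measurable (moment_measure x)"
  using poly_measurable[of p] by simp

lemma moment_integrable:
  fixes f :: "real \<Rightarrow> real" and K :: real
  assumes [measurable]: "f \<in> borel_measurable borel" and "\<And>t. 0 \<le> t \<Longrightarrow> t \<le> 1 \<Longrightarrow> \<bar>f t\<bar> \<le> K"
  shows "integrable (moment_measure x) f"
proof -
  interpret finite_measure "moment_measure x" by (rule finite_moment_measure)
  show ?thesis
  proof (rule integrable_const_bound[where B = K])
    show "AE t in moment_measure x. norm (f t) \<le> K"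
      using AE_moment_measure[of x] by eventually_elim (use assms in auto)
  qed simp
qed

lemma poly_bounded_unit_interval: "\<exists>K. \<forall>t. 0 \<le> t \<longrightarrow> t \<le> 1 \<longrightarrow> \<bar>poly p t :: real\<bar> \<le> K"
proof -
  have "compact (poly p ` {0..1})" by (intro compact_continuous_image continuous_intros compact_Icc)
  then obtain K where "\<And>y. y \<in> poly p ` {0..1} \<Longrightarrow> norm y \<le> K" by (meson bounded_iff compact_imp_bounded)
  then show ?thesis by (intro exI[of _ K]) auto
qed

lemma moment_integrable_poly [simp]: "integrable (moment_measure x) (poly p)"
  using poly_bounded_unit_interval[of p] moment_integrable[OF poly_measurable] by blast

lemma moment_dominated:
  fixes g :: "real \<Rightarrow> real" and K :: real
  assumes [measurable]: "\<And>n. f n \<in> borel_measurable borel" "g \<in> borel_measurable borel"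
    and "\<And>n t. 0 \<le> t \<Longrightarrow> t \<le> 1 \<Longrightarrow> \<bar>f n t\<bar> \<le> K"
    and "\<And>t. 0 \<le> t \<Longrightarrow> t \<le> 1 \<Longrightarrow> (\<lambda>n. f n t) \<longlonglongrightarrow> g t"
  shows "(\<lambda>n. LINT t|moment_measure x. f n t) \<longlonglongrightarrow> (LINT t|moment_measure x. g t)"
proof -
  interpret finite_measure "moment_measure x" by (rule finite_moment_measure)
  show ?thesis
  proof (rule integral_dominated_convergence[where w = "\<lambda>_. K"])
    show "AE t in moment_measure x. (\<lambda>n. f n t) \<longlonglongrightarrow> g t"
      using AE_moment_measure[of x] by eventually_elim (use assms in auto)
    show "AE t in moment_measure x. norm (f n t) \<le> K" for n
      using AE_moment_measure[of x] by eventually_elim (use assms in auto)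
  qed (use assms in auto)
qed

lemma norm_opoly_integral: "(norm (opoly p x))\<^sup>2 = (LINT t|moment_measure x. (poly p t)\<^sup>2)"
  using integral_moment_measure[of x "p\<^sup>2"] by (simp add: norm_opoly poly_power)

lemma measure_moment_UNIV: "measure (moment_measure x) UNIV = (norm x)\<^sup>2"
proof -
  interpret finite_measure "moment_measure x" by (rule finite_moment_measure)
  have sp: "space (moment_measure x) = UNIV" using sets_eq_imp_space_eq[OF sets_moment_measure[of x]] by simp
  have "(LINT t|moment_measure x. poly 1 t) = (norm x)\<^sup>2"
    by (simp only: integral_moment_measure opoly_1 dot_square_norm)
  then show ?thesis by (simp add: sp)
qed

text \<open>
  Expressing the spectral projection by the quadratic form alone determines it uniquely, because a symmetric
  operator is determined by its quadratic form.
\<close>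

definition spectral_projection :: "real set \<Rightarrow> ('h \<Rightarrow> 'h) \<Rightarrow> bool" where
  "spectral_projection S E \<longleftrightarrow> linear E \<and> (\<forall>x y. E x \<bullet> y = x \<bullet> E y) \<and>
     (\<forall>x. E x \<bullet> x = measure (moment_measure x) S) \<and> (\<forall>x. (norm (E x))\<^sup>2 = E x \<bullet> x)"

lemma symmetric_form_eqI:
  fixes D E :: "'h \<Rightarrow> 'h"
  assumes "linear D" "linear E" and sym: "\<And>x y. D x \<bullet> y = x \<bullet> D y" "\<And>x y. E x \<bullet> y = x \<bullet> E y"
    and eq: "\<And>x. D x \<bullet> x = E x \<bullet> x"
  shows "D = E"
proof
  fix x
  define F where "F z = D z - E z" for z
  have F: "F (x + y) = F x + F y" "F x \<bullet> y = x \<bullet> F y" "F x \<bullet> x = 0" for x y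
    using assms by (auto simp: F_def linear_add inner_diff_left inner_diff_right)
  have "F x \<bullet> y = 0" for y
  proof -
    have "0 = F (x + y) \<bullet> (x + y)" by (simp add: F(3))
    also have "\<dots> = 2 * (F x \<bullet> y)" using F(3)[of x] F(3)[of y] F(2)[of x y]
      by (simp add: F(1) inner_add_left inner_add_right inner_commute)
    finally show ?thesis by simp
  qed
  then have "F x = 0" by (metis inner_eq_zero_iff)
  then show "D x = E x" by (simp add: F_def)
qed

lemma spectral_projection_unique:
  "spectral_projection S E \<Longrightarrow> spectral_projection S E' \<Longrightarrow> E = E'"
  unfolding spectral_projection_def by (intro symmetric_form_eqI) auto

lemma spectral_projection_idem:
  assumes "spectral_projection S E" shows "E (E x) = E x"
proof -
  have E: "linear E" "\<And>x y. E x \<bullet> y = x \<bullet> E y" "\<And>x. (norm (E x))\<^sup>2 = E x \<bullet> x"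
    using assms by (auto simp: spectral_projection_def)
  have "(\<lambda>x. E (E x)) = E"
  proof (rule symmetric_form_eqI)
    show "linear (\<lambda>x. E (E x))" using linear_compose[OF E(1) E(1)] by (simp add: o_def)
    show "E (E x) \<bullet> x = E x \<bullet> x" for x using E(3)[of x] by (simp add: E(2) power2_norm_eq_inner)
  qed (use E in auto)
  then show ?thesis by (rule fun_cong)
qed

text \<open>
  By dominated convergence in every moment measure the vectors \<open>p\<^sub>n(T) x\<close> form a Cauchy sequence; their
  limits define the projection.
\<close>

lemma spectral_projection_limit:
  assumes bd: "\<And>n t. 0 \<le> t \<Longrightarrow> t \<le> 1 \<Longrightarrow> \<bar>poly (p n) t\<bar> \<le> K"
    and lim: "\<And>t. 0 \<le> t \<Longrightarrow> t \<le> 1 \<Longrightarrow> (\<lambda>n. poly (p n) t) \<longlonglongrightarrow> indicator S t"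
    and [measurable]: "S \<in> sets borel"
  shows "\<exists>E. spectral_projection S E"
proof -
  have K: "0 \<le> K" using bd[of 0 0] by linarith
  have conv: "convergent (\<lambda>n. opoly (p n) x)" for x
  proof -
    define d where "d n = (LINT t|moment_measure x. (poly (p n) t - indicator S t)\<^sup>2)" for n
    have dbd: "(poly (p n) t - indicator S t)\<^sup>2 \<le> (K + 1)\<^sup>2" if "0 \<le> t" "t \<le> 1" for n t
      using bd[OF that, of n] by (intro abs_le_square_iff[THEN iffD1]) (auto simp: indicator_def split: if_splits)
    have int: "integrable (moment_measure x) (\<lambda>t. (poly (p n) t - indicator S t)\<^sup>2)" for n
      by (rule moment_integrable[where K = "(K + 1)\<^sup>2"]) (use dbd in auto)
    have "d \<longlonglongrightarrow> (LINT t|moment_measure x. 0)" unfolding d_def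
    proof (rule moment_dominated[where K = "(K + 1)\<^sup>2"])
      fix t :: real assume t: "0 \<le> t" "t \<le> 1"
      show "(\<lambda>n. (poly (p n) t - indicator S t)\<^sup>2) \<longlonglongrightarrow> 0" using tendsto_power[OF LIM_zero[OF lim[OF t]], of 2] by simp
    qed (use dbd in auto)
    then have d: "d \<longlonglongrightarrow> 0" by simp
    have ineq: "(norm (opoly (p n) x - opoly (p m) x))\<^sup>2 \<le> 2 * d n + 2 * d m" for n m
    proof -
      have "(norm (opoly (p n) x - opoly (p m) x))\<^sup>2 = (LINT t|moment_measure x. (poly (p n - p m) t)\<^sup>2)"
        by (simp only: norm_opoly_integral[symmetric] opoly_diff)
      also have "\<dots> \<le> (LINT t|moment_measure x. 2 * (poly (p n) t - indicator S t)\<^sup>2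
            + 2 * (poly (p m) t - indicator S t)\<^sup>2)"
      proof (rule integral_mono)
        show "integrable (moment_measure x) (\<lambda>t. (poly (p n - p m) t)\<^sup>2)"
        proof -
          have "(\<lambda>t. (poly (p n - p m) t)\<^sup>2) = poly ((p n - p m)\<^sup>2)" by (intro ext) (simp only: poly_power)
          then show ?thesis by simp
        qed
        show "(poly (p n - p m) t)\<^sup>2 \<le> 2 * (poly (p n) t - indicator S t)\<^sup>2
            + 2 * (poly (p m) t - indicator S t)\<^sup>2" for t
        proof -
          have "(a - b)\<^sup>2 \<le> 2 * (a - c)\<^sup>2 + 2 * (b - c)\<^sup>2" for a b c :: real
          proof -
            have "2 * (a - c)\<^sup>2 + 2 * (b - c)\<^sup>2 - (a - b)\<^sup>2 = (a + b - 2 * c)\<^sup>2"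
              by (simp add: power2_eq_square algebra_simps)
            then show ?thesis by (metis diff_ge_0_iff_ge zero_le_power2)
          qed
          then show ?thesis by simp
        qed
      qed (use int in auto)
      also have "\<dots> = 2 * d n + 2 * d m" unfolding d_def using int by simp
      finally show ?thesis .
    qed
    have "Cauchy (\<lambda>n. opoly (p n) x)"
    proof (rule metric_CauchyI)
      fix e :: real assume e: "0 < e"
      then have "\<forall>\<^sub>F n in sequentially. d n < e\<^sup>2 / 4" using d by (intro order_tendstoD) auto
      then obtain N where N: "\<And>n. n \<ge> N \<Longrightarrow> d n < e\<^sup>2 / 4" by (auto simp: eventually_sequentially)
      show "\<exists>M. \<forall>m\<ge>M. \<forall>n\<ge>M. dist (opoly (p m) x) (opoly (p n) x) < e"
      proof (intro exI[of _ N] allI impI)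
        fix m n assume "N \<le> m" "N \<le> n"
        then have "(norm (opoly (p m) x - opoly (p n) x))\<^sup>2 < e\<^sup>2" using ineq[of m n] N[of m] N[of n] by linarith
        then show "dist (opoly (p m) x) (opoly (p n) x) < e" using e by (simp add: dist_norm power_less_imp_less_base)
      qed
    qed
    then show ?thesis by (rule Cauchy_convergent)
  qed
  define E where "E x = lim (\<lambda>n. opoly (p n) x)" for x
  have E: "(\<lambda>n. opoly (p n) x) \<longlonglongrightarrow> E x" for x using conv unfolding E_def by (simp add: convergent_LIMSEQ_iff)
  have "linear E"
  proof (rule linearI)
    show "E (x + y) = E x + E y" for x y using E[of "x + y"] tendsto_add[OF E[of x] E[of y]]
      by (intro LIMSEQ_unique[of "\<lambda>n. opoly (p n) (x + y)"]) (simp_all add: linear_add[OF linear_opoly])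
    show "E (c *\<^sub>R x) = c *\<^sub>R E x" for c x using E[of "c *\<^sub>R x"] tendsto_scaleR[OF tendsto_const[of c] E[of x]]
      by (intro LIMSEQ_unique[of "\<lambda>n. opoly (p n) (c *\<^sub>R x)"]) (simp_all add: linear_scale[OF linear_opoly])
  qed
  moreover have "E x \<bullet> y = x \<bullet> E y" for x y
    using tendsto_inner[OF E[of x] tendsto_const[of y]] tendsto_inner[OF tendsto_const[of x] E[of y]]
    by (intro LIMSEQ_unique[of "\<lambda>n. opoly (p n) x \<bullet> y"]) (simp_all add: symmetric_opoly)
  moreover have meas: "(LINT t|moment_measure x. indicator S t) = measure (moment_measure x) S" for x
  proof -
    interpret finite_measure "moment_measure x" by (rule finite_moment_measure)
    show ?thesis by simp
  qed
  have 1: "E x \<bullet> x = measure (moment_measure x) S" for x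
  proof (rule LIMSEQ_unique)
    show "(\<lambda>n. opoly (p n) x \<bullet> x) \<longlonglongrightarrow> E x \<bullet> x" by (intro tendsto_inner E tendsto_const)
    show "(\<lambda>n. opoly (p n) x \<bullet> x) \<longlonglongrightarrow> measure (moment_measure x) S"
      unfolding integral_moment_measure[symmetric] meas[symmetric]
      by (rule moment_dominated[where K = K]) (use bd lim in auto)
  qed
  moreover have "(norm (E x))\<^sup>2 = measure (moment_measure x) S" for x
  proof (rule LIMSEQ_unique)
    show "(\<lambda>n. (norm (opoly (p n) x))\<^sup>2) \<longlonglongrightarrow> (norm (E x))\<^sup>2" by (intro tendsto_intros E)
    show "(\<lambda>n. (norm (opoly (p n) x))\<^sup>2) \<longlonglongrightarrow> measure (moment_measure x) S" unfolding norm_opoly_integral meas[symmetric]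
    proof (rule moment_dominated[where K = "K\<^sup>2"])
      fix t :: real and n :: nat assume t: "0 \<le> t" "t \<le> 1"
      show "\<bar>(poly (p n) t)\<^sup>2\<bar> \<le> K\<^sup>2" using power_mono[OF bd[OF t, of n], of 2] by simp
    next
      fix t :: real assume t: "0 \<le> t" "t \<le> 1"
      show "(\<lambda>n. (poly (p n) t)\<^sup>2) \<longlonglongrightarrow> indicator S t"
        using tendsto_power[OF lim[OF t], of 2] by (auto simp: indicator_def split: if_splits)
    qed auto
  qed
  ultimately show ?thesis unfolding spectral_projection_def by (intro exI[of _ E]) simp
qed

lemma polynomial_approximation:
  fixes f :: "real \<Rightarrow> real"
  assumes "continuous_on {0..1} f" "0 < e"
  obtains p where "\<And>t. 0 \<le> t \<Longrightarrow> t \<le> 1 \<Longrightarrow> \<bar>f t - poly p t\<bar> < e"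
proof -
  obtain g where g: "real_polynomial_function g" "\<And>x. x \<in> {0..1} \<Longrightarrow> \<bar>f x - g x\<bar> < e"
    using Stone_Weierstrass_real_polynomial_function[OF compact_Icc assms] by blast
  then obtain a n where gs: "g = (\<lambda>x. \<Sum>i\<le>n. a i * x ^ i)" by (auto simp: real_polynomial_function_iff_sum)
  have "poly (\<Sum>i\<le>n. monom (a i) i) x = g x" for x by (simp add: gs poly_sum poly_monom)
  then show ?thesis using g by (intro that[of "\<Sum>i\<le>n. monom (a i) i"]) auto
qed

lemma spectral_projection_half_line: "\<exists>E. spectral_projection {..l} E"
proof -
  define f where "f n t = max 0 (min 1 (1 - real n * (t - l)))" for n :: nat and t
  have "\<exists>p. \<forall>t. 0 \<le> t \<longrightarrow> t \<le> 1 \<longrightarrow> \<bar>f n t - poly p t\<bar> < 1 / real (Suc n)" for n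
    by (rule polynomial_approximation[of "f n" "1 / real (Suc n)"])
      (auto simp: f_def intro!: continuous_intros simp del: of_nat_Suc)
  then obtain p where p: "\<And>n t. 0 \<le> t \<Longrightarrow> t \<le> 1 \<Longrightarrow> \<bar>f n t - poly (p n) t\<bar> < 1 / real (Suc n)" by metis
  show ?thesis
  proof (rule spectral_projection_limit[of p 2])
    fix n and t :: real assume t: "0 \<le> t" "t \<le> 1"
    have "1 / real (Suc n) \<le> 1" by simp
    then show "\<bar>poly (p n) t\<bar> \<le> 2" using p[OF t, of n] unfolding f_def by linarith
  next
    fix t :: real assume t: "0 \<le> t" "t \<le> 1"
    have z: "(\<lambda>n. 1 / real (Suc n)) \<longlonglongrightarrow> 0" using LIMSEQ_inverse_real_of_nat by (simp add: inverse_eq_divide)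
    have "(\<lambda>n. f n t - poly (p n) t) \<longlonglongrightarrow> 0"
      by (rule Lim_null_comparison[OF _ z]) (auto intro!: always_eventually less_imp_le p t simp del: of_nat_Suc)
    moreover have "(\<lambda>n. f n t) \<longlonglongrightarrow> indicator {..l} t"
    proof (rule tendsto_eventually)
      show "\<forall>\<^sub>F n in sequentially. f n t = indicator {..l} t"
      proof (cases "t \<le> l")
        case True
        then have "real n * (t - l) \<le> 0" for n by (simp add: mult_nonneg_nonpos)
        then show ?thesis using True by (simp add: f_def)
      next
        case False
        obtain N :: nat where N: "1 / (t - l) < real N" using reals_Archimedean2 by blast
        have "f n t = 0" if "n \<ge> N" for n
        proof -
          have "1 / (t - l) \<le> real n" using N that by linarith
          then have "1 \<le> real n * (t - l)" using False by (simp add: field_simps)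
          then show ?thesis by (simp add: f_def)
        qed
        then show ?thesis using False by (intro eventually_sequentiallyI[of N]) simp
      qed
    qed
    ultimately show "(\<lambda>n. poly (p n) t) \<longlonglongrightarrow> indicator {..l} t" using tendsto_diff by fastforce
  qed simp
qed

lemma spectral_projection_union:
  fixes A :: "nat \<Rightarrow> real set"
  assumes disj: "disjoint_family A" and [measurable]: "\<And>i. A i \<in> sets borel"
    and E: "\<And>i. spectral_projection (A i) (E i)"
  shows "\<exists>F. spectral_projection (\<Union>i. A i) F \<and> (\<forall>x. (\<lambda>i. E i x) sums F x)"
proof -
  have lin: "linear (E i)" and sym: "E i x \<bullet> y = x \<bullet> E i y"
    and ms: "E i x \<bullet> x = measure (moment_measure x) (A i)" and nrm: "(norm (E i x))\<^sup>2 = E i x \<bullet> x" for i x y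
    using E[of i] by (auto simp: spectral_projection_def)
  have orth: "E i (E j x) = 0" if "i \<noteq> j" for i j x
  proof -
    define y where "y = E j x"
    interpret finite_measure "moment_measure y" by (rule finite_moment_measure)
    have "measure (moment_measure y) (A i) + measure (moment_measure y) (A j)
        = measure (moment_measure y) (A i \<union> A j)"
      using disj that by (intro finite_measure_Union[symmetric]) (auto simp: disjoint_family_on_def)
    also have "\<dots> \<le> (norm y)\<^sup>2" using bounded_measure[of "A i \<union> A j"] measure_moment_UNIV[of y]
        sets_eq_imp_space_eq[OF sets_moment_measure[of y]] by simp
    finally have "(norm (E i y))\<^sup>2 + (norm (E j y))\<^sup>2 \<le> (norm y)\<^sup>2" by (simp add: nrm ms)
    moreover have "E j y = y" unfolding y_def by (rule spectral_projection_idem[OF E])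
    ultimately have "(norm (E i y))\<^sup>2 \<le> 0" by simp
    then show ?thesis by (simp add: y_def)
  qed
  have pyth: "(norm (\<Sum>i\<in>I. E i x))\<^sup>2 = (\<Sum>i\<in>I. measure (moment_measure x) (A i))" if "finite I" for I x
  proof -
    have "(norm (\<Sum>i\<in>I. E i x))\<^sup>2 = (\<Sum>i\<in>I. (norm (E i x))\<^sup>2)"
    proof (rule norm_sum_Pythagorean[OF that])
      show "pairwise (\<lambda>i j. orthogonal (E i x) (E j x)) I" by (auto simp: pairwise_def orthogonal_def sym orth)
    qed
    then show ?thesis by (simp add: nrm ms)
  qed
  have sm: "(\<lambda>i. measure (moment_measure x) (A i)) sums measure (moment_measure x) (\<Union>i. A i)" for x
  proof -
    interpret finite_measure "moment_measure x" by (rule finite_moment_measure)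
    show ?thesis using disj by (intro finite_measure_UNION) auto
  qed
  have "summable (\<lambda>i. E i x)" for x unfolding summable_iff_convergent
  proof (rule Cauchy_convergent, rule CauchyI')
    fix e :: real assume e: "0 < e"
    obtain N where N: "\<And>m n. m \<ge> N \<Longrightarrow> norm (\<Sum>i\<in>{m..<n}. measure (moment_measure x) (A i)) < e\<^sup>2"
      using sm[of x] e unfolding sums_iff summable_Cauchy by (metis zero_less_power)
    show "\<exists>N. \<forall>m\<ge>N. \<forall>n>m. dist (\<Sum>i<m. E i x) (\<Sum>i<n. E i x) < e"
    proof (intro exI[of _ N] allI impI)
      fix m n assume "N \<le> m" and mn: "m < n"
      then have "(norm (\<Sum>i\<in>{m..<n}. E i x))\<^sup>2 < e\<^sup>2" using N[of m n] by (simp add: pyth)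
      then have "norm (\<Sum>i\<in>{m..<n}. E i x) < e" using e by (simp add: power_less_imp_less_base)
      moreover have "(\<Sum>i<n. E i x) - (\<Sum>i<m. E i x) = (\<Sum>i\<in>{m..<n}. E i x)"
        using mn by (simp add: lessThan_atLeast0 sum_diff_nat_ivl)
      ultimately show "dist (\<Sum>i<m. E i x) (\<Sum>i<n. E i x) < e" by (metis dist_norm norm_minus_commute)
    qed
  qed
  define F where "F x = (\<Sum>i. E i x)" for x
  have F: "(\<lambda>i. E i x) sums F x" for x unfolding F_def using \<open>summable (\<lambda>i. E i x)\<close> by (rule summable_sums)
  have "linear F"
  proof (rule linearI)
    show "F (x + y) = F x + F y" for x y
      using F[of "x + y"] sums_add[OF F[of x] F[of y]] by (simp add: linear_add[OF lin] sums_unique2)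
    show "F (c *\<^sub>R x) = c *\<^sub>R F x" for c x
      using F[of "c *\<^sub>R x"] bounded_linear.sums[OF bounded_linear_scaleR_right F[of x], of c]
      by (simp add: linear_scale[OF lin] sums_unique2)
  qed
  moreover have "F x \<bullet> y = x \<bullet> F y" for x y using bounded_linear.sums[OF bounded_linear_inner_left F[of x], of y]
      bounded_linear.sums[OF bounded_linear_inner_right F[of y], of x] by (simp add: sym sums_unique2)
  moreover have "F x \<bullet> x = measure (moment_measure x) (\<Union>i. A i)" for x
    using bounded_linear.sums[OF bounded_linear_inner_left F[of x], of x] sm[of x] by (simp add: ms sums_unique2)
  moreover have "(norm (F x))\<^sup>2 = measure (moment_measure x) (\<Union>i. A i)" for x
  proof -
    have "(\<lambda>n. (norm (\<Sum>i<n. E i x))\<^sup>2) \<longlonglongrightarrow> (norm (F x))\<^sup>2" using F[of x] unfolding sums_def by (intro tendsto_intros)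
    then show ?thesis using sm[of x] unfolding sums_def by (intro LIMSEQ_unique) (simp_all add: pyth)
  qed
  ultimately show ?thesis using F unfolding spectral_projection_def by (intro exI[of _ F]) auto
qed

text \<open>
  The sets with a spectral projection form a Dynkin system, and they contain the half-lines, which are closed
  under intersection.
\<close>

lemma spectral_projection_exists:
  assumes "S \<in> sets borel"
  shows "\<exists>E. spectral_projection S E"
proof -
  define G :: "real set set" where "G = range atMost"
  have "sigma_sets UNIV G = sets borel" unfolding borel_eq_atMost G_def by simp
  then have "S \<in> sigma_sets UNIV G" using assms by simp
  have "Int_stable G" by (auto simp: Int_stable_def G_def image_iff intro!: exI[of _ "min _ _"])
  moreover have "G \<subseteq> Pow UNIV" by simp
  ultimately show ?thesis using \<open>S \<in> sigma_sets UNIV G\<close>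
  proof (induction rule: sigma_sets_induct_disjoint)
    case (basic A)
    then show ?case using spectral_projection_half_line by (auto simp: G_def)
  next
    case empty
    show ?case by (intro exI[of _ "\<lambda>_. 0"]) (simp add: spectral_projection_def linear_zero)
  next
    case (compl A)
    then obtain E where E: "spectral_projection A E" by blast
    have A: "A \<in> sets borel" using compl(1) \<open>sigma_sets UNIV G = sets borel\<close> by simp
    have "measure (moment_measure x) (UNIV - A) = x \<bullet> x - measure (moment_measure x) A" for x
    proof -
      interpret finite_measure "moment_measure x" by (rule finite_moment_measure)
      show ?thesis using finite_measure_compl[of A] A measure_moment_UNIV[of x]
        sets_eq_imp_space_eq[OF sets_moment_measure[of x]] by (simp add: power2_norm_eq_inner)
    qed
    then have "spectral_projection (UNIV - A) (\<lambda>x. x - E x)" using E unfolding spectral_projection_def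
      by (auto simp: linear_compose_sub linear_id[unfolded id_def] inner_diff_left inner_diff_right
          power2_norm_eq_inner inner_commute)
    then show ?case by blast
  next
    case (union A)
    then obtain E where "\<And>i. spectral_projection (A i) (E i)" by metis
    moreover have "\<And>i. A i \<in> sets borel" using union(2) \<open>sigma_sets UNIV G = sets borel\<close> by auto
    ultimately show ?case using spectral_projection_union[OF union(1)] by blast
  qed
qed

definition proj :: "real set \<Rightarrow> 'h \<Rightarrow> 'h" where
  "proj S = (SOME E. spectral_projection S E)"

lemma spectral_projection_proj: "S \<in> sets borel \<Longrightarrow> spectral_projection S (proj S)"
  unfolding proj_def using spectral_projection_exists by (rule someI_ex)

lemma proj:
  assumes "S \<in> sets borel"
  shows linear_proj: "linear (proj S)"
    and symmetric_proj: "proj S x \<bullet> y = x \<bullet> proj S y"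
    and inner_proj: "proj S x \<bullet> x = measure (moment_measure x) S"
    and norm_proj: "(norm (proj S x))\<^sup>2 = measure (moment_measure x) S"
    and proj_idem: "proj S (proj S x) = proj S x"
  using spectral_projection_proj[OF assms] spectral_projection_idem[OF spectral_projection_proj[OF assms]]
  by (auto simp: spectral_projection_def)

lemma proj_UNIV: "proj UNIV x = x"
proof -
  have "spectral_projection UNIV (\<lambda>x. x)"
    by (auto simp: spectral_projection_def measure_moment_UNIV power2_norm_eq_inner linear_id[unfolded id_def])
  then show ?thesis using spectral_projection_unique[OF _ spectral_projection_proj[of UNIV]] by (metis sets.top space_borel)
qed

lemma sums_proj:
  assumes "disjoint_family A" "\<And>i::nat. A i \<in> sets borel"
  shows "(\<lambda>i. proj (A i) x) sums proj (\<Union>i. A i) x"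
proof -
  obtain F where F: "spectral_projection (\<Union>i. A i) F" "\<And>x. (\<lambda>i. proj (A i) x) sums F x"
    using spectral_projection_union[OF assms spectral_projection_proj] assms(2) by blast
  have "F = proj (\<Union>i. A i)"
    using assms(2) by (intro spectral_projection_unique[OF F(1) spectral_projection_proj]) auto
  then show ?thesis using F(2) by simp
qed

lemma proj_disjoint_Un:
  assumes "A \<in> sets borel" "B \<in> sets borel" "A \<inter> B = {}"
  shows "proj (A \<union> B) x = proj A x + proj B x"
proof -
  have "(\<lambda>x. proj A x + proj B x) = proj (A \<union> B)"
  proof (rule symmetric_form_eqI)
    fix x
    interpret finite_measure "moment_measure x" by (rule finite_moment_measure)
    show "(proj A x + proj B x) \<bullet> x = proj (A \<union> B) x \<bullet> x"
      using assms by (simp add: inner_add_left inner_proj finite_measure_Union)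
  qed (use assms in \<open>auto simp: inner_add_left inner_add_right symmetric_proj intro: linear_compose_add linear_proj\<close>)
  then show ?thesis by metis
qed

end

section \<open>The Friedrichs extension and its spectral resolution\<close>

text \<open>
  The map \<open>pr\<close> is the orthogonal projection of the ambient space onto the Hilbert space of the operator,
  and \<open>S\<close> is the graph of a densely defined symmetric operator with \<open>S + c \<ge> 1\<close>.
\<close>

locale semibounded_form =
  fixes pr :: "'h::{real_inner, complete_space} \<Rightarrow> 'h" and S :: "('h \<times> 'h) set" and c :: real
  assumes linear_pr: "linear pr" and symmetric_pr: "pr x \<bullet> y = x \<bullet> pr y" and pr_idem: "pr (pr x) = pr x"
    and subspace_S: "subspace S"
    and S_range: "(x, y) \<in> S \<Longrightarrow> pr x = x \<and> pr y = y"
    and S_sym: "(x, y) \<in> S \<Longrightarrow> (v, w) \<in> S \<Longrightarrow> y \<bullet> v = x \<bullet> w"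
    and S_lower: "(x, y) \<in> S \<Longrightarrow> x \<bullet> x \<le> y \<bullet> x + c * (x \<bullet> x)"
    and S_dense: "pr h = h \<Longrightarrow> (\<And>x y. (x, y) \<in> S \<Longrightarrow> h \<bullet> x = 0) \<Longrightarrow> h = 0"
begin

abbreviation A where "A \<equiv> friedrichs_extension (range pr) S"

text \<open>
  The form of \<open>S + c\<close>, as a form on the graph of \<open>S\<close>; it dominates the norm.
\<close>

definition b :: "'h \<times> 'h \<Rightarrow> 'h \<times> 'h \<Rightarrow> real" where
  "b z w = snd z \<bullet> fst w + c * (fst z \<bullet> fst w)"

lemma b_sym: "z \<in> S \<Longrightarrow> w \<in> S \<Longrightarrow> b z w = b w z"
  using S_sym[of "fst z" "snd z" "fst w" "snd w"] by (simp add: b_def inner_commute)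

lemma b_linear:
  "b (z + z') w = b z w + b z' w" "b (z - z') w = b z w - b z' w" "b (r *\<^sub>R z) w = r * b z w"
  "b w (z + z') = b w z + b w z'" "b w (z - z') = b w z - b w z'" "b w (r *\<^sub>R z) = r * b w z"
  by (simp_all add: b_def inner_add_left inner_add_right inner_diff_left inner_diff_right algebra_simps)

lemma b_lower: "z \<in> S \<Longrightarrow> (norm (fst z))\<^sup>2 \<le> b z z"
  using S_lower[of "fst z" "snd z"] by (simp add: b_def dot_square_norm)

lemma b_nonneg: "z \<in> S \<Longrightarrow> 0 \<le> b z z" using b_lower[of z] by (meson order_trans zero_le_power2)

lemma S_closed: "z \<in> S \<Longrightarrow> w \<in> S \<Longrightarrow> z + w \<in> S" "z \<in> S \<Longrightarrow> w \<in> S \<Longrightarrow> z - w \<in> S"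
  "z \<in> S \<Longrightarrow> r *\<^sub>R z \<in> S" "0 \<in> S" using subspace_S by (auto simp: subspace_add subspace_diff subspace_scale subspace_0)

lemma norm_pr_le: "norm (pr x) \<le> norm x"
proof -
  have "norm (pr x) * norm (pr x) = pr x \<bullet> x"
    by (metis pr_idem symmetric_pr inner_commute dot_square_norm power2_eq_square)
  also have "\<dots> \<le> norm (pr x) * norm x" by (rule norm_cauchy_schwarz)
  finally show ?thesis by (cases "norm (pr x) = 0") auto
qed

lemma bounded_linear_pr: "bounded_linear pr" using linear_pr norm_pr_le
  by (intro bounded_linear_intro[where K = 1]) (auto simp: linear_add linear_scale)

lemma in_range_pr: "x \<in> range pr \<longleftrightarrow> pr x = x" by (metis pr_idem rangeE rangeI)

lemma form_converges_bounded:
  assumes p: "form_converges S p v"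
  shows "\<exists>K N. \<forall>k\<ge>N. b (p k) (p k) \<le> K"
proof -
  have pS: "\<And>k. p k \<in> S" and lim: "(\<lambda>k. fst (p k)) \<longlonglongrightarrow> v" using p by (auto simp: form_converges_def)
  obtain N where N: "\<And>k m. k \<ge> N \<Longrightarrow> m \<ge> N \<Longrightarrow> \<bar>(snd (p k) - snd (p m)) \<bullet> (fst (p k) - fst (p m))\<bar> < 1"
    using p unfolding form_converges_def by (metis zero_less_one)
  obtain B where B: "\<And>k. norm (fst (p k)) \<le> B"
    using convergent_imp_Bseq[OF convergentI[OF lim]] by (auto simp: Bseq_def)
  define M where "M = 1 + \<bar>c\<bar> * (2 * B)\<^sup>2"
  have "b (p k) (p k) \<le> 2 * M + 2 * b (p N) (p N)" if "k \<ge> N" for k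
  proof -
    define u where "u = p k - p N"
    have u: "u \<in> S" unfolding u_def by (intro S_closed pS)
    have "norm (fst u) \<le> 2 * B"
      using norm_triangle_ineq4[of "fst (p k)" "fst (p N)"] B[of k] B[of N] by (simp add: u_def)
    then have "(norm (fst u))\<^sup>2 \<le> (2 * B)\<^sup>2" by (intro power_mono) auto
    then have "\<bar>fst u \<bullet> fst u\<bar> \<le> (2 * B)\<^sup>2" by (simp only: dot_square_norm abs_power2)
    then have "\<bar>c * (fst u \<bullet> fst u)\<bar> \<le> \<bar>c\<bar> * (2 * B)\<^sup>2" by (simp add: abs_mult mult_left_mono)
    moreover have "\<bar>snd u \<bullet> fst u\<bar> < 1" using N[OF that order_refl] by (simp add: u_def)
    ultimately have bu: "b u u \<le> M" unfolding b_def M_def by linarith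
    have "0 \<le> b (u - p N) (u - p N)" by (intro b_nonneg S_closed u pS)
    moreover have "b (p k) (p k) + b (u - p N) (u - p N) = 2 * b u u + 2 * b (p N) (p N)"
    proof -
      have "p k = u + p N" by (simp add: u_def)
      then show ?thesis by (simp add: b_linear)
    qed
    ultimately show ?thesis using bu by linarith
  qed
  then show ?thesis by blast
qed

text \<open>
  A minimizing sequence of \<open>b(z, z) - 2 \<langle>h, z\<rangle>\<close> on the domain of \<open>S\<close> is Cauchy for the form by the
  parallelogram law.  Its limit lies in the form domain and satisfies the Euler equation, which says that it
  is mapped to \<open>h\<close> by the Friedrichs extension plus \<open>c\<close>.
\<close>

lemma resolvent_exists:
  assumes h: "pr h = h"
  shows "\<exists>x. (x, h - c *\<^sub>R x) \<in> A"
proof -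
  define J where "J z = b z z - 2 * (h \<bullet> fst z)" for z
  have J_lower: "- (norm h)\<^sup>2 \<le> J z" if "z \<in> S" for z
  proof -
    have "0 \<le> (norm (fst z - h))\<^sup>2" by simp
    then show ?thesis using b_lower[OF that]
      by (simp add: J_def power2_norm_eq_inner inner_diff_left inner_diff_right inner_commute)
  qed
  define d where "d = Inf (J ` S)"
  have bdd: "bdd_below (J ` S)" using J_lower by (intro bdd_belowI2[where m = "- (norm h)\<^sup>2"]) auto
  have d: "d \<le> J z" if "z \<in> S" for z unfolding d_def by (rule cINF_lower[OF bdd that])
  have "\<exists>z\<in>S. J z < d + 1 / real (Suc k)" for k
  proof (rule ccontr)
    assume "\<not> (\<exists>z\<in>S. J z < d + 1 / real (Suc k))"
    then have "d + 1 / real (Suc k) \<le> d" unfolding d_def using S_closed(4) by (intro cINF_greatest) force+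
    then show False by simp
  qed
  then obtain p where pS: "\<And>k. p k \<in> S" and pJ: "\<And>k. J (p k) < d + 1 / real (Suc k)" by metis
  have Jplus: "J (z + t *\<^sub>R w) = J z + 2 * t * (b z w - h \<bullet> fst w) + t\<^sup>2 * b w w" if "z \<in> S" "w \<in> S" for z w t
    using b_sym[OF that] by (simp add: J_def b_linear inner_add_right power2_eq_square algebra_simps)
  have var: "\<bar>b (p k) w - h \<bullet> fst w\<bar> \<le> (1 + b w w) / 2 * (1 / sqrt (real (Suc k)))" if w: "w \<in> S" for k w
  proof -
    define \<beta> where "\<beta> = b (p k) w - h \<bullet> fst w"
    define s where "s = 1 / sqrt (real (Suc k))"
    have s: "0 < s" "s\<^sup>2 = 1 / real (Suc k)" by (auto simp: s_def power_divide)
    define t where "t = (if \<beta> \<ge> 0 then - s else s)"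
    have t: "t * \<beta> = - s * \<bar>\<beta>\<bar>" "t\<^sup>2 = s\<^sup>2" by (auto simp: t_def)
    have "d \<le> J (p k + t *\<^sub>R w)" by (intro d S_closed pS w)
    also have "\<dots> = J (p k) + 2 * (t * \<beta>) + t\<^sup>2 * b w w" using Jplus[OF pS w] by (simp add: \<beta>_def)
    finally have "2 * (s * \<bar>\<beta>\<bar>) \<le> s\<^sup>2 + s\<^sup>2 * b w w" using pJ[of k] unfolding t s(2)[symmetric] by linarith
    then have "s * (2 * \<bar>\<beta>\<bar>) \<le> s * (s * (1 + b w w))" by (simp add: power2_eq_square algebra_simps)
    then have "2 * \<bar>\<beta>\<bar> \<le> s * (1 + b w w)" using s(1) by (rule mult_left_le_imp_le)
    then show ?thesis unfolding \<beta>_def[symmetric] s_def[symmetric] by (simp add: algebra_simps)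
  qed
  have cau: "b (p k - p m) (p k - p m) \<le> 2 / real (Suc k) + 2 / real (Suc m)" for k m
  proof -
    have "d \<le> J ((1 / 2) *\<^sub>R (p k + p m))" by (intro d S_closed pS)
    moreover have "b (p k - p m) (p k - p m) = 2 * J (p k) + 2 * J (p m) - 4 * J ((1 / 2) *\<^sub>R (p k + p m))"
      using b_sym[OF pS pS, of k m] by (simp add: J_def b_linear inner_add_right algebra_simps)
    moreover have "2 / real (Suc k) = 2 * (1 / real (Suc k))" "2 / real (Suc m) = 2 * (1 / real (Suc m))"
      by (simp_all del: of_nat_Suc)
    ultimately show ?thesis using pJ[of k] pJ[of m] by linarith
  qed
  have small: "\<exists>N. \<forall>k\<ge>N. \<forall>m\<ge>N. b (p k - p m) (p k - p m) < e" if "0 < e" for e :: real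
  proof -
    obtain N where N: "4 / e < real N" using reals_Archimedean2 by blast
    have *: "2 / real (Suc k) < e / 2" if "k \<ge> N" for k
    proof -
      have "4 / e < real (Suc k)" using N that by linarith
      then show ?thesis using \<open>0 < e\<close> by (simp add: field_simps)
    qed
    then have "b (p k - p m) (p k - p m) < e" if "k \<ge> N" "m \<ge> N" for k m
      using cau[of k m] *[OF that(1)] *[OF that(2)] by linarith
    then show ?thesis by blast
  qed
  have diffS: "p k - p m \<in> S" for k m by (intro S_closed pS)
  have "Cauchy (\<lambda>k. fst (p k))"
  proof (rule metric_CauchyI)
    fix e :: real assume e: "0 < e"
    obtain N where N: "\<And>k m. k \<ge> N \<Longrightarrow> m \<ge> N \<Longrightarrow> b (p k - p m) (p k - p m) < e\<^sup>2" using small[of "e\<^sup>2"] e by auto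
    show "\<exists>M. \<forall>m\<ge>M. \<forall>n\<ge>M. dist (fst (p m)) (fst (p n)) < e"
    proof (intro exI[of _ N] allI impI)
      fix m n assume "N \<le> m" "N \<le> n"
      then have "(norm (fst (p m - p n)))\<^sup>2 < e\<^sup>2" using N[of m n] b_lower[OF diffS, of m n] by linarith
      then show "dist (fst (p m)) (fst (p n)) < e" using e by (simp add: dist_norm power_less_imp_less_base)
    qed
  qed
  then obtain x where x: "(\<lambda>k. fst (p k)) \<longlonglongrightarrow> x" using Cauchy_convergent convergent_def by blast
  have "form_converges S p x" unfolding form_converges_def
  proof (intro conjI allI impI pS x)
    fix e :: real assume e: "0 < e"
    define e' where "e' = e / (1 + \<bar>c\<bar>)"
    have e': "0 < e'" "e' * (1 + \<bar>c\<bar>) = e" using e by (auto simp: e'_def)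
    obtain N where N: "\<And>k m. k \<ge> N \<Longrightarrow> m \<ge> N \<Longrightarrow> b (p k - p m) (p k - p m) < e'" using small[OF e'(1)] by auto
    show "\<exists>N. \<forall>k\<ge>N. \<forall>m\<ge>N. \<bar>(snd (p k) - snd (p m)) \<bullet> (fst (p k) - fst (p m))\<bar> < e"
    proof (intro exI[of _ N] allI impI)
      fix k m assume km: "N \<le> k" "N \<le> m"
      define u where "u = p k - p m"
      have bu: "b u u < e'" "0 \<le> b u u" "(norm (fst u))\<^sup>2 \<le> b u u"
        using N[OF km] b_lower[OF diffS] b_nonneg[OF diffS] by (auto simp: u_def)
      have "\<bar>snd u \<bullet> fst u\<bar> \<le> b u u + \<bar>c\<bar> * (norm (fst u))\<^sup>2"
      proof -
        have "\<bar>snd u \<bullet> fst u\<bar> = \<bar>b u u - c * (norm (fst u))\<^sup>2\<bar>" by (simp add: b_def dot_square_norm)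
        also have "\<dots> \<le> \<bar>b u u\<bar> + \<bar>c * (norm (fst u))\<^sup>2\<bar>" by (rule abs_triangle_ineq4)
        finally show ?thesis using bu by (simp add: abs_mult)
      qed
      also have "\<dots> \<le> b u u * (1 + \<bar>c\<bar>)" using mult_left_mono[OF bu(3), of "\<bar>c\<bar>"] by (simp add: algebra_simps)
      also have "\<dots> < e' * (1 + \<bar>c\<bar>)" using bu by (intro mult_strict_right_mono) auto
      finally show "\<bar>(snd (p k) - snd (p m)) \<bullet> (fst (p k) - fst (p m))\<bar> < e" by (simp add: e' u_def)
    qed
  qed
  moreover have "(\<lambda>k. snd (p k) \<bullet> fst (p' k)) \<longlonglongrightarrow> (h - c *\<^sub>R x) \<bullet> v" if p': "form_converges S p' v" for p' v
  proof -
    have p'S: "\<And>k. p' k \<in> S" and v: "(\<lambda>k. fst (p' k)) \<longlonglongrightarrow> v" using p' by (auto simp: form_converges_def)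
    obtain K N where K: "\<And>k. k \<ge> N \<Longrightarrow> b (p' k) (p' k) \<le> K" using form_converges_bounded[OF p'] by blast
    have "(\<lambda>k. b (p k) (p' k) - h \<bullet> fst (p' k)) \<longlonglongrightarrow> 0"
    proof (rule Lim_null_comparison)
      show "\<forall>\<^sub>F k in sequentially. norm (b (p k) (p' k) - h \<bullet> fst (p' k)) \<le> (1 + K) / 2 * (1 / sqrt (real (Suc k)))"
      proof (rule eventually_sequentiallyI[of N])
        fix k assume "N \<le> k"
        then have "(1 + b (p' k) (p' k)) / 2 * (1 / sqrt (real (Suc k))) \<le> (1 + K) / 2 * (1 / sqrt (real (Suc k)))"
          using K by (intro mult_right_mono) auto
        then show "norm (b (p k) (p' k) - h \<bullet> fst (p' k)) \<le> (1 + K) / 2 * (1 / sqrt (real (Suc k)))"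
          using var[OF p'S, of k k] by (simp only: real_norm_def)
      qed
      have "(\<lambda>k. sqrt (inverse (real (Suc k)))) \<longlonglongrightarrow> sqrt 0" by (intro tendsto_real_sqrt LIMSEQ_inverse_real_of_nat)
      then have "(\<lambda>k. 1 / sqrt (real (Suc k))) \<longlonglongrightarrow> 0" by (simp add: real_sqrt_inverse inverse_eq_divide real_sqrt_divide)
      then show "(\<lambda>k. (1 + K) / 2 * (1 / sqrt (real (Suc k)))) \<longlonglongrightarrow> 0" by (rule tendsto_mult_right_zero)
    qed
    moreover have "(\<lambda>k. h \<bullet> fst (p' k) - c * (fst (p k) \<bullet> fst (p' k))) \<longlonglongrightarrow> h \<bullet> v - c * (x \<bullet> v)"
      by (intro tendsto_intros x v)
    ultimately have "(\<lambda>k. (b (p k) (p' k) - h \<bullet> fst (p' k)) + (h \<bullet> fst (p' k) - c * (fst (p k) \<bullet> fst (p' k))))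
        \<longlonglongrightarrow> 0 + (h \<bullet> v - c * (x \<bullet> v))" by (rule tendsto_add)
    then show ?thesis by (simp add: b_def inner_diff_left)
  qed
  moreover have "pr x = x"
  proof (rule LIMSEQ_unique)
    have "pr (fst (p k)) = fst (p k)" for k using S_range[of "fst (p k)" "snd (p k)"] pS by simp
    then show "(\<lambda>k. fst (p k)) \<longlonglongrightarrow> pr x" using bounded_linear.tendsto[OF bounded_linear_pr x] by simp
  qed (rule x)
  then have "h - c *\<^sub>R x \<in> range pr" by (simp add: in_range_pr linear_diff[OF linear_pr] linear_scale[OF linear_pr] h)
  ultimately show ?thesis unfolding friedrichs_extension_def by (intro exI[of _ x]) blast
qed

lemma A_sym:
  assumes "(x, y) \<in> A" "(v, w) \<in> A"
  shows "y \<bullet> v = x \<bullet> w"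
proof -
  from assms obtain p p' where p: "form_converges S p x" "form_converges S p' v"
    and 1: "(\<lambda>k. snd (p k) \<bullet> fst (p' k)) \<longlonglongrightarrow> y \<bullet> v" and 2: "(\<lambda>k. snd (p' k) \<bullet> fst (p k)) \<longlonglongrightarrow> w \<bullet> x"
    unfolding friedrichs_extension_def by blast
  have "snd (p k) \<bullet> fst (p' k) = snd (p' k) \<bullet> fst (p k)" for k
    using S_sym[of "fst (p k)" "snd (p k)" "fst (p' k)" "snd (p' k)"] p
    by (simp add: form_converges_def inner_commute)
  then have "y \<bullet> v = w \<bullet> x" using 1 2 LIMSEQ_unique by auto
  then show ?thesis by (simp add: inner_commute)
qed

lemma A_lower:
  assumes "(x, y) \<in> A" shows "x \<bullet> x \<le> y \<bullet> x + c * (x \<bullet> x)"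
proof -
  from assms obtain p where p: "form_converges S p x" and 1: "(\<lambda>k. snd (p k) \<bullet> fst (p k)) \<longlonglongrightarrow> y \<bullet> x"
    unfolding friedrichs_extension_def by blast
  have pS: "\<And>k. p k \<in> S" and x: "(\<lambda>k. fst (p k)) \<longlonglongrightarrow> x" using p by (auto simp: form_converges_def)
  show ?thesis
  proof (rule LIMSEQ_le)
    show "(\<lambda>k. fst (p k) \<bullet> fst (p k)) \<longlonglongrightarrow> x \<bullet> x" by (intro tendsto_intros x)
    show "(\<lambda>k. snd (p k) \<bullet> fst (p k) + c * (fst (p k) \<bullet> fst (p k))) \<longlonglongrightarrow> y \<bullet> x + c * (x \<bullet> x)"
      by (intro tendsto_intros x 1)
    show "\<exists>N. \<forall>n\<ge>N. fst (p n) \<bullet> fst (p n) \<le> snd (p n) \<bullet> fst (p n) + c * (fst (p n) \<bullet> fst (p n))"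
      using S_lower pS by (metis prod.collapse)
  qed
qed

lemma A_range:
  assumes "(x, y) \<in> A" shows "pr x = x" "pr y = y"
proof -
  from assms obtain p where p: "form_converges S p x" unfolding friedrichs_extension_def by blast
  have pS: "\<And>k. p k \<in> S" and x: "(\<lambda>k. fst (p k)) \<longlonglongrightarrow> x" using p by (auto simp: form_converges_def)
  show "pr x = x"
  proof (rule LIMSEQ_unique)
    have "pr (fst (p k)) = fst (p k)" for k using S_range[of "fst (p k)" "snd (p k)"] pS by simp
    then show "(\<lambda>k. fst (p k)) \<longlonglongrightarrow> pr x" using bounded_linear.tendsto[OF bounded_linear_pr x] by simp
  qed (rule x)
  show "pr y = y" using assms by (auto simp: friedrichs_extension_def pr_idem)
qed

lemma S_subset_A: "S \<subseteq> A"
proof (rule subrelI)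
  fix x y assume xy: "(x, y) \<in> S"
  have "form_converges S (\<lambda>_. (x, y)) x" using xy by (auto simp: form_converges_def)
  moreover have "(\<lambda>k. y \<bullet> fst (p' k)) \<longlonglongrightarrow> y \<bullet> v" if "form_converges S p' v" for p' v
    using that unfolding form_converges_def by (intro tendsto_intros) auto
  moreover have "y \<in> range pr" using S_range[OF xy] by (simp add: in_range_pr)
  ultimately show "(x, y) \<in> A" unfolding friedrichs_extension_def by force
qed

text \<open>
  The resolvent \<open>(A + c)\<^sup>-\<^sup>1\<close>, extended by \<open>0\<close> to the orthogonal complement.
\<close>

definition T :: "'h \<Rightarrow> 'h" where
  "T h = (SOME x. (x, pr h - c *\<^sub>R x) \<in> A)"

lemma T_in_A: "(T h, pr h - c *\<^sub>R T h) \<in> A" unfolding T_def by (rule someI_ex) (rule resolvent_exists[OF pr_idem])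

lemma pr_T: "pr (T h) = T h" using A_range[OF T_in_A] by simp

lemma T_pr: "T (pr h) = T h" by (simp add: T_def pr_idem)

lemma T_sym: "T x \<bullet> y = x \<bullet> T y"
proof -
  have "(pr x - c *\<^sub>R T x) \<bullet> T y = T x \<bullet> (pr y - c *\<^sub>R T y)" by (rule A_sym[OF T_in_A T_in_A])
  then have "pr x \<bullet> T y = T x \<bullet> pr y" by (simp add: inner_diff_left inner_diff_right)
  then show ?thesis by (metis symmetric_pr pr_T)
qed

lemma T_unique:
  assumes "(x, y) \<in> A" shows "x = T (y + c *\<^sub>R x)"
proof -
  have "(x - T (y + c *\<^sub>R x)) \<bullet> g = 0" for g
  proof -
    have "y \<bullet> T g = x \<bullet> (pr g - c *\<^sub>R T g)" by (rule A_sym[OF assms T_in_A])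
    then have "(y + c *\<^sub>R x) \<bullet> T g = x \<bullet> pr g" by (simp add: inner_diff_right inner_add_left)
    also have "\<dots> = x \<bullet> g" using A_range[OF assms] by (metis symmetric_pr)
    finally show ?thesis by (simp add: inner_diff_left T_sym)
  qed
  then show ?thesis by (metis inner_eq_zero_iff eq_iff_diff_eq_0)
qed

lemma linear_T: "linear T"
proof (rule linearI)
  show "T (x + y) = T x + T y" for x y using T_sym by (subst vector_eq_rdot[symmetric]) (simp add: inner_add_left)
  show "T (r *\<^sub>R x) = r *\<^sub>R T x" for r x using T_sym by (subst vector_eq_rdot[symmetric]) simp
qed

lemma norm_T_inner: "(norm (T x))\<^sup>2 \<le> T x \<bullet> x"
proof -
  have "T x \<bullet> T x \<le> (pr x - c *\<^sub>R T x) \<bullet> T x + c * (T x \<bullet> T x)" by (rule A_lower[OF T_in_A])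
  also have "\<dots> = pr x \<bullet> T x" by (simp add: inner_diff_left)
  also have "\<dots> = T x \<bullet> x" by (metis inner_commute symmetric_pr pr_T)
  finally show ?thesis by (simp add: power2_norm_eq_inner)
qed

lemma T_injective:
  assumes "T h = 0" "pr h = h" shows "h = 0"
proof (rule S_dense[OF assms(2)])
  fix x y assume "(x, y) \<in> S"
  then have "(x, y) \<in> A" using S_subset_A by auto
  moreover have "(0, h) \<in> A" using T_in_A[of h] assms by simp
  ultimately have "h \<bullet> x = 0 \<bullet> y" using A_sym by blast
  then show "h \<bullet> x = 0" by simp
qed

sublocale T: positive_contraction T by (rule positive_contraction.intro[OF linear_T T_sym norm_T_inner])

lemma A_eq: "A = {(T h, h - c *\<^sub>R T h) |h. pr h = h}"
proof (intro equalityI subrelI)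
  fix x y assume xy: "(x, y) \<in> A"
  have "pr (y + c *\<^sub>R x) = y + c *\<^sub>R x"
    using A_range[OF xy] by (simp add: linear_add[OF linear_pr] linear_scale[OF linear_pr])
  moreover have x: "x = T (y + c *\<^sub>R x)" by (rule T_unique[OF xy])
  then have "y = (y + c *\<^sub>R x) - c *\<^sub>R T (y + c *\<^sub>R x)" by (metis add_diff_cancel_right')
  ultimately show "(x, y) \<in> {(T h, h - c *\<^sub>R T h) |h. pr h = h}" using x by blast
next
  fix x y assume "(x, y) \<in> {(T h, h - c *\<^sub>R T h) |h. pr h = h}"
  then obtain h where "pr h = h" "x = T h" "y = h - c *\<^sub>R T h" by blast
  then show "(x, y) \<in> A" using T_in_A[of h] by simp
qed

text \<open>
  Surjectivity of \<open>A + c\<close> makes \<open>A\<close> maximal among symmetric operators.  This turns inclusions of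
  self-adjoint operators into equalities.
\<close>

lemma A_maximal:
  assumes "pr x = x" "pr y = y" and sym: "\<And>v w. (v, w) \<in> A \<Longrightarrow> y \<bullet> v = x \<bullet> w"
  shows "(x, y) \<in> A"
proof -
  define h where "h = y + c *\<^sub>R x"
  have h: "pr h = h" by (simp add: h_def linear_add[OF linear_pr] linear_scale[OF linear_pr] assms)
  have "x = T h"
  proof (subst vector_eq_rdot[symmetric], rule allI)
    fix g
    have "y \<bullet> T g = x \<bullet> (pr g - c *\<^sub>R T g)" by (rule sym[OF T_in_A])
    then have "h \<bullet> T g = x \<bullet> pr g" by (simp add: h_def inner_diff_right inner_add_left)
    then show "x \<bullet> g = T h \<bullet> g" by (metis T_sym symmetric_pr assms(1))
  qed
  then have "y = h - c *\<^sub>R T h" by (simp add: h_def)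
  then show ?thesis using A_eq h \<open>x = T h\<close> by blast
qed

abbreviation mom where "mom \<equiv> T.moment_measure"

definition unit where "unit = {0<..1::real}"

lemma unit_borel [measurable]: "unit \<in> sets borel" by (simp add: unit_def)

text \<open>
  The spectral calculus \<open>s = 1/t - c\<close> for \<open>T = (A + c)\<^sup>-\<^sup>1\<close>.  The point \<open>t = 0\<close> is the value on the
  orthogonal complement and is left out.
\<close>

definition E :: "real set \<Rightarrow> 'h \<Rightarrow> 'h" where
  "E B = T.proj (unit \<inter> (\<lambda>t. 1 / t - c) -` B)"

lemma pullback_borel [measurable]: "B \<in> sets borel \<Longrightarrow> unit \<inter> (\<lambda>t. 1 / t - c) -` B \<in> sets borel"
proof -
  assume [measurable]: "B \<in> sets borel"
  have "(\<lambda>t. 1 / t - c) \<in> borel_measurable borel" by measurable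
  from measurable_sets[OF this] show ?thesis by (simp add: sets.Int)
qed

text \<open>
  The functions \<open>(1 - t)\<^sup>2\<^sup>k\<close> tend to the indicator of \<open>{0}\<close> on \<open>[0, 1]\<close>, and \<open>T (1 - T)\<^sup>k h \<rightarrow> 0\<close>.
\<close>

lemma moment_zero_T: "measure (mom (T h)) (- unit) = 0"
proof -
  interpret finite_measure "mom (T h)" by (rule T.finite_moment_measure)
  have "measure (mom (T h)) (- unit) = (LINT t|mom (T h). indicator (- unit) t)" by simp
  also have "\<dots> = 0"
  proof (rule LIMSEQ_unique)
    have lim1: "(\<lambda>k. (1 - t) ^ (2 * k)) \<longlonglongrightarrow> indicator (- unit) t" if "0 \<le> t" "t \<le> 1" for t :: real
    proof (cases "t = 0")
      case False
      then have "\<bar>(1 - t)\<^sup>2\<bar> < 1" using that by (simp add: abs_square_less_1)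
      then have "(\<lambda>k. ((1 - t)\<^sup>2) ^ k) \<longlonglongrightarrow> 0" using LIMSEQ_power_zero[of "(1 - t)\<^sup>2"] by simp
      then show ?thesis using False that by (simp add: power_mult unit_def)
    qed (simp add: unit_def)
    show "(\<lambda>k. LINT t|mom (T h). (1 - t) ^ (2 * k)) \<longlonglongrightarrow> (LINT t|mom (T h). indicator (- unit) t)"
    proof (rule T.moment_dominated[where K = 1])
      show "\<bar>(1 - t) ^ (2 * k)\<bar> \<le> 1" if "0 \<le> t" "t \<le> 1" for t :: real and k using that by (simp add: power_le_one)
    qed (use lim1 in auto)
    have eq: "(LINT t|mom (T h). (1 - t) ^ (2 * k)) = (LINT t|mom h. t\<^sup>2 * (1 - t) ^ (2 * k))" for k
    proof -
      define r :: "real poly" where "r = [:1, - 1:] ^ k"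
      have "(LINT t|mom (T h). (1 - t) ^ (2 * k)) = (norm (T.opoly r (T h)))\<^sup>2"
        unfolding T.norm_opoly_integral r_def by (simp add: poly_power power_mult[symmetric] mult.commute)
      also have "\<dots> = (norm (T.opoly ([:0, 1:] * r) h))\<^sup>2" by (simp only: T.opoly_mult T.opoly_X T.opoly_T)
      also have "\<dots> = (LINT t|mom h. t\<^sup>2 * (1 - t) ^ (2 * k))" unfolding T.norm_opoly_integral r_def
        by (simp add: poly_power power_mult_distrib power_mult[symmetric] mult.commute)
      finally show ?thesis .
    qed
    have "(\<lambda>k. LINT t|mom h. t\<^sup>2 * (1 - t) ^ (2 * k)) \<longlonglongrightarrow> (LINT t|mom h. 0)"
    proof (rule T.moment_dominated[where K = 1])
      show "\<bar>t\<^sup>2 * (1 - t) ^ (2 * k)\<bar> \<le> 1" if "0 \<le> t" "t \<le> 1" for t :: real and k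
        using that by (simp add: abs_mult power_le_one mult_le_one)
      show "(\<lambda>k. t\<^sup>2 * (1 - t) ^ (2 * k)) \<longlonglongrightarrow> 0" if "0 \<le> t" "t \<le> 1" for t :: real
      proof -
        have "t\<^sup>2 * indicator (- unit) t = 0" using that by (auto simp: indicator_def unit_def)
        with tendsto_mult[OF tendsto_const[of "t\<^sup>2"] lim1[OF that]] show ?thesis by (simp only:)
      qed
    qed auto
    then show "(\<lambda>k. LINT t|mom (T h). (1 - t) ^ (2 * k)) \<longlonglongrightarrow> 0" by (simp add: eq)
  qed
  finally show ?thesis .
qed

lemma proj_unit: "T.proj unit x = pr x"
proof -
  have N: "- unit \<in> sets borel" by simp
  have split: "T.proj unit x + T.proj (- unit) x = x" for x
    using T.proj_disjoint_Un[OF unit_borel N, of x] by (simp add: T.proj_UNIV)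
  have "T.proj (- unit) (T y) = 0" for y using T.norm_proj[OF N, of "T y"] moment_zero_T by simp
  then have "T (T.proj (- unit) x) = 0" for x
    by (subst vector_eq_rdot[symmetric]) (simp add: T_sym T.symmetric_proj[OF N])
  then have "pr (T.proj (- unit) x) = 0" for x
    using T_injective[of "pr (T.proj (- unit) x)"] by (simp add: T_pr pr_idem)
  then have 1: "pr x = pr (T.proj unit x)" for x by (metis split linear_add[OF linear_pr] add.right_neutral)
  have "T.proj unit z = 0" if "T z = 0" for z
  proof -
    interpret finite_measure "mom z" by (rule T.finite_moment_measure)
    have int: "integrable (mom z) (\<lambda>t. t\<^sup>2)" by (rule T.moment_integrable[where K = 1]) (auto simp: power_le_one)
    have "0 = (norm (T.opoly [:0, 1:] z))\<^sup>2" using that by (simp add: T.opoly_X)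
    also have "\<dots> = (LINT t|mom z. t\<^sup>2)" unfolding T.norm_opoly_integral by simp
    finally have "AE t in mom z. t\<^sup>2 = 0" using integral_nonneg_eq_0_iff_AE[OF int] by simp
    then have "AE t in mom z. t \<notin> unit" by eventually_elim (auto simp: unit_def)
    then have "measure (mom z) unit = 0" by (simp add: AE_iff_measurable[OF _ refl] measure_def emeasure_notin_sets
          sets_eq_imp_space_eq[OF T.sets_moment_measure] Collect_mem_eq)
    then show ?thesis using T.norm_proj[OF unit_borel, of z] by simp
  qed
  then have "T.proj unit (x - pr x) = 0" for x by (simp add: linear_diff[OF linear_T] T_pr)
  then have "T.proj unit x = T.proj unit (pr x)" for x
    by (metis linear_diff[OF T.linear_proj[OF unit_borel]] eq_iff_diff_eq_0)
  then have "T.proj unit x = pr (T.proj unit x)" for x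
    by (subst vector_eq_rdot[symmetric]) (metis T.symmetric_proj[OF unit_borel] symmetric_pr)
  then show ?thesis using 1 by metis
qed

lemma moment_zero: "pr z = z \<Longrightarrow> measure (mom z) (- unit) = 0"
proof -
  assume z: "pr z = z"
  have N: "- unit \<in> sets borel" by simp
  have "T.proj unit z + T.proj (- unit) z = z"
    using T.proj_disjoint_Un[OF unit_borel N, of z] by (simp add: T.proj_UNIV)
  then have "T.proj (- unit) z = 0" using z by (simp add: proj_unit)
  then show ?thesis using T.norm_proj[OF N, of z] by simp
qed

lemma pvm_E: "projection_valued_measure (range pr) E" unfolding projection_valued_measure_def
proof (intro conjI ballI allI impI)
  fix B :: "real set" assume [measurable]: "B \<in> sets borel"
  show "linear (E B)" "E B (E B x) = E B x" "E B x \<bullet> y = x \<bullet> E B y" for x y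
    unfolding E_def by (simp_all add: T.linear_proj T.proj_idem T.symmetric_proj)
next
  show "range (E UNIV) = range pr" by (simp add: E_def proj_unit)
next
  fix B :: "nat \<Rightarrow> real set" and x
  assume B: "range B \<subseteq> sets borel" "disjoint_family B"
  have "(\<lambda>i. T.proj (unit \<inter> (\<lambda>t. 1 / t - c) -` B i) x) sums
      T.proj (\<Union>i. unit \<inter> (\<lambda>t. 1 / t - c) -` B i) x"
    using B by (intro T.sums_proj pullback_borel) (auto simp: disjoint_family_on_def)
  moreover have "(\<Union>i. unit \<inter> (\<lambda>t. 1 / t - c) -` B i) = unit \<inter> (\<lambda>t. 1 / t - c) -` (\<Union>i. B i)" by auto
  ultimately show "(\<lambda>i. E (B i) x) sums E (\<Union>i. B i) x" by (simp add: E_def)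
qed

lemma scalar_measure_E:
  "scalar_measure E x = distr (restrict_space (mom x) unit) borel (\<lambda>t. 1 / t - c)"
proof -
  interpret finite_measure "mom x" by (rule T.finite_moment_measure)
  let ?N = "distr (restrict_space (mom x) unit) borel (\<lambda>t. 1 / t - c)"
  have meas: "(\<lambda>t. 1 / t - c) \<in> measurable (restrict_space (mom x) unit) borel"
    by (rule measurable_restrict_space1) simp
  have "emeasure ?N B = ennreal (E B x \<bullet> x)" if B: "B \<in> sets borel" for B
  proof -
    have [simp]: "space (mom x) = UNIV" using sets_eq_imp_space_eq[OF T.sets_moment_measure[of x]] by simp
    have "emeasure ?N B = emeasure (restrict_space (mom x) unit) ((\<lambda>t. 1 / t - c) -` B \<inter> unit)"
      using emeasure_distr[OF meas B] by (simp add: space_restrict_space)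
    also have "\<dots> = emeasure (mom x) ((\<lambda>t. 1 / t - c) -` B \<inter> unit)" by (rule emeasure_restrict_space) auto
    also have "\<dots> = ennreal (E B x \<bullet> x)"
      using B by (simp add: E_def T.inner_proj pullback_borel emeasure_eq_measure Int_commute)
    finally show ?thesis .
  qed
  then have "scalar_measure E x = measure_of UNIV (sets borel) (emeasure ?N)" unfolding scalar_measure_def
    by (intro measure_of_eq) (auto simp: sets.sigma_sets_eq[of borel, simplified])
  also have "\<dots> = ?N" using measure_of_of_measure[of ?N] by simp
  finally show ?thesis .
qed

lemma integral_scalar_measure_E:
  fixes g :: "real \<Rightarrow> real"
  assumes [measurable]: "g \<in> borel_measurable borel"
  shows "(LINT s|scalar_measure E x. g s) = (LINT t|mom x. indicator unit t * g (1 / t - c))"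
    and "integrable (scalar_measure E x) g \<longleftrightarrow> integrable (mom x) (\<lambda>t. indicator unit t * g (1 / t - c))"
proof -
  have [simp]: "space (mom x) = UNIV" using sets_eq_imp_space_eq[OF T.sets_moment_measure[of x]] by simp
  have meas: "(\<lambda>t. 1 / t - c) \<in> measurable (restrict_space (mom x) unit) borel"
    by (rule measurable_restrict_space1) simp
  show "(LINT s|scalar_measure E x. g s) = (LINT t|mom x. indicator unit t * g (1 / t - c))"
    unfolding scalar_measure_E by (subst integral_distr[OF meas]) (simp_all add: integral_restrict_space)
  show "integrable (scalar_measure E x) g \<longleftrightarrow> integrable (mom x) (\<lambda>t. indicator unit t * g (1 / t - c))"
    unfolding scalar_measure_E by (subst integrable_distr_eq[OF meas]) (simp_all add: integrable_restrict_space)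
qed

text \<open>
  The truncated geometric series of \<open>1/t = 1/(1 - (1 - t))\<close>.  Applied to \<open>T\<close> it approximates the unbounded
  operator \<open>T\<^sup>-\<^sup>1 = A + c\<close> by polynomials, monotonically on \<open>(0, 1]\<close>.
\<close>

definition geo :: "nat \<Rightarrow> real poly" where
  "geo k = (\<Sum>j<k. [:1, - 1:] ^ j)"

lemma poly_geo: "poly (geo k) t = (\<Sum>j<k. (1 - t) ^ j)" by (simp add: geo_def poly_sum poly_power)

lemma X_geo: "[:0, 1:] * geo k = 1 - [:1, - 1:] ^ k"
proof -
  have X: "[:0, 1:] = 1 - [:1, - 1 :: real:]" by (simp add: one_pCons)
  show ?thesis unfolding geo_def X by (rule one_diff_power_eq[symmetric])
qed

lemma geo_unit:
  assumes "t \<in> unit"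
  shows "0 \<le> poly (geo k) t" "poly (geo k) t \<le> 1 / t" "(\<lambda>k. poly (geo k) t) \<longlonglongrightarrow> 1 / t"
proof -
  have t: "0 < t" "t \<le> 1" using assms by (auto simp: unit_def)
  show "0 \<le> poly (geo k) t" unfolding poly_geo using t by (intro sum_nonneg) auto
  have sms: "(\<lambda>j. (1 - t) ^ j) sums (1 / t)" using geometric_sums[of "1 - t"] t by simp
  show "(\<lambda>k. poly (geo k) t) \<longlonglongrightarrow> 1 / t" unfolding poly_geo using sms by (simp add: sums_def)
  show "poly (geo k) t \<le> 1 / t" unfolding poly_geo using t
    by (subst sums_unique[OF sms]) (intro sum_le_suminf sums_summable[OF sms], auto)
qed

lemma integrable_inverse_square_iff:
  assumes z: "pr z = z"
  shows "integrable (mom z) (\<lambda>t. indicator unit t * (1 / t)\<^sup>2) \<longleftrightarrow> (\<exists>K. \<forall>k. (norm (T.opoly (geo k) z))\<^sup>2 \<le> K)"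
proof -
  interpret finite_measure "mom z" by (rule T.finite_moment_measure)
  have AE: "AE t in mom z. t \<in> unit"
  proof -
    have "emeasure (mom z) (- unit) = 0" using moment_zero[OF z] by (simp add: emeasure_eq_measure)
    then have "- unit \<in> null_sets (mom z)" by (simp add: null_sets_def)
    then show ?thesis by (rule AE_I') auto
  qed
  have eq: "(norm (T.opoly (geo k) z))\<^sup>2 = (LINT t|mom z. indicator unit t * (poly (geo k) t)\<^sup>2)" for k
    unfolding T.norm_opoly_integral by (intro integral_cong_AE) (use AE in \<open>auto elim!: eventually_mono\<close>)
  have int: "integrable (mom z) (\<lambda>t. indicator unit t * (poly (geo k) t)\<^sup>2)" for k
  proof -
    have "integrable (mom z) (poly ((geo k)\<^sup>2))" by simp
    then have "integrable (mom z) (\<lambda>t. (poly (geo k) t)\<^sup>2)"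
      by (rule Bochner_Integration.integrable_cong[THEN iffD1, rotated -1]) (simp_all add: poly_power)
    from integrable_mult_indicator[where A = unit, OF _ this] show ?thesis by simp
  qed
  show ?thesis
  proof
    assume I: "integrable (mom z) (\<lambda>t. indicator unit t * (1 / t)\<^sup>2)"
    have "(norm (T.opoly (geo k) z))\<^sup>2 \<le> (LINT t|mom z. indicator unit t * (1 / t)\<^sup>2)" for k unfolding eq
    proof (intro integral_mono int I)
      show "indicator unit t * (poly (geo k) t)\<^sup>2 \<le> indicator unit t * (1 / t)\<^sup>2" for t :: real
        using geo_unit(1,2)[of t k] by (auto simp: indicator_def intro: power_mono simp del: power_one_over power_divide)
    qed
    then show "\<exists>K. \<forall>k. (norm (T.opoly (geo k) z))\<^sup>2 \<le> K" by blast
  next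
    assume "\<exists>K. \<forall>k. (norm (T.opoly (geo k) z))\<^sup>2 \<le> K"
    then obtain K where K: "\<And>k. (norm (T.opoly (geo k) z))\<^sup>2 \<le> K" by blast
    have mono_geo: "poly (geo i) t \<le> poly (geo j) t" if "i \<le> j" "t \<in> unit" for i j t
      unfolding poly_geo using that by (intro sum_mono2) (auto simp: unit_def)
    have "incseq (\<lambda>k. (norm (T.opoly (geo k) z))\<^sup>2)" unfolding eq
    proof (intro monoI integral_mono int)
      fix i j :: nat and t :: real assume "i \<le> j"
      then show "indicator unit t * (poly (geo i) t)\<^sup>2 \<le> indicator unit t * (poly (geo j) t)\<^sup>2"
        using geo_unit(1,2)[of t i] mono_geo[of i j t] by (auto simp: indicator_def intro: power_mono)
    qed
    then obtain L where L: "(\<lambda>k. (norm (T.opoly (geo k) z))\<^sup>2) \<longlonglongrightarrow> L"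
      using incseq_convergent[of "\<lambda>k. (norm (T.opoly (geo k) z))\<^sup>2" K] K by blast
    show "integrable (mom z) (\<lambda>t. indicator unit t * (1 / t)\<^sup>2)"
    proof (rule integrable_monotone_convergence)
      show "AE t in mom z. mono (\<lambda>k. indicator unit t * (poly (geo k) t)\<^sup>2)"
        using geo_unit(1) mono_geo by (auto simp: mono_def indicator_def intro!: power_mono)
      show "AE t in mom z. (\<lambda>k. indicator unit t * (poly (geo k) t)\<^sup>2) \<longlonglongrightarrow> indicator unit t * (1 / t)\<^sup>2"
        using geo_unit(3) by (auto simp: indicator_def intro!: tendsto_power simp del: power_one_over power_divide)
      show "(\<lambda>k. LINT t|mom z. indicator unit t * (poly (geo k) t)\<^sup>2) \<longlonglongrightarrow> L" using L unfolding eq .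
    qed (use int in auto)
  qed
qed

lemma integrable_square_iff:
  assumes z: "pr z = z"
  shows "integrable (scalar_measure E z) (\<lambda>s. s\<^sup>2) \<longleftrightarrow> (\<exists>K. \<forall>k. (norm (T.opoly (geo k) z))\<^sup>2 \<le> K)"
proof -
  interpret finite_measure "mom z" by (rule T.finite_moment_measure)
  have 1: "(u - v)\<^sup>2 \<le> 2 * u\<^sup>2 + 2 * v\<^sup>2" for u v :: real
  proof -
    have "2 * u\<^sup>2 + 2 * v\<^sup>2 - (u - v)\<^sup>2 = (u + v)\<^sup>2" by (simp add: power2_eq_square algebra_simps)
    then show ?thesis by (metis diff_ge_0_iff_ge zero_le_power2)
  qed
  have c: "integrable (mom z) (\<lambda>t. indicator unit t * (2 * c\<^sup>2))"
    by (rule T.moment_integrable[where K = "2 * c\<^sup>2"]) (auto simp: indicator_def)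
  have "integrable (mom z) (\<lambda>t. indicator unit t * (1 / t - c)\<^sup>2) \<longleftrightarrow>
      integrable (mom z) (\<lambda>t. indicator unit t * (1 / t)\<^sup>2)"
  proof
    assume "integrable (mom z) (\<lambda>t. indicator unit t * (1 / t - c)\<^sup>2)"
    then have "integrable (mom z) (\<lambda>t. 2 * (indicator unit t * (1 / t - c)\<^sup>2) + indicator unit t * (2 * c\<^sup>2))"
      using c by auto
    then show "integrable (mom z) (\<lambda>t. indicator unit t * (1 / t)\<^sup>2)"
    proof (rule Bochner_Integration.integrable_bound)
      show "AE t in mom z. norm (indicator unit t * (1 / t)\<^sup>2) \<le>
          norm (2 * (indicator unit t * (1 / t - c)\<^sup>2) + indicator unit t * (2 * c\<^sup>2))"
        using 1[of "1 / _ - c" "- c"] by (auto intro!: AE_I2 simp: indicator_def simp del: power_one_over power_divide)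
    qed auto
  next
    assume "integrable (mom z) (\<lambda>t. indicator unit t * (1 / t)\<^sup>2)"
    then have "integrable (mom z) (\<lambda>t. 2 * (indicator unit t * (1 / t)\<^sup>2) + indicator unit t * (2 * c\<^sup>2))"
      using c by auto
    then show "integrable (mom z) (\<lambda>t. indicator unit t * (1 / t - c)\<^sup>2)"
    proof (rule Bochner_Integration.integrable_bound)
      show "AE t in mom z. norm (indicator unit t * (1 / t - c)\<^sup>2) \<le>
          norm (2 * (indicator unit t * (1 / t)\<^sup>2) + indicator unit t * (2 * c\<^sup>2))"
        using 1[of "1 / _" c] by (auto intro!: AE_I2 simp: indicator_def simp del: power_one_over power_divide)
    qed auto
  qed
  then show ?thesis using integral_scalar_measure_E(2)[of "\<lambda>s. s\<^sup>2" z] integrable_inverse_square_iff[OF z] by simp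
qed

lemma opoly_geo_limit:
  assumes z: "pr z = z" and I: "integrable (scalar_measure E z) (\<lambda>s. s\<^sup>2)"
  shows "(\<lambda>k. T.opoly (geo k - [:c:]) z \<bullet> z) \<longlonglongrightarrow> (LINT s|scalar_measure E z. s)"
proof -
  interpret finite_measure "mom z" by (rule T.finite_moment_measure)
  have AE: "AE t in mom z. t \<in> unit"
  proof -
    have "emeasure (mom z) (- unit) = 0" using moment_zero[OF z] by (simp add: emeasure_eq_measure)
    then have "- unit \<in> null_sets (mom z)" by (simp add: null_sets_def)
    then show ?thesis by (rule AE_I') auto
  qed
  have I': "integrable (mom z) (\<lambda>t. indicator unit t * (1 / t)\<^sup>2)"
    using I by (simp only: integrable_square_iff[OF z] integrable_inverse_square_iff[OF z])
  have "(\<lambda>k. LINT t|mom z. poly (geo k - [:c:]) t) \<longlonglongrightarrow> (LINT t|mom z. indicator unit t * (1 / t - c))"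
  proof (rule integral_dominated_convergence[where w = "\<lambda>t. indicator unit t * (1 / t)\<^sup>2 + (1 + \<bar>c\<bar>)"])
    show "integrable (mom z) (\<lambda>t. indicator unit t * (1 / t)\<^sup>2 + (1 + \<bar>c\<bar>))" using I' by auto
    show "AE t in mom z. (\<lambda>k. poly (geo k - [:c:]) t) \<longlonglongrightarrow> indicator unit t * (1 / t - c)"
      using AE by eventually_elim (auto intro!: tendsto_intros geo_unit(3))
    show "AE t in mom z. norm (poly (geo k - [:c:]) t) \<le> indicator unit t * (1 / t)\<^sup>2 + (1 + \<bar>c\<bar>)" for k using AE
    proof eventually_elim
      case (elim t)
      have "0 \<le> (1 / t - 1)\<^sup>2" by simp
      then have "2 * (1 / t) \<le> (1 / t)\<^sup>2 + 1" by (simp add: power2_eq_square algebra_simps)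
      moreover have "0 \<le> 1 / t" using elim by (simp add: unit_def)
      ultimately have "1 / t \<le> (1 / t)\<^sup>2 + 1" by linarith
      then show ?case using geo_unit(1,2)[OF elim, of k] elim by (simp del: power_one_over power_divide)
    qed
  qed auto
  then show ?thesis
    using integral_scalar_measure_E(1)[of "\<lambda>s. s" z] by (simp add: T.integral_moment_measure[symmetric])
qed

lemma opoly_geo_T_limit:
  assumes h: "pr h = h"
  shows "(\<lambda>k. T.opoly (geo k - [:c:]) (T h)) \<longlonglongrightarrow> h - c *\<^sub>R T h"
proof -
  interpret finite_measure "mom h" by (rule T.finite_moment_measure)
  have eq: "T.opoly (geo k - [:c:]) (T h) = h - T.opoly ([:1, - 1:] ^ k) h - c *\<^sub>R T h" for k
  proof -
    have "T.opoly (geo k) (T h) = T.opoly ([:0, 1:] * geo k) h" by (simp only: T.opoly_mult T.opoly_X T.opoly_T)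
    also have "\<dots> = h - T.opoly ([:1, - 1:] ^ k) h" by (simp only: X_geo T.opoly_diff T.opoly_1)
    finally show ?thesis by (simp add: T.opoly_diff T.opoly_pCons T.opoly_0 T.T_simps)
  qed
  have "(\<lambda>k. LINT t|mom h. (1 - t) ^ (2 * k)) \<longlonglongrightarrow> (LINT t|mom h. indicator (- unit) t)"
  proof (rule T.moment_dominated[where K = 1])
    show "\<bar>(1 - t) ^ (2 * k)\<bar> \<le> 1" if "0 \<le> t" "t \<le> 1" for t :: real and k using that by (simp add: power_le_one)
    show "(\<lambda>k. (1 - t) ^ (2 * k)) \<longlonglongrightarrow> indicator (- unit) t" if "0 \<le> t" "t \<le> 1" for t :: real
    proof (cases "t = 0")
      case False
      then have "\<bar>(1 - t)\<^sup>2\<bar> < 1" using that by (simp add: abs_square_less_1)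
      then have "(\<lambda>k. ((1 - t)\<^sup>2) ^ k) \<longlonglongrightarrow> 0" using LIMSEQ_power_zero[of "(1 - t)\<^sup>2"] by simp
      then show ?thesis using False that by (simp add: power_mult unit_def)
    qed (simp add: unit_def)
  qed auto
  moreover have "(LINT t|mom h. (1 - t) ^ (2 * k)) = (norm (T.opoly ([:1, - 1:] ^ k) h))\<^sup>2" for k
    unfolding T.norm_opoly_integral by (simp add: poly_power power_mult[symmetric] mult.commute)
  ultimately have "(\<lambda>k. (norm (T.opoly ([:1, - 1:] ^ k) h))\<^sup>2) \<longlonglongrightarrow> 0" using moment_zero[OF h] by simp
  then have "(\<lambda>k. sqrt ((norm (T.opoly ([:1, - 1:] ^ k) h))\<^sup>2)) \<longlonglongrightarrow> sqrt 0" by (rule tendsto_real_sqrt)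
  then have "(\<lambda>k. T.opoly ([:1, - 1:] ^ k) h) \<longlonglongrightarrow> 0" by (simp add: tendsto_norm_zero_iff)
  then have "(\<lambda>k. h - T.opoly ([:1, - 1:] ^ k) h - c *\<^sub>R T h) \<longlonglongrightarrow> h - 0 - c *\<^sub>R T h" by (intro tendsto_intros)
  then show ?thesis by (simp add: eq)
qed

lemma A_subset_spectral_integral: "A \<subseteq> spectral_integral (range pr) E"
proof (rule subrelI)
  fix x y assume "(x, y) \<in> A"
  then obtain h where h: "pr h = h" "x = T h" "y = h - c *\<^sub>R T h" by (auto simp: A_eq)
  have x: "pr x = x" and y: "pr y = y"
    using h by (auto simp: pr_T linear_diff[OF linear_pr] linear_scale[OF linear_pr])
  have Ix: "integrable (scalar_measure E x) (\<lambda>s. s\<^sup>2)"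
  proof -
    have "(\<lambda>k. T.opoly (geo k - [:c:]) (T h) + c *\<^sub>R T h) \<longlonglongrightarrow> (h - c *\<^sub>R T h) + c *\<^sub>R T h"
      by (intro tendsto_add opoly_geo_T_limit[OF h(1)] tendsto_const)
    then have "(\<lambda>k. T.opoly (geo k) (T h)) \<longlonglongrightarrow> h" by (simp add: T.opoly_diff T.opoly_pCons T.opoly_0 T.T_simps)
    then obtain K where "\<And>k. norm (T.opoly (geo k) (T h)) \<le> K"
      using convergent_imp_Bseq[OF convergentI] by (metis Bseq_def)
    then have "(norm (T.opoly (geo k) x))\<^sup>2 \<le> K\<^sup>2" for k unfolding h(2) by (intro power_mono) auto
    then show ?thesis unfolding integrable_square_iff[OF x] by blast
  qed
  have "y \<bullet> v = ((LINT s|scalar_measure E (x + v). s) - (LINT s|scalar_measure E (x - v). s)) / 4"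
    if v: "pr v = v" and Iv: "integrable (scalar_measure E v) (\<lambda>s. s\<^sup>2)" for v
  proof -
    obtain K1 where K1: "\<And>k. (norm (T.opoly (geo k) x))\<^sup>2 \<le> K1" using Ix integrable_square_iff[OF x] by blast
    obtain K2 where K2: "\<And>k. (norm (T.opoly (geo k) v))\<^sup>2 \<le> K2" using Iv integrable_square_iff[OF v] by blast
    have par: "(norm (p + q))\<^sup>2 + (norm (p - q))\<^sup>2 = 2 * (norm p)\<^sup>2 + 2 * (norm q)\<^sup>2" for p q :: 'h
      by (simp add: power2_norm_eq_inner inner_add_left inner_add_right inner_diff_left inner_diff_right inner_commute)
    have xv: "pr (x + v) = x + v" "pr (x - v) = x - v"
      using x v by (auto simp: linear_diff[OF linear_pr] linear_add[OF linear_pr])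
    have B: "(norm (T.opoly (geo k) (x + v)))\<^sup>2 \<le> 2 * K1 + 2 * K2"
      "(norm (T.opoly (geo k) (x - v)))\<^sup>2 \<le> 2 * K1 + 2 * K2" for k
      using par[of "T.opoly (geo k) x" "T.opoly (geo k) v"] K1[of k] K2[of k]
        zero_le_power2[of "norm (T.opoly (geo k) x + T.opoly (geo k) v)"]
        zero_le_power2[of "norm (T.opoly (geo k) x - T.opoly (geo k) v)"]
      unfolding linear_add[OF T.linear_opoly] linear_diff[OF T.linear_opoly] by linarith+
    have I1: "integrable (scalar_measure E (x + v)) (\<lambda>s. s\<^sup>2)" "integrable (scalar_measure E (x - v)) (\<lambda>s. s\<^sup>2)"
      unfolding integrable_square_iff[OF xv(1)] integrable_square_iff[OF xv(2)] using B by blast+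
    have pol: "T.opoly p x \<bullet> v = (T.opoly p (x + v) \<bullet> (x + v) - T.opoly p (x - v) \<bullet> (x - v)) / 4" for p
      using T.symmetric_opoly[of p v x]
      by (simp add: linear_add[OF T.linear_opoly] linear_diff[OF T.linear_opoly] inner_add_left inner_add_right
          inner_diff_left inner_diff_right inner_commute)
    show ?thesis
    proof (rule LIMSEQ_unique)
      show "(\<lambda>k. T.opoly (geo k - [:c:]) x \<bullet> v) \<longlonglongrightarrow> y \<bullet> v"
        unfolding h(2,3) by (intro tendsto_inner opoly_geo_T_limit[OF h(1)] tendsto_const)
      show "(\<lambda>k. T.opoly (geo k - [:c:]) x \<bullet> v) \<longlonglongrightarrow>
          ((LINT s|scalar_measure E (x + v). s) - (LINT s|scalar_measure E (x - v). s)) / 4"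
        unfolding pol by (intro tendsto_divide tendsto_diff opoly_geo_limit xv I1 tendsto_const) simp
    qed
  qed
  then show "(x, y) \<in> spectral_integral (range pr) E" by (simp add: spectral_integral_def in_range_pr x y Ix pr_idem)
qed

lemma scalar_measure_minus:
  assumes "projection_valued_measure (range pr) F" shows "scalar_measure F (- x) = scalar_measure F x"
  unfolding scalar_measure_def
proof (intro measure_of_eq)
  fix a :: "real set" assume "a \<in> sigma_sets UNIV (sets borel)"
  then have "linear (F a)"
    using assms by (simp add: projection_valued_measure_def sets.sigma_sets_eq[of borel, simplified])
  then show "ennreal (F a (- x) \<bullet> - x) = ennreal (F a x \<bullet> x)" by (simp add: linear_neg)
qed auto

text \<open>
  The spectral integral is symmetric and extends \<open>A\<close>, so it equals \<open>A\<close> by maximality.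
\<close>

theorem friedrichs_spectral_integral: "A = spectral_integral (range pr) E"
proof (intro equalityI A_subset_spectral_integral subrelI)
  fix x y assume xy: "(x, y) \<in> spectral_integral (range pr) E"
  show "(x, y) \<in> A"
  proof (rule A_maximal)
    show "pr x = x" "pr y = y" using xy by (auto simp: spectral_integral_def in_range_pr)
    fix v w assume "(v, w) \<in> A"
    then have vw: "(v, w) \<in> spectral_integral (range pr) E" using A_subset_spectral_integral by auto
    have "y \<bullet> v = ((LINT s|scalar_measure E (x + v). s) - (LINT s|scalar_measure E (x - v). s)) / 4"
      using xy vw by (auto simp: spectral_integral_def)
    also have "x - v = - (v - x)" by simp
    also have "scalar_measure E \<dots> = scalar_measure E (v - x)" by (rule scalar_measure_minus[OF pvm_E])
    also have "x + v = v + x" by simp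
    also have "((LINT s|scalar_measure E (v + x). s) - (LINT s|scalar_measure E (v - x). s)) / 4 = w \<bullet> x"
      using xy vw by (auto simp: spectral_integral_def)
    finally show "y \<bullet> v = x \<bullet> w" by (simp add: inner_commute)
  qed
qed

end

section \<open>Negative definite families\<close>

definition negative_definite :: "'i set \<Rightarrow> ('i \<Rightarrow> 'i \<Rightarrow> real) \<Rightarrow> bool" where
  "negative_definite I M \<longleftrightarrow> (\<forall>c. (\<exists>i\<in>I. c i \<noteq> 0) \<longrightarrow> (\<Sum>i\<in>I. \<Sum>j\<in>I. c i * c j * M i j) < 0)"

lemma compact_unit_sphere_fun:
  assumes "finite I"
  shows "compact {c :: 'i \<Rightarrow> real. (\<forall>i. i \<notin> I \<longrightarrow> c i = 0) \<and> (\<Sum>i\<in>I. (c i)\<^sup>2) = 1}"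
proof -
  let ?K = "PiE UNIV (\<lambda>i. if i \<in> I then {-1..1} else {0::real})"
  have "compactin (product_topology (\<lambda>i::'i. euclidean) UNIV) ?K" unfolding compactin_PiE by auto
  then have K: "compact ?K" by (simp add: euclidean_product_topology)
  have cont: "continuous_on UNIV (\<lambda>c :: 'i \<Rightarrow> real. \<Sum>i\<in>I. (c i)\<^sup>2)"
    by (intro continuous_intros continuous_on_product_coordinates)
  have "closed {c :: 'i \<Rightarrow> real. (\<Sum>i\<in>I. (c i)\<^sup>2) = 1}" by (intro closed_Collect_eq cont continuous_on_const)
  with K have "compact (?K \<inter> {c. (\<Sum>i\<in>I. (c i)\<^sup>2) = 1})" by (rule compact_Int_closed)
  also have "?K \<inter> {c. (\<Sum>i\<in>I. (c i)\<^sup>2) = 1} = {c. (\<forall>i. i \<notin> I \<longrightarrow> c i = 0) \<and> (\<Sum>i\<in>I. (c i)\<^sup>2) = 1}"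
  proof (intro equalityI subsetI)
    fix c :: "'i \<Rightarrow> real" assume "c \<in> {c. (\<forall>i. i \<notin> I \<longrightarrow> c i = 0) \<and> (\<Sum>i\<in>I. (c i)\<^sup>2) = 1}"
    then have c: "\<And>i. i \<notin> I \<Longrightarrow> c i = 0" "(\<Sum>i\<in>I. (c i)\<^sup>2) = 1" by auto
    have "\<bar>c i\<bar> \<le> 1" if "i \<in> I" for i
    proof -
      have "(c i)\<^sup>2 \<le> (\<Sum>i\<in>I. (c i)\<^sup>2)" using that assms by (intro member_le_sum) auto
      then show ?thesis using c(2) by (simp add: abs_square_le_1)
    qed
    then show "c \<in> ?K \<inter> {c. (\<Sum>i\<in>I. (c i)\<^sup>2) = 1}" using c by (auto simp: PiE_iff abs_le_iff)
  qed (auto simp: PiE_iff split: if_splits)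
  finally show ?thesis .
qed

lemma negative_definite_coercive:
  assumes "finite I" "negative_definite I M"
  shows "\<exists>e>0. \<forall>c. (\<Sum>i\<in>I. \<Sum>j\<in>I. c i * c j * M i j) \<le> - e * (\<Sum>i\<in>I. (c i)\<^sup>2)"
proof (cases "I = {}")
  case True
  then show ?thesis by (intro exI[of _ 1]) simp
next
  case False
  let ?K = "{c :: 'a \<Rightarrow> real. (\<forall>i. i \<notin> I \<longrightarrow> c i = 0) \<and> (\<Sum>i\<in>I. (c i)\<^sup>2) = 1}"
  define Q where "Q c = (\<Sum>i\<in>I. \<Sum>j\<in>I. c i * c j * M i j)" for c :: "'a \<Rightarrow> real"
  obtain i0 where i0: "i0 \<in> I" using False by blast
  define c0 where "c0 i = (if i = i0 then 1 else 0 :: real)" for i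
  have "(\<Sum>i\<in>I. (c0 i)\<^sup>2) = (\<Sum>i\<in>I. c0 i)" by (intro sum.cong refl) (simp add: c0_def)
  also have "\<dots> = 1" unfolding c0_def using i0 assms(1) by (simp add: sum.delta)
  finally have "c0 \<in> ?K" using i0 by (auto simp: c0_def)
  then have ne: "?K \<noteq> {}" by blast
  have cont: "continuous_on ?K Q"
  proof -
    have "continuous_on ?K (\<lambda>c. c i)" for i by (rule continuous_on_subset[OF continuous_on_product_coordinates]) simp
    then show ?thesis unfolding Q_def by (intro continuous_on_sum continuous_on_mult continuous_on_const)
  qed
  from continuous_attains_sup[OF compact_unit_sphere_fun[OF assms(1)] ne cont]
  obtain m where m1: "m \<in> ?K" and m2: "\<forall>c\<in>?K. Q c \<le> Q m" by (elim bexE) (rule that)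
  have "\<exists>i\<in>I. m i \<noteq> 0"
  proof (rule ccontr)
    assume "\<not> ?thesis"
    then have "(\<Sum>i\<in>I. (m i)\<^sup>2) = 0" by simp
    then show False using m1 by simp
  qed
  then have neg: "Q m < 0" using assms(2) unfolding negative_definite_def Q_def by blast
  have "Q c \<le> - (- Q m) * (\<Sum>i\<in>I. (c i)\<^sup>2)" for c
  proof (cases "(\<Sum>i\<in>I. (c i)\<^sup>2) = 0")
    case True
    then have "\<And>i. i \<in> I \<Longrightarrow> c i = 0" using assms(1) by (simp add: sum_nonneg_eq_0_iff)
    then show ?thesis by (simp add: Q_def)
  next
    case False
    define r where "r = sqrt (\<Sum>i\<in>I. (c i)\<^sup>2)"
    have "0 \<le> (\<Sum>i\<in>I. (c i)\<^sup>2)" by (intro sum_nonneg) simp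
    then have r: "0 < r" "r\<^sup>2 = (\<Sum>i\<in>I. (c i)\<^sup>2)" using False by (auto simp: r_def)
    define c' where "c' i = (if i \<in> I then c i / r else 0)" for i
    have "(\<Sum>i\<in>I. (c' i)\<^sup>2) = (\<Sum>i\<in>I. (c i)\<^sup>2) / r\<^sup>2" by (simp add: c'_def power_divide sum_divide_distrib)
    also have "\<dots> = 1" unfolding r(2)[symmetric] using r(1) by simp
    finally have "c' \<in> ?K" by (auto simp: c'_def)
    then have "Q c' \<le> Q m" by (rule m2[rule_format])
    moreover have "Q c = r\<^sup>2 * Q c'" unfolding Q_def sum_distrib_left using r(1)
      by (intro sum.cong refl) (simp add: c'_def power2_eq_square)
    ultimately have "Q c \<le> r\<^sup>2 * Q m" by (simp only: mult_left_mono zero_le_power2)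
    then show ?thesis using r(2) by (simp add: mult.commute)
  qed
  then show ?thesis using neg unfolding Q_def by (intro exI[of _ "- Q m"]) (auto simp: Q_def)
qed

text \<open>
  Negative definiteness is an open condition, by compactness of the unit sphere.  This is what allows
  replacing vectors by approximations in the form domain.
\<close>

lemma negative_definite_perturb:
  fixes M :: "'i \<Rightarrow> 'i \<Rightarrow> real"
  assumes fin: "finite I" and neg: "negative_definite I M"
    and lim: "\<And>i j. i \<in> I \<Longrightarrow> j \<in> I \<Longrightarrow> ((\<lambda>n. N n i j) \<longlongrightarrow> M i j) F"
  shows "\<forall>\<^sub>F n in F. negative_definite I (N n)"
proof -
  obtain e where e: "e > 0" "\<And>c. (\<Sum>i\<in>I. \<Sum>j\<in>I. c i * c j * M i j) \<le> - e * (\<Sum>i\<in>I. (c i)\<^sup>2)"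
    using negative_definite_coercive[OF fin neg] by blast
  have "((\<lambda>n. \<Sum>i\<in>I. \<Sum>j\<in>I. \<bar>N n i j - M i j\<bar>) \<longlongrightarrow> (\<Sum>i\<in>I. \<Sum>j\<in>I. \<bar>M i j - M i j\<bar>)) F" by (intro tendsto_intros lim)
  then have "\<forall>\<^sub>F n in F. (\<Sum>i\<in>I. \<Sum>j\<in>I. \<bar>N n i j - M i j\<bar>) < e"
    using e(1) by (intro order_tendstoD(2)[where y = 0]) auto
  then show ?thesis
  proof eventually_elim
    case (elim n)
    show ?case unfolding negative_definite_def
    proof (intro allI impI)
      fix c :: "'i \<Rightarrow> real" assume "\<exists>i\<in>I. c i \<noteq> 0"
      define s where "s = (\<Sum>i\<in>I. (c i)\<^sup>2)"
      have s: "(c i)\<^sup>2 \<le> s" if "i \<in> I" for i unfolding s_def using that fin by (intro member_le_sum) auto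
      obtain i where i: "i \<in> I" "c i \<noteq> 0" using \<open>\<exists>i\<in>I. c i \<noteq> 0\<close> by blast
      then have s0: "0 < s" using s[of i] by (meson less_le_trans zero_less_power2)
      have cc: "\<bar>c i * c j\<bar> \<le> s" if "i \<in> I" "j \<in> I" for i j
      proof -
        have "0 \<le> (\<bar>c i\<bar> - \<bar>c j\<bar>)\<^sup>2" by simp
        then have "2 * (\<bar>c i\<bar> * \<bar>c j\<bar>) \<le> (c i)\<^sup>2 + (c j)\<^sup>2" by (simp add: power2_diff algebra_simps)
        then show ?thesis using s[OF that(1)] s[OF that(2)] by (simp add: abs_mult)
      qed
      have "(\<Sum>i\<in>I. \<Sum>j\<in>I. c i * c j * N n i j) =
          (\<Sum>i\<in>I. \<Sum>j\<in>I. c i * c j * M i j) + (\<Sum>i\<in>I. \<Sum>j\<in>I. c i * c j * (N n i j - M i j))"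
        by (simp add: sum.distrib[symmetric] algebra_simps)
      also have "\<dots> \<le> - e * s + (\<Sum>i\<in>I. \<Sum>j\<in>I. s * \<bar>N n i j - M i j\<bar>)"
      proof (intro add_mono sum_mono)
        show "(\<Sum>i\<in>I. \<Sum>j\<in>I. c i * c j * M i j) \<le> - e * s" unfolding s_def by (rule e(2))
        fix i j assume "i \<in> I" "j \<in> I"
        then have "\<bar>c i * c j\<bar> * \<bar>N n i j - M i j\<bar> \<le> s * \<bar>N n i j - M i j\<bar>" by (intro mult_right_mono cc) auto
        then show "c i * c j * (N n i j - M i j) \<le> s * \<bar>N n i j - M i j\<bar>"
          using abs_ge_self[of "c i * c j * (N n i j - M i j)"] by (simp add: abs_mult)
      qed
      also have "\<dots> = s * ((\<Sum>i\<in>I. \<Sum>j\<in>I. \<bar>N n i j - M i j\<bar>) - e)"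
        by (simp add: sum_distrib_left[symmetric] algebra_simps)
      also have "\<dots> < 0" using elim s0 by (simp add: mult_pos_neg)
      finally show "(\<Sum>i\<in>I. \<Sum>j\<in>I. c i * c j * N n i j) < 0" .
    qed
  qed
qed

lemma negative_definite_reindex:
  assumes "bij_betw f I J" "negative_definite J M"
  shows "negative_definite I (\<lambda>i j. M (f i) (f j))" unfolding negative_definite_def
proof (intro allI impI)
  fix c :: "'a \<Rightarrow> real" assume c: "\<exists>i\<in>I. c i \<noteq> 0"
  define c' where "c' = c \<circ> inv_into I f"
  have c': "c' (f i) = c i" if "i \<in> I" for i using that assms(1) by (simp add: c'_def bij_betw_def)
  have "(\<Sum>i\<in>I. \<Sum>j\<in>I. c i * c j * M (f i) (f j)) = (\<Sum>i\<in>I. \<Sum>j\<in>I. c' (f i) * c' (f j) * M (f i) (f j))"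
    by (intro sum.cong refl) (simp add: c')
  also have "\<dots> = (\<Sum>i\<in>J. \<Sum>j\<in>J. c' i * c' j * M i j)"
    by (simp add: sum.reindex_bij_betw[OF assms(1), of "\<lambda>j. c' _ * c' j * M _ j"]
        sum.reindex_bij_betw[OF assms(1), of "\<lambda>i. \<Sum>j\<in>J. c' i * c' j * M i j"])
  also have "\<dots> < 0"
  proof -
    have "\<exists>i\<in>J. c' i \<noteq> 0" using c c' assms(1) by (metis bij_betwE)
    then show ?thesis using assms(2) by (auto simp: negative_definite_def)
  qed
  finally show "(\<Sum>i\<in>I. \<Sum>j\<in>I. c i * c j * M (f i) (f j)) < 0" .
qed

definition negative_family :: "('h::real_inner \<times> 'h) set \<Rightarrow> nat \<Rightarrow> bool" where
  "negative_family S k \<longleftrightarrow>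
     (\<exists>z. (\<forall>i<k. z i \<in> S) \<and> negative_definite {..<k} (\<lambda>i j. snd (z i) \<bullet> fst (z j)))"

lemma negative_familyI:
  assumes "finite I" "\<And>i. i \<in> I \<Longrightarrow> z i \<in> S" "negative_definite I (\<lambda>i j. snd (z i) \<bullet> fst (z j))"
  shows "negative_family S (card I)"
proof -
  obtain f where f: "bij_betw f {..<card I} I"
    using ex_bij_betw_nat_finite[OF assms(1)] by (auto simp: lessThan_atLeast0)
  show ?thesis unfolding negative_family_def using negative_definite_reindex[OF f assms(3)] assms(2) f
    by (intro exI[of _ "\<lambda>i. z (f i)"]) (auto dest: bij_betwE)
qed

lemma negative_family_mono: "S \<subseteq> S' \<Longrightarrow> negative_family S k \<Longrightarrow> negative_family S' k"
  unfolding negative_family_def by blast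

lemma negative_family_closure:
  assumes "negative_family (closure S) k"
  shows "negative_family S k"
proof -
  from assms obtain z where z: "\<And>i. i < k \<Longrightarrow> z i \<in> closure S"
    and neg: "negative_definite {..<k} (\<lambda>i j. snd (z i) \<bullet> fst (z j))" by (auto simp: negative_family_def)
  have "\<forall>i. \<exists>f. i < k \<longrightarrow> (\<forall>n. f n \<in> S) \<and> f \<longlonglongrightarrow> z i" using z by (meson closure_sequential)
  then obtain f where f: "\<And>i n. i < k \<Longrightarrow> f i n \<in> S" "\<And>i. i < k \<Longrightarrow> f i \<longlonglongrightarrow> z i" by metis
  have "\<forall>\<^sub>F n in sequentially. negative_definite {..<k} (\<lambda>i j. snd (f i n) \<bullet> fst (f j n))"
    by (rule negative_definite_perturb[OF _ neg]) (auto intro!: tendsto_inner tendsto_snd tendsto_fst f)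
  then obtain n where "negative_definite {..<k} (\<lambda>i j. snd (f i n) \<bullet> fst (f j n))"
    by (auto simp: eventually_sequentially)
  then show ?thesis unfolding negative_family_def using f(1) by (intro exI[of _ "\<lambda>i. f i n"]) auto
qed

text \<open>
  Vectors in the domain of the Friedrichs extension are form limits of vectors in the domain of \<open>S\<close>, so the
  values of the form converge.
\<close>

lemma negative_family_friedrichs:
  assumes "negative_family (friedrichs_extension H S) k"
  shows "negative_family S k"
proof -
  from assms obtain z where z: "\<And>i. i < k \<Longrightarrow> z i \<in> friedrichs_extension H S"
    and neg: "negative_definite {..<k} (\<lambda>i j. snd (z i) \<bullet> fst (z j))" by (auto simp: negative_family_def)
  have "\<forall>i. \<exists>p. i < k \<longrightarrow> form_converges S p (fst (z i)) \<and>
      (\<forall>p' v. form_converges S p' v \<longrightarrow> (\<lambda>n. snd (p n) \<bullet> fst (p' n)) \<longlonglongrightarrow> snd (z i) \<bullet> v)"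
  proof
    fix i
    show "\<exists>p. i < k \<longrightarrow> form_converges S p (fst (z i)) \<and>
      (\<forall>p' v. form_converges S p' v \<longrightarrow> (\<lambda>n. snd (p n) \<bullet> fst (p' n)) \<longlonglongrightarrow> snd (z i) \<bullet> v)"
    proof (cases "i < k")
      case True
      then have "(fst (z i), snd (z i)) \<in> friedrichs_extension H S" using z by simp
      then show ?thesis unfolding friedrichs_extension_def by blast
    qed simp
  qed
  then obtain p where p: "\<And>i. i < k \<Longrightarrow> form_converges S (p i) (fst (z i))"
    and lim: "\<And>i p' v. i < k \<Longrightarrow> form_converges S p' v \<Longrightarrow> (\<lambda>n. snd (p i n) \<bullet> fst (p' n)) \<longlonglongrightarrow> snd (z i) \<bullet> v" by metis
  have "\<forall>\<^sub>F n in sequentially. negative_definite {..<k} (\<lambda>i j. snd (p i n) \<bullet> fst (p j n))"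
    by (rule negative_definite_perturb[OF _ neg]) (auto intro!: lim p)
  then obtain n where "negative_definite {..<k} (\<lambda>i j. snd (p i n) \<bullet> fst (p j n))"
    by (auto simp: eventually_sequentially)
  then show ?thesis unfolding negative_family_def using p
    by (intro exI[of _ "\<lambda>i. p i n"]) (auto simp: form_converges_def)
qed

section \<open>The Morse index of a Friedrichs extension\<close>

text \<open>
  The negative spectral subspace is defined from an arbitrarily chosen spectral resolution, so the following
  facts are proved for every projection-valued measure.
\<close>

locale projection_valued =
  fixes H :: "'h::real_inner set" and F :: "real set \<Rightarrow> 'h \<Rightarrow> 'h"
  assumes pvm: "projection_valued_measure H F"
begin

lemma linear_F: "B \<in> sets borel \<Longrightarrow> linear (F B)"
  and idem_F: "B \<in> sets borel \<Longrightarrow> F B (F B x) = F B x"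
  and symmetric_F: "B \<in> sets borel \<Longrightarrow> F B x \<bullet> y = x \<bullet> F B y"
  and range_F_UNIV: "range (F UNIV) = H"
  and sums_F: "range C \<subseteq> sets borel \<Longrightarrow> disjoint_family C \<Longrightarrow> (\<lambda>i. F (C i) x) sums F (\<Union>i::nat. C i) x"
  using pvm unfolding projection_valued_measure_def by auto

lemma inner_F: "B \<in> sets borel \<Longrightarrow> F B x \<bullet> x = (norm (F B x))\<^sup>2" by (metis idem_F symmetric_F power2_norm_eq_inner)

lemma norm_F_le: "B \<in> sets borel \<Longrightarrow> norm (F B x) \<le> norm x"
proof -
  assume B: "B \<in> sets borel"
  have "norm (F B x) * norm (F B x) \<le> norm (F B x) * norm x"
    using inner_F[OF B, of x] norm_cauchy_schwarz[of "F B x" x] by (simp add: power2_eq_square)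
  then show ?thesis by (cases "norm (F B x) = 0") auto
qed

lemma F_empty: "F {} x = 0"
proof -
  have "(\<lambda>i::nat. F {} x) sums F {} x" using sums_F[of "\<lambda>_. {}" x] by (simp add: disjoint_family_on_def)
  then have "(\<lambda>i::nat. F {} x) \<longlonglongrightarrow> 0" by (intro summable_LIMSEQ_zero sums_summable)
  then show ?thesis by (simp add: LIMSEQ_const_iff)
qed

lemma F_Un:
  assumes "B \<in> sets borel" "C \<in> sets borel" "B \<inter> C = {}"
  shows "F (B \<union> C) x = F B x + F C x"
proof -
  let ?A = "\<lambda>i::nat. if i = 0 then B else if i = 1 then C else {}"
  have "(\<lambda>i. F (?A i) x) sums F (\<Union>i. ?A i) x" using assms by (intro sums_F) (auto simp: disjoint_family_on_def)
  moreover have "(\<Union>i. ?A i) = B \<union> C" by (auto split: if_splits)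
  moreover have "(\<lambda>i. F (?A i) x) sums (\<Sum>i\<in>{0, 1}. F (?A i) x)" by (intro sums_finite) (auto simp: F_empty)
  ultimately show ?thesis using sums_unique2 by fastforce
qed

lemma F_disjoint:
  assumes "B \<in> sets borel" "C \<in> sets borel" "B \<inter> C = {}"
  shows "F B (F C x) = 0"
proof -
  define y where "y = F C x"
  have y: "F C y = y" using idem_F[OF assms(2)] by (simp add: y_def)
  have U: "B \<union> C \<in> sets borel" using assms by simp
  have "(norm (F B y))\<^sup>2 + (norm y)\<^sup>2 = F B y \<bullet> y + F C y \<bullet> y"
    using inner_F[OF assms(1), of y] by (simp add: y power2_norm_eq_inner)
  also have "\<dots> = F (B \<union> C) y \<bullet> y" by (simp add: F_Un[OF assms] inner_add_left)
  also have "\<dots> \<le> (norm y)\<^sup>2" using norm_F_le[OF U, of y] by (simp add: inner_F[OF U] power_mono)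
  finally show ?thesis by (simp add: y_def)
qed

lemma F_Int:
  assumes "B \<in> sets borel" "C \<in> sets borel"
  shows "F B (F C x) = F (B \<inter> C) x"
proof -
  have sets: "B \<inter> C \<in> sets borel" "B - C \<in> sets borel" "C - B \<in> sets borel" using assms by auto
  have "F B (F C x) = F ((B \<inter> C) \<union> (B - C)) (F C x)" by (simp add: Int_Diff_Un)
  also have "\<dots> = F (B \<inter> C) (F C x) + F (B - C) (F C x)" by (rule F_Un) (use sets in auto)
  also have "F (B - C) (F C x) = 0" by (rule F_disjoint) (use sets assms in auto)
  finally have 1: "F B (F C x) = F (B \<inter> C) (F C x)" by simp
  have "F C x = F ((B \<inter> C) \<union> (C - B)) x" by (metis Int_Diff_Un Int_commute)
  also have "\<dots> = F (B \<inter> C) x + F (C - B) x" by (rule F_Un) (use sets in auto)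
  finally have 2: "F C x = F (B \<inter> C) x + F (C - B) x" .
  have "F (B \<inter> C) (F (B \<inter> C) x + F (C - B) x) = F (B \<inter> C) x + F (B \<inter> C) (F (C - B) x)"
    by (simp add: linear_add[OF linear_F[OF sets(1)]] idem_F[OF sets(1)])
  also have "F (B \<inter> C) (F (C - B) x) = 0" by (rule F_disjoint) (use sets in auto)
  finally show ?thesis unfolding 1 by (simp add: 2[symmetric])
qed

lemma F_UNIV: "x \<in> H \<Longrightarrow> F UNIV x = x" using range_F_UNIV idem_F[of UNIV] by auto

lemma F_in_H: "B \<in> sets borel \<Longrightarrow> F B x \<in> H"
proof -
  assume "B \<in> sets borel"
  then have "F UNIV (F B x) = F B x" using F_Int[of UNIV B x] by simp
  then show ?thesis using range_F_UNIV by (metis rangeI)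
qed

lemma sets_scalar_measure [simp, measurable_cong]: "sets (scalar_measure F x) = sets borel"
  and space_scalar_measure [simp]: "space (scalar_measure F x) = UNIV"
  unfolding scalar_measure_def by (simp_all add: sets.sigma_sets_eq[of borel, simplified])

lemma emeasure_scalar_measure:
  assumes B: "B \<in> sets borel"
  shows "emeasure (scalar_measure F x) B = ennreal (F B x \<bullet> x)"
proof (rule emeasure_measure_of[OF scalar_measure_def])
  show "B \<in> sets (scalar_measure F x)" using B by simp
  show "positive (sets (scalar_measure F x)) (\<lambda>S. ennreal (F S x \<bullet> x))" by (simp add: positive_def F_empty)
  show "countably_additive (sets (scalar_measure F x)) (\<lambda>S. ennreal (F S x \<bullet> x))" unfolding countably_additive_def
  proof (intro allI impI)
    fix A :: "nat \<Rightarrow> real set"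
    assume A: "range A \<subseteq> sets (scalar_measure F x)" "disjoint_family A" "\<Union> (range A) \<in> sets (scalar_measure F x)"
    have "(\<lambda>i. F (A i) x) sums F (\<Union>i. A i) x" using A by (intro sums_F) auto
    then have "(\<lambda>i. F (A i) x \<bullet> x) sums (F (\<Union>i. A i) x \<bullet> x)"
      by (rule bounded_linear.sums[OF bounded_linear_inner_left])
    moreover have "0 \<le> F (A i) x \<bullet> x" for i using A inner_F[of "A i" x] by auto
    ultimately show "(\<Sum>i. ennreal (F (A i) x \<bullet> x)) = ennreal (F (\<Union> (range A)) x \<bullet> x)" by (intro suminf_ennreal_eq)
  qed
qed auto

lemma finite_scalar_measure: "finite_measure (scalar_measure F x)"
  by (rule finite_measureI) (simp add: emeasure_scalar_measure)

lemma scalar_measure_scale: "scalar_measure F (r *\<^sub>R x) = density (scalar_measure F x) (\<lambda>_. ennreal (r\<^sup>2))"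
proof (rule measure_eqI)
  fix B assume "B \<in> sets (scalar_measure F (r *\<^sub>R x))"
  then have B: "B \<in> sets borel" by simp
  then show "emeasure (scalar_measure F (r *\<^sub>R x)) B = emeasure (density (scalar_measure F x) (\<lambda>_. ennreal (r\<^sup>2))) B"
  proof -
    have "emeasure (density (scalar_measure F x) (\<lambda>_. ennreal (r\<^sup>2))) B = ennreal (r\<^sup>2) * emeasure (scalar_measure F x) B"
      using B by (simp add: emeasure_density nn_integral_cmult_indicator)
    also have "\<dots> = ennreal (r\<^sup>2 * (F B x \<bullet> x))"
      using inner_F[OF B, of x] by (simp only: emeasure_scalar_measure[OF B]) (simp add: ennreal_mult)
    finally show ?thesis
      using B by (simp add: emeasure_scalar_measure linear_scale[OF linear_F] power2_eq_square mult.assoc)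
  qed
qed simp

lemma integral_scalar_measure_scale:
  "(LINT s|scalar_measure F (r *\<^sub>R x). s) = r\<^sup>2 * (LINT s|scalar_measure F x. s)"
  unfolding scalar_measure_scale by (subst integral_density) auto

lemma spectral_integral_form:
  assumes "(v, w) \<in> spectral_integral H F"
  shows "w \<bullet> v = (LINT s|scalar_measure F v. s)"
proof -
  have "w \<bullet> v = ((LINT s|scalar_measure F (v + v). s) - (LINT s|scalar_measure F (v - v). s)) / 4"
    using assms unfolding spectral_integral_def by blast
  also have "v + v = 2 *\<^sub>R v" by (simp add: scaleR_2)
  also have "v - v = 0 *\<^sub>R v" by simp
  finally show ?thesis unfolding integral_scalar_measure_scale by simp
qed

lemma scalar_measure_cong_on:
  fixes f :: "real \<Rightarrow> real"
  assumes B: "B \<in> sets borel" and [measurable]: "f \<in> borel_measurable borel"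
    and eq: "\<And>C. C \<in> sets borel \<Longrightarrow> C \<subseteq> B \<Longrightarrow> F C x \<bullet> x = F C y \<bullet> y"
  shows "integrable (scalar_measure F x) (\<lambda>s. indicator B s * f s) \<longleftrightarrow>
      integrable (scalar_measure F y) (\<lambda>s. indicator B s * f s)"
    and "(LINT s|scalar_measure F x. indicator B s * f s) = (LINT s|scalar_measure F y. indicator B s * f s)"
proof -
  have "density (scalar_measure F x) (indicator B) = density (scalar_measure F y) (indicator B)"
  proof (rule measure_eqI)
    fix C assume "C \<in> sets (density (scalar_measure F x) (indicator B))"
    then have C: "C \<in> sets borel" by simp
    have "emeasure (density (scalar_measure F z) (indicator B)) C = ennreal (F (B \<inter> C) z \<bullet> z)" for z
      using B C by (simp add: emeasure_density indicator_inter_arith[symmetric] emeasure_scalar_measure)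
    then show "emeasure (density (scalar_measure F x) (indicator B)) C = emeasure (density (scalar_measure F y) (indicator B)) C"
      using eq[of "B \<inter> C"] B C by simp
  qed simp
  moreover have "indicator B = (\<lambda>s. ennreal (indicator B s))" by (auto simp: indicator_def)
  ultimately have d: "density (scalar_measure F x) (\<lambda>s. ennreal (indicator B s)) = density (scalar_measure F y) (\<lambda>s. ennreal (indicator B s))"
    by simp
  have [measurable]: "B \<in> sets borel" by fact
  have 1: "integrable (scalar_measure F z) (\<lambda>s. indicator B s * f s) \<longleftrightarrow>
      integrable (density (scalar_measure F z) (\<lambda>s. ennreal (indicator B s))) f" for z
    by (subst integrable_density) auto
  have 2: "(LINT s|scalar_measure F z. indicator B s * f s) =
      (LINT s|density (scalar_measure F z) (\<lambda>s. ennreal (indicator B s)). f s)" for z by (subst integral_density) auto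
  show "integrable (scalar_measure F x) (\<lambda>s. indicator B s * f s) \<longleftrightarrow>
      integrable (scalar_measure F y) (\<lambda>s. indicator B s * f s)" unfolding 1 d ..
  show "(LINT s|scalar_measure F x. indicator B s * f s) = (LINT s|scalar_measure F y. indicator B s * f s)"
    unfolding 2 d ..
qed

lemma integrable_of_square:
  assumes "integrable (scalar_measure F x) (\<lambda>s. s\<^sup>2)" shows "integrable (scalar_measure F x) (\<lambda>s. s)"
proof -
  interpret finite_measure "scalar_measure F x" by (rule finite_scalar_measure)
  have "integrable (scalar_measure F x) (\<lambda>s. s\<^sup>2 + 1)" using assms by auto
  then show ?thesis
  proof (rule Bochner_Integration.integrable_bound)
    show "AE s in scalar_measure F x. norm s \<le> norm (s\<^sup>2 + 1)"
    proof (intro AE_I2)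
      fix s :: real
      have "0 \<le> (\<bar>s\<bar> - 1)\<^sup>2" by simp
      then have "2 * \<bar>s\<bar> \<le> s\<^sup>2 + 1" by (simp add: power2_diff)
      then show "norm s \<le> norm (s\<^sup>2 + 1)" by simp
    qed
  qed auto
qed

lemma integral_split:
  assumes B: "B \<in> sets borel"
    and I: "integrable (scalar_measure F y) (\<lambda>s. s)" "integrable (scalar_measure F z) (\<lambda>s. s)"
    and eqB: "\<And>C. C \<in> sets borel \<Longrightarrow> C \<subseteq> B \<Longrightarrow> F C x \<bullet> x = F C y \<bullet> y"
    and eqC: "\<And>C. C \<in> sets borel \<Longrightarrow> C \<subseteq> - B \<Longrightarrow> F C x \<bullet> x = F C z \<bullet> z"
  shows "(LINT s|scalar_measure F x. s) =
    (LINT s|scalar_measure F y. indicator B s * s) + (LINT s|scalar_measure F z. indicator (- B) s * s)"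
proof -
  have B': "- B \<in> sets borel" using B by simp
  have 1: "integrable (scalar_measure F y) (\<lambda>s. indicator B s * s)"
    using integrable_mult_indicator[OF _ I(1), of B] B by simp
  have 2: "integrable (scalar_measure F z) (\<lambda>s. indicator (- B) s * s)"
    using integrable_mult_indicator[OF _ I(2), of "- B"] B by simp
  have m: "(\<lambda>s. s) \<in> borel_measurable (borel :: real measure)" by simp
  have "(LINT s|scalar_measure F x. s) = (LINT s|scalar_measure F x. indicator B s * s + indicator (- B) s * s)"
    by (intro Bochner_Integration.integral_cong refl) (simp add: indicator_def)
  also have "\<dots> = (LINT s|scalar_measure F x. indicator B s * s) + (LINT s|scalar_measure F x. indicator (- B) s * s)"
    using scalar_measure_cong_on(1)[OF B m eqB] scalar_measure_cong_on(1)[OF B' m eqC] 1 2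
    by (intro Bochner_Integration.integral_add) auto
  finally show ?thesis using scalar_measure_cong_on(2)[OF B m eqB] scalar_measure_cong_on(2)[OF B' m eqC] by simp
qed

end

context semibounded_form
begin

lemma subspace_A: "subspace A" unfolding A_eq subspace_def
proof (intro conjI ballI allI)
  show "0 \<in> {(T h, h - c *\<^sub>R T h) |h. pr h = h}"
    by (auto simp: T.T_simps linear_0[OF linear_pr] zero_prod_def intro!: exI[of _ 0])
  fix z w assume z: "z \<in> {(T h, h - c *\<^sub>R T h) |h. pr h = h}"
  then obtain h where h: "pr h = h" "z = (T h, h - c *\<^sub>R T h)" by blast
  show "r *\<^sub>R z \<in> {(T h, h - c *\<^sub>R T h) |h. pr h = h}" for r
  proof -
    have "r *\<^sub>R z = (T (r *\<^sub>R h), r *\<^sub>R h - c *\<^sub>R T (r *\<^sub>R h))" "pr (r *\<^sub>R h) = r *\<^sub>R h"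
      using h by (auto simp: T.T_simps linear_scale[OF linear_pr] algebra_simps)
    then show ?thesis by blast
  qed
  assume "w \<in> {(T h, h - c *\<^sub>R T h) |h. pr h = h}"
  then obtain k where k: "pr k = k" "w = (T k, k - c *\<^sub>R T k)" by blast
  have "z + w = (T (h + k), (h + k) - c *\<^sub>R T (h + k))" "pr (h + k) = h + k"
    using h k by (auto simp: T.T_simps linear_add[OF linear_pr] algebra_simps)
  then show "z + w \<in> {(T h, h - c *\<^sub>R T h) |h. pr h = h}" by blast
qed

context
  fixes F assumes pvmF: "projection_valued_measure (range pr) F"
    and AF: "A = spectral_integral (range pr) F"
begin

interpretation F: projection_valued "range pr" F by (rule projection_valued.intro[OF pvmF])

lemma A_integrable: "(v, w) \<in> A \<Longrightarrow> integrable (scalar_measure F v) (\<lambda>s. s\<^sup>2)"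
  using AF by (auto simp: spectral_integral_def)

lemma integrable_F:
  assumes B: "B \<in> sets borel" and vw: "(v, w) \<in> A"
  shows "integrable (scalar_measure F (F B v)) (\<lambda>s. s\<^sup>2)"
proof -
  have B': "- B \<in> sets borel" using B by simp
  have in1: "integrable (scalar_measure F v) (\<lambda>s. indicator B s * s\<^sup>2)"
    using integrable_mult_indicator[OF _ A_integrable[OF vw], of B] B by simp
  have e1: "F C v \<bullet> v = F C (F B v) \<bullet> F B v" if "C \<in> sets borel" "C \<subseteq> B" for C
  proof -
    have "F C (F B v) \<bullet> F B v = F B (F C (F B v)) \<bullet> v" using F.symmetric_F[OF B] by simp
    also have "\<dots> = F C v \<bullet> v" using that B by (simp add: F.F_Int Int_absorb1 Int_absorb2 sets.Int)
    finally show ?thesis by simp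
  qed
  have e2: "F C (F B v) \<bullet> F B v = F C 0 \<bullet> 0" if "C \<in> sets borel" "C \<subseteq> - B" for C
  proof -
    have "C \<inter> B = {}" using that by auto
    then show ?thesis using that B by (simp add: F.F_Int F.F_empty)
  qed
  have m: "(\<lambda>s::real. s\<^sup>2) \<in> borel_measurable borel" by simp
  have z: "integrable (scalar_measure F 0) (\<lambda>s. indicator (- B) s * s\<^sup>2)"
  proof -
    have "integrable (density (scalar_measure F 0) (\<lambda>_. ennreal (0\<^sup>2))) (\<lambda>s. indicator (- B) s * s\<^sup>2)"
      using B by (subst integrable_density) auto
    then show ?thesis by (metis F.scalar_measure_scale scaleR_zero_left)
  qed
  have "integrable (scalar_measure F (F B v)) (\<lambda>s. indicator B s * s\<^sup>2 + indicator (- B) s * s\<^sup>2)"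
    using F.scalar_measure_cong_on(1)[OF B m e1] in1 F.scalar_measure_cong_on(1)[OF B' m e2] z by auto
  then show ?thesis by (rule Bochner_Integration.integrable_cong[THEN iffD1, rotated -1]) (auto simp: indicator_def)
qed

text \<open>
  Spectral projections of \<open>A\<close> commute with \<open>A\<close>.  By maximality it suffices to test against the domain of
  \<open>A\<close>, where the weak definition of the spectral integral applies after splitting each vector into its parts
  in \<open>B\<close> and in the complement of \<open>B\<close>.
\<close>

lemma A_reduces:
  assumes B: "B \<in> sets borel" and vw: "(v, w) \<in> A"
  shows "(F B v, F B w) \<in> A"
proof (rule A_maximal)
  show "pr (F B v) = F B v" "pr (F B w) = F B w" using F.F_in_H[OF B] by (auto simp: in_range_pr)
  fix a b assume ab: "(a, b) \<in> A"
  have lin: "linear (F C)" if "C \<in> sets borel" for C using F.linear_F that by blast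
  have key: "(LINT s|scalar_measure F (v + F B a). s) =
      (LINT s|scalar_measure F (v + a). indicator B s * s) + (LINT s|scalar_measure F v. indicator (- B) s * s)"
    if vw: "(v, w) \<in> A" and ab: "(a, b) \<in> A" for v w a b
  proof (rule F.integral_split[OF B])
    have "(v + a, w + b) \<in> A" using subspace_add[OF subspace_A vw ab] by simp
    then show "integrable (scalar_measure F (v + a)) (\<lambda>s. s)" "integrable (scalar_measure F v) (\<lambda>s. s)"
      using A_integrable vw F.integrable_of_square by blast+
    fix C :: "real set" assume C: "C \<in> sets borel"
    have e: "F C (v + F B a) = F C v + F (C \<inter> B) a" using C B by (simp add: linear_add[OF lin] F.F_Int)
    have e': "F C (v + F B a) \<bullet> (v + F B a) = (norm (F C v + F (C \<inter> B) a))\<^sup>2"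
      by (rule trans[OF F.inner_F[OF C]]) (simp only: e)
    show "F C (v + F B a) \<bullet> (v + F B a) = F C (v + a) \<bullet> (v + a)" if "C \<subseteq> B"
    proof -
      have "C \<inter> B = C" using that by auto
      then have "F C (v + F B a) \<bullet> (v + F B a) = (norm (F C v + F C a))\<^sup>2" using e' by simp
      also have "\<dots> = F C (v + a) \<bullet> (v + a)" 
      proof -
        have "F C v + F C a = F C (v + a)" by (rule linear_add[OF lin[OF C], symmetric])
        then show ?thesis by (simp only: F.inner_F[OF C])
      qed
      finally show ?thesis .
    qed
    show "F C (v + F B a) \<bullet> (v + F B a) = F C v \<bullet> v" if "C \<subseteq> - B"
    proof -
      have "C \<inter> B = {}" using that by auto
      then have "F C (v + F B a) \<bullet> (v + F B a) = (norm (F C v))\<^sup>2" using e' by (simp add: F.F_empty)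
      also have "\<dots> = F C v \<bullet> v" by (simp only: F.inner_F[OF C])
      finally show ?thesis .
    qed
  qed
  have neg: "(- a, - b) \<in> A" if "(a, b) \<in> A" for a b using subspace_scale[OF subspace_A that, of "- 1"] by simp
  have FB: "F B (- a) = - F B a" for a using linear_neg[OF lin[OF B]] .
  have form: "w \<bullet> F B a = ((LINT s|scalar_measure F (v + a). indicator B s * s)
      - (LINT s|scalar_measure F (v - a). indicator B s * s)) / 4"
    if vw: "(v, w) \<in> A" and ab: "(a, b) \<in> A" for v w a b
  proof -
    have "w \<bullet> F B a = ((LINT s|scalar_measure F (v + F B a). s) - (LINT s|scalar_measure F (v - F B a). s)) / 4"
      using vw F.F_in_H[OF B] integrable_F[OF B ab] unfolding AF spectral_integral_def by blast
    then show ?thesis using key[OF vw ab] key[OF vw neg[OF ab]] by (simp add: FB)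
  qed
  have "scalar_measure F (a - v) = scalar_measure F (v - a)" using scalar_measure_minus[OF pvmF, of "v - a"] by simp
  then have "w \<bullet> F B a = b \<bullet> F B v" unfolding form[OF vw ab] form[OF ab vw] by (simp add: add.commute)
  then show "F B w \<bullet> a = F B v \<bullet> b"
    using F.symmetric_F[OF B, of w a] F.symmetric_F[OF B, of v b] F.symmetric_F[OF B, of b v]
    by (simp add: inner_commute)
qed

lemma form_nonneg:
  assumes vw: "(v, w) \<in> A" and z: "F {..<0} v = 0"
  shows "0 \<le> w \<bullet> v"
proof -
  have "emeasure (scalar_measure F v) {..<0} = 0" by (simp add: F.emeasure_scalar_measure z)
  then have "AE s in scalar_measure F v. \<not> s < 0" by (intro AE_I[of _ _ "{..<0}"]) auto
  then have "0 \<le> (LINT s|scalar_measure F v. s)" by (intro integral_nonneg_AE) (auto elim: eventually_mono)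
  then show ?thesis using F.spectral_integral_form[of v w] vw AF by simp
qed

lemma form_negative:
  assumes vw: "(v, w) \<in> A" and z: "F {..<0} v = v" and v: "v \<noteq> 0"
  shows "w \<bullet> v < 0"
proof -
  have "F {0..} v = F {0..} (F {..<0} v)" by (simp add: z)
  also have "\<dots> = 0" by (rule F.F_disjoint) auto
  finally have "emeasure (scalar_measure F v) {0..} = 0" by (simp add: F.emeasure_scalar_measure)
  then have AE: "AE s in scalar_measure F v. s < 0" by (intro AE_I[of _ _ "{0..}"]) auto
  have I: "integrable (scalar_measure F v) (\<lambda>s. - s)" using F.integrable_of_square[OF A_integrable[OF vw]] by auto
  have nn: "0 \<le> (LINT s|scalar_measure F v. - s)"
    by (intro integral_nonneg_AE) (use AE in \<open>auto elim: eventually_mono\<close>)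
  moreover have "(LINT s|scalar_measure F v. - s) \<noteq> 0"
  proof
    assume "(LINT s|scalar_measure F v. - s) = 0"
    then have "AE s in scalar_measure F v. - s = 0"
      using integral_nonneg_eq_0_iff_AE[OF I eventually_mono[OF AE]] by simp
    with AE have "AE s in scalar_measure F v. False" by eventually_elim auto
    then have "emeasure (scalar_measure F v) UNIV = 0" by (simp add: AE_iff_measurable[of UNIV])
    then have "F UNIV v \<bullet> v = 0" using F.inner_F[of UNIV v] by (simp add: F.emeasure_scalar_measure)
    moreover have "F UNIV v = v" using A_range[OF vw] by (intro F.F_UNIV) (simp add: in_range_pr)
    ultimately show False using v by simp
  qed
  ultimately have "0 < - (LINT s|scalar_measure F v. s)" by simp
  then show ?thesis using F.spectral_integral_form[of v w] vw AF by simp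
qed

lemma T_range_negative:
  assumes "F {..<0} x = x" shows "F {..<0} (T x) = T x" "pr x = x"
proof -
  show px: "pr x = x" using F.F_in_H[of "{..<0}" x] assms by (simp add: in_range_pr)
  have "(T x, x - c *\<^sub>R T x) \<in> A" using T_in_A[of x] px by simp
  then have "(F {..<0} (T x), F {..<0} (x - c *\<^sub>R T x)) \<in> A" by (intro A_reduces) auto
  from T_unique[OF this] show "F {..<0} (T x) = T x"
    using assms by (simp add: linear_diff[OF F.linear_F] linear_scale[OF F.linear_F])
qed

lemma sum_in_S: "(\<And>i. i \<in> I \<Longrightarrow> z i \<in> V) \<Longrightarrow> subspace V \<Longrightarrow>
    ((\<Sum>i\<in>I. a i *\<^sub>R fst (z i)), (\<Sum>i\<in>I. a i *\<^sub>R snd (z i))) \<in> V"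
proof -
  assume z: "\<And>i. i \<in> I \<Longrightarrow> z i \<in> V" and V: "subspace V"
  have "(\<Sum>i\<in>I. a i *\<^sub>R z i) \<in> V" by (intro subspace_sum[OF V] subspace_scale[OF V] z)
  moreover have "(\<Sum>i\<in>I. a i *\<^sub>R z i) = ((\<Sum>i\<in>I. a i *\<^sub>R fst (z i)), (\<Sum>i\<in>I. a i *\<^sub>R snd (z i)))"
    by (simp add: prod_eq_iff fst_sum snd_sum)
  ultimately show ?thesis by simp
qed

lemma family_form:
  "(\<Sum>i\<in>I. a i *\<^sub>R snd (z i)) \<bullet> (\<Sum>i\<in>I. a i *\<^sub>R fst (z i)) = (\<Sum>i\<in>I. \<Sum>j\<in>I. a i * a j * (snd (z i) \<bullet> fst (z j)))"
  for z :: "'i \<Rightarrow> 'h \<times> 'h" by (subst inner_sum_left, intro sum.cong refl, subst inner_sum_right) (simp add: mult_ac)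

text \<open>
  The negative spectral projection is injective on the span of a negative family: a vector with vanishing
  projection would have a nonnegative form value.
\<close>

lemma negative_family_le_edim:
  assumes "negative_family S k"
  shows "\<exists>B. finite B \<and> B \<subseteq> range (F {..<0}) \<and> independent B \<and> card B = k"
proof -
  from assms obtain z where z: "\<And>i. i \<in> {..<k} \<Longrightarrow> z i \<in> S"
    and neg: "negative_definite {..<k} (\<lambda>i j. snd (z i) \<bullet> fst (z j))" by (auto simp: negative_family_def)
  have lin: "linear (F {..<0})" by (rule F.linear_F) simp
  define f where "f i = F {..<0} (fst (z i))" for i
  have indep: "a i = 0" if "(\<Sum>i<k. a i *\<^sub>R f i) = 0" "i < k" for a i
  proof (rule ccontr)
    assume "a i \<noteq> 0"
    define v where "v = (\<Sum>i<k. a i *\<^sub>R fst (z i))"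
    define w where "w = (\<Sum>i<k. a i *\<^sub>R snd (z i))"
    have "F {..<0} v = 0" using that(1) by (simp add: v_def f_def linear_sum[OF lin] linear_scale[OF lin])
    moreover have "(v, w) \<in> A" unfolding v_def w_def by (rule subsetD[OF S_subset_A sum_in_S[OF z subspace_S]])
    ultimately have "0 \<le> w \<bullet> v" by (intro form_nonneg)
    moreover have "w \<bullet> v < 0" unfolding v_def w_def family_form
      using neg[unfolded negative_definite_def, rule_format, of a] that(2) \<open>a i \<noteq> 0\<close> by blast
    ultimately show False by simp
  qed
  have inj: "inj_on f {..<k}"
  proof (rule inj_onI, rule ccontr)
    fix i j assume ij: "i \<in> {..<k}" "j \<in> {..<k}" "f i = f j" "i \<noteq> j"
    define a where "a l = (if l = i then 1 else if l = j then - 1 else 0 :: real)" for l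
    have "(\<Sum>l<k. a l *\<^sub>R f l) = (\<Sum>l\<in>{i, j}. a l *\<^sub>R f l)"
      using ij by (intro sum.mono_neutral_right) (auto simp: a_def)
    also have "\<dots> = 0" using ij by (simp add: a_def)
    finally have "a i = 0" using ij by (intro indep) auto
    then show False by (simp add: a_def)
  qed
  have "independent (f ` {..<k})" unfolding independent_explicit_finite_subsets
  proof (intro allI impI ballI)
    fix U u v assume U: "U \<subseteq> f ` {..<k}" "finite U" and s: "(\<Sum>v\<in>U. u v *\<^sub>R v) = 0" and v: "v \<in> U"
    define a where "a l = (if f l \<in> U then u (f l) else 0)" for l
    have "(\<Sum>l<k. a l *\<^sub>R f l) = (\<Sum>l\<in>{l\<in>{..<k}. f l \<in> U}. u (f l) *\<^sub>R f l)"
      by (intro sum.mono_neutral_cong_right) (auto simp: a_def)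
    also have "\<dots> = (\<Sum>v\<in>U. u v *\<^sub>R v)"
    proof (rule sum.reindex_bij_betw)
      show "bij_betw f {l \<in> {..<k}. f l \<in> U} U" using inj U by (auto simp: bij_betw_def inj_on_def)
    qed
    finally have 0: "(\<Sum>l<k. a l *\<^sub>R f l) = 0" using s by simp
    obtain l where l: "l < k" "v = f l" using v U by auto
    have "a l = 0" by (rule indep[OF 0 l(1)])
    then show "u v = 0" using l v by (simp add: a_def)
  qed
  moreover have "card (f ` {..<k}) = k" using card_image[OF inj] by simp
  ultimately show ?thesis by (intro exI[of _ "f ` {..<k}"]) (auto simp: f_def)
qed

text \<open>
  Vectors of the negative spectral subspace need not lie in the domain of \<open>A\<close>.  Their images under the
  resolvent do, and the injective operator \<open>T\<close> preserves the subspace; the resulting negative family passes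
  from \<open>A\<close> to \<open>S\<close>.
\<close>

lemma edim_le_negative_family:
  assumes "finite B" "B \<subseteq> range (F {..<0})" "independent B"
  shows "negative_family S (card B)"
proof -
  have FB: "F {..<0} x = x" if "x \<in> B" for x using assms(2) that F.idem_F[of "{..<0}"] by auto
  have lin: "linear (F {..<0})" by (rule F.linear_F) simp
  define z where "z x = (T x, x - c *\<^sub>R T x)" for x
  have zA: "z x \<in> A" if "x \<in> B" for x using T_in_A[of x] T_range_negative(2)[OF FB[OF that]] by (simp add: z_def)
  have "negative_definite B (\<lambda>x y. snd (z x) \<bullet> fst (z y))" unfolding negative_definite_def
  proof (intro allI impI)
    fix a :: "'h \<Rightarrow> real" assume a: "\<exists>x\<in>B. a x \<noteq> 0"
    define v where "v = (\<Sum>x\<in>B. a x *\<^sub>R fst (z x))"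
    define w where "w = (\<Sum>x\<in>B. a x *\<^sub>R snd (z x))"
    have vw: "(v, w) \<in> A" unfolding v_def w_def by (rule sum_in_S[OF zA subspace_A])
    have "F {..<0} v = v" unfolding v_def using T_range_negative(1)[OF FB]
      by (simp add: linear_sum[OF lin] linear_scale[OF lin] z_def)
    moreover have "v \<noteq> 0"
    proof
      assume "v = 0"
      have v: "v = T (\<Sum>x\<in>B. a x *\<^sub>R x)" by (simp add: v_def z_def linear_sum[OF linear_T] linear_scale[OF linear_T])
      have "pr (\<Sum>x\<in>B. a x *\<^sub>R x) = (\<Sum>x\<in>B. a x *\<^sub>R x)"
        using T_range_negative(2)[OF FB] by (simp add: linear_sum[OF linear_pr] linear_scale[OF linear_pr])
      then have "(\<Sum>x\<in>B. a x *\<^sub>R x) = 0" using T_injective v \<open>v = 0\<close> by simp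
      then have "\<forall>x\<in>B. a x = 0" using assms(1,3) independent_explicit_finite_subsets[of B] by blast
      then show False using a by blast
    qed
    ultimately have "w \<bullet> v < 0" by (intro form_negative vw)
    then show "(\<Sum>x\<in>B. \<Sum>y\<in>B. a x * a y * (snd (z x) \<bullet> fst (z y))) < 0" unfolding v_def w_def family_form .
  qed
  then have "negative_family A (card B)" by (intro negative_familyI[where z = z] assms zA)
  then show ?thesis by (rule negative_family_friedrichs)
qed

end

text \<open>
  Glazman's lemma: the Morse index is the largest size of a negative family in the original domain.
\<close>

theorem morse_index_friedrichs:
  "morse_index (range pr) A = (SUP k\<in>{k. negative_family S k}. enat k)"
proof -
  define F where "F = spectral_measure (range pr) A"
  have "projection_valued_measure (range pr) F \<and> A = spectral_integral (range pr) F"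
    unfolding F_def spectral_measure_def using pvm_E friedrichs_spectral_integral
    by (rule someI[of "\<lambda>E. projection_valued_measure (range pr) E \<and> A = spectral_integral (range pr) E", OF conjI])
  then have F: "projection_valued_measure (range pr) F" "A = spectral_integral (range pr) F" by auto
  show ?thesis unfolding morse_index_def negative_spectral_subspace_def edim_def F_def[symmetric]
  proof (rule antisym)
    show "(SUP B\<in>{B. finite B \<and> B \<subseteq> range (F {..<0}) \<and> independent B}. enat (card B))
        \<le> (SUP k\<in>{k. negative_family S k}. enat k)"
      using edim_le_negative_family[OF F] by (intro SUP_least SUP_upper) auto
    show "(SUP k\<in>{k. negative_family S k}. enat k)
        \<le> (SUP B\<in>{B. finite B \<and> B \<subseteq> range (F {..<0}) \<and> independent B}. enat (card B))"
    proof (rule SUP_least)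
      fix k assume "k \<in> {k. negative_family S k}"
      then obtain B where "finite B \<and> B \<subseteq> range (F {..<0}) \<and> independent B" "card B = k"
        using negative_family_le_edim[OF F] by blast
      then show "enat k \<le> (SUP B\<in>{B. finite B \<and> B \<subseteq> range (F {..<0}) \<and> independent B}. enat (card B))"
        by (intro SUP_upper2[of B]) auto
    qed
  qed
qed

end

section \<open>Completeness of the space of square integrable functions\<close>

lemma l2_class_rep: "l2_class (rep_l2 x) = x" by (rule Quotient_abs_rep[OF Quotient_l2])

lemma square_integrable_rep: "square_integrable (rep_l2 x)" using Quotient_rep_reflp[OF Quotient_l2, of x] by simp

lemma l2_class_eq_iff:
  "square_integrable f \<Longrightarrow> square_integrable g \<Longrightarrow> l2_class f = l2_class g \<longleftrightarrow> (AE t in lborel. f t = g t)"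
  using Quotient_rel[OF Quotient_l2, of f g] by simp

lemma l2_class_add:
  "square_integrable f \<Longrightarrow> square_integrable g \<Longrightarrow> l2_class f + l2_class g = l2_class (\<lambda>t. f t + g t)"
  by (rule plus_l2.abs_eq) simp_all

lemma l2_class_diff:
  "square_integrable f \<Longrightarrow> square_integrable g \<Longrightarrow> l2_class f - l2_class g = l2_class (\<lambda>t. f t - g t)"
  by (rule minus_l2.abs_eq) simp_all

lemma l2_class_scaleR: "square_integrable f \<Longrightarrow> c *\<^sub>R l2_class f = l2_class (\<lambda>t. c *\<^sub>R f t)"
  by (rule scaleR_l2.abs_eq) simp_all

lemma l2_class_zero: "l2_class (\<lambda>_. 0) = 0" by (simp add: zero_l2.abs_eq)

lemma inner_l2_class:
  "square_integrable f \<Longrightarrow> square_integrable g \<Longrightarrow> l2_class f \<bullet> l2_class g = (\<integral>t. f t \<bullet> g t \<partial>lborel)"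
  by (rule inner_l2.abs_eq) simp_all

lemma nn_integral_norm_l2_class:
  assumes "square_integrable f"
  shows "(\<integral>\<^sup>+t. ennreal ((norm (f t))\<^sup>2) \<partial>lborel) = ennreal ((norm (l2_class f))\<^sup>2)"
proof -
  have "integrable lborel (\<lambda>t. (norm (f t))\<^sup>2)" using assms by (simp add: square_integrable_def)
  then have "(\<integral>\<^sup>+t. ennreal ((norm (f t))\<^sup>2) \<partial>lborel) = ennreal (\<integral>t. (norm (f t))\<^sup>2 \<partial>lborel)"
    by (rule nn_integral_eq_integral) simp
  also have "(\<integral>t. (norm (f t))\<^sup>2 \<partial>lborel) = (norm (l2_class f))\<^sup>2"
    using inner_l2_class[OF assms assms] by (simp add: power2_norm_eq_inner)
  finally show ?thesis .
qed

text \<open>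
  The Riesz--Fischer argument: a rapidly converging sequence has square integrable, hence almost everywhere
  summable, increments.
\<close>

lemma l2_limit_exists:
  fixes X :: "nat \<Rightarrow> 'a::euclidean_space l2"
  assumes fast: "\<And>k. (norm (X (Suc k) - X k))\<^sup>2 \<le> (1 / 8) ^ k" and "Cauchy X"
  shows "convergent X"
proof -
  define f where "f k = rep_l2 (X k)" for k
  have sq: "square_integrable (f k)" for k unfolding f_def by (rule square_integrable_rep)
  have X: "X k = l2_class (f k)" for k by (simp add: f_def l2_class_rep)
  have [measurable]: "f k \<in> borel_measurable lborel" for k using sq by (simp add: square_integrable_def)
  have nnd: "(\<integral>\<^sup>+t. ennreal ((norm (f j t - f k t))\<^sup>2) \<partial>lborel) = ennreal ((norm (X j - X k))\<^sup>2)" for j k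
    using nn_integral_norm_l2_class[OF square_integrable_diff[OF sq sq, of j k]]
    by (simp add: X l2_class_diff[OF sq sq])
  \<comment> \<open>The weights \<open>4\<^sup>k\<close> are still summable against \<open>8\<^sup>-\<^sup>k\<close> and force increments of size \<open>2\<^sup>-\<^sup>k\<close> almost everywhere.\<close>
  have "(\<integral>\<^sup>+t. (\<Sum>k. ennreal (4 ^ k * (norm (f (Suc k) t - f k t))\<^sup>2)) \<partial>lborel)
      = (\<Sum>k. \<integral>\<^sup>+t. ennreal (4 ^ k * (norm (f (Suc k) t - f k t))\<^sup>2) \<partial>lborel)" by (rule nn_integral_suminf) measurable
  also have "\<dots> \<le> (\<Sum>k. ennreal ((1 / 2) ^ k))"
  proof (intro suminf_le summableI)
    fix k :: nat
    have "(\<integral>\<^sup>+t. ennreal (4 ^ k * (norm (f (Suc k) t - f k t))\<^sup>2) \<partial>lborel)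
        = ennreal (4 ^ k) * ennreal ((norm (X (Suc k) - X k))\<^sup>2)" by (simp add: ennreal_mult nn_integral_cmult nnd)
    also have "\<dots> = ennreal (4 ^ k * (norm (X (Suc k) - X k))\<^sup>2)" by (simp add: ennreal_mult)
    also have "\<dots> \<le> ennreal (4 ^ k * (1 / 8) ^ k)" by (intro ennreal_leI mult_left_mono fast) simp
    also have "(4::real) ^ k * (1 / 8) ^ k = (1 / 2) ^ k" by (simp add: power_mult_distrib[symmetric])
    finally show "(\<integral>\<^sup>+t. ennreal (4 ^ k * (norm (f (Suc k) t - f k t))\<^sup>2) \<partial>lborel) \<le> ennreal ((1 / 2) ^ k)" .
  qed
  also have "\<dots> = ennreal 2" using geometric_sums[of "1 / 2 :: real"] by (intro suminf_ennreal_eq) auto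
  finally have "(\<integral>\<^sup>+t. (\<Sum>k. ennreal (4 ^ k * (norm (f (Suc k) t - f k t))\<^sup>2)) \<partial>lborel) \<le> ennreal 2" .
  then have fin: "(\<integral>\<^sup>+t. (\<Sum>k. ennreal (4 ^ k * (norm (f (Suc k) t - f k t))\<^sup>2)) \<partial>lborel) \<noteq> \<infinity>"
    using ennreal_less_top[of 2] by (metis infinity_ennreal_def leD)
  have "AE t in lborel. (\<Sum>k. ennreal (4 ^ k * (norm (f (Suc k) t - f k t))\<^sup>2)) \<noteq> \<infinity>"
  proof (rule nn_integral_PInf_AE[OF _ fin])
    show "(\<lambda>t. \<Sum>k. ennreal (4 ^ k * (norm (f (Suc k) t - f k t))\<^sup>2)) \<in> borel_measurable lborel" by measurable
  qed
  then have AE: "AE t in lborel. convergent (\<lambda>k. f k t)"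
  proof eventually_elim
    case (elim t)
    define d where "d k = f (Suc k) t - f k t" for k
    obtain M where M: "(\<Sum>k. ennreal (4 ^ k * (norm (d k))\<^sup>2)) = ennreal M" "0 \<le> M"
    proof
      have "(\<Sum>k. ennreal (4 ^ k * (norm (d k))\<^sup>2)) \<noteq> top" using elim unfolding d_def infinity_ennreal_def .
      then show "(\<Sum>k. ennreal (4 ^ k * (norm (d k))\<^sup>2)) = ennreal (enn2real (\<Sum>k. ennreal (4 ^ k * (norm (d k))\<^sup>2)))"
        by (simp only: ennreal_enn2real_if if_False)
    qed (rule enn2real_nonneg)
    have "norm (d k) \<le> sqrt M * (1 / 2) ^ k" for k
    proof -
      have "ennreal (4 ^ k * (norm (d k))\<^sup>2) \<le> ennreal M"
      proof -
        have "sum (\<lambda>k. ennreal (4 ^ k * (norm (d k))\<^sup>2)) {k} \<le> (\<Sum>k. ennreal (4 ^ k * (norm (d k))\<^sup>2))"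
          by (rule sum_le_suminf) (auto intro: summableI)
        then show ?thesis unfolding M(1) by (simp only: sum.insert sum.empty finite.emptyI empty_iff not_False_eq_True add_0_right)
      qed
      then have le: "4 ^ k * (norm (d k))\<^sup>2 \<le> M" using M(2) by (simp only: ennreal_le_iff)
      have "(2::real) ^ k * 2 ^ k = 4 ^ k" by (simp add: power_mult_distrib[symmetric])
      then have "(2 ^ k * norm (d k))\<^sup>2 = 4 ^ k * (norm (d k))\<^sup>2" by (simp add: power2_eq_square ac_simps)
      then have "(2 ^ k * norm (d k))\<^sup>2 \<le> M" using le by simp
      then have "2 ^ k * norm (d k) \<le> sqrt M" by (rule real_le_rsqrt)
      then show ?thesis by (simp add: field_simps power_one_over)
    qed
    then have "summable d"
      by (intro summable_comparison_test[of d "\<lambda>k. sqrt M * (1 / 2) ^ k"] summable_mult summable_geometric) auto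
    then have "convergent (\<lambda>n. f 0 t + (\<Sum>k<n. d k))"
      unfolding summable_iff_convergent by (simp add: convergent_add_const_iff)
    moreover have "f 0 t + (\<Sum>k<n. d k) = f n t" for n
      using sum_lessThan_telescope[of "\<lambda>k. f k t" n] by (simp add: d_def)
    ultimately show ?case by simp
  qed
  define g where "g t = lim (\<lambda>k. f k t)" for t
  have [measurable]: "g \<in> borel_measurable lborel" unfolding g_def by measurable
  have AElim: "AE t in lborel. (\<lambda>k. f k t) \<longlonglongrightarrow> g t"
    using AE unfolding g_def by eventually_elim (simp add: convergent_LIMSEQ_iff)
  have bound: "(\<integral>\<^sup>+t. ennreal ((norm (g t - f k t))\<^sup>2) \<partial>lborel) \<le> ennreal (e\<^sup>2)"
    if N: "\<And>j. j \<ge> N \<Longrightarrow> norm (X j - X k) \<le> e" and "0 \<le> e" for k N e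
  proof -
    have "(\<integral>\<^sup>+t. ennreal ((norm (g t - f k t))\<^sup>2) \<partial>lborel)
        = (\<integral>\<^sup>+t. liminf (\<lambda>j. ennreal ((norm (f j t - f k t))\<^sup>2)) \<partial>lborel)"
    proof (rule nn_integral_cong_AE)
      show "AE t in lborel. ennreal ((norm (g t - f k t))\<^sup>2) = liminf (\<lambda>j. ennreal ((norm (f j t - f k t))\<^sup>2))"
        using AElim
      proof eventually_elim
        case (elim t)
        have "(\<lambda>j. ennreal ((norm (f j t - f k t))\<^sup>2)) \<longlonglongrightarrow> ennreal ((norm (g t - f k t))\<^sup>2)"
          by (intro tendsto_ennrealI tendsto_intros elim)
        then show ?case by (rule lim_imp_Liminf[OF sequentially_bot, symmetric])
      qed
    qed
    also have "\<dots> \<le> liminf (\<lambda>j. \<integral>\<^sup>+t. ennreal ((norm (f j t - f k t))\<^sup>2) \<partial>lborel)"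
      by (rule nn_integral_liminf) measurable
    also have "\<dots> \<le> ennreal (e\<^sup>2)"
    proof -
      have "\<forall>\<^sub>F j in sequentially. ennreal ((norm (X j - X k))\<^sup>2) \<le> ennreal (e\<^sup>2)"
        using N by (intro eventually_sequentiallyI[of N] ennreal_leI power_mono) auto
      then have "liminf (\<lambda>j. ennreal ((norm (X j - X k))\<^sup>2)) \<le> liminf (\<lambda>j. ennreal (e\<^sup>2))" by (rule Liminf_mono)
      then show ?thesis by (simp add: nnd Liminf_const)
    qed
    finally show ?thesis .
  qed
  have Cau: "\<exists>N. \<forall>j\<ge>N. \<forall>k\<ge>N. norm (X j - X k) \<le> e" if "0 < e" for e
    using metric_CauchyD[OF \<open>Cauchy X\<close> that] by (metis dist_norm less_imp_le)
  have sqd: "square_integrable (\<lambda>t. g t - f k t)" if "\<And>j. j \<ge> N \<Longrightarrow> norm (X j - X k) \<le> 1" for k N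
  proof -
    have "(\<integral>\<^sup>+t. ennreal ((norm (g t - f k t))\<^sup>2) \<partial>lborel) \<le> ennreal (1\<^sup>2)"
      by (rule bound[where N = N]) (erule that, simp)
    then have "(\<integral>\<^sup>+t. ennreal ((norm (g t - f k t))\<^sup>2) \<partial>lborel) < \<infinity>" by (rule le_less_trans) simp
    then have "integrable lborel (\<lambda>t. (norm (g t - f k t))\<^sup>2)" by (intro integrableI_bounded) simp_all
    then show ?thesis unfolding square_integrable_def by simp
  qed
  obtain N0 where N0: "\<And>j k. j \<ge> N0 \<Longrightarrow> k \<ge> N0 \<Longrightarrow> norm (X j - X k) \<le> 1" using Cau[of 1] by auto
  have sqg: "square_integrable g" using square_integrable_add[OF sqd[OF N0[of _ N0]] sq[of N0]] by simp
  have "X \<longlonglongrightarrow> l2_class g"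
  proof (rule metric_LIMSEQ_I)
    fix e :: real assume e: "0 < e"
    then have "0 < e / 2" by simp
    from Cau[OF this] obtain N where N': "\<forall>j\<ge>N. \<forall>k\<ge>N. norm (X j - X k) \<le> e / 2" ..
    show "\<exists>no. \<forall>n\<ge>no. dist (X n) (l2_class g) < e"
    proof (intro exI[of _ N] allI impI)
      fix k assume k: "N \<le> k"
      have "ennreal ((norm (l2_class g - X k))\<^sup>2) = (\<integral>\<^sup>+t. ennreal ((norm (g t - f k t))\<^sup>2) \<partial>lborel)"
        using nn_integral_norm_l2_class[OF square_integrable_diff[OF sqg sq[of k]]]
        by (simp add: X l2_class_diff[OF sqg sq])
      also have "\<dots> \<le> ennreal ((e / 2)\<^sup>2)" 
      proof (rule bound[where N = N])
        show "norm (X j - X k) \<le> e / 2" if "N \<le> j" for j using N' k that by blast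
        show "0 \<le> e / 2" using e by simp
      qed
      finally have "(norm (l2_class g - X k))\<^sup>2 \<le> (e / 2)\<^sup>2" by (simp only: ennreal_le_iff zero_le_power2)
      then have "norm (l2_class g - X k) \<le> e / 2" by (rule power2_le_imp_le) (use e in simp)
      then show "dist (X k) (l2_class g) < e" using e by (simp add: dist_norm norm_minus_commute)
    qed
  qed
  then show ?thesis by (rule convergentI)
qed

instance l2 :: (euclidean_space) complete_space
proof
  fix X :: "nat \<Rightarrow> 'a l2" assume X: "Cauchy X"
  have "\<exists>N. \<forall>m\<ge>N. \<forall>n\<ge>N. (norm (X m - X n))\<^sup>2 \<le> (1 / 8) ^ k" for k
  proof -
    have "0 < sqrt ((1 / 8 :: real) ^ k)" by simp
    from metric_CauchyD[OF X this] obtain N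
      where N: "\<And>m n. m \<ge> N \<Longrightarrow> n \<ge> N \<Longrightarrow> norm (X m - X n) < sqrt ((1 / 8) ^ k)" by (auto simp: dist_norm)
    have "(norm (X m - X n))\<^sup>2 \<le> (1 / 8) ^ k" if "m \<ge> N" "n \<ge> N" for m n
    proof -
      have "(norm (X m - X n))\<^sup>2 \<le> (sqrt ((1 / 8) ^ k))\<^sup>2" using N[OF that] by (intro power_mono) auto
      then show ?thesis by simp
    qed
    then show ?thesis by blast
  qed
  then obtain N where N: "\<And>k m n. m \<ge> N k \<Longrightarrow> n \<ge> N k \<Longrightarrow> (norm (X m - X n))\<^sup>2 \<le> (1 / 8) ^ k" by metis
  define r where "r k = (\<Sum>i\<le>k. N i) + k" for k
  have r: "strict_mono r" by (rule strict_mono_Suc_iff[THEN iffD2]) (simp add: r_def)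
  have rN: "N k \<le> r k" for k unfolding r_def using member_le_sum[of k "{..k}" N] by simp
  have "convergent (X \<circ> r)"
  proof (rule l2_limit_exists)
    show "(norm ((X \<circ> r) (Suc k) - (X \<circ> r) k))\<^sup>2 \<le> (1 / 8) ^ k" for k
      using N[of k "r (Suc k)" "r k"] rN[of k] strict_monoD[OF r, of k "Suc k"] by simp
    show "Cauchy (X \<circ> r)" by (rule Cauchy_subseq_Cauchy[OF X r])
  qed
  then obtain l where "(X \<circ> r) \<longlonglongrightarrow> l" by (auto simp: convergent_def)
  then have "X \<longlonglongrightarrow> l" by (rule Cauchy_converges_subseq[OF X r])
  then show "convergent X" by (rule convergentI)
qed

lift_definition l2_restrict :: "ereal \<Rightarrow> ereal \<Rightarrow> 'a::euclidean_space l2 \<Rightarrow> 'a l2" is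
  "\<lambda>c d f t. indicator (einterval c d) t *\<^sub>R f t"
proof -
  fix c d :: ereal and f g :: "real \<Rightarrow> 'a"
  assume fg: "square_integrable f \<and> square_integrable g \<and> (AE t in lborel. f t = g t)"
  have "square_integrable (\<lambda>t. indicator (einterval c d) t *\<^sub>R h t)" if h: "square_integrable h" for h :: "real \<Rightarrow> 'a"
  proof -
    have [measurable]: "h \<in> borel_measurable lborel" using h by (simp add: square_integrable_def)
    have "integrable lborel (\<lambda>t. indicator (einterval c d) t *\<^sub>R (norm (h t))\<^sup>2)"
      using h by (intro integrable_mult_indicator) (auto simp: square_integrable_def)
    moreover have "indicator (einterval c d) t *\<^sub>R (norm (h t))\<^sup>2 = (norm (indicator (einterval c d) t *\<^sub>R h t))\<^sup>2" for t
      by (simp add: indicator_def)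
    ultimately show ?thesis by (simp add: square_integrable_def)
  qed
  then show "square_integrable (\<lambda>t. indicator (einterval c d) t *\<^sub>R f t) \<and>
      square_integrable (\<lambda>t. indicator (einterval c d) t *\<^sub>R g t) \<and>
      (AE t in lborel. indicator (einterval c d) t *\<^sub>R f t = indicator (einterval c d) t *\<^sub>R g t)"
    using fg by (auto elim: eventually_mono)
qed

lemma square_integrable_restrict:
  "square_integrable f \<Longrightarrow> square_integrable (\<lambda>t. indicator (einterval c d) t *\<^sub>R f t)"
  using l2_restrict.rsp unfolding rel_fun_def by blast

lemma l2_restrict_class:
  "square_integrable f \<Longrightarrow> l2_restrict c d (l2_class f) = l2_class (\<lambda>t. indicator (einterval c d) t *\<^sub>R f t)"
  by (rule l2_restrict.abs_eq) simp

lemma linear_l2_restrict: "linear (l2_restrict c d)"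
proof (rule linearI)
  fix x y :: "'a l2" and r :: real
  have sq: "square_integrable (rep_l2 x)" "square_integrable (rep_l2 y)" by (rule square_integrable_rep)+
  show "l2_restrict c d (x + y) = l2_restrict c d x + l2_restrict c d y"
    using l2_restrict_class[OF square_integrable_add[OF sq], of c d] l2_class_add[OF sq]
      l2_class_add[OF square_integrable_restrict[OF sq(1), of c d] square_integrable_restrict[OF sq(2), of c d]]
      l2_restrict_class[OF sq(1), of c d] l2_restrict_class[OF sq(2), of c d]
    by (simp add: l2_class_rep scaleR_add_right)
  show "l2_restrict c d (r *\<^sub>R x) = r *\<^sub>R l2_restrict c d x"
    using l2_restrict_class[OF square_integrable_scaleR[OF sq(1), of r], of c d] l2_class_scaleR[OF sq(1), of r]
      l2_class_scaleR[OF square_integrable_restrict[OF sq(1), of c d], of r] l2_restrict_class[OF sq(1), of c d]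
    by (simp add: l2_class_rep mult.commute)
qed

lemma symmetric_l2_restrict: "l2_restrict c d x \<bullet> y = x \<bullet> l2_restrict c d y"
proof -
  have sq: "square_integrable (rep_l2 x)" "square_integrable (rep_l2 y)" by (rule square_integrable_rep)+
  show ?thesis using l2_restrict_class[OF sq(1), of c d] l2_restrict_class[OF sq(2), of c d]
      inner_l2_class[OF square_integrable_restrict[OF sq(1), of c d] sq(2)]
      inner_l2_class[OF sq(1) square_integrable_restrict[OF sq(2), of c d]] by (simp add: l2_class_rep)
qed

lemma l2_restrict_of_support:
  "square_integrable f \<Longrightarrow> (\<And>t. t \<notin> einterval c d \<Longrightarrow> f t = 0) \<Longrightarrow> l2_restrict c d (l2_class f) = l2_class f"
  by (subst l2_restrict_class) (auto intro!: arg_cong[where f = l2_class] simp: indicator_def)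

lemma l2_restrict_idem: "l2_restrict c d (l2_restrict c d x) = l2_restrict c d x"
proof -
  have sq: "square_integrable (rep_l2 x)" by (rule square_integrable_rep)
  have "l2_restrict c d (l2_restrict c d (l2_class (rep_l2 x))) = l2_restrict c d (l2_class (rep_l2 x))"
    unfolding l2_restrict_class[OF sq] by (rule l2_restrict_of_support[OF square_integrable_restrict[OF sq]]) simp
  then show ?thesis by (simp add: l2_class_rep)
qed

lemma range_l2_restrict: "range (l2_restrict c d) = l2_on (einterval c d)"
proof (intro equalityI subsetI)
  fix x :: "'a l2" assume "x \<in> range (l2_restrict c d)"
  then obtain y where "x = l2_restrict c d (l2_class (rep_l2 y))" by (auto simp: l2_class_rep)
  then have "x = l2_class (\<lambda>t. indicator (einterval c d) t *\<^sub>R rep_l2 y t)"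
    by (simp add: l2_restrict_class square_integrable_rep)
  then show "x \<in> l2_on (einterval c d)"
    unfolding l2_on_def using square_integrable_restrict[OF square_integrable_rep[of y], of c d]
    by (auto intro!: exI[of _ "\<lambda>t. indicator (einterval c d) t *\<^sub>R rep_l2 y t"])
next
  fix x :: "'a l2" assume "x \<in> l2_on (einterval c d)"
  then obtain f where "x = l2_class f" "square_integrable f" "\<forall>t. t \<notin> einterval c d \<longrightarrow> f t = 0"
    by (auto simp: l2_on_def)
  then have "l2_restrict c d x = x" by (simp add: l2_restrict_of_support)
  then show "x \<in> range (l2_restrict c d)" by (metis rangeI)
qed

section \<open>Smooth functions and test functions\<close>

definition smooth :: "(real \<Rightarrow> 'a::real_normed_vector) \<Rightarrow> bool" where
  "smooth u \<longleftrightarrow> (\<exists>D. D 0 = u \<and> (\<forall>k t. (D k has_vector_derivative D (Suc k) t) (at t)))"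

text \<open>
  To prove smoothness, exhibit a class of functions that is closed under differentiation.
\<close>

lemma smooth_coinduct:
  assumes "\<S> u" and step: "\<And>f. \<S> f \<Longrightarrow> \<exists>g. \<S> g \<and> (\<forall>t. (f has_vector_derivative g t) (at t))"
  shows "smooth u"
proof -
  have "\<exists>D. D 0 = u \<and> (\<forall>k. \<S> (D k) \<and> (\<forall>t. (D k has_vector_derivative D (Suc k) t) (at t)))"
  proof -
    define N where "N f = (SOME g. \<S> g \<and> (\<forall>t. (f has_vector_derivative g t) (at t)))" for f
    have N: "\<S> (N f) \<and> (\<forall>t. (f has_vector_derivative N f t) (at t))" if "\<S> f" for f
      unfolding N_def using step[OF that] by (rule someI_ex)
    define D where "D k = (N ^^ k) u" for k
    have S: "\<S> (D k)" for k by (induction k) (auto simp: D_def assms(1) N)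
    have "(D k has_vector_derivative D (Suc k) t) (at t)" for k t using N[OF S[of k]] by (simp add: D_def)
    then show ?thesis using S by (intro exI[of _ D]) (simp add: D_def)
  qed
  then show ?thesis unfolding smooth_def by blast
qed

lemma smooth_derivative:
  assumes "smooth u"
  shows "\<exists>v. smooth v \<and> (\<forall>t. (u has_vector_derivative v t) (at t))"
proof -
  from assms obtain D where D: "D 0 = u" "\<And>k t. (D k has_vector_derivative D (Suc k) t) (at t)"
    unfolding smooth_def by blast
  have "smooth (D 1)" unfolding smooth_def by (rule exI[of _ "\<lambda>k. D (Suc k)"]) (use D(2) in simp)
  moreover have "(u has_vector_derivative D 1 t) (at t)" for t using D(2)[of 0 t] D(1) by simp
  ultimately show ?thesis by blast
qed

lemma smooth_antiderivative:
  assumes "smooth v" and u: "\<And>t. (u has_vector_derivative v t) (at t)"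
  shows "smooth u"
proof -
  from assms obtain D where D: "D 0 = v" "\<And>k t. (D k has_vector_derivative D (Suc k) t) (at t)"
    unfolding smooth_def by blast
  define D' where "D' k = (case k of 0 \<Rightarrow> u | Suc j \<Rightarrow> D j)" for k
  have "(D' k has_vector_derivative D' (Suc k) t) (at t)" for k t by (cases k) (use u D in \<open>auto simp: D'_def\<close>)
  then show ?thesis unfolding smooth_def by (intro exI[of _ D']) (auto simp: D'_def)
qed

lemma smooth_continuous: "smooth u \<Longrightarrow> continuous_on S u"
  by (meson smooth_derivative continuous_at_imp_continuous_on has_vector_derivative_continuous)

lemma smooth_const: "smooth (\<lambda>_. c)"
  by (rule smooth_coinduct[where \<S> = "\<lambda>f. \<exists>c. f = (\<lambda>_. c)"]) (auto intro!: exI[of _ "\<lambda>_. 0"])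

text \<open>
  The smallest class that contains all products of smooth functions and is closed under the Leibniz rule.
\<close>

inductive products :: "(real \<Rightarrow> 'a::real_normed_vector) \<Rightarrow> bool" where
  product: "smooth f \<Longrightarrow> smooth g \<Longrightarrow> products (\<lambda>t. f t *\<^sub>R g t)"
| sum: "products h \<Longrightarrow> products k \<Longrightarrow> products (\<lambda>t. h t + k t)"

lemma smooth_products: "products u \<Longrightarrow> smooth u"
proof (erule smooth_coinduct)
  fix f :: "real \<Rightarrow> 'a" assume "products f"
  then show "\<exists>g. products g \<and> (\<forall>t. (f has_vector_derivative g t) (at t))"
  proof induction
    case (product f g)
    obtain f' where f': "smooth f'" "\<And>t. (f has_vector_derivative f' t) (at t)" using smooth_derivative[OF product(1)] by blast
    obtain g' where g': "smooth g'" "\<And>t. (g has_vector_derivative g' t) (at t)" using smooth_derivative[OF product(2)] by blast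
    show ?case
    proof (intro exI conjI allI)
      show "products (\<lambda>t. f t *\<^sub>R g' t + f' t *\<^sub>R g t)" by (intro products.intros product f' g')
      show "((\<lambda>t. f t *\<^sub>R g t) has_vector_derivative f t *\<^sub>R g' t + f' t *\<^sub>R g t) (at t)" for t
        using has_vector_derivative_scaleR[of f "f' t" t UNIV g "g' t"] f'(2)[of t] g'(2)[of t]
        by (simp add: has_real_derivative_iff_has_vector_derivative)
    qed
  next
    case (sum h k)
    then obtain h' k' where "products h'" "\<forall>t. (h has_vector_derivative h' t) (at t)"
      "products k'" "\<forall>t. (k has_vector_derivative k' t) (at t)" by blast
    then show ?case by (intro exI[of _ "\<lambda>t. h' t + k' t"]) (auto intro: products.intros has_vector_derivative_add)
  qed
qed

lemma smooth_scaleR: "smooth f \<Longrightarrow> smooth g \<Longrightarrow> smooth (\<lambda>t. f t *\<^sub>R g t)" by (rule smooth_products[OF products.product])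

lemma smooth_mult: "smooth f \<Longrightarrow> smooth g \<Longrightarrow> smooth (\<lambda>t. f t * g t :: real)" using smooth_scaleR[of f g] by simp

lemma smooth_add:
  assumes "smooth f" "smooth g" shows "smooth (\<lambda>t. f t + g t)"
proof -
  have "products (\<lambda>t. 1 *\<^sub>R f t + 1 *\<^sub>R g t)" by (intro products.intros smooth_const assms)
  then show ?thesis using smooth_products by fastforce
qed

lemma smooth_sum: "(\<And>i. i \<in> I \<Longrightarrow> smooth (f i)) \<Longrightarrow> smooth (\<lambda>t. \<Sum>i\<in>I. f i t)"
  by (induction I rule: infinite_finite_induct) (auto intro: smooth_const smooth_add)

lemma smooth_minus: "smooth f \<Longrightarrow> smooth g \<Longrightarrow> smooth (\<lambda>t. f t - g t)"
  using smooth_add[of f "\<lambda>t. (- 1) *\<^sub>R g t"] smooth_scaleR[OF smooth_const[of "- 1"], of g] by simp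

lemma smooth_ident: "smooth (\<lambda>t. t)"
  by (rule smooth_antiderivative[OF smooth_const[of 1]]) (rule has_vector_derivative_id[unfolded id_def])

lemma smooth_affine:
  assumes "smooth f" shows "smooth (\<lambda>t. f (m * t + b))"
proof (rule smooth_coinduct[where \<S> = "\<lambda>h. \<exists>c g. smooth g \<and> h = (\<lambda>t. c *\<^sub>R g (m * t + b))"])
  show "\<exists>c g. smooth g \<and> (\<lambda>t. f (m * t + b)) = (\<lambda>t. c *\<^sub>R g (m * t + b))"
    using assms by (intro exI[of _ 1] exI[of _ f]) simp
next
  fix h :: "real \<Rightarrow> 'a" assume "\<exists>c g. smooth g \<and> h = (\<lambda>t. c *\<^sub>R g (m * t + b))"
  then obtain c g where g: "smooth g" and h: "h = (\<lambda>t. c *\<^sub>R g (m * t + b))" by blast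
  obtain g' where g': "smooth g'" "\<And>t. (g has_vector_derivative g' t) (at t)" using smooth_derivative[OF g] by blast
  have "(h has_vector_derivative (c * m) *\<^sub>R g' (m * t + b)) (at t)" for t
  proof -
    have "((\<lambda>t. m * t + b) has_vector_derivative m) (at t)" 
      by (auto intro!: derivative_eq_intros simp: has_real_derivative_iff_has_vector_derivative[symmetric])
    from vector_diff_chain_at[OF this g'(2)]
    have "((\<lambda>t. g (m * t + b)) has_vector_derivative m *\<^sub>R g' (m * t + b)) (at t)" by (simp add: o_def)
    then have "((\<lambda>t. c *\<^sub>R g (m * t + b)) has_vector_derivative c *\<^sub>R m *\<^sub>R g' (m * t + b)) (at t)"
      by (rule bounded_linear.has_vector_derivative[OF bounded_linear_scaleR_right])
    then show ?thesis by (simp add: h)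
  qed
  then show "\<exists>g. (\<exists>c ga. smooth ga \<and> g = (\<lambda>t. c *\<^sub>R ga (m * t + b))) \<and> (\<forall>t. (h has_vector_derivative g t) (at t))"
    using g'(1) by blast
qed

lemma smooth_real_polynomial_function:
  "real_polynomial_function p \<Longrightarrow> smooth p"
proof (induction rule: real_polynomial_function.induct)
  case (linear f)
  then have "f = (\<lambda>t. t * f 1)"
    by (intro ext) (metis bounded_linear.linear linear_cmul mult.right_neutral real_scaleR_def)
  then show ?case using smooth_mult[OF smooth_ident smooth_const] by metis
qed (auto intro: smooth_const smooth_add smooth_mult)

lemma smooth_polynomial_function:
  fixes p :: "real \<Rightarrow> 'a::euclidean_space"
  assumes "polynomial_function p" shows "smooth p"
proof -
  have "smooth (\<lambda>t. p t \<bullet> b)" for b using assms bounded_linear_inner_left[of b] unfolding polynomial_function_def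
    by (intro smooth_real_polynomial_function) (auto simp: o_def)
  then have "smooth (\<lambda>t. \<Sum>b\<in>Basis. (p t \<bullet> b) *\<^sub>R b)" by (intro smooth_sum smooth_scaleR smooth_const)
  then show ?thesis by (simp add: euclidean_representation)
qed

text \<open>
  The classical flat functions \<open>p(1/x) e\<^sup>-\<^sup>1\<^sup>/\<^sup>x\<close>.  Arbitrary polynomials \<open>p\<close> are included because the class is
  then closed under differentiation.
\<close>

definition flat :: "real poly \<Rightarrow> real \<Rightarrow> real" where
  "flat p x = (if 0 < x then poly p (1 / x) * exp (- (1 / x)) else 0)"

lemma tendsto_poly_exp: "((\<lambda>y. poly p y * exp (- y)) \<longlongrightarrow> (0::real)) at_top"
proof -
  have "((\<lambda>y. \<Sum>i\<le>degree p. coeff p i * (y ^ i / exp y)) \<longlongrightarrow> (\<Sum>i\<le>degree p. coeff p i * 0)) at_top"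
    by (intro tendsto_intros tendsto_power_div_exp_0)
  then show ?thesis by (simp add: poly_altdef sum_distrib_right sum_divide_distrib exp_minus field_simps)
qed

lemma flat_derivative: "(flat p has_real_derivative flat ([:0, 0, 1:] * (p - pderiv p)) x) (at x)"
proof -
  consider "0 < x" | "x < 0" | "x = 0" by linarith
  then show ?thesis
  proof cases
    case 1
    have "((\<lambda>x. poly p (1 / x) * exp (- (1 / x))) has_real_derivative flat ([:0, 0, 1:] * (p - pderiv p)) x) (at x)"
      using 1 by (auto intro!: derivative_eq_intros simp: flat_def divide_simps) (simp add: algebra_simps power2_eq_square)
    then show ?thesis
      by (rule has_field_derivative_transform_within_open[where S = "{0<..}"]) (use 1 in \<open>auto simp: flat_def\<close>)
  next
    case 2
    have "((\<lambda>x. 0) has_real_derivative flat ([:0, 0, 1:] * (p - pderiv p)) x) (at x)" using 2 by (simp add: flat_def)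
    then show ?thesis
      by (rule has_field_derivative_transform_within_open[where S = "{..<0}"]) (use 2 in \<open>auto simp: flat_def\<close>)
  next
    case 3
    have "((\<lambda>h. flat p h / h) \<longlongrightarrow> 0) (at 0)"
    proof (rule filterlim_split_at)
      show "((\<lambda>h. flat p h / h) \<longlongrightarrow> 0) (at_left 0)"
      proof (rule tendsto_eventually)
        show "\<forall>\<^sub>F h in at_left 0. flat p h / h = 0" by (auto simp: flat_def eventually_at_filter)
      qed
      have "((\<lambda>h. poly (pCons 0 p) (inverse h) * exp (- inverse h)) \<longlongrightarrow> 0) (at_right 0)"
        by (rule filterlim_compose[OF tendsto_poly_exp filterlim_inverse_at_top_right])
      then show "((\<lambda>h. flat p h / h) \<longlongrightarrow> 0) (at_right 0)"
      proof (rule Lim_transform_eventually)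
        show "\<forall>\<^sub>F h in at_right 0. poly (pCons 0 p) (inverse h) * exp (- inverse h) = flat p h / h"
          by (auto simp: flat_def eventually_at_filter field_simps)
      qed
    qed
    then show ?thesis unfolding 3 has_field_derivative_iff by (simp add: flat_def)
  qed
qed

lemma smooth_flat: "smooth (flat p)" by (rule smooth_coinduct[where \<S> = "\<lambda>f. \<exists>p. f = flat p"])
    (auto simp: has_real_derivative_iff_has_vector_derivative[symmetric] intro: flat_derivative)

text \<open>
  A smooth cutoff that vanishes outside the interval from \<open>c + 1/k\<close> to \<open>d - 1/k\<close> and tends to the indicator
  of the open interval \<open>(c, d)\<close> as \<open>k \<rightarrow> \<infinity>\<close>.
\<close>

definition cutoff :: "real \<Rightarrow> real \<Rightarrow> nat \<Rightarrow> real \<Rightarrow> real" where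
  "cutoff c d k t = flat 1 (real k * (t - c) - 1) * flat 1 (real k * (d - t) - 1)"

lemma flat_1: "0 \<le> flat 1 x" "flat 1 x \<le> 1" "flat 1 x \<noteq> 0 \<longleftrightarrow> 0 < x" by (auto simp: flat_def)

lemma smooth_cutoff: "smooth (cutoff c d k)"
proof -
  have "smooth (\<lambda>t. flat 1 (real k * t + (- real k * c - 1)) * flat 1 (- real k * t + (real k * d - 1)))"
    by (intro smooth_mult smooth_affine smooth_flat)
  then show ?thesis unfolding cutoff_def by (simp add: algebra_simps)
qed

lemma cutoff_bounds: "0 \<le> cutoff c d k t" "cutoff c d k t \<le> 1"
  unfolding cutoff_def using flat_1 by (auto intro: mult_le_one)

lemma cutoff_support: "cutoff c d k t \<noteq> 0 \<Longrightarrow> 1 < real k * (t - c) \<and> 1 < real k * (d - t)"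
  unfolding cutoff_def using flat_1(3) by auto

lemma cutoff_tendsto: "(\<lambda>k. cutoff c d k t) \<longlonglongrightarrow> indicator {c<..<d} t"
proof (cases "c < t \<and> t < d")
  case True
  have 1: "(\<lambda>k. flat 1 (real k * y - 1)) \<longlonglongrightarrow> 1" if "0 < y" for y :: real
  proof -
    have lim: "filterlim (\<lambda>k. - 1 + real k * y) at_top sequentially"
      by (rule filterlim_tendsto_add_at_top[OF tendsto_const])
        (rule filterlim_at_top_mult_tendsto_pos[OF tendsto_const that filterlim_real_sequentially])
    then have "(\<lambda>k. exp (- inverse (- 1 + real k * y))) \<longlonglongrightarrow> exp (- 0)"
      by (intro tendsto_intros tendsto_inverse_0_at_top)
    moreover have "\<forall>\<^sub>F k in sequentially. exp (- inverse (- 1 + real k * y)) = flat 1 (real k * y - 1)"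
      using filterlim_at_top_dense[THEN iffD1, OF lim, rule_format, of 0]
      by eventually_elim (simp add: flat_def inverse_eq_divide)
    ultimately show ?thesis using Lim_transform_eventually by fastforce
  qed
  show ?thesis unfolding cutoff_def using True tendsto_mult[OF 1[of "t - c"] 1[of "d - t"]] by simp
next
  case False
  have "cutoff c d k t = 0" for k
  proof (rule ccontr)
    assume "cutoff c d k t \<noteq> 0"
    from cutoff_support[OF this] have "0 < real k * (t - c)" "0 < real k * (d - t)" by auto
    then show False using False by (auto simp: zero_less_mult_iff)
  qed
  then show ?thesis using False by auto
qed

lemma cutoff_pos:
  assumes "1 < real k * (t - c)" "1 < real k * (d - t)" shows "0 < cutoff c d k t"
  unfolding cutoff_def using assms flat_1(1,3)[of "real k * (t - c) - 1"] flat_1(1,3)[of "real k * (d - t) - 1"]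
  by (intro mult_pos_pos) linarith+

lemma test_functionsI:
  assumes "smooth u" "{c..d} \<subseteq> einterval a b" and u: "\<And>t. t \<notin> {c..d} \<Longrightarrow> u t = 0"
  shows "u \<in> test_functions a b"
proof -
  have sub: "closure {t. u t \<noteq> 0} \<subseteq> {c..d}" by (rule closure_minimal) (use u in force, simp)
  then have "compact (closure {t. u t \<noteq> 0})"
    using compact_Icc[of c d] by (metis bounded_subset closed_closure compact_eq_bounded_closed)
  then show ?thesis using assms sub unfolding test_functions_def smooth_def by blast
qed

lemma einterval_Icc: "c \<in> einterval a b \<Longrightarrow> d \<in> einterval a b \<Longrightarrow> {c..d} \<subseteq> einterval a b"
  by (auto simp: einterval_iff) (metis ereal_less_eq(3) less_le_trans, metis ereal_less_eq(3) le_less_trans)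

lemma test_functionsE:
  assumes "u \<in> test_functions a b" and ab: "a < b"
  obtains v w c d where "smooth v" "\<And>t. (u has_vector_derivative v t) (at t)"
    "c < d" "{c..d} \<subseteq> einterval a b" "\<And>t. t \<notin> {c<..<d} \<Longrightarrow> u t = 0" "\<And>t. t \<notin> {c<..<d} \<Longrightarrow> v t = 0"
proof -
  have u: "smooth u" using assms by (auto simp: test_functions_def smooth_def)
  obtain v where v: "smooth v" "\<And>t. (u has_vector_derivative v t) (at t)" using smooth_derivative[OF u] by blast
  define K where "K = closure {t. u t \<noteq> 0}"
  have K: "compact K" "K \<subseteq> einterval a b" using assms by (auto simp: test_functions_def K_def)
  obtain m where m: "m \<in> einterval a b" using einterval_nonempty[OF ab] by blast
  define K' where "K' = insert m K"
  have K': "compact K'" "K' \<noteq> {}" "K' \<subseteq> einterval a b" using K m by (auto simp: K'_def)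
  obtain x where x: "x \<in> K'" "\<And>y. y \<in> K' \<Longrightarrow> x \<le> y" using compact_attains_inf[OF K'(1,2)] by blast
  obtain y where y: "y \<in> K'" "\<And>z. z \<in> K' \<Longrightarrow> z \<le> y" using compact_attains_sup[OF K'(1,2)] by blast
  obtain e where e: "0 < e" "cball x e \<subseteq> einterval a b"
    using open_contains_cball[of "einterval a b"] open_einterval x(1) K'(3) by blast
  obtain e' where e': "0 < e'" "cball y e' \<subseteq> einterval a b"
    using open_contains_cball[of "einterval a b"] open_einterval y(1) K'(3) by blast
  define c d where "c = x - e" and "d = y + e'"
  have "c \<in> einterval a b" "d \<in> einterval a b" using e e' by (auto simp: c_def d_def dist_real_def subset_iff)
  then have cd: "{c..d} \<subseteq> einterval a b" by (rule einterval_Icc)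
  have "x \<le> y" using x y by blast
  then have "c < d" using e(1) e'(1) by (simp add: c_def d_def)
  have Kcd: "K \<subseteq> {c<..<d}"
  proof
    fix t assume "t \<in> K"
    then have "t \<in> K'" by (simp add: K'_def)
    then show "t \<in> {c<..<d}" using x(2)[of t] y(2)[of t] e(1) e'(1) by (auto simp: c_def d_def)
  qed
  have u0: "u t = 0" if "t \<notin> K" for t using that closure_subset[of "{t. u t \<noteq> 0}"] by (auto simp: K_def)
  have v0: "v t = 0" if "t \<notin> K" for t
  proof -
    have "((\<lambda>_. 0) has_vector_derivative v t) (at t)"
    proof (rule has_vector_derivative_transform_within_open[OF v(2)])
      show "open (- K)" using K(1) compact_imp_closed by blast
    qed (use that u0 in auto)
    then show ?thesis using vector_derivative_unique_at has_vector_derivative_const by blast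
  qed
  show ?thesis by (rule that[OF v \<open>c < d\<close> cd]) (use u0 v0 Kcd in blast)+
qed

section \<open>Approximation by test functions\<close>

lemma compactly_supported_borel:
  fixes f F :: "real \<Rightarrow> 'a::euclidean_space"
  assumes F: "continuous_on {c..d} F" and eq: "\<And>t. t \<in> {c..d} \<Longrightarrow> f t = F t" and z: "\<And>t. t \<notin> {c..d} \<Longrightarrow> f t = 0"
  shows "f \<in> borel_measurable lborel" and "integrable lborel f" and "square_integrable f"
proof -
  have f: "f = (\<lambda>t. indicator {c..d} t *\<^sub>R F t)" using eq z by (auto simp: indicator_def)
  have meas: "(\<lambda>t. indicator {c..d} t *\<^sub>R G t) \<in> borel_measurable borel" if "continuous_on {c..d} G" for G :: "real \<Rightarrow> 'c::euclidean_space"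
    using borel_measurable_continuous_on_indicator[OF _ that] by simp
  have int: "integrable lborel (\<lambda>t. indicator {c..d} t *\<^sub>R G t)" if "continuous_on {c..d} G" for G :: "real \<Rightarrow> 'c::euclidean_space"
    using borel_integrable_atLeastAtMost'[OF that] by (simp add: set_integrable_def)
  show 1: "f \<in> borel_measurable lborel" using meas[OF F] f by simp
  show "integrable lborel f" using int[OF F] f by simp
  have "integrable lborel (\<lambda>t. indicator {c..d} t *\<^sub>R (norm (F t))\<^sup>2)" by (intro int continuous_intros F)
  moreover have "(\<lambda>t. (norm (f t))\<^sup>2) = (\<lambda>t. indicator {c..d} t *\<^sub>R (norm (F t))\<^sup>2)" by (auto simp: f indicator_def)
  ultimately show "square_integrable f" using 1 by (simp add: square_integrable_def)
qed

lemma antiderivative_of_compact_support: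
  fixes v :: "real \<Rightarrow> 'a::euclidean_space"
  assumes v: "continuous_on UNIV v" and z: "\<And>t. t \<le> c \<Longrightarrow> v t = 0"
  shows "((\<lambda>t. integral {c..t} v) has_vector_derivative v t) (at t)"
proof -
  define a where "a = min c t - 1"
  have eq: "integral {a..s} v = integral {c..s} v" for s
  proof (cases "c \<le> s")
    case True
    have "integral {a..c} v + integral {c..s} v = integral {a..s} v"
      by (rule Henstock_Kurzweil_Integration.integral_combine)
        (use True in \<open>auto simp: a_def intro: integrable_continuous_real continuous_on_subset[OF v]\<close>)
    moreover have "integral {a..c} v = integral {a..c} (\<lambda>_. 0)" by (rule integral_cong) (use z in auto)
    ultimately show ?thesis by simp
  next
    case False
    have "integral {a..s} v = integral {a..s} (\<lambda>_. 0)" by (rule integral_cong) (use z False in auto)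
    then show ?thesis using False by simp
  qed
  have "((\<lambda>s. integral {a..s} v) has_vector_derivative v t) (at t within {a..t + 1})"
    by (rule integral_has_vector_derivative[OF continuous_on_subset[OF v]]) (auto simp: a_def)
  then have "((\<lambda>s. integral {c..s} v) has_vector_derivative v t) (at t within {a..t + 1})" unfolding eq .
  moreover have "at t within {a..t + 1} = at t" by (rule at_within_interior) (auto simp: a_def)
  ultimately show ?thesis by simp
qed

text \<open>
  Test functions approximate functions that vanish at both endpoints and have a bounded derivative.  The
  convergence is bounded and pointwise, which is the form needed for dominated convergence of the quadratic form.
  The derivative is approximated first and then integrated; a correction by a multiple of a bump removes the
  total integral, so that the antiderivative has compact support.
\<close>

lemma smooth_approximation:
  fixes w g :: "real \<Rightarrow> 'a::euclidean_space"
  assumes cd: "c < d" and w: "continuous_on {c..d} w" "w c = 0" "w d = 0"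
    and deriv: "\<And>t. t \<in> {c<..<d} \<Longrightarrow> (w has_vector_derivative g t) (at t)"
    and g: "continuous_on {c<..<d} g" and G: "\<And>t. t \<in> {c<..<d} \<Longrightarrow> norm (g t) \<le> G"
  shows "\<exists>u v K. (\<forall>k. smooth (u k) \<and> (\<forall>t. (u k has_vector_derivative v k t) (at t)) \<and>
            (\<exists>e>0. \<forall>t. t \<notin> {c + e..d - e} \<longrightarrow> u k t = 0)) \<and>
      (\<forall>k t. norm (u k t) \<le> K \<and> norm (v k t) \<le> K) \<and>
      (\<forall>t. (\<lambda>k. u k t) \<longlonglongrightarrow> (if t \<in> {c<..<d} then w t else 0)) \<and>
      (\<forall>t. (\<lambda>k. v k t) \<longlonglongrightarrow> (if t \<in> {c<..<d} then g t else 0))"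
proof -
  define ghat where "ghat t = (if t \<in> {c<..<d} then g t else 0)" for t
  have "\<exists>p. polynomial_function p \<and> (\<forall>t\<in>{c + 1 / real (Suc k)..d - 1 / real (Suc k)}. norm (g t - p t) < 1 / real (Suc k))" for k
  proof (rule Stone_Weierstrass_polynomial_function)
    show "continuous_on {c + 1 / real (Suc k)..d - 1 / real (Suc k)} g"
    proof (rule continuous_on_subset[OF g], rule subsetI)
      fix t assume "t \<in> {c + 1 / real (Suc k)..d - 1 / real (Suc k)}"
      moreover have "0 < 1 / real (Suc k)" by simp
      ultimately show "t \<in> {c<..<d}" unfolding atLeastAtMost_iff greaterThanLessThan_iff by linarith
    qed
  qed simp_all
  then obtain p where p: "\<And>k. polynomial_function (p k)"
    "\<And>k t. t \<in> {c + 1 / real (Suc k)..d - 1 / real (Suc k)} \<Longrightarrow> norm (g t - p k t) < 1 / real (Suc k)" by metis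
  define h where "h k t = cutoff c d (Suc k) t *\<^sub>R p k t" for k t
  have smh: "smooth (h k)" for k unfolding h_def by (intro smooth_scaleR smooth_cutoff smooth_polynomial_function p)
  have supp: "t \<in> {c + 1 / real (Suc k)<..<d - 1 / real (Suc k)}" if "cutoff c d (Suc k) t \<noteq> 0" for k t
    using cutoff_support[OF that] by (auto simp: field_simps)
  have "(c + d) / 2 \<in> {c<..<d}" using cd by auto
  then have G0: "0 \<le> G" by (rule order_trans[OF norm_ge_zero G])
  have hbound: "norm (h k t) \<le> G + 1" for k t
  proof (cases "cutoff c d (Suc k) t = 0")
    case False
    have "1 / real (Suc k) \<le> 1" by simp
    moreover have "norm (g t) \<le> G"
    proof (rule G)
      have "0 < 1 / real (Suc k)" by simp
      then show "t \<in> {c<..<d}" using supp[OF False] unfolding greaterThanLessThan_iff by linarith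
    qed
    moreover have "norm (g t - p k t) < 1 / real (Suc k)" using supp[OF False] by (intro p(2)) auto
    ultimately have "norm (p k t) \<le> G + 1" using norm_triangle_sub[of "p k t" "g t"]
      unfolding norm_minus_commute[of "p k t" "g t"] by linarith
    then have "\<bar>cutoff c d (Suc k) t\<bar> * norm (p k t) \<le> 1 * (G + 1)"
      using cutoff_bounds[of c d "Suc k" t] by (intro mult_mono) auto
    then show ?thesis by (simp add: h_def)
  qed (use G0 in \<open>simp add: h_def\<close>)
  have z: "(\<lambda>k. 1 / real (Suc k)) \<longlonglongrightarrow> 0" using LIMSEQ_inverse_real_of_nat by (simp add: inverse_eq_divide)
  have cut: "(\<lambda>k. cutoff c d (Suc k) t) \<longlonglongrightarrow> indicator {c<..<d} t" for t by (rule LIMSEQ_Suc[OF cutoff_tendsto])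
  have hlim: "(\<lambda>k. h k t) \<longlonglongrightarrow> ghat t" for t
  proof -
    have "(\<lambda>k. cutoff c d (Suc k) t *\<^sub>R (g t - p k t)) \<longlonglongrightarrow> 0"
    proof (rule Lim_null_comparison[OF _ z], rule always_eventually, rule allI)
      fix k
      show "norm (cutoff c d (Suc k) t *\<^sub>R (g t - p k t)) \<le> 1 / real (Suc k)"
      proof (cases "cutoff c d (Suc k) t = 0")
        case False
        have "norm (g t - p k t) < 1 / real (Suc k)" using supp[OF False] by (intro p(2)) auto
        then have "\<bar>cutoff c d (Suc k) t\<bar> * norm (g t - p k t) \<le> 1 * (1 / real (Suc k))"
          using cutoff_bounds[of c d "Suc k" t] by (intro mult_mono) auto
        then show ?thesis by simp
      qed simp
    qed
    moreover have "(\<lambda>k. cutoff c d (Suc k) t *\<^sub>R g t) \<longlonglongrightarrow> indicator {c<..<d} t *\<^sub>R g t" by (intro tendsto_intros cut)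
    ultimately have "(\<lambda>k. cutoff c d (Suc k) t *\<^sub>R g t - cutoff c d (Suc k) t *\<^sub>R (g t - p k t)) \<longlonglongrightarrow> indicator {c<..<d} t *\<^sub>R g t - 0"
      by (intro tendsto_diff)
    moreover have "indicator {c<..<d} t *\<^sub>R g t = ghat t" by (simp add: ghat_def indicator_def)
    ultimately show ?thesis by (simp add: h_def algebra_simps)
  qed
  have hcont: "continuous_on S (h k)" for S k by (rule smooth_continuous[OF smh])
  have hint: "(\<lambda>k. integral {c..t} (h k)) \<longlonglongrightarrow> w t" if "t \<in> {c..d}" for t
  proof -
    have "(ghat has_integral (w t - w c)) {c..t}"
    proof (rule fundamental_theorem_of_calculus_interior)
      show "continuous_on {c..t} w" by (rule continuous_on_subset[OF w(1)]) (use that in auto)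
      show "(w has_vector_derivative ghat x) (at x)" if "x \<in> {c<..<t}" for x
        using deriv[of x] that \<open>t \<in> {c..d}\<close> by (simp add: ghat_def)
    qed (use that in auto)
    moreover have "(\<lambda>k. integral {c..t} (h k)) \<longlonglongrightarrow> integral {c..t} ghat"
      by (rule dominated_convergence(2)[where h = "\<lambda>_. G + 1"])
        (use hbound hlim in \<open>auto intro: integrable_continuous_real hcont\<close>)
    ultimately show ?thesis using w(2) by (simp add: integral_unique)
  qed
  obtain m :: nat where m: "4 / (d - c) < real m" using reals_Archimedean2 by blast
  define \<beta> where "\<beta> = cutoff c d m"
  have m0: "0 < m" using m cd by (cases m) (auto simp: field_simps)
  have \<beta>cont: "continuous_on S \<beta>" for S unfolding \<beta>_def by (rule smooth_continuous[OF smooth_cutoff])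
  define J where "J = integral {c..d} \<beta>"
  have "J \<noteq> 0"
  proof
    assume "J = 0"
    have mid: "1 < real m * ((d - c) / 2)" using m cd by (simp add: field_simps)
    have "(\<beta> has_integral 0) (cbox c d)"
      using \<open>J = 0\<close> integrable_integral[OF integrable_continuous_real[OF \<beta>cont[of "{c..d}"]]] by (simp add: J_def)
    then have "\<beta> ((c + d) / 2) = 0"
      by (rule has_integral_0_cbox_imp_0[rotated 2]) (use cd \<beta>cont cutoff_bounds in \<open>auto simp: \<beta>_def box_real\<close>)
    moreover have "0 < \<beta> ((c + d) / 2)" unfolding \<beta>_def by (rule cutoff_pos) (use mid in \<open>simp_all add: field_simps\<close>)
    ultimately show False by simp
  qed
  define I where "I k = integral {c..d} (h k)" for k
  have Ilim: "I \<longlonglongrightarrow> 0" unfolding I_def using hint[of d] cd w(3) by simp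
  then obtain B where B: "\<And>k. norm (I k) \<le> B" using convergent_imp_Bseq[OF convergentI] by (metis Bseq_def)
  define v where "v k t = h k t - \<beta> t *\<^sub>R (I k /\<^sub>R J)" for k t
  define u where "u k t = integral {c..t} (v k)" for k t
  have smv: "smooth (v k)" for k
    unfolding v_def \<beta>_def by (intro smooth_minus smh smooth_scaleR smooth_cutoff smooth_const)
  have vcont: "continuous_on S (v k)" for S k by (rule smooth_continuous[OF smv])
  have vz: "\<exists>e>0. \<forall>t. t \<notin> {c + e..d - e} \<longrightarrow> v k t = 0" for k
  proof -
    define e where "e = min (1 / real (Suc k)) (1 / real m)"
    have e: "0 < e" "e \<le> 1 / real (Suc k)" "e \<le> 1 / real m" using m0 by (auto simp: e_def)
    have "v k t = 0" if "t \<notin> {c + e..d - e}" for t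
    proof -
      have "cutoff c d (Suc k) t = 0"
      proof (rule ccontr)
        assume "cutoff c d (Suc k) t \<noteq> 0"
        from supp[OF this] show False using e that by (auto simp del: of_nat_Suc)
      qed
      moreover have "\<beta> t = 0"
      proof (rule ccontr)
        assume "\<beta> t \<noteq> 0"
        then have "t \<in> {c + 1 / real m<..<d - 1 / real m}"
          using cutoff_support[of c d m t] m0 by (auto simp: \<beta>_def field_simps)
        then show False using e that by auto
      qed
      ultimately show ?thesis by (simp add: v_def h_def)
    qed
    then show ?thesis using e(1) by blast
  qed
  have uderiv: "(u k has_vector_derivative v k t) (at t)" for k t unfolding u_def
  proof (rule antiderivative_of_compact_support[OF vcont])
    fix t assume "t \<le> c"
    obtain e where "0 < e" "\<And>t. t \<notin> {c + e..d - e} \<Longrightarrow> v k t = 0" using vz[of k] by blast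
    then show "v k t = 0" using \<open>t \<le> c\<close> by simp
  qed
  have smu: "smooth (u k)" for k by (rule smooth_antiderivative[OF smv uderiv])
  have uint: "integral {c..t} (v k) = integral {c..t} (h k) - integral {c..t} \<beta> *\<^sub>R (I k /\<^sub>R J)" for k t
  proof -
    have "((\<lambda>t. h k t - \<beta> t *\<^sub>R (I k /\<^sub>R J)) has_integral (integral {c..t} (h k) - integral {c..t} \<beta> *\<^sub>R (I k /\<^sub>R J))) {c..t}"
      by (intro has_integral_diff has_integral_scaleR_left integrable_integral integrable_continuous_real hcont \<beta>cont)
    then show ?thesis unfolding v_def by (rule integral_unique)
  qed
  have uz: "\<exists>e>0. \<forall>t. t \<notin> {c + e..d - e} \<longrightarrow> u k t = 0" for k
  proof -
    obtain e where e: "0 < e" "\<And>t. t \<notin> {c + e..d - e} \<Longrightarrow> v k t = 0" using vz[of k] by blast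
    have ud: "u k d = 0" using \<open>J \<noteq> 0\<close> unfolding u_def uint by (simp add: I_def J_def)
    have "u k t = 0" if "t \<notin> {c + e..d - e}" for t
    proof (cases "t < c + e")
      case True
      have "u k t = integral {c..t} (\<lambda>_. 0)" unfolding u_def by (rule integral_cong) (use True e(2) in auto)
      then show ?thesis by simp
    next
      case False
      then have td: "d - e < t" using that by auto
      have "u k t = u k d"
      proof (rule has_derivative_zero_unique_connected[of "{d - e<..}"])
        fix s assume "s \<in> {d - e<..}"
        then have "v k s = 0" using e(2) by auto
        then show "(u k has_derivative (\<lambda>_. 0)) (at s)" using uderiv[of k s] by (simp add: has_vector_derivative_def)
      qed (use td e(1) in auto)
      then show ?thesis using ud by simp
    qed
    then show ?thesis using e(1) by blast
  qed
  have Bh: "norm (\<beta> t *\<^sub>R (I k /\<^sub>R J)) \<le> B / \<bar>J\<bar>" for k t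
  proof -
    have "norm (\<beta> t *\<^sub>R (I k /\<^sub>R J)) = \<bar>\<beta> t\<bar> * (norm (I k) / \<bar>J\<bar>)" by (simp add: divide_inverse abs_mult)
    also have "\<dots> \<le> 1 * (B / \<bar>J\<bar>)"
      using cutoff_bounds[of c d m t] B[of k] by (intro mult_mono divide_right_mono) (auto simp: \<beta>_def)
    finally show ?thesis by simp
  qed
  define K where "K = G + 1 + B / \<bar>J\<bar>"
  have vb: "norm (v k t) \<le> K" for k t
    unfolding v_def K_def by (rule order_trans[OF norm_triangle_ineq4 add_mono[OF hbound Bh]])
  have K0: "0 \<le> K" using order_trans[OF norm_ge_zero vb] .
  have ub: "norm (u k t) \<le> K * (d - c)" for k t
  proof (cases "t \<in> {c..d}")
    case True
    have "norm (u k t) \<le> K * (t - c)" unfolding u_def by (rule integral_bound) (use True vcont vb in auto)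
    also have "\<dots> \<le> K * (d - c)" using True K0 by (intro mult_left_mono) auto
    finally show ?thesis .
  next
    case False
    obtain e where "0 < e" "\<And>t. t \<notin> {c + e..d - e} \<Longrightarrow> u k t = 0" using uz[of k] by blast
    then have "u k t = 0" using False by auto
    then show ?thesis using K0 cd by simp
  qed
  have Imul: "(\<lambda>k. r *\<^sub>R (I k /\<^sub>R J)) \<longlonglongrightarrow> 0" for r
    using tendsto_scaleR[OF tendsto_const[of r] tendsto_scaleR[OF tendsto_const[of "inverse J"] Ilim]] by simp
  have vlim: "(\<lambda>k. v k t) \<longlonglongrightarrow> (if t \<in> {c<..<d} then g t else 0)" for t
    using tendsto_diff[OF hlim[of t] Imul[of "\<beta> t"]] by (simp add: v_def ghat_def)
  have ulim: "(\<lambda>k. u k t) \<longlonglongrightarrow> (if t \<in> {c<..<d} then w t else 0)" for t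
  proof (cases "t \<in> {c<..<d}")
    case True
    then have "(\<lambda>k. u k t) \<longlonglongrightarrow> w t"
      using tendsto_diff[OF hint[of t] Imul[of "integral {c..t} \<beta>"]] by (simp add: u_def uint)
    then show ?thesis using True by simp
  next
    case False
    have "u k t = 0" for k
    proof -
      obtain e where "0 < e" "\<And>t. t \<notin> {c + e..d - e} \<Longrightarrow> u k t = 0" using uz[of k] by blast
      then show ?thesis using False by auto
    qed
    then show ?thesis using False by auto
  qed
  define K' where "K' = max K (K * (d - c))"
  have "norm (u k t) \<le> K' \<and> norm (v k t) \<le> K'" for k t
    using ub[of k t] vb[of k t] by (simp add: K'_def le_max_iff_disj)
  then show ?thesis using smu uderiv uz ulim vlim by (intro exI[of _ u] exI[of _ v] exI[of _ K']) blast
qed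

lemma AE_zero_of_integral_zero:
  fixes g :: "real \<Rightarrow> real"
  assumes int: "integrable lborel g" and z: "\<And>x. (LINT t|lborel. g t * indicator {x<..} t) = 0"
  shows "AE t in lborel. g t = 0"
proof -
  have [measurable]: "g \<in> borel_measurable borel" using borel_measurable_integrable[OF int] by simp
  define p n where "p t = ennreal (max 0 (g t))" and "n t = ennreal (max 0 (- g t))" for t
  have [measurable]: "p \<in> borel_measurable borel" "n \<in> borel_measurable borel" unfolding p_def n_def by measurable
  have ip: "integrable lborel (\<lambda>t. max 0 (g t) * indicator {x<..} t)" for x
    using integrable_mult_indicator[of "{x<..}" lborel "\<lambda>t. max 0 (g t)"] int by (simp add: mult.commute)
  have i_n: "integrable lborel (\<lambda>t. max 0 (- g t) * indicator {x<..} t)" for x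
    using integrable_mult_indicator[of "{x<..}" lborel "\<lambda>t. max 0 (- g t)"] int by (simp add: mult.commute)
  have ep: "emeasure (density lborel p) {x<..} = ennreal (LINT t|lborel. max 0 (g t) * indicator {x<..} t)" for x
  proof -
    have "emeasure (density lborel p) {x<..} = (\<integral>\<^sup>+t. p t * indicator {x<..} t \<partial>lborel)"
      by (rule emeasure_density) simp_all
    also have "\<dots> = (\<integral>\<^sup>+t. ennreal (max 0 (g t) * indicator {x<..} t) \<partial>lborel)"
      by (intro nn_integral_cong) (simp add: p_def indicator_def)
    also have "\<dots> = ennreal (LINT t|lborel. max 0 (g t) * indicator {x<..} t)"
      by (rule nn_integral_eq_integral[OF ip]) (simp add: indicator_def)
    finally show ?thesis .
  qed
  have en: "emeasure (density lborel n) {x<..} = ennreal (LINT t|lborel. max 0 (- g t) * indicator {x<..} t)" for x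
  proof -
    have "emeasure (density lborel n) {x<..} = (\<integral>\<^sup>+t. n t * indicator {x<..} t \<partial>lborel)"
      by (rule emeasure_density) simp_all
    also have "\<dots> = (\<integral>\<^sup>+t. ennreal (max 0 (- g t) * indicator {x<..} t) \<partial>lborel)"
      by (intro nn_integral_cong) (simp add: n_def indicator_def)
    also have "\<dots> = ennreal (LINT t|lborel. max 0 (- g t) * indicator {x<..} t)"
      by (rule nn_integral_eq_integral[OF i_n]) (simp add: indicator_def)
    finally show ?thesis .
  qed
  have "density lborel p = density lborel n"
  proof (rule measure_eqI_lessThan)
    fix x
    have "(LINT t|lborel. g t * indicator {x<..} t) =
        (LINT t|lborel. max 0 (g t) * indicator {x<..} t - max 0 (- g t) * indicator {x<..} t)"
      by (intro Bochner_Integration.integral_cong refl) (auto simp: max_def indicator_def)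
    also have "\<dots> = (LINT t|lborel. max 0 (g t) * indicator {x<..} t) - (LINT t|lborel. max 0 (- g t) * indicator {x<..} t)"
      by (rule Bochner_Integration.integral_diff[OF ip i_n])
    finally show "emeasure (density lborel p) {x<..} = emeasure (density lborel n) {x<..}" by (simp add: ep en z)
    show "emeasure (density lborel p) {x<..} < \<infinity>" by (simp add: ep)
  qed simp_all
  then have "AE t in lborel. p t = n t"
    by (intro sigma_finite_measure.density_unique[OF sigma_finite_lborel, of p n]) simp_all
  then show ?thesis by eventually_elim (auto simp: p_def n_def max_def split: if_splits)
qed

text \<open>
  Testing against cutoffs of indicators shows that the integrals of each component over all subintervals
  vanish.
\<close>

lemma fundamental_lemma:
  fixes f :: "real \<Rightarrow> real^'n"
  assumes f: "square_integrable f" and ab: "a < b"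
    and orth: "\<And>u. u \<in> test_functions a b \<Longrightarrow> (LINT t|lborel. f t \<bullet> u t) = 0"
    and supp: "\<And>t. t \<notin> einterval a b \<Longrightarrow> f t = 0"
  shows "AE t in lborel. f t = 0"
proof -
  have [measurable]: "f \<in> borel_measurable borel" using f by (simp add: square_integrable_def)
  have comp [measurable]: "(\<lambda>t. f t $ i) \<in> borel_measurable borel" for i
  proof -
    have "(\<lambda>t. f t \<bullet> axis i 1) \<in> borel_measurable borel" by measurable
    then show ?thesis by (simp add: inner_axis)
  qed
  have loc: "AE t in lborel. t \<in> {p<..<q} \<longrightarrow> f t $ i = 0" if pq: "{p..q} \<subseteq> einterval a b" for p q i
  proof -
    define g where "g t = f t $ i * indicator {p<..<q} t" for t
    have bound: "\<bar>f t $ i\<bar> * indicator {p..q} t \<le> (norm (f t))\<^sup>2 + indicator {p..q} t" for t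
    proof -
      have "\<bar>f t $ i\<bar> \<le> norm (f t)" by (rule component_le_norm_cart)
      moreover have "2 * norm (f t) \<le> (norm (f t))\<^sup>2 + 1"
        using zero_le_power2[of "norm (f t) - 1"] by (simp add: power2_diff)
      ultimately have "\<bar>f t $ i\<bar> \<le> (norm (f t))\<^sup>2 + 1" using norm_ge_zero[of "f t"] by linarith
      then show ?thesis by (auto simp: indicator_def)
    qed
    have sqf: "integrable lborel (\<lambda>t. (norm (f t))\<^sup>2)" using f by (simp add: square_integrable_def)
    have ind: "integrable lborel (\<lambda>t. indicator {p..q} t :: real)"
      by (rule integrable_real_indicator) (simp_all add: emeasure_lborel_Icc_eq)
    have dom: "integrable lborel (\<lambda>t. \<bar>f t $ i\<bar> * indicator {p..q} t)"
    proof (rule Bochner_Integration.integrable_bound[OF Bochner_Integration.integrable_add[OF sqf ind]])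
      show "AE t in lborel. norm (\<bar>f t $ i\<bar> * indicator {p..q} t) \<le> norm ((norm (f t))\<^sup>2 + indicator {p..q} t)"
        using bound by (intro AE_I2) (simp add: abs_mult)
    qed simp
    have intg: "integrable lborel g"
    proof (rule Bochner_Integration.integrable_bound[OF dom])
      show "AE t in lborel. norm (g t) \<le> norm (\<bar>f t $ i\<bar> * indicator {p..q} t)"
        by (intro AE_I2) (auto simp: g_def abs_mult indicator_def)
    qed (unfold g_def, measurable)
    have "(LINT t|lborel. g t * indicator {x<..} t) = 0" for x
    proof -
      define y where "y = max x p"
      have sub: "{y..q} \<subseteq> {p..q}" by (auto simp: y_def)
      have zero: "(LINT t|lborel. f t $ i * cutoff y q k t) = 0" for k
      proof -
        have "(\<lambda>t. cutoff y q k t *\<^sub>R axis i 1) \<in> test_functions a b"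
        proof (rule test_functionsI[of _ y q])
          show "smooth (\<lambda>t. cutoff y q k t *\<^sub>R axis i 1 :: real^'n)" by (intro smooth_scaleR smooth_cutoff smooth_const)
          show "{y..q} \<subseteq> einterval a b" using sub pq by auto
          fix t assume "t \<notin> {y..q}"
          then have "cutoff y q k t = 0"
            using cutoff_support[of y q k t] by (auto simp: not_le) (smt (verit) mult_nonneg_nonpos of_nat_0_le_iff)+
          then show "cutoff y q k t *\<^sub>R axis i 1 = (0 :: real^'n)" by simp
        qed
        from orth[OF this] show ?thesis by (simp add: inner_axis mult.commute)
      qed
      have "(\<lambda>k. LINT t|lborel. f t $ i * cutoff y q k t) \<longlonglongrightarrow> (LINT t|lborel. g t * indicator {x<..} t)"
      proof (rule integral_dominated_convergence[OF _ _ dom])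
        show "(\<lambda>t. g t * indicator {x<..} t) \<in> borel_measurable lborel" unfolding g_def by measurable
        have [measurable]: "cutoff y q k \<in> borel_measurable borel" for k
          by (intro borel_measurable_continuous_onI smooth_continuous smooth_cutoff)
        show "(\<lambda>t. f t $ i * cutoff y q k t) \<in> borel_measurable lborel" for k by measurable
        show "AE t in lborel. (\<lambda>k. f t $ i * cutoff y q k t) \<longlonglongrightarrow> g t * indicator {x<..} t"
        proof (intro AE_I2)
          fix t
          have "(\<lambda>k. f t $ i * cutoff y q k t) \<longlonglongrightarrow> f t $ i * indicator {y<..<q} t"
            by (intro tendsto_intros cutoff_tendsto)
          moreover have "f t $ i * indicator {y<..<q} t = g t * indicator {x<..} t"
            by (auto simp: g_def y_def indicator_def)
          ultimately show "(\<lambda>k. f t $ i * cutoff y q k t) \<longlonglongrightarrow> g t * indicator {x<..} t" by simp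
        qed
        show "AE t in lborel. norm (f t $ i * cutoff y q k t) \<le> \<bar>f t $ i\<bar> * indicator {p..q} t" for k
        proof (intro AE_I2)
          fix t
          show "norm (f t $ i * cutoff y q k t) \<le> \<bar>f t $ i\<bar> * indicator {p..q} t"
          proof (cases "cutoff y q k t = 0")
            case False
            from cutoff_support[OF this] have "0 < real k * (t - y)" "0 < real k * (q - t)" by auto
            then have "t \<in> {p..q}" by (auto simp: zero_less_mult_iff y_def)
            then show ?thesis using cutoff_bounds[of y q k t] by (auto simp: abs_mult intro: mult_left_le)
          qed (simp add: indicator_def)
        qed
      qed
      then show ?thesis by (simp add: zero LIMSEQ_const_iff)
    qed
    from AE_zero_of_integral_zero[OF intg this] show ?thesis by eventually_elim (auto simp: g_def)
  qed
  have loc': "AE t in lborel. t \<in> {p<..<q} \<longrightarrow> f t = 0" if "{p..q} \<subseteq> einterval a b" for p q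
  proof -
    have "AE t in lborel. \<forall>i. t \<in> {p<..<q} \<longrightarrow> f t $ i = 0" unfolding AE_all_countable using loc[OF that] by blast
    then show ?thesis by eventually_elim (simp add: vec_eq_iff)
  qed
  define C where "C = {pq \<in> \<rat> \<times> \<rat>. {fst pq..snd pq} \<subseteq> einterval a b}"
  have "countable C" unfolding C_def by (rule countable_subset[of _ "\<rat> \<times> \<rat>"]) (auto intro: countable_rat)
  then have "AE t in lborel. \<forall>pq\<in>C. t \<in> {fst pq<..<snd pq} \<longrightarrow> f t = 0"
    by (subst AE_ball_countable) (auto simp only: C_def mem_Collect_eq intro: loc')
  then show ?thesis
  proof eventually_elim
    case (elim t)
    show ?case
    proof (cases "t \<in> einterval a b")
      case True
      then obtain e where e: "0 < e" "cball t e \<subseteq> einterval a b" using open_contains_cball[of "einterval a b"] by auto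
      obtain p where p: "p \<in> \<rat>" "t - e < p" "p < t" using Rats_dense_in_real[of "t - e" t] e(1) by auto
      obtain q where q: "q \<in> \<rat>" "t < q" "q < t + e" using Rats_dense_in_real[of t "t + e"] e(1) by auto
      have "{p..q} \<subseteq> cball t e" using p q by (auto simp: dist_real_def)
      then have "(p, q) \<in> C" using p q e by (auto simp: C_def)
      from bspec[OF elim this] show ?thesis using p q by simp
    qed (rule supp)
  qed
qed

section \<open>Calculus of matrix functions\<close>

lemma bounded_bilinear_matrix_vector: "bounded_bilinear ((*v) :: real^'n^'m \<Rightarrow> real^'n \<Rightarrow> real^'m)"
  unfolding bilinear_conv_bounded_bilinear[symmetric] bilinear_def
  by (auto intro!: linearI simp: matrix_vector_mult_add_rdistrib matrix_vector_right_distrib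
      matrix_vector_mult_scaleR scaleR_matrix_vector_assoc[symmetric])

lemma bounded_bilinear_matrix_matrix: "bounded_bilinear ((**) :: real^'n^'m \<Rightarrow> real^'k^'n \<Rightarrow> real^'k^'m)"
  unfolding bilinear_conv_bounded_bilinear[symmetric] bilinear_def
  by (auto intro!: linearI simp: matrix_matrix_mult_def vec_eq_iff sum.distrib sum_distrib_left algebra_simps)

lemma bounded_linear_transpose: "bounded_linear (transpose :: real^'n^'m \<Rightarrow> real^'m^'n)"
  unfolding linear_conv_bounded_linear[symmetric] by (auto intro!: linearI simp: transpose_def vec_eq_iff)

lemmas tendsto_matrix_vector = bounded_bilinear.tendsto[OF bounded_bilinear_matrix_vector]
lemmas tendsto_matrix_matrix = bounded_bilinear.tendsto[OF bounded_bilinear_matrix_matrix]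
lemmas continuous_on_matrix_vector = bounded_bilinear.continuous_on[OF bounded_bilinear_matrix_vector]
lemmas continuous_on_matrix_matrix = bounded_bilinear.continuous_on[OF bounded_bilinear_matrix_matrix]
lemmas has_vector_derivative_matrix_vector =
  bounded_bilinear.has_vector_derivative[OF bounded_bilinear_matrix_vector]
lemmas continuous_on_transpose = bounded_linear.continuous_on[OF bounded_linear_transpose]

lemma matrix_inv_mult:
  fixes A :: "real^'n^'n"
  assumes "invertible A"
  shows "A ** matrix_inv A = mat 1" "matrix_inv A ** A = mat 1"
  using assms unfolding matrix_inv_def invertible_def by (metis (mono_tags, lifting) someI_ex)+

lemma invertible_matrix_inv: "invertible (A :: real^'n^'n) \<Longrightarrow> invertible (matrix_inv A)"
  unfolding invertible_def using matrix_inv_mult[of A] by (metis invertible_def)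

lemma matrix_inv_unique: "A ** B = mat 1 \<Longrightarrow> B = matrix_inv (A :: real^'n^'n)"
  by (metis invertible_right_inverse matrix_inv_mult(2) matrix_mul_assoc matrix_mul_lid matrix_mul_rid)

lemma matrix_inv_inv: "invertible (A :: real^'n^'n) \<Longrightarrow> matrix_inv (matrix_inv A) = A"
  by (metis matrix_inv_mult(2) matrix_inv_unique)

lemma matrix_inv_diff:
  fixes A B :: "real^'n^'n"
  assumes "invertible A" "invertible B"
  shows "matrix_inv A - matrix_inv B = matrix_inv A ** ((B - A) ** matrix_inv B)"
proof -
  have "matrix_inv A ** ((B - A) ** matrix_inv B) = matrix_inv A ** (B ** matrix_inv B) - (matrix_inv A ** A) ** matrix_inv B"
    by (simp add: matrix_mul_assoc[symmetric] bounded_bilinear.diff_left[OF bounded_bilinear_matrix_matrix]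
        bounded_bilinear.diff_right[OF bounded_bilinear_matrix_matrix])
  then show ?thesis using assms by (simp add: matrix_inv_mult)
qed

lemma tendsto_matrix_inv:
  fixes f :: "'a \<Rightarrow> real^'n^'n"
  assumes lim: "(f \<longlongrightarrow> L) F" and L: "invertible L" and inv: "\<forall>\<^sub>F x in F. invertible (f x)"
  shows "((\<lambda>x. matrix_inv (f x)) \<longlongrightarrow> matrix_inv L) F"
proof -
  obtain K where K: "K > 0" "\<And>(A :: real^'n^'n) (B :: real^'n^'n). norm (A ** B) \<le> norm A * norm B * K"
    using bounded_bilinear.pos_bounded[OF bounded_bilinear_matrix_matrix] by blast
  define e where "e = 1 / (2 * K * K * (norm (matrix_inv L) + 1))"
  have nL: "0 < norm (matrix_inv L) + 1" by (simp add: add_nonneg_pos)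
  have e: "0 < e" using K(1) nL by (simp add: e_def)
  have diff: "norm (matrix_inv A - matrix_inv L) \<le> norm (matrix_inv A) * (norm (L - A) * (K * K * (norm (matrix_inv L) + 1)))"
    if A: "invertible A" for A
  proof -
    have "norm (matrix_inv A - matrix_inv L) \<le> norm (matrix_inv A) * norm ((L - A) ** matrix_inv L) * K"
      unfolding matrix_inv_diff[OF A L] by (rule K(2))
    also have "\<dots> \<le> norm (matrix_inv A) * (norm (L - A) * norm (matrix_inv L) * K) * K"
      using K by (intro mult_right_mono mult_left_mono) auto
    also have "\<dots> \<le> norm (matrix_inv A) * (norm (L - A) * (norm (matrix_inv L) + 1) * K) * K"
      using K by (intro mult_right_mono mult_left_mono) auto
    finally show ?thesis by (simp add: ac_simps)
  qed
  have bound: "norm (matrix_inv A) \<le> 2 * norm (matrix_inv L)" if A: "invertible A" "norm (L - A) < e" for A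
  proof -
    have "norm (L - A) * (K * K * (norm (matrix_inv L) + 1)) \<le> e * (K * K * (norm (matrix_inv L) + 1))"
      using A(2) K(1) nL by (intro mult_right_mono) auto
    also have "\<dots> = 1 / 2" using K(1) nL by (simp add: e_def)
    finally have "norm (matrix_inv A - matrix_inv L) \<le> norm (matrix_inv A) * (1 / 2)"
      using diff[OF A(1)] by (meson mult_left_mono norm_ge_zero order_trans)
    then show ?thesis using norm_triangle_sub[of "matrix_inv A" "matrix_inv L"] by linarith
  qed
  have "((\<lambda>x. matrix_inv (f x) - matrix_inv L) \<longlongrightarrow> 0) F"
  proof (rule Lim_null_comparison)
    have "((\<lambda>x. norm (L - f x)) \<longlongrightarrow> norm (L - L)) F" by (intro tendsto_intros lim)
    then have "\<forall>\<^sub>F x in F. norm (L - f x) < e" using e by (intro order_tendstoD(2)[where y = 0]) auto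
    with inv show "\<forall>\<^sub>F x in F. norm (matrix_inv (f x) - matrix_inv L)
        \<le> 2 * norm (matrix_inv L) * (norm (L - f x) * (K * K * (norm (matrix_inv L) + 1)))"
    proof eventually_elim
      case (elim x)
      have "0 \<le> norm (L - f x) * (K * K * (norm (matrix_inv L) + 1))" using K(1) nL by simp
      then show ?case using order_trans[OF diff[OF elim(1)] mult_right_mono[OF bound[OF elim]]] by blast
    qed
    have "((\<lambda>x. 2 * norm (matrix_inv L) * (norm (L - f x) * (K * K * (norm (matrix_inv L) + 1)))) \<longlongrightarrow>
        2 * norm (matrix_inv L) * (norm (L - L) * (K * K * (norm (matrix_inv L) + 1)))) F"
      by (intro tendsto_intros lim)
    then show "((\<lambda>x. 2 * norm (matrix_inv L) * (norm (L - f x) * (K * K * (norm (matrix_inv L) + 1)))) \<longlongrightarrow> 0) F" by simp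
  qed
  then show ?thesis by (simp add: LIM_zero_iff)
qed

lemma has_vector_derivative_iff_quotient:
  fixes f :: "real \<Rightarrow> 'a::real_normed_vector"
  shows "(f has_vector_derivative D) (at t) \<longleftrightarrow> ((\<lambda>s. (f s - f t) /\<^sub>R (s - t)) \<longlongrightarrow> D) (at t)"
proof -
  have "norm (((f s - f t) - (s - t) *\<^sub>R D) /\<^sub>R norm (s - t)) = norm ((f s - f t) /\<^sub>R (s - t) - D)" if "s \<noteq> t" for s
  proof -
    have "(f s - f t) /\<^sub>R (s - t) - D = ((f s - f t) - (s - t) *\<^sub>R D) /\<^sub>R (s - t)"
      using that by (simp add: scaleR_diff_right)
    then show ?thesis by simp
  qed
  then have "((\<lambda>s. norm (((f s - f t) - (s - t) *\<^sub>R D) /\<^sub>R norm (s - t))) \<longlongrightarrow> 0) (at t) \<longleftrightarrow>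
      ((\<lambda>s. norm ((f s - f t) /\<^sub>R (s - t) - D)) \<longlongrightarrow> 0) (at t)"
    by (intro filterlim_cong refl) (auto simp: eventually_at_filter)
  then show ?thesis
    by (simp only: tendsto_norm_zero_iff LIM_zero_iff has_vector_derivative_def has_derivative_at_within
        bounded_linear_scaleR_left simp_thms)
qed

lemma has_vector_derivative_matrix_inv:
  fixes f :: "real \<Rightarrow> real^'n^'n"
  assumes f: "(f has_vector_derivative f') (at t)" and inv: "\<forall>\<^sub>F s in at t. invertible (f s)" "invertible (f t)"
  shows "((\<lambda>s. matrix_inv (f s)) has_vector_derivative - (matrix_inv (f t) ** (f' ** matrix_inv (f t)))) (at t)"
  unfolding has_vector_derivative_iff_quotient
proof (rule Lim_transform_eventually)
  have lim: "((\<lambda>s. (f s - f t) /\<^sub>R (s - t)) \<longlongrightarrow> f') (at t)" using f by (simp only: has_vector_derivative_iff_quotient)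
  have "(f \<longlongrightarrow> f t) (at t)" using has_vector_derivative_continuous[OF f] by (simp add: isCont_def)
  then have "((\<lambda>s. matrix_inv (f s)) \<longlongrightarrow> matrix_inv (f t)) (at t)" by (intro tendsto_matrix_inv inv)
  then show "((\<lambda>s. - (matrix_inv (f s) ** (((f s - f t) /\<^sub>R (s - t)) ** matrix_inv (f t)))) \<longlongrightarrow>
      - (matrix_inv (f t) ** (f' ** matrix_inv (f t)))) (at t)"
    by (intro tendsto_minus tendsto_matrix_matrix lim tendsto_const)
  show "\<forall>\<^sub>F s in at t. - (matrix_inv (f s) ** (((f s - f t) /\<^sub>R (s - t)) ** matrix_inv (f t))) =
      (matrix_inv (f s) - matrix_inv (f t)) /\<^sub>R (s - t)" using inv(1)
  proof eventually_elim
    case (elim s)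
    interpret mm: bounded_bilinear "(**) :: real^'n^'n \<Rightarrow> real^'n^'n \<Rightarrow> real^'n^'n" by (rule bounded_bilinear_matrix_matrix)
    have "f t - f s = - (f s - f t)" by simp
    then show ?case unfolding matrix_inv_diff[OF elim inv(2)]
      by (simp only: mm.minus_left mm.minus_right mm.scaleR_left mm.scaleR_right scaleR_minus_right)
  qed
qed

section \<open>The quadratic form of a Sturm--Liouville expression\<close>

lemma transpose_inner: "(transpose A *v x) \<bullet> y = x \<bullet> (A *v (y :: real^'n))" for A :: "real^'n^'m"
  by (simp add: dot_lmul_matrix transpose_matrix_vector)

locale sturm_liouville =
  fixes a b :: ereal and P Q R :: "real \<Rightarrow> real^'n^'n"
  assumes ab: "a < b" and coefficients: "sl_coefficients a b P Q R"
begin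

abbreviation "W t \<equiv> matrix_inv (P t)"

lemma invertible_P: "t \<in> einterval a b \<Longrightarrow> invertible (P t)"
  and transpose_W: "t \<in> einterval a b \<Longrightarrow> transpose (W t) = W t"
  and transpose_R: "t \<in> einterval a b \<Longrightarrow> transpose (R t) = R t"
  and continuous_R: "continuous_on (einterval a b) R" using coefficients by (auto simp: sl_coefficients_def)

lemma transpose_P: "t \<in> einterval a b \<Longrightarrow> transpose (P t) = P t"
proof -
  assume t: "t \<in> einterval a b"
  have "transpose (W t ** P t) = mat 1" using matrix_inv_mult(2)[OF invertible_P[OF t]] by (simp add: transpose_mat)
  then have 1: "transpose (P t) ** W t = mat 1" by (simp add: matrix_transpose_mul transpose_W[OF t])
  have "transpose (P t) = transpose (P t) ** (W t ** P t)"
    using matrix_inv_mult(2)[OF invertible_P[OF t]] by (simp add: matrix_mul_rid)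
  also have "\<dots> = P t" unfolding matrix_mul_assoc 1 by (simp add: matrix_mul_lid)
  finally show ?thesis .
qed

definition "DQ t = vector_derivative Q (at t)"
definition "DW t = vector_derivative W (at t)"
definition "DP t = - (P t ** (DW t ** P t))"

lemma derivative_Q: "t \<in> einterval a b \<Longrightarrow> (Q has_vector_derivative DQ t) (at t)"
  and continuous_DQ: "continuous_on (einterval a b) DQ"
  and derivative_W: "t \<in> einterval a b \<Longrightarrow> (W has_vector_derivative DW t) (at t)"
  and continuous_DW: "continuous_on (einterval a b) DW"
  using coefficients unfolding sl_coefficients_def C1_differentiable_on_eq DQ_def DW_def
  by (auto simp: vector_derivative_works)

lemma derivative_P:
  assumes t: "t \<in> einterval a b" shows "(P has_vector_derivative DP t) (at t)"
proof (rule has_vector_derivative_transform_within_open)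
  have "\<forall>\<^sub>F s in at t. invertible (W s)"
    using eventually_at_in_open'[OF open_einterval t] by eventually_elim (rule invertible_matrix_inv[OF invertible_P])
  from has_vector_derivative_matrix_inv[OF derivative_W[OF t] this invertible_matrix_inv[OF invertible_P[OF t]]]
  show "((\<lambda>s. matrix_inv (W s)) has_vector_derivative DP t) (at t)"
    by (simp add: DP_def matrix_inv_inv[OF invertible_P[OF t]])
qed (use t open_einterval matrix_inv_inv[OF invertible_P] in auto)

lemma continuous_P: "continuous_on (einterval a b) P"
  and continuous_Q: "continuous_on (einterval a b) Q"
  by (meson derivative_P derivative_Q continuous_at_imp_continuous_on has_vector_derivative_continuous)+

lemma continuous_W: "continuous_on (einterval a b) W"
  by (rule continuous_at_imp_continuous_on) (auto intro: has_vector_derivative_continuous derivative_W)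

lemma continuous_DP: "continuous_on (einterval a b) DP" unfolding DP_def
  by (intro continuous_on_minus continuous_on_matrix_matrix continuous_P continuous_DW)

text \<open>
  The integrand of the bilinear form of \<open>l\<close>.  The values and the derivatives of the two functions are separate
  arguments, so that it makes sense for functions that are only piecewise differentiable.
\<close>

definition integrand :: "real \<Rightarrow> real^'n \<Rightarrow> real^'n \<Rightarrow> real^'n \<Rightarrow> real^'n \<Rightarrow> real" where
  "integrand t x x' y y' = (P t *v x' + Q t *v x) \<bullet> y' + x' \<bullet> (Q t *v y) + (R t *v x) \<bullet> y"

lemma integrand_sym:
  assumes "t \<in> einterval a b" shows "integrand t x x' y y' = integrand t y y' x x'"
  using transpose_inner[of "P t" x' y'] transpose_inner[of "R t" x y] transpose_P[OF assms] transpose_R[OF assms]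
  by (simp add: integrand_def inner_add_left inner_add_right inner_commute)

lemma integrand_linear:
  "integrand t (x + z) (x' + z') y y' = integrand t x x' y y' + integrand t z z' y y'"
  "integrand t (r *\<^sub>R x) (r *\<^sub>R x') y y' = r * integrand t x x' y y'"
  "integrand t y y' (x + z) (x' + z') = integrand t y y' x x' + integrand t y y' z z'"
  "integrand t y y' (r *\<^sub>R x) (r *\<^sub>R x') = r * integrand t y y' x x'"
  "integrand t 0 0 y y' = 0" "integrand t y y' 0 0 = 0"
  by (simp_all add: integrand_def matrix_vector_right_distrib inner_add_left inner_add_right
      matrix_vector_mult_scaleR algebra_simps)

lemma continuous_integrand:
  assumes "S \<subseteq> einterval a b" "continuous_on S x" "continuous_on S x'" "continuous_on S y" "continuous_on S y'"
  shows "continuous_on S (\<lambda>t. integrand t (x t) (x' t) (y t) (y' t))" unfolding integrand_def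
  by (intro continuous_intros continuous_on_matrix_vector assms continuous_on_subset[OF continuous_P assms(1)]
      continuous_on_subset[OF continuous_Q assms(1)] continuous_on_subset[OF continuous_R assms(1)])

text \<open>
  Integration by parts moves the outer derivative of \<open>l u\<close> onto the second argument; the boundary terms vanish
  because \<open>u\<close> has compact support.
\<close>

lemma sl_expression_of_test_function:
  assumes u: "\<And>t. (u has_vector_derivative v t) (at t)" and v: "smooth v"
    and pq: "p < q" "{p..q} \<subseteq> einterval a b" and z: "\<And>t. t \<notin> {p<..<q} \<Longrightarrow> u t = 0" "\<And>t. t \<notin> {p<..<q} \<Longrightarrow> v t = 0"
  shows square_integrable_sl_expression: "square_integrable (sl_expression P Q R u)"
    and sl_expression_zero: "\<And>t. t \<notin> {p..q} \<Longrightarrow> sl_expression P Q R u t = 0"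
    and integral_sl_expression: "\<And>f g. (\<And>t. (f has_vector_derivative g t) (at t)) \<Longrightarrow> continuous_on UNIV g \<Longrightarrow>
      (LINT t|lborel. sl_expression P Q R u t \<bullet> f t) = (LINT t|lborel. integrand t (u t) (v t) (f t) (g t))"
proof -
  obtain v' where v': "smooth v'" "\<And>t. (v has_vector_derivative v' t) (at t)" using smooth_derivative[OF v] by blast
  have vd: "vector_derivative u (at t) = v t" for t using vector_derivative_at[OF u] .
  define qu where "qu t = P t *v v t + Q t *v u t" for t
  define qu' where "qu' t = (P t *v v' t + DP t *v v t) + (Q t *v v t + DQ t *v u t)" for t
  have quasi: "quasi_derivative P Q u = qu" by (simp add: fun_eq_iff quasi_derivative_def qu_def vd)
  have dqu: "(qu has_vector_derivative qu' t) (at t)" if "t \<in> einterval a b" for t unfolding qu_def qu'_def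
    by (intro has_vector_derivative_add has_vector_derivative_matrix_vector derivative_P[OF that] derivative_Q[OF that] u v'(2))
  have dqu0: "(qu has_vector_derivative 0) (at t)" if "t \<notin> {p..q}" for t
  proof (rule has_vector_derivative_transform_within_open[OF has_vector_derivative_const])
    show "open (- {p..q})" "t \<in> - {p..q}" using that by (auto simp: open_Compl)
    show "0 = qu s" if "s \<in> - {p..q}" for s using z[of s] that by (auto simp: qu_def)
  qed
  define F where "F t = - qu' t + transpose (Q t) *v v t + R t *v u t" for t
  have sl_in: "sl_expression P Q R u t = F t" if "t \<in> {p..q}" for t
    using vector_derivative_at[OF dqu] that pq(2) by (auto simp: sl_expression_def quasi vd F_def)
  show sl_out: "sl_expression P Q R u t = 0" if "t \<notin> {p..q}" for t
    using vector_derivative_at[OF dqu0[OF that]] z[of t] that by (auto simp: sl_expression_def quasi vd)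
  have uc: "continuous_on S u" for S by (meson u continuous_at_imp_continuous_on has_vector_derivative_continuous)
  have vc: "continuous_on S v" "continuous_on S v'" for S using smooth_continuous v v' by blast+
  have qc: "continuous_on {p..q} qu'" unfolding qu'_def
    by (intro continuous_on_add continuous_on_matrix_vector continuous_on_subset[OF _ pq(2)]
      continuous_P continuous_Q continuous_DP continuous_DQ uc vc)
  have Fc: "continuous_on {p..q} F" unfolding F_def
    by (intro continuous_on_add continuous_on_minus qc continuous_on_matrix_vector continuous_on_transpose uc vc
       continuous_on_subset[OF _ pq(2)] continuous_Q continuous_R)
  show "square_integrable (sl_expression P Q R u)" by (rule compactly_supported_borel(3)[OF Fc sl_in sl_out])
  fix f g :: "real \<Rightarrow> real^'n" assume f: "\<And>t. (f has_vector_derivative g t) (at t)" and g: "continuous_on UNIV g"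
  have fc: "continuous_on S f" for S by (meson f continuous_at_imp_continuous_on has_vector_derivative_continuous)
  have gc: "continuous_on S g" for S by (rule continuous_on_subset[OF g]) simp
  define B where "B t = qu t \<bullet> g t + qu' t \<bullet> f t" for t
  have qucont: "continuous_on {p..q} qu" unfolding qu_def
    by (intro continuous_on_add continuous_on_matrix_vector continuous_on_subset[OF _ pq(2)] continuous_P continuous_Q uc vc)
  have Bc: "continuous_on {p..q} B" unfolding B_def by (intro continuous_on_add continuous_on_inner qucont qc fc gc)
  have "(LINT t|lborel. indicator {p..q} t *\<^sub>R B t) = qu q \<bullet> f q - qu p \<bullet> f p"
  proof (rule integral_FTC_atLeastAtMost[OF _ _ Bc])
    fix t assume "p \<le> t" "t \<le> q"
    then have "t \<in> einterval a b" using pq(2) by auto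
    from bounded_bilinear.has_vector_derivative[OF bounded_bilinear_inner dqu[OF this] f]
    show "((\<lambda>t. qu t \<bullet> f t) has_vector_derivative B t) (at t within {p..q})"
      unfolding B_def by (rule has_vector_derivative_at_within)
  qed (use pq in simp)
  also have "\<dots> = 0" using z[of p] z[of q] by (simp add: qu_def)
  finally have B0: "(LINT t|lborel. indicator {p..q} t *\<^sub>R B t) = 0" .
  have iB: "integrable lborel (\<lambda>t. indicator {p..q} t *\<^sub>R B t)" by (rule compactly_supported_borel(2)[OF Bc]) auto
  have ic: "continuous_on {p..q} (\<lambda>t. integrand t (u t) (v t) (f t) (g t))"
    by (intro continuous_integrand pq uc vc fc gc)
  have iI: "integrable lborel (\<lambda>t. integrand t (u t) (v t) (f t) (g t))"
    by (rule compactly_supported_borel(2)[OF ic]) (use z in \<open>auto simp: integrand_linear\<close>)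
  have "(LINT t|lborel. sl_expression P Q R u t \<bullet> f t)
      = (LINT t|lborel. integrand t (u t) (v t) (f t) (g t) - indicator {p..q} t *\<^sub>R B t)"
  proof (intro Bochner_Integration.integral_cong refl)
    fix t
    show "sl_expression P Q R u t \<bullet> f t = integrand t (u t) (v t) (f t) (g t) - indicator {p..q} t *\<^sub>R B t"
    proof (cases "t \<in> {p..q}")
      case True
      then show ?thesis
        by (simp add: sl_in F_def B_def integrand_def qu_def inner_add_left inner_diff_left dot_lmul_matrix transpose_inner)
    next
      case False
      then have "u t = 0" "v t = 0" using z[of t] by auto
      then show ?thesis using False by (simp add: sl_out integrand_linear)
    qed
  qed
  also have "\<dots> = (LINT t|lborel. integrand t (u t) (v t) (f t) (g t))"
    using Bochner_Integration.integral_diff[OF iI iB] B0 by simp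
  finally show "(LINT t|lborel. sl_expression P Q R u t \<bullet> f t) = (LINT t|lborel. integrand t (u t) (v t) (f t) (g t))" .
qed

definition form :: "(real \<Rightarrow> real^'n) \<Rightarrow> (real \<Rightarrow> real^'n) \<Rightarrow> real" where
  "form u v = (LINT t|lborel. sl_expression P Q R u t \<bullet> v t)"

lemma form_eq_integrand:
  assumes u: "u \<in> test_functions a b" and du: "\<And>t. (u has_vector_derivative u' t) (at t)"
    and f: "\<And>t. (f has_vector_derivative f' t) (at t)" "continuous_on UNIV f'"
  shows "form u f = (LINT t|lborel. integrand t (u t) (u' t) (f t) (f' t))"
proof -
  obtain v p q where v: "smooth v" "\<And>t. (u has_vector_derivative v t) (at t)"
    "p < q" "{p..q} \<subseteq> einterval a b" "\<And>t. t \<notin> {p<..<q} \<Longrightarrow> u t = 0" "\<And>t. t \<notin> {p<..<q} \<Longrightarrow> v t = 0"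
    using test_functionsE[OF u ab] by metis
  have "v = u'" using v(2) du vector_derivative_unique_at by blast
  then show ?thesis unfolding form_def using integral_sl_expression[OF v(2,1,3-6) f] by simp
qed

lemma test_square_integrable:
  assumes u: "u \<in> test_functions a b" shows "square_integrable u" "square_integrable (sl_expression P Q R u)"
proof -
  obtain v p q where v: "smooth v" "\<And>t. (u has_vector_derivative v t) (at t)"
    "p < q" "{p..q} \<subseteq> einterval a b" "\<And>t. t \<notin> {p<..<q} \<Longrightarrow> u t = 0" "\<And>t. t \<notin> {p<..<q} \<Longrightarrow> v t = 0"
    using test_functionsE[OF u ab] by metis
  show "square_integrable (sl_expression P Q R u)" by (rule square_integrable_sl_expression[OF v(2,1,3-6)])
  have "continuous_on {p..q} u" by (meson v(2) continuous_at_imp_continuous_on has_vector_derivative_continuous)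
  then show "square_integrable u" by (rule compactly_supported_borel(3)) (use v(5) in auto)
qed

lemma form_eq_inner:
  "u \<in> test_functions a b \<Longrightarrow> v \<in> test_functions a b \<Longrightarrow>
    form u v = l2_class (sl_expression P Q R u) \<bullet> l2_class v"
  by (simp add: form_def inner_l2_class test_square_integrable)

lemma smooth_test_function: "u \<in> test_functions c d \<Longrightarrow> smooth u" by (auto simp: test_functions_def smooth_def)

lemma form_sym:
  assumes u: "u \<in> test_functions a b" and v: "v \<in> test_functions a b"
  shows "form u v = form v u"
proof -
  obtain u' where u': "smooth u'" "\<And>t. (u has_vector_derivative u' t) (at t)"
    using smooth_derivative[OF smooth_test_function[OF u]] by blast
  obtain v' p q where v': "smooth v'" "\<And>t. (v has_vector_derivative v' t) (at t)"
    "{p..q} \<subseteq> einterval a b" "\<And>t. t \<notin> {p<..<q} \<Longrightarrow> v t = 0" "\<And>t. t \<notin> {p<..<q} \<Longrightarrow> v' t = 0"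
    using test_functionsE[OF v ab] by metis
  have "integrand t (u t) (u' t) (v t) (v' t) = integrand t (v t) (v' t) (u t) (u' t)" for t
  proof (cases "t \<in> {p<..<q}")
    case True
    then have "t \<in> einterval a b" using v'(3) by auto
    then show ?thesis by (rule integrand_sym)
  next
    case False
    then show ?thesis using v'(4,5) by (simp add: integrand_linear)
  qed
  then show ?thesis using form_eq_integrand[OF u u'(2) v'(2) smooth_continuous[OF v'(1)]]
      form_eq_integrand[OF v v'(2) u'(2) smooth_continuous[OF u'(1)]] by simp
qed

lemma sl_expression_add_scale:
  assumes u: "u \<in> test_functions a b" and v: "v \<in> test_functions a b"
  shows "sl_expression P Q R (\<lambda>t. r *\<^sub>R u t + s *\<^sub>R v t) = (\<lambda>t. r *\<^sub>R sl_expression P Q R u t + s *\<^sub>R sl_expression P Q R v t)"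
proof
  fix t
  have *: "\<exists>f'. (\<forall>t. (f has_vector_derivative f' t) (at t)) \<and>
      (\<forall>t. \<exists>w. ((\<lambda>t. P t *v f' t + Q t *v f t) has_vector_derivative w) (at t))" if f: "f \<in> test_functions a b" for f
  proof -
    obtain f' p q where f': "smooth f'" "\<And>t. (f has_vector_derivative f' t) (at t)"
      "{p..q} \<subseteq> einterval a b" "\<And>t. t \<notin> {p<..<q} \<Longrightarrow> f t = 0" "\<And>t. t \<notin> {p<..<q} \<Longrightarrow> f' t = 0"
      using test_functionsE[OF f ab] by metis
    obtain f'' where f'': "\<And>t. (f' has_vector_derivative f'' t) (at t)" using smooth_derivative[OF f'(1)] by blast
    have "\<exists>w. ((\<lambda>t. P t *v f' t + Q t *v f t) has_vector_derivative w) (at t)" for t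
    proof (cases "t \<in> {p..q}")
      case True
      then have "t \<in> einterval a b" using f'(3) by auto
      then show ?thesis
        using has_vector_derivative_add[OF has_vector_derivative_matrix_vector[OF derivative_P f''] has_vector_derivative_matrix_vector[OF derivative_Q f'(2)]]
        by blast
    next
      case False
      have "((\<lambda>t. P t *v f' t + Q t *v f t) has_vector_derivative 0) (at t)"
      proof (rule has_vector_derivative_transform_within_open[OF has_vector_derivative_const])
        show "open (- {p..q})" "t \<in> - {p..q}" using False by (auto simp: open_Compl)
        show "0 = P s *v f' s + Q s *v f s" if "s \<in> - {p..q}" for s using f'(4,5)[of s] that by auto
      qed
      then show ?thesis by blast
    qed
    then show ?thesis using f'(2) by blast
  qed
  obtain u' where u': "\<And>t. (u has_vector_derivative u' t) (at t)"
    "\<And>t. \<exists>w. ((\<lambda>t. P t *v u' t + Q t *v u t) has_vector_derivative w) (at t)" using *[OF u] by blast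
  obtain v' where v': "\<And>t. (v has_vector_derivative v' t) (at t)"
    "\<And>t. \<exists>w. ((\<lambda>t. P t *v v' t + Q t *v v t) has_vector_derivative w) (at t)" using *[OF v] by blast
  obtain w1 where w1: "((\<lambda>t. P t *v u' t + Q t *v u t) has_vector_derivative w1) (at t)" using u'(2) by blast
  obtain w2 where w2: "((\<lambda>t. P t *v v' t + Q t *v v t) has_vector_derivative w2) (at t)" using v'(2) by blast
  have duv: "((\<lambda>t. r *\<^sub>R u t + s *\<^sub>R v t) has_vector_derivative r *\<^sub>R u' t + s *\<^sub>R v' t) (at t)" for t
    by (intro has_vector_derivative_add bounded_linear.has_vector_derivative[OF bounded_linear_scaleR_right] u' v')
  have qd: "quasi_derivative P Q f = (\<lambda>t. P t *v f' t + Q t *v f t)"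
    if "\<And>t. (f has_vector_derivative f' t) (at t)" for f f'
    using vector_derivative_at[OF that] by (simp add: fun_eq_iff quasi_derivative_def)
  have "((\<lambda>t. r *\<^sub>R (P t *v u' t + Q t *v u t) + s *\<^sub>R (P t *v v' t + Q t *v v t)) has_vector_derivative r *\<^sub>R w1 + s *\<^sub>R w2) (at t)"
    by (intro has_vector_derivative_add bounded_linear.has_vector_derivative[OF bounded_linear_scaleR_right] w1 w2)
  moreover have "quasi_derivative P Q (\<lambda>t. r *\<^sub>R u t + s *\<^sub>R v t) =
      (\<lambda>t. r *\<^sub>R (P t *v u' t + Q t *v u t) + s *\<^sub>R (P t *v v' t + Q t *v v t))"
    unfolding qd[OF duv] by (simp add: matrix_vector_right_distrib matrix_vector_mult_scaleR scaleR_add_right algebra_simps)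
  ultimately have "vector_derivative (quasi_derivative P Q (\<lambda>t. r *\<^sub>R u t + s *\<^sub>R v t)) (at t) = r *\<^sub>R w1 + s *\<^sub>R w2"
    using vector_derivative_at by metis
  then show "sl_expression P Q R (\<lambda>t. r *\<^sub>R u t + s *\<^sub>R v t) t = r *\<^sub>R sl_expression P Q R u t + s *\<^sub>R sl_expression P Q R v t"
    unfolding sl_expression_def
    by (simp add: vector_derivative_at[OF duv] vector_derivative_at[OF u'(1)] vector_derivative_at[OF v'(1)]
        vector_derivative_at[OF w1] vector_derivative_at[OF w2] qd[OF u'(1)] qd[OF v'(1)]
        matrix_vector_right_distrib matrix_vector_mult_scaleR algebra_simps)
qed

lemma test_functions_add_scale:
  assumes u: "u \<in> test_functions a b" and v: "v \<in> test_functions a b"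
  shows "(\<lambda>t. r *\<^sub>R u t + s *\<^sub>R v t) \<in> test_functions a b"
proof -
  obtain p q where u': "p < q" "{p..q} \<subseteq> einterval a b" "\<And>t. t \<notin> {p<..<q} \<Longrightarrow> u t = 0" using test_functionsE[OF u ab] by metis
  obtain p' q' where v': "p' < q'" "{p'..q'} \<subseteq> einterval a b" "\<And>t. t \<notin> {p'<..<q'} \<Longrightarrow> v t = 0" using test_functionsE[OF v ab] by metis
  show ?thesis
  proof (rule test_functionsI)
    show "smooth (\<lambda>t. r *\<^sub>R u t + s *\<^sub>R v t)"
      by (intro smooth_add smooth_scaleR smooth_const smooth_test_function[OF u] smooth_test_function[OF v])
    have "min p p' \<in> einterval a b" "max q q' \<in> einterval a b" using u'(1,2) v'(1,2) by (auto simp: min_def max_def)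
    then show "{min p p'..max q q'} \<subseteq> einterval a b" by (rule einterval_Icc)
    show "r *\<^sub>R u t + s *\<^sub>R v t = 0" if "t \<notin> {min p p'..max q q'}" for t
    proof -
      have "t \<notin> {p<..<q}" "t \<notin> {p'<..<q'}" using that by (auto simp: min_le_iff_disj le_max_iff_disj)
      then show ?thesis using u'(3) v'(3) by simp
    qed
  qed
qed

end

lemma subspace_closure_inner:
  fixes S :: "'h::real_normed_vector set"
  assumes "subspace S" shows "subspace (closure S)" unfolding subspace_def
proof (intro conjI ballI allI)
  show "0 \<in> closure S" using closure_subset subspace_0[OF assms] by blast
  fix x assume "x \<in> closure S"
  then obtain f where f: "\<And>n. f n \<in> S" "f \<longlonglongrightarrow> x" by (auto simp: closure_sequential)
  show "c *\<^sub>R x \<in> closure S" for c unfolding closure_sequential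
    by (intro exI[of _ "\<lambda>n. c *\<^sub>R f n"] conjI allI subspace_scale[OF assms] f tendsto_scaleR tendsto_const)
  fix y assume "y \<in> closure S"
  then obtain g where g: "\<And>n. g n \<in> S" "g \<longlonglongrightarrow> y" by (auto simp: closure_sequential)
  show "x + y \<in> closure S" unfolding closure_sequential
    by (intro exI[of _ "\<lambda>n. f n + g n"] conjI allI subspace_add[OF assms] f g tendsto_add)
qed

context sturm_liouville
begin

definition core :: "((real^'n) l2 \<times> (real^'n) l2) set" where
  "core = {(l2_class u, l2_class (sl_expression P Q R u)) |u. u \<in> test_functions a b}"

lemma coreI: "u \<in> test_functions a b \<Longrightarrow> (l2_class u, l2_class (sl_expression P Q R u)) \<in> core"
  unfolding core_def by blast

lemma zero_test_function: "(\<lambda>_. 0) \<in> test_functions a b"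
proof -
  obtain c where "c \<in> einterval a b" using einterval_nonempty[OF ab] by blast
  then show ?thesis by (intro test_functionsI[of _ c c] smooth_const) auto
qed

lemma subspace_core: "subspace core"
proof -
  have comb: "r *\<^sub>R z + s *\<^sub>R w \<in> core" if z: "z \<in> core" and w: "w \<in> core" for r s z w
  proof -
    obtain u where u: "u \<in> test_functions a b" "z = (l2_class u, l2_class (sl_expression P Q R u))"
      using z by (auto simp: core_def)
    obtain v where v: "v \<in> test_functions a b" "w = (l2_class v, l2_class (sl_expression P Q R v))"
      using w by (auto simp: core_def)
    have lin: "r *\<^sub>R l2_class f + s *\<^sub>R l2_class g = l2_class (\<lambda>t. r *\<^sub>R f t + s *\<^sub>R g t)"
      if "square_integrable f" "square_integrable g" for f g :: "real \<Rightarrow> real^'n"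
      using that by (simp add: l2_class_scaleR l2_class_add square_integrable_scaleR)
    have "r *\<^sub>R z + s *\<^sub>R w = (l2_class (\<lambda>t. r *\<^sub>R u t + s *\<^sub>R v t),
        l2_class (sl_expression P Q R (\<lambda>t. r *\<^sub>R u t + s *\<^sub>R v t)))" unfolding sl_expression_add_scale[OF u(1) v(1)]
      by (simp add: u(2) v(2) lin test_square_integrable u(1) v(1))
    then show ?thesis using coreI[OF test_functions_add_scale[OF u(1) v(1)]] by simp
  qed
  have ne: "core \<noteq> {}" using coreI[OF zero_test_function] by blast
  then obtain z where z: "z \<in> core" by blast
  show ?thesis unfolding subspace_def
  proof (intro conjI ballI allI)
    show "0 \<in> core" using comb[OF z z, of 0 0] by simp
    show "x + y \<in> core" if "x \<in> core" "y \<in> core" for x y using comb[OF that, of 1 1] by simp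
    show "c *\<^sub>R x \<in> core" if "x \<in> core" for x c using comb[OF that that, of c 0] by simp
  qed
qed

lemma negative_family_core:
  "negative_family core k \<longleftrightarrow> (\<exists>u. (\<forall>i<k. u i \<in> test_functions a b) \<and> negative_definite {..<k} (\<lambda>i j. form (u i) (u j)))"
proof
  assume "negative_family core k"
  then obtain z where z: "\<And>i. i < k \<Longrightarrow> z i \<in> core" "negative_definite {..<k} (\<lambda>i j. snd (z i) \<bullet> fst (z j))"
    by (auto simp: negative_family_def)
  have "\<forall>i. \<exists>u. i < k \<longrightarrow> u \<in> test_functions a b \<and> z i = (l2_class u, l2_class (sl_expression P Q R u))"
    using z(1) unfolding core_def by blast
  then obtain u where u: "\<And>i. i < k \<Longrightarrow> u i \<in> test_functions a b"
    "\<And>i. i < k \<Longrightarrow> z i = (l2_class (u i), l2_class (sl_expression P Q R (u i)))" by metis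
  have "(\<Sum>i<k. \<Sum>j<k. c i * c j * form (u i) (u j)) = (\<Sum>i<k. \<Sum>j<k. c i * c j * (snd (z i) \<bullet> fst (z j)))" for c
    by (intro sum.cong refl) (simp add: form_eq_inner u)
  then show "\<exists>u. (\<forall>i<k. u i \<in> test_functions a b) \<and> negative_definite {..<k} (\<lambda>i j. form (u i) (u j))"
    using z(2) u(1) unfolding negative_definite_def by (intro exI[of _ u]) simp
next
  assume "\<exists>u. (\<forall>i<k. u i \<in> test_functions a b) \<and> negative_definite {..<k} (\<lambda>i j. form (u i) (u j))"
  then obtain u where u: "\<And>i. i < k \<Longrightarrow> u i \<in> test_functions a b" "negative_definite {..<k} (\<lambda>i j. form (u i) (u j))" by blast
  define z where "z i = (l2_class (u i), l2_class (sl_expression P Q R (u i)))" for i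
  have "(\<Sum>i<k. \<Sum>j<k. c i * c j * form (u i) (u j)) = (\<Sum>i<k. \<Sum>j<k. c i * c j * (snd (z i) \<bullet> fst (z j)))" for c
    by (intro sum.cong refl) (simp add: form_eq_inner u z_def)
  then show "negative_family core k" unfolding negative_family_def using u coreI
    by (intro exI[of _ z]) (simp add: negative_definite_def z_def)
qed

text \<open>
  Passing to the closure of the minimal operator does not change the largest size of a negative family, so only
  test functions are left.  The test functions are dense by the fundamental lemma, and a shift of the lower
  bound makes the form dominate the norm.
\<close>

theorem sl_morse_index_eq:
  assumes bounded: "sl_form_bounded_below P Q R a b"
  shows "sl_morse_index P Q R a b =
    (SUP k\<in>{k. \<exists>u. (\<forall>i<k. u i \<in> test_functions a b) \<and> negative_definite {..<k} (\<lambda>i j. form (u i) (u j))}. enat k)"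
proof -
  obtain C where C: "\<And>u. u \<in> test_functions a b \<Longrightarrow> C * (\<integral>t. (norm (u t))\<^sup>2 \<partial>lborel) \<le> form u u"
    using bounded unfolding sl_form_bounded_below_def form_def by blast
  let ?pr = "l2_restrict a b :: (real^'n) l2 \<Rightarrow> (real^'n) l2"
  have pr_bl: "bounded_linear ?pr"
  proof (rule bounded_linear_intro[where K = 1])
    fix x :: "(real^'n) l2"
    have "norm (?pr x) * norm (?pr x) = ?pr x \<bullet> x"
      by (metis l2_restrict_idem symmetric_l2_restrict inner_commute dot_square_norm power2_eq_square)
    also have "\<dots> \<le> norm (?pr x) * norm x" by (rule norm_cauchy_schwarz)
    finally show "norm (?pr x) \<le> norm x * 1" by (cases "norm (?pr x) = 0") auto
  qed (simp_all add: linear_add[OF linear_l2_restrict] linear_scale[OF linear_l2_restrict])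
  have core_pr: "?pr (fst z) = fst z" "?pr (snd z) = snd z" if z: "z \<in> core" for z
  proof -
    obtain u where u: "u \<in> test_functions a b" "z = (l2_class u, l2_class (sl_expression P Q R u))"
      using z by (auto simp: core_def)
    obtain v p q where v: "smooth v" "\<And>t. (u has_vector_derivative v t) (at t)"
      "p < q" "{p..q} \<subseteq> einterval a b" "\<And>t. t \<notin> {p<..<q} \<Longrightarrow> u t = 0" "\<And>t. t \<notin> {p<..<q} \<Longrightarrow> v t = 0"
      using test_functionsE[OF u(1) ab] by metis
    have out: "t \<notin> {p..q}" if "t \<notin> einterval a b" for t using that v(4) by blast
    have "u t = 0" if "t \<notin> einterval a b" for t using out[OF that] by (intro v(5)) auto
    then show "?pr (fst z) = fst z" unfolding u(2) by (simp add: l2_restrict_of_support test_square_integrable u(1))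
    have "sl_expression P Q R u t = 0" if "t \<notin> einterval a b" for t
      by (intro sl_expression_zero[OF v(2,1,3-6)] out that)
    then show "?pr (snd z) = snd z" unfolding u(2) by (simp add: l2_restrict_of_support test_square_integrable u(1))
  qed
  have min: "minimal_operator P Q R a b = closure core" by (simp add: minimal_operator_def core_def)
  interpret F: semibounded_form ?pr "closure core" "1 - C"
  proof (rule semibounded_form.intro)
    show "linear ?pr" by (rule linear_l2_restrict)
    show "?pr x \<bullet> y = x \<bullet> ?pr y" for x y by (rule symmetric_l2_restrict)
    show "?pr (?pr x) = ?pr x" for x by (rule l2_restrict_idem)
    show "subspace (closure core)" by (rule subspace_closure_inner[OF subspace_core])
  next
    fix x y assume "(x, y) \<in> closure core"
    then obtain f where f: "\<And>n. f n \<in> core" "f \<longlonglongrightarrow> (x, y)" by (auto simp: closure_sequential)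
    have l: "(\<lambda>n. fst (f n)) \<longlonglongrightarrow> x" "(\<lambda>n. snd (f n)) \<longlonglongrightarrow> y" using tendsto_fst[OF f(2)] tendsto_snd[OF f(2)] by auto
    have "?pr x = x"
      by (rule LIMSEQ_unique[OF _ l(1)]) (use bounded_linear.tendsto[OF pr_bl l(1)] core_pr(1)[OF f(1)] in simp)
    moreover have "?pr y = y"
      by (rule LIMSEQ_unique[OF _ l(2)]) (use bounded_linear.tendsto[OF pr_bl l(2)] core_pr(2)[OF f(1)] in simp)
    ultimately show "?pr x = x \<and> ?pr y = y" by simp
    have low: "fst z \<bullet> fst z \<le> snd z \<bullet> fst z + (1 - C) * (fst z \<bullet> fst z)" if z: "z \<in> core" for z
    proof -
      obtain u where u: "u \<in> test_functions a b" "z = (l2_class u, l2_class (sl_expression P Q R u))"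
        using z by (auto simp: core_def)
      have "l2_class u \<bullet> l2_class u = (\<integral>t. (norm (u t))\<^sup>2 \<partial>lborel)"
        by (simp add: inner_l2_class test_square_integrable u(1) power2_norm_eq_inner)
      then show ?thesis using C[OF u(1)] form_eq_inner[OF u(1) u(1)] by (simp add: u(2) algebra_simps)
    qed
    show "x \<bullet> x \<le> y \<bullet> x + (1 - C) * (x \<bullet> x)"
    proof (rule LIMSEQ_le)
      show "(\<lambda>n. fst (f n) \<bullet> fst (f n)) \<longlonglongrightarrow> x \<bullet> x" by (intro tendsto_intros l)
      show "(\<lambda>n. snd (f n) \<bullet> fst (f n) + (1 - C) * (fst (f n) \<bullet> fst (f n))) \<longlonglongrightarrow> y \<bullet> x + (1 - C) * (x \<bullet> x)"
        by (intro tendsto_intros l)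
      show "\<exists>N. \<forall>n\<ge>N. fst (f n) \<bullet> fst (f n) \<le> snd (f n) \<bullet> fst (f n) + (1 - C) * (fst (f n) \<bullet> fst (f n))"
        using low[OF f(1)] by blast
    qed
    have sym: "snd z \<bullet> fst z' = fst z \<bullet> snd z'" if z: "z \<in> core" and z': "z' \<in> core" for z z'
    proof -
      obtain u where u: "u \<in> test_functions a b" "z = (l2_class u, l2_class (sl_expression P Q R u))"
        using z by (auto simp: core_def)
      obtain v where v: "v \<in> test_functions a b" "z' = (l2_class v, l2_class (sl_expression P Q R v))"
        using z' by (auto simp: core_def)
      show ?thesis using form_sym[OF u(1) v(1)] form_eq_inner[OF u(1) v(1)] form_eq_inner[OF v(1) u(1)]
        by (simp add: u(2) v(2) inner_commute)
    qed
    fix v w assume "(v, w) \<in> closure core"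
    then obtain g where g: "\<And>n. g n \<in> core" "g \<longlonglongrightarrow> (v, w)" by (auto simp: closure_sequential)
    have l': "(\<lambda>n. fst (g n)) \<longlonglongrightarrow> v" "(\<lambda>n. snd (g n)) \<longlonglongrightarrow> w" using tendsto_fst[OF g(2)] tendsto_snd[OF g(2)] by auto
    show "y \<bullet> v = x \<bullet> w"
    proof (rule LIMSEQ_unique)
      show "(\<lambda>n. snd (f n) \<bullet> fst (g n)) \<longlonglongrightarrow> y \<bullet> v" by (intro tendsto_intros l l')
      show "(\<lambda>n. snd (f n) \<bullet> fst (g n)) \<longlonglongrightarrow> x \<bullet> w" unfolding sym[OF f(1) g(1)] by (intro tendsto_intros l l')
    qed
  next
    fix h :: "(real^'n) l2" assume h: "?pr h = h" and orth: "\<And>x y. (x, y) \<in> closure core \<Longrightarrow> h \<bullet> x = 0"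
    define f where "f t = indicator (einterval a b) t *\<^sub>R rep_l2 h t" for t
    have sqf: "square_integrable f" unfolding f_def by (rule square_integrable_restrict[OF square_integrable_rep])
    have hf: "h = l2_class f"
      using l2_restrict_class[OF square_integrable_rep, of a b h] h by (simp add: l2_class_rep f_def[abs_def])
    have "AE t in lborel. f t = 0"
    proof (rule fundamental_lemma[OF sqf ab])
      fix u :: "real \<Rightarrow> real^'n" assume u: "u \<in> test_functions a b"
      have "h \<bullet> l2_class u = 0" using orth coreI[OF u] closure_subset by blast
      then show "(LINT t|lborel. f t \<bullet> u t) = 0" by (simp add: hf inner_l2_class sqf test_square_integrable u)
    qed (simp add: f_def)
    then have "l2_class f = l2_class (\<lambda>_. 0)" by (subst l2_class_eq_iff[OF sqf square_integrable_zero])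
    then show "h = 0" by (simp add: hf l2_class_zero)
  qed
  have "sl_morse_index P Q R a b = (SUP k\<in>{k. negative_family (closure core) k}. enat k)"
    unfolding sl_morse_index_def sl_friedrichs_def min range_l2_restrict[symmetric] by (rule F.morse_index_friedrichs)
  also have "{k. negative_family (closure core) k} = {k. negative_family core k}"
    using negative_family_closure negative_family_mono[OF closure_subset] by blast
  finally show ?thesis by (simp add: negative_family_core)
qed

end

lemma test_bump_exists:
  "\<exists>\<psi> \<psi>'. smooth \<psi> \<and> smooth \<psi>' \<and> (\<forall>t. (\<psi> has_vector_derivative \<psi>' t) (at t)) \<and> (\<forall>t. \<bar>t\<bar> \<ge> 1 \<longrightarrow> \<psi> t = (0::real) \<and> \<psi>' t = 0) \<and>
    0 < (LINT t|lborel. (\<psi>' t)\<^sup>2)"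
proof -
  define \<psi> where "\<psi> = cutoff (- 1) 1 2"
  have sm: "smooth \<psi>" unfolding \<psi>_def by (rule smooth_cutoff)
  obtain \<psi>' where d: "smooth \<psi>'" "\<And>t. (\<psi> has_vector_derivative \<psi>' t) (at t)" using smooth_derivative[OF sm] by blast
  have z: "\<psi> t = 0" if "t \<notin> {- 1 / 2..1 / 2}" for t
  proof (rule ccontr)
    assume "\<psi> t \<noteq> 0"
    then show False using cutoff_support[of "- 1" 1 2 t] that by (auto simp: \<psi>_def)
  qed
  have z': "\<psi>' t = 0" if "t \<notin> {- 1 / 2..1 / 2}" for t
  proof -
    have "(\<psi> has_vector_derivative 0) (at t)"
    proof (rule has_vector_derivative_transform_within_open[OF has_vector_derivative_const])
      show "open (- {- 1 / 2..1 / 2 :: real})" "t \<in> - {- 1 / 2..1 / 2}" using that by (auto simp: open_Compl)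
    qed (use z in auto)
    then show ?thesis using d(2) vector_derivative_unique_at by blast
  qed
  have c: "continuous_on S \<psi>'" for S by (rule smooth_continuous[OF d(1)])
  have int: "integrable lborel (\<lambda>t. (\<psi>' t)\<^sup>2)"
    by (rule compactly_supported_borel(2)[of "- 1 / 2" "1 / 2" "\<lambda>t. (\<psi>' t)\<^sup>2"])
      (auto intro: continuous_intros c simp: z')
  have "(LINT t|lborel. (\<psi>' t)\<^sup>2) \<noteq> 0"
  proof
    assume "(LINT t|lborel. (\<psi>' t)\<^sup>2) = 0"
    then have AE0: "AE t in lborel. (\<psi>' t)\<^sup>2 = 0" using integral_nonneg_eq_0_iff_AE[OF int] by simp
    have "(LINT t|lborel. indicator {- 1..0} t *\<^sub>R \<psi>' t) = (LINT t|(lborel :: real measure). 0)"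
    proof (rule integral_cong_AE)
      show "AE t in lborel. indicator {- 1..0} t *\<^sub>R \<psi>' t = 0" using AE0 by eventually_elim simp
      show "(\<lambda>t. indicator {- 1..0} t *\<^sub>R \<psi>' t) \<in> borel_measurable lborel"
        by (rule compactly_supported_borel(1)[OF c[of "{- 1..0}"]]) auto
    qed simp
    moreover have "(LINT t|lborel. indicator {- 1..0} t *\<^sub>R \<psi>' t) = \<psi> 0 - \<psi> (- 1)"
      by (rule integral_FTC_atLeastAtMost[OF _ _ c]) (auto intro: has_vector_derivative_at_within d(2))
    moreover have "\<psi> (- 1) = 0" by (rule z) simp
    moreover have "0 < \<psi> 0" unfolding \<psi>_def by (rule cutoff_pos) simp_all
    ultimately show False by simp
  qed
  moreover have "0 \<le> (LINT t|lborel. (\<psi>' t)\<^sup>2)" by simp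
  ultimately have "0 < (LINT t|lborel. (\<psi>' t)\<^sup>2)" by linarith
  moreover have "\<forall>t. \<bar>t\<bar> \<ge> 1 \<longrightarrow> \<psi> t = 0 \<and> \<psi>' t = 0"
  proof (intro allI impI)
    fix t :: real assume "1 \<le> \<bar>t\<bar>"
    then have "t \<notin> {- 1 / 2..1 / 2}" by (cases "0 \<le> t") auto
    then show "\<psi> t = 0 \<and> \<psi>' t = 0" using z z' by blast
  qed
  ultimately show ?thesis using sm d by blast
qed

context sturm_liouville
begin

section \<open>Legendre's condition\<close>

text \<open>
  Legendre's necessary condition.  If \<open>P\<close> had a negative direction at some point, then rescaled bumps
  concentrating there in this direction would have a form value tending to \<open>-\<infinity>\<close> relative to their norm,
  since the derivative term dominates.
\<close>

lemma legendre_nonneg: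
  assumes bounded: "sl_form_bounded_below P Q R a b" and t0: "t0 \<in> einterval a b"
  shows "0 \<le> (P t0 *v \<xi>) \<bullet> \<xi>"
proof (rule ccontr)
  assume "\<not> 0 \<le> (P t0 *v \<xi>) \<bullet> \<xi>"
  then have neg: "(P t0 *v \<xi>) \<bullet> \<xi> < 0" by simp
  define \<eta> where "\<eta> = - ((P t0 *v \<xi>) \<bullet> \<xi>) / 2"
  have \<eta>: "0 < \<eta>" using neg by (simp add: \<eta>_def)
  obtain C where C: "\<And>u. u \<in> test_functions a b \<Longrightarrow> C * (\<integral>t. (norm (u t))\<^sup>2 \<partial>lborel) \<le> form u u"
    using bounded unfolding sl_form_bounded_below_def form_def by blast
  have Pc: "continuous_on (einterval a b) (\<lambda>t. (P t *v \<xi>) \<bullet> \<xi>)"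
    by (intro continuous_on_inner continuous_on_matrix_vector continuous_P continuous_on_const)
  have Qc: "continuous_on (einterval a b) (\<lambda>t. 2 * ((Q t *v \<xi>) \<bullet> \<xi>))"
    by (intro continuous_on_mult continuous_on_inner continuous_on_matrix_vector continuous_Q continuous_on_const)
  have Rc: "continuous_on (einterval a b) (\<lambda>t. (R t *v \<xi>) \<bullet> \<xi>)"
    by (intro continuous_on_inner continuous_on_matrix_vector continuous_R continuous_on_const)
  define M where "M = 1 + \<bar>2 * ((Q t0 *v \<xi>) \<bullet> \<xi>)\<bar> + \<bar>(R t0 *v \<xi>) \<bullet> \<xi>\<bar>"
  have at: "(f \<longlongrightarrow> f t0) (at t0)" if "continuous_on (einterval a b) f" for f :: "real \<Rightarrow> real"
    using that t0 by (simp add: continuous_on_eq_continuous_at isCont_def)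
  have nhds: "\<forall>\<^sub>F t in nhds t0. \<phi> t" if "\<forall>\<^sub>F t in at t0. \<phi> t" "\<phi> t0" for \<phi>
    using that by (simp add: eventually_nhds_conv_at)
  have "\<forall>\<^sub>F t in nhds t0. (P t *v \<xi>) \<bullet> \<xi> < - \<eta>"
    by (intro nhds order_tendstoD(2)[OF at[OF Pc]]) (use neg in \<open>auto simp: \<eta>_def\<close>)
  moreover have "\<forall>\<^sub>F t in nhds t0. \<bar>2 * ((Q t *v \<xi>) \<bullet> \<xi>)\<bar> < M"
    by (intro nhds order_tendstoD(2)[OF tendsto_rabs[OF at[OF Qc]]]) (auto simp: M_def)
  moreover have "\<forall>\<^sub>F t in nhds t0. \<bar>(R t *v \<xi>) \<bullet> \<xi>\<bar> < M"
    by (intro nhds order_tendstoD(2)[OF tendsto_rabs[OF at[OF Rc]]]) (auto simp: M_def)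
  moreover have "\<forall>\<^sub>F t in nhds t0. t \<in> einterval a b" using eventually_nhds_in_open[OF open_einterval t0] .
  ultimately have "\<forall>\<^sub>F t in nhds t0. (P t *v \<xi>) \<bullet> \<xi> < - \<eta> \<and> \<bar>2 * ((Q t *v \<xi>) \<bullet> \<xi>)\<bar> < M \<and> \<bar>(R t *v \<xi>) \<bullet> \<xi>\<bar> < M \<and> t \<in> einterval a b"
    by eventually_elim blast
  then obtain e where e: "0 < e" and near: "\<And>t. dist t t0 < e \<Longrightarrow> (P t *v \<xi>) \<bullet> \<xi> < - \<eta> \<and> \<bar>2 * ((Q t *v \<xi>) \<bullet> \<xi>)\<bar> < M \<and> \<bar>(R t *v \<xi>) \<bullet> \<xi>\<bar> < M \<and> t \<in> einterval a b"
    unfolding eventually_nhds_metric by blast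
  obtain \<psi> \<psi>' where \<psi>: "smooth \<psi>" "smooth \<psi>'" "\<And>t. (\<psi> has_vector_derivative \<psi>' t) (at t)"
    "\<And>t. \<bar>t\<bar> \<ge> 1 \<Longrightarrow> \<psi> t = (0::real)" "\<And>t. \<bar>t\<bar> \<ge> 1 \<Longrightarrow> \<psi>' t = 0" "0 < (LINT t|lborel. (\<psi>' t)\<^sup>2)"
    using test_bump_exists by blast
  define A where "A = (LINT t|lborel. (\<psi> t)\<^sup>2)"
  define B where "B = (LINT t|lborel. (\<psi>' t)\<^sup>2)"
  have c: "continuous_on S \<psi>" "continuous_on S \<psi>'" for S using \<psi>(1,2) smooth_continuous by blast+
  have iA: "integrable lborel (\<lambda>t. (\<psi> t)\<^sup>2)"
    by (rule compactly_supported_borel(2)[of "- 1" "1" "\<lambda>t. (\<psi> t)\<^sup>2"]) (auto intro: continuous_intros c simp: \<psi>(4))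
  have iB: "integrable lborel (\<lambda>t. (\<psi>' t)\<^sup>2)"
    by (rule compactly_supported_borel(2)[of "- 1" "1" "\<lambda>t. (\<psi>' t)\<^sup>2"]) (auto intro: continuous_intros c simp: \<psi>(5))
  \<comment> \<open>The bump is shrunk by the factor \<open>m\<close>; the left side grows like \<open>m\<^sup>2\<close> while the right side is fixed.\<close>
  have key: "(\<eta> / 2) * m\<^sup>2 * B \<le> (2 * M\<^sup>2 / \<eta> + M - C * (norm \<xi>)\<^sup>2) * A" if m: "1 < m * e" "0 < m" for m :: real
  proof -
    define s where "s t = \<psi> (m * t + - (m * t0))" for t
    define s' where "s' t = \<psi>' (m * t + - (m * t0))" for t
    have ms: "m * t + - (m * t0) = m * (t - t0)" for t by (simp add: algebra_simps)
    have far: "1 \<le> \<bar>m * (t - t0)\<bar>" if "1 / m \<le> \<bar>t - t0\<bar>" for t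
    proof -
      have "m * (1 / m) \<le> m * \<bar>t - t0\<bar>" using m(2) that by (intro mult_left_mono) auto
      moreover have "\<bar>m * (t - t0)\<bar> = m * \<bar>t - t0\<bar>" using m(2) by (simp add: abs_mult)
      ultimately show ?thesis using m(2) by simp
    qed
    define u where "u t = s t *\<^sub>R \<xi>" for t
    define u' where "u' t = (m * s' t) *\<^sub>R \<xi>" for t
    have sm: "smooth s" "smooth s'" unfolding s_def s'_def by (intro smooth_affine \<psi>)+
    have "(s has_vector_derivative m *\<^sub>R s' t) (at t)" for t
    proof -
      have "((\<lambda>t. m * t + - (m * t0)) has_vector_derivative m) (at t)"
        by (auto intro!: derivative_eq_intros simp: has_real_derivative_iff_has_vector_derivative[symmetric])
      from vector_diff_chain_at[OF this \<psi>(3)] show ?thesis by (simp add: o_def s_def[abs_def] s'_def)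
    qed
    then have du: "(u has_vector_derivative u' t) (at t)" for t
      unfolding u_def u'_def using bounded_linear.has_vector_derivative[OF bounded_linear_scaleR_left] by fastforce
    have supp: "dist t t0 < e" if "s t \<noteq> 0 \<or> s' t \<noteq> 0" for t
    proof (rule ccontr)
      assume "\<not> dist t t0 < e"
      then have "m * e \<le> m * \<bar>t - t0\<bar>" using m(2) by (intro mult_left_mono) (auto simp: dist_real_def)
      moreover have "\<bar>m * (t - t0)\<bar> = m * \<bar>t - t0\<bar>" using m(2) by (simp add: abs_mult)
      ultimately have "1 \<le> \<bar>m * (t - t0)\<bar>" using m(1) by linarith
      from \<psi>(4)[OF this] \<psi>(5)[OF this] have "\<psi> (m * (t - t0)) = 0" "\<psi>' (m * (t - t0)) = 0" .
      then show False using that by (simp only: s_def s'_def ms simp_thms)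
    qed
    have ut: "u \<in> test_functions a b"
    proof (rule test_functionsI[of _ "t0 - 1 / m" "t0 + 1 / m"])
      show "smooth u" unfolding u_def by (intro smooth_scaleR sm smooth_const)
      have "1 / m < e" using m by (simp add: field_simps)
      then have "dist t t0 < e" if "t \<in> {t0 - 1 / m..t0 + 1 / m}" for t using that by (auto simp: dist_real_def)
      then show "{t0 - 1 / m..t0 + 1 / m} \<subseteq> einterval a b" using near by blast
      show "u t = 0" if t: "t \<notin> {t0 - 1 / m..t0 + 1 / m}" for t
      proof -
        have "1 / m \<le> \<bar>t - t0\<bar>" using t by auto
        from \<psi>(4)[OF far[OF this]] have "s t = 0" by (simp only: s_def ms)
        then show ?thesis by (simp add: u_def)
      qed
    qed
    have cu': "continuous_on UNIV u'" unfolding u'_def by (intro continuous_intros smooth_continuous sm)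
    have scale: "(LINT t|lborel. f (m * t + - (m * t0))) = (1 / m) * (LINT t|lborel. f t)" for f :: "real \<Rightarrow> real"
      using lborel_integral_real_affine[of m f "- (m * t0)"] m(2) by (simp add: add.commute)
    have int_s: "integrable lborel (\<lambda>t. (s t)\<^sup>2)" "integrable lborel (\<lambda>t. (s' t)\<^sup>2)"
      using lborel_integrable_real_affine[OF iA, of m "- (m * t0)"] lborel_integrable_real_affine[OF iB, of m "- (m * t0)"] m(2)
      by (auto simp: s_def s'_def add.commute)
    have "C * (norm \<xi>)\<^sup>2 * ((1 / m) * A) = C * (LINT t|lborel. (norm (u t))\<^sup>2)"
      using scale[of "\<lambda>t. (\<psi> t)\<^sup>2"] by (simp add: u_def s_def A_def power_mult_distrib)
    also have "\<dots> \<le> form u u" by (rule C[OF ut])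
    also have "\<dots> = (LINT t|lborel. integrand t (u t) (u' t) (u t) (u' t))"
      by (rule form_eq_integrand[OF ut du du cu'])
    also have "\<dots> \<le> (LINT t|lborel. - (\<eta> / 2) * m\<^sup>2 * (s' t)\<^sup>2 + (2 * M\<^sup>2 / \<eta> + M) * (s t)\<^sup>2)"
    proof (rule integral_mono)
      show "integrable lborel (\<lambda>t. - (\<eta> / 2) * m\<^sup>2 * (s' t)\<^sup>2 + (2 * M\<^sup>2 / \<eta> + M) * (s t)\<^sup>2)" using int_s by auto
      have cI: "{t0 - 1 / m..t0 + 1 / m} \<subseteq> einterval a b"
      proof
        fix t assume "t \<in> {t0 - 1 / m..t0 + 1 / m}"
        moreover have "1 / m < e" using m by (simp add: field_simps)
        ultimately have "dist t t0 < e" by (auto simp: dist_real_def)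
        then show "t \<in> einterval a b" using near by blast
      qed
      have cc: "continuous_on {t0 - 1 / m..t0 + 1 / m} (\<lambda>t. integrand t (u t) (u' t) (u t) (u' t))"
        by (intro continuous_integrand cI continuous_on_subset[OF cu'] smooth_continuous[OF smooth_test_function[OF ut]]) auto
      show "integrable lborel (\<lambda>t. integrand t (u t) (u' t) (u t) (u' t))"
      proof (rule compactly_supported_borel(2)[OF cc])
        fix t assume t: "t \<notin> {t0 - 1 / m..t0 + 1 / m}"
        have "1 / m \<le> \<bar>t - t0\<bar>" using t by auto
        from \<psi>(4)[OF far[OF this]] \<psi>(5)[OF far[OF this]] have "s t = 0" "s' t = 0" by (simp_all only: s_def s'_def ms)
        then have "u t = 0" "u' t = 0" by (simp_all add: u_def u'_def)
        then show "integrand t (u t) (u' t) (u t) (u' t) = 0" by (simp add: integrand_linear)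
      qed simp
      fix t
      show "integrand t (u t) (u' t) (u t) (u' t) \<le> - (\<eta> / 2) * m\<^sup>2 * (s' t)\<^sup>2 + (2 * M\<^sup>2 / \<eta> + M) * (s t)\<^sup>2"
      proof (cases "s t \<noteq> 0 \<or> s' t \<noteq> 0")
        case True
        from near[OF supp[OF True]] have n: "(P t *v \<xi>) \<bullet> \<xi> < - \<eta>" "\<bar>2 * ((Q t *v \<xi>) \<bullet> \<xi>)\<bar> < M" "\<bar>(R t *v \<xi>) \<bullet> \<xi>\<bar> < M" by auto
        define x y where "x = m * s' t" and "y = s t"
        have eq: "integrand t (u t) (u' t) (u t) (u' t) = x\<^sup>2 * ((P t *v \<xi>) \<bullet> \<xi>) + x * y * (2 * ((Q t *v \<xi>) \<bullet> \<xi>)) + y\<^sup>2 * ((R t *v \<xi>) \<bullet> \<xi>)"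
          by (simp add: integrand_def u_def u'_def x_def[symmetric] y_def[symmetric] matrix_vector_mult_scaleR inner_add_left inner_commute
              power2_eq_square algebra_simps)
        have 1: "x\<^sup>2 * ((P t *v \<xi>) \<bullet> \<xi>) \<le> x\<^sup>2 * (- \<eta>)" using n(1) by (intro mult_left_mono) auto
        have 2: "y\<^sup>2 * ((R t *v \<xi>) \<bullet> \<xi>) \<le> y\<^sup>2 * M" using n(3) by (intro mult_left_mono) auto
        have 3: "x * y * (2 * ((Q t *v \<xi>) \<bullet> \<xi>)) \<le> \<bar>x\<bar> * \<bar>y\<bar> * M"
        proof -
          have "x * y * (2 * ((Q t *v \<xi>) \<bullet> \<xi>)) \<le> \<bar>x * y\<bar> * \<bar>2 * ((Q t *v \<xi>) \<bullet> \<xi>)\<bar>" by (metis abs_ge_self abs_mult)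
          also have "\<dots> \<le> \<bar>x * y\<bar> * M" using n(2) by (intro mult_left_mono) auto
          finally show ?thesis by (simp add: abs_mult)
        qed
        have 4: "\<bar>x\<bar> * \<bar>y\<bar> * M \<le> (\<eta> / 2) * x\<^sup>2 + (2 * M\<^sup>2 / \<eta>) * y\<^sup>2"
        proof -
          have "0 \<le> (\<eta> * \<bar>x\<bar> - 2 * M * \<bar>y\<bar>)\<^sup>2" by simp
          also have "\<dots> = \<eta>\<^sup>2 * x\<^sup>2 + 4 * M\<^sup>2 * y\<^sup>2 - 4 * \<eta> * (\<bar>x\<bar> * \<bar>y\<bar> * M)"
            by (simp add: power2_diff power_mult_distrib)
          finally have "4 * \<eta> * (\<bar>x\<bar> * \<bar>y\<bar> * M) \<le> \<eta>\<^sup>2 * x\<^sup>2 + 4 * M\<^sup>2 * y\<^sup>2" by simp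
          also have "\<dots> \<le> 4 * \<eta> * ((\<eta> / 2) * x\<^sup>2 + (2 * M\<^sup>2 / \<eta>) * y\<^sup>2)"
          proof -
            have eq: "4 * \<eta> * ((\<eta> / 2) * x\<^sup>2 + (2 * M\<^sup>2 / \<eta>) * y\<^sup>2) = 2 * (\<eta>\<^sup>2 * x\<^sup>2 + 4 * M\<^sup>2 * y\<^sup>2)"
              using \<eta> by (simp add: field_simps power2_eq_square)
            have nn: "0 \<le> \<eta>\<^sup>2 * x\<^sup>2 + 4 * M\<^sup>2 * y\<^sup>2" by simp
            have "z \<le> 2 * z" if "0 \<le> z" for z :: real using that by simp
            from this[OF nn] show ?thesis unfolding eq .
          qed
          finally show ?thesis using \<eta> by (simp add: mult_le_cancel_left)
        qed
        have "integrand t (u t) (u' t) (u t) (u' t) \<le> - (\<eta> / 2) * x\<^sup>2 + (2 * M\<^sup>2 / \<eta> + M) * y\<^sup>2"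
          unfolding eq using 1 2 3 4 by (simp add: algebra_simps)
        then show ?thesis by (simp add: x_def y_def power_mult_distrib mult.assoc)
      next
        case False
        then show ?thesis by (simp add: u_def u'_def integrand_linear)
      qed
    qed
    also have "\<dots> = - (\<eta> / 2) * m\<^sup>2 * ((1 / m) * B) + (2 * M\<^sup>2 / \<eta> + M) * ((1 / m) * A)"
    proof -
      have "(LINT t|lborel. - (\<eta> / 2) * m\<^sup>2 * (s' t)\<^sup>2 + (2 * M\<^sup>2 / \<eta> + M) * (s t)\<^sup>2) =
          - (\<eta> / 2) * m\<^sup>2 * (LINT t|lborel. (s' t)\<^sup>2) + (2 * M\<^sup>2 / \<eta> + M) * (LINT t|lborel. (s t)\<^sup>2)"
        using int_s by (subst Bochner_Integration.integral_add) auto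
      then show ?thesis
        using scale[of "\<lambda>t. (\<psi> t)\<^sup>2"] scale[of "\<lambda>t. (\<psi>' t)\<^sup>2"] by (simp only: s_def s'_def A_def B_def)
    qed
    finally have fin: "C * (norm \<xi>)\<^sup>2 * ((1 / m) * A) \<le> - (\<eta> / 2) * m\<^sup>2 * ((1 / m) * B) + (2 * M\<^sup>2 / \<eta> + M) * ((1 / m) * A)" .
    have "(1 / m) * ((\<eta> / 2) * m\<^sup>2 * B) \<le> (1 / m) * ((2 * M\<^sup>2 / \<eta> + M - C * (norm \<xi>)\<^sup>2) * A)"
      using fin by (simp only: algebra_simps)
    then show ?thesis using m(2) by (simp only: mult_le_cancel_left zero_less_divide_1_iff)
  qed
  define K where "K = (2 * M\<^sup>2 / \<eta> + M - C * (norm \<xi>)\<^sup>2) * A"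
  have B0: "0 < \<eta> / 2 * B" using \<psi>(6) \<eta> by (simp add: B_def)
  obtain m :: nat where m: "max (1 / e + 1) (\<bar>K\<bar> / (\<eta> / 2 * B) + 1) < real m" using reals_Archimedean2 by blast
  have m1: "1 < real m * e" "1 < real m"
  proof -
    have "1 / e < real m" using m by simp
    then show "1 < real m * e" using e by (simp only: pos_divide_less_eq)
    have "0 \<le> \<bar>K\<bar> / (\<eta> / 2 * B)" using B0 by (intro divide_nonneg_pos) auto
    then show "1 < real m" using m by linarith
  qed
  have "\<bar>K\<bar> / (\<eta> / 2 * B) < real m" using m by simp
  then have "\<bar>K\<bar> < real m * (\<eta> / 2 * B)" using B0 by (simp only: pos_divide_less_eq)
  also have "\<dots> \<le> (real m)\<^sup>2 * (\<eta> / 2 * B)" using m1(2) B0 by (intro mult_right_mono) (auto simp: power2_eq_square)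
  also have "\<dots> \<le> K" using key[OF m1(1)] m1(2) unfolding K_def by (simp add: mult_ac)
  finally show False by simp
qed

text \<open>
  For the semidefinite matrix \<open>P t\<close> an isotropic vector lies in the kernel, which is trivial.
\<close>

lemma P_positive:
  assumes bounded: "sl_form_bounded_below P Q R a b" and t: "t \<in> einterval a b" and "\<xi> \<noteq> 0"
  shows "0 < (P t *v \<xi>) \<bullet> \<xi>"
proof (rule ccontr)
  assume "\<not> 0 < (P t *v \<xi>) \<bullet> \<xi>"
  then have z: "(P t *v \<xi>) \<bullet> \<xi> = 0" using legendre_nonneg[OF bounded t, of \<xi>] by linarith
  have sym: "(P t *v x) \<bullet> y = x \<bullet> (P t *v y)" for x y using transpose_inner[of "P t" x y] transpose_P[OF t] by simp
  have "(P t *v \<xi>) \<bullet> y = 0" for y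
  proof (rule ccontr)
    define p where "p = (P t *v \<xi>) \<bullet> y"
    define r where "r = (P t *v y) \<bullet> y"
    assume "(P t *v \<xi>) \<bullet> y \<noteq> 0"
    then have p: "p \<noteq> 0" by (simp add: p_def)
    have r: "0 \<le> r" unfolding r_def by (rule legendre_nonneg[OF bounded t])
    have "0 \<le> (P t *v (\<xi> + s *\<^sub>R y)) \<bullet> (\<xi> + s *\<^sub>R y)" for s by (rule legendre_nonneg[OF bounded t])
    then have ineq: "0 \<le> 2 * s * p + s\<^sup>2 * r" for s
      using z sym[of y \<xi>] by (simp add: matrix_vector_right_distrib matrix_vector_mult_scaleR inner_add_left inner_add_right
          p_def r_def power2_eq_square inner_commute algebra_simps)
    define w where "w = p / (r + 1)"
    have w: "p = w * (r + 1)" "w \<noteq> 0" using r p by (auto simp: w_def)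
    have "2 * (- w) * p + (- w)\<^sup>2 * r = - (w\<^sup>2 * (r + 2))"
      unfolding w(1) by (simp add: power2_eq_square algebra_simps)
    also have "\<dots> < 0" using w(2) r by simp
    finally show False using ineq[of "- w"] by simp
  qed
  then have "P t *v \<xi> = 0" by (metis inner_eq_zero_iff)
  then have "W t *v (P t *v \<xi>) = 0" by simp
  then have "\<xi> = 0" by (simp add: matrix_vector_mul_assoc matrix_inv_mult[OF invertible_P[OF t]])
  then show False using assms(3) by simp
qed

end

section \<open>Conjugate points\<close>

text \<open>
  The Hamiltonian system is studied from a base point \<open>t0\<close>, which is the left or the right endpoint.  Both
  cases are treated together through segments from \<open>t0\<close>.
\<close>

locale jacobi = sturm_liouville a b P Q R
  for a b :: ereal and P Q R :: "real \<Rightarrow> real^'n^'n" +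
  fixes t0 :: real
  assumes endpoint: "a = ereal t0 \<or> b = ereal t0"
begin

definition solution :: "(real \<Rightarrow> real^'n^'n) \<Rightarrow> (real \<Rightarrow> real^'n^'n) \<Rightarrow> bool" where
  "solution Y U \<longleftrightarrow> continuous_on (insert t0 (einterval a b)) Y \<and> continuous_on (insert t0 (einterval a b)) U \<and>
     (\<forall>t\<in>einterval a b. (U has_vector_derivative W t ** (Y t - Q t ** U t)) (at t) \<and>
       (Y has_vector_derivative transpose (Q t) ** (W t ** (Y t - Q t ** U t)) + R t ** U t) (at t))"

lemma segment_subset:
  assumes "t \<in> einterval a b"
  shows "closed_segment t0 t - {t0} \<subseteq> einterval a b" "t \<noteq> t0"
proof -
  show "t \<noteq> t0" using assms endpoint by (auto simp: einterval_iff)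
  show "closed_segment t0 t - {t0} \<subseteq> einterval a b"
  proof
    fix s assume s: "s \<in> closed_segment t0 t - {t0}"
    from endpoint show "s \<in> einterval a b"
    proof
      assume a: "a = ereal t0"
      then have "t0 < t" using assms by (simp add: einterval_iff)
      then have "t0 < s" "s \<le> t" using s by (auto simp: closed_segment_eq_real_ivl)
      then show ?thesis using assms a by (auto simp: einterval_iff) (metis ereal_less_eq(3) le_less_trans)
    next
      assume b: "b = ereal t0"
      then have "t < t0" using assms by (simp add: einterval_iff)
      then have "s < t0" "t \<le> s" using s by (auto simp: closed_segment_eq_real_ivl)
      then show ?thesis using assms b by (auto simp: einterval_iff) (metis ereal_less_eq(3) less_le_trans)
    qed
  qed
qed

lemma constant_of_zero_derivative:
  fixes f :: "real \<Rightarrow> real"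
  assumes f: "continuous_on (insert t0 (einterval a b)) f"
    and d: "\<And>t. t \<in> einterval a b \<Longrightarrow> (f has_real_derivative 0) (at t)" and t: "t \<in> einterval a b"
  shows "f t = f t0"
proof -
  have sub: "closed_segment t0 t \<subseteq> insert t0 (einterval a b)" using segment_subset(1)[OF t] by blast
  have c: "continuous_on {min t0 t..max t0 t} f"
    by (rule continuous_on_subset[OF f]) (use sub in \<open>auto simp: closed_segment_eq_real_ivl min_def max_def split: if_splits\<close>)
  have lt: "min t0 t < max t0 t" using segment_subset(2)[OF t] by (auto simp: min_def max_def)
  have "s \<in> einterval a b" if "min t0 t < s" "s < max t0 t" for s
  proof -
    have "s \<in> closed_segment t0 t - {t0}" using that by (auto simp: closed_segment_eq_real_ivl min_def max_def split: if_splits)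
    then show ?thesis using segment_subset(1)[OF t] by blast
  qed
  then have "f s = f (min t0 t)" if "min t0 t \<le> s" "s \<le> max t0 t" for s using DERIV_isconst2[OF lt c] d that by blast
  from this[of t] this[of t0] show ?thesis by (simp add: min_def max_def)
qed

text \<open>
  The Hamiltonian flow is symplectic.
\<close>

lemma wronskian:
  assumes s1: "solution Y U" and s2: "solution Y' U'" and t: "t \<in> einterval a b"
  shows "(Y t *v x) \<bullet> (U' t *v y) - (U t *v x) \<bullet> (Y' t *v y) = (Y t0 *v x) \<bullet> (U' t0 *v y) - (U t0 *v x) \<bullet> (Y' t0 *v y)"
proof (rule constant_of_zero_derivative[OF _ _ t])
  show "continuous_on (insert t0 (einterval a b)) (\<lambda>t. (Y t *v x) \<bullet> (U' t *v y) - (U t *v x) \<bullet> (Y' t *v y))"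
    using s1 s2 unfolding solution_def
    by (intro continuous_on_diff continuous_on_inner continuous_on_matrix_vector continuous_on_const) auto
  fix s assume s: "s \<in> einterval a b"
  define V where "V = W s ** (Y s - Q s ** U s)"
  define V' where "V' = W s ** (Y' s - Q s ** U' s)"
  have PV: "Y s *v x = P s *v (V *v x) + Q s *v (U s *v x)" for x
    by (simp add: V_def matrix_vector_mul_assoc matrix_mul_assoc matrix_inv_mult[OF invertible_P[OF s]]
        matrix_vector_mult_diff_rdistrib)
  have PV': "Y' s *v x = P s *v (V' *v x) + Q s *v (U' s *v x)" for x
    by (simp add: V'_def matrix_vector_mul_assoc matrix_mul_assoc matrix_inv_mult[OF invertible_P[OF s]]
        matrix_vector_mult_diff_rdistrib)
  have d: "(U has_vector_derivative V) (at s)" "(Y has_vector_derivative transpose (Q s) ** V + R s ** U s) (at s)"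
    "(U' has_vector_derivative V') (at s)" "(Y' has_vector_derivative transpose (Q s) ** V' + R s ** U' s) (at s)"
    using s1 s2 s unfolding solution_def V_def V'_def by auto
  have mv: "((\<lambda>t. F t *v z) has_vector_derivative D *v z) (at s)" if "(F has_vector_derivative D) (at s)" for F :: "real \<Rightarrow> real^'n^'n" and D z
    using has_vector_derivative_matrix_vector[OF that has_vector_derivative_const[of z]] by simp
  have sym: "(P s *v u) \<bullet> v = u \<bullet> (P s *v v)" "(R s *v u) \<bullet> v = u \<bullet> (R s *v v)" for u v
    using transpose_inner[of "P s" u v] transpose_inner[of "R s" u v] transpose_P[OF s] transpose_R[OF s] by simp_all
  have tr: "u \<bullet> (transpose (Q s) *v v) = (Q s *v u) \<bullet> v" for u v
    using transpose_inner[of "Q s" v u] by (simp add: inner_commute)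
  have "((\<lambda>t. (Y t *v x) \<bullet> (U' t *v y) - (U t *v x) \<bullet> (Y' t *v y)) has_vector_derivative
      ((Y s *v x) \<bullet> (V' *v y) + ((transpose (Q s) ** V + R s ** U s) *v x) \<bullet> (U' s *v y)) -
      ((U s *v x) \<bullet> ((transpose (Q s) ** V' + R s ** U' s) *v y) + (V *v x) \<bullet> (Y' s *v y))) (at s)"
    by (intro has_vector_derivative_diff bounded_bilinear.has_vector_derivative[OF bounded_bilinear_inner] mv d)
  moreover have "((Y s *v x) \<bullet> (V' *v y) + ((transpose (Q s) ** V + R s ** U s) *v x) \<bullet> (U' s *v y)) -
      ((U s *v x) \<bullet> ((transpose (Q s) ** V' + R s ** U' s) *v y) + (V *v x) \<bullet> (Y' s *v y)) = 0"
    unfolding PV PV' matrix_vector_mult_add_rdistrib matrix_vector_mul_assoc[symmetric] inner_add_left inner_add_right tr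
      transpose_inner sym by simp
  ultimately show "((\<lambda>t. (Y t *v x) \<bullet> (U' t *v y) - (U t *v x) \<bullet> (Y' t *v y)) has_real_derivative 0) (at s)"
    by (simp add: has_real_derivative_iff_has_vector_derivative)
qed

end

text \<open>
  The pair \<open>(Y, U)\<close> consists of the momenta and the values of the solutions starting in the Dirichlet subspace;
  the pair \<open>(Yd, Ud)\<close> starts in the complementary subspace and only serves, through the Wronskian, to show
  that the flow is injective.
\<close>

locale conjugate = jacobi a b P Q R t0
  for a b :: ereal and P Q R :: "real \<Rightarrow> real^'n^'n" and t0 :: real +
  fixes Y U Yd Ud :: "real \<Rightarrow> real^'n^'n"
  assumes sol: "solution Y U" and sold: "solution Yd Ud"
    and init: "Y t0 = mat 1" "U t0 = 0" "Ud t0 = mat 1"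
    and bounded: "sl_form_bounded_below P Q R a b"
begin

definition "dU t = W t ** (Y t - Q t ** U t)"

lemma U_derivative: "t \<in> einterval a b \<Longrightarrow> (U has_vector_derivative dU t) (at t)"
  and Y_derivative: "t \<in> einterval a b \<Longrightarrow> (Y has_vector_derivative transpose (Q t) ** dU t + R t ** U t) (at t)"
  and U_cont: "continuous_on (insert t0 (einterval a b)) U" and Y_cont: "continuous_on (insert t0 (einterval a b)) Y"
  using sol unfolding solution_def dU_def by auto

lemma U_cont_at: "t \<in> einterval a b \<Longrightarrow> (U \<longlongrightarrow> U t) (at t)"
  and Y_cont_at: "t \<in> einterval a b \<Longrightarrow> (Y \<longlongrightarrow> Y t) (at t)"
  using has_vector_derivative_continuous[OF U_derivative] has_vector_derivative_continuous[OF Y_derivative]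
  by (auto simp: isCont_def)

lemma momentum: "t \<in> einterval a b \<Longrightarrow> Y t *v x = P t *v (dU t *v x) + Q t *v (U t *v x)"
  by (simp add: dU_def matrix_vector_mul_assoc matrix_mul_assoc matrix_inv_mult[OF invertible_P]
        matrix_vector_mult_diff_rdistrib)

text \<open>
  The flow carries the Dirichlet subspace to Lagrangian subspaces.
\<close>

lemma isotropic: "t \<in> einterval a b \<Longrightarrow> (Y t *v x) \<bullet> (U t *v y) = (U t *v x) \<bullet> (Y t *v y)"
  using wronskian[OF sol sol, of t x y] by (simp add: init)

lemma nondegenerate:
  assumes t: "t \<in> einterval a b" and "U t *v x = 0" "Y t *v x = 0" shows "x = 0"
proof -
  have "x \<bullet> x = 0" using wronskian[OF sol sold t, of x x] assms by (simp add: init matrix_vector_mul_lid)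
  then show ?thesis by simp
qed

text \<open>
  The matrix \<open>U\<close> degenerates at most linearly.  Otherwise unit vectors \<open>y\<^sub>n\<close> with \<open>U(s\<^sub>n) y\<^sub>n = o(s\<^sub>n - t\<^sub>1)\<close>
  have a limit \<open>z\<close> in the kernel.  The isotropy relation for \<open>y\<^sub>n\<close> and \<open>z\<close>, divided by \<open>s\<^sub>n - t\<^sub>1\<close>, gives
  \<open>\<langle>P U' z, U' z\<rangle> = 0\<close>.  Since \<open>P\<close> is positive, \<open>U' z\<close> and then also \<open>Y z\<close> vanish, so \<open>z = 0\<close>.  This replaces
  the usual analysis of the regularity of crossings.
\<close>

lemma pole_order:
  assumes t1: "t1 \<in> einterval a b"
  shows "\<exists>\<kappa>>0. \<exists>\<delta>>0. \<forall>t x. 0 < \<bar>t - t1\<bar> \<longrightarrow> \<bar>t - t1\<bar> < \<delta> \<longrightarrow>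
    t \<in> einterval a b \<and> \<kappa> * \<bar>t - t1\<bar> * norm x \<le> norm (U t *v x)"
proof (rule ccontr)
  assume contr: "\<not> ?thesis"
  obtain d where d: "0 < d" "ball t1 d \<subseteq> einterval a b" using open_contains_ball[of "einterval a b"] t1 by auto
  have "\<exists>t x. 0 < \<bar>t - t1\<bar> \<and> \<bar>t - t1\<bar> < min d (1 / real (Suc n)) \<and>
      norm (U t *v x) < 1 / real (Suc n) * \<bar>t - t1\<bar> * norm x" for n
  proof (rule ccontr)
    assume H: "\<not> ?thesis"
    have "t \<in> einterval a b \<and> 1 / real (Suc n) * \<bar>t - t1\<bar> * norm x \<le> norm (U t *v x)"
      if "0 < \<bar>t - t1\<bar>" "\<bar>t - t1\<bar> < min d (1 / real (Suc n))" for t x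
    proof
      have "t \<in> ball t1 d" using that by (simp add: dist_real_def abs_minus_commute)
      then show "t \<in> einterval a b" using d(2) by blast
      show "1 / real (Suc n) * \<bar>t - t1\<bar> * norm x \<le> norm (U t *v x)" using H that not_le by blast
    qed
    moreover have "0 < min d (1 / real (Suc n))" "0 < 1 / real (Suc n)" using d(1) by auto
    ultimately show False using contr by blast
  qed
  then obtain s x where s: "\<And>n. 0 < \<bar>s n - t1\<bar>" "\<And>n. \<bar>s n - t1\<bar> < min d (1 / real (Suc n))"
    and x: "\<And>n. norm (U (s n) *v x n) < 1 / real (Suc n) * \<bar>s n - t1\<bar> * norm (x n)" by metis
  have xn: "x n \<noteq> 0" for n using x[of n] by auto
  define y where "y n = x n /\<^sub>R norm (x n)" for n
  have y1: "norm (y n) = 1" for n using xn[of n] by (simp add: y_def)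
  have yU: "norm (U (s n) *v y n) \<le> 1 / real (Suc n) * \<bar>s n - t1\<bar>" for n
  proof -
    have "norm (U (s n) *v y n) = norm (U (s n) *v x n) / norm (x n)"
      by (simp add: y_def matrix_vector_mult_scaleR divide_inverse mult.commute)
    also have "\<dots> \<le> (1 / real (Suc n) * \<bar>s n - t1\<bar> * norm (x n)) / norm (x n)"
      by (intro divide_right_mono less_imp_le[OF x]) simp
    also have "\<dots> = 1 / real (Suc n) * \<bar>s n - t1\<bar>" using xn[of n] by (simp del: of_nat_Suc)
    finally show ?thesis .
  qed
  have "compact (sphere (0 :: real^'n) 1)" by simp
  then obtain z r where z: "z \<in> sphere 0 1" and r: "strict_mono (r :: nat \<Rightarrow> nat)" and lim: "(y \<circ> r) \<longlonglongrightarrow> z"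
    unfolding compact_def using y1 by (metis dist_0_norm mem_sphere)
  have z1: "norm z = 1" using z by simp
  have n0: "(\<lambda>n. 1 / real (Suc n)) \<longlonglongrightarrow> 0" using LIMSEQ_inverse_real_of_nat by (simp add: inverse_eq_divide)
  then have r0: "(\<lambda>n. 1 / real (Suc (r n))) \<longlonglongrightarrow> 0" using LIMSEQ_subseq_LIMSEQ[OF _ r] by (simp add: o_def)
  have "(\<lambda>n. s (r n) - t1) \<longlonglongrightarrow> 0"
    by (rule Lim_null_comparison[OF always_eventually r0]) (use s(2) in \<open>auto intro: less_imp_le\<close>)
  then have slim: "(\<lambda>n. s (r n)) \<longlonglongrightarrow> t1" by (simp add: LIM_zero_iff)
  have sat: "filterlim (\<lambda>n. s (r n)) (at t1) sequentially"
    unfolding filterlim_at using slim s(1) by (auto intro!: always_eventually)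
  have Yl: "(\<lambda>n. Y (s (r n))) \<longlonglongrightarrow> Y t1" by (rule filterlim_compose[OF Y_cont_at[OF t1] sat])
  have Ul: "(\<lambda>n. U (s (r n))) \<longlonglongrightarrow> U t1" by (rule filterlim_compose[OF U_cont_at[OF t1] sat])
  have yl: "(\<lambda>n. y (r n)) \<longlonglongrightarrow> z" using lim by (simp add: o_def)
  have "U t1 *v z = 0"
  proof (rule LIMSEQ_unique)
    show "(\<lambda>n. U (s (r n)) *v y (r n)) \<longlonglongrightarrow> U t1 *v z" by (rule tendsto_matrix_vector[OF Ul yl])
    show "(\<lambda>n. U (s (r n)) *v y (r n)) \<longlonglongrightarrow> 0"
    proof (rule Lim_null_comparison[OF always_eventually])
      show "(\<lambda>n. 1 / real (Suc (r n)) * \<bar>s (r n) - t1\<bar>) \<longlonglongrightarrow> 0"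
        using tendsto_mult[OF r0 tendsto_rabs[OF LIM_zero[OF slim]]] by simp
    qed (use yU in blast)
  qed
  note Uz = this
  define q where "q n = (s (r n) - t1)" for n
  have q: "q n \<noteq> 0" for n using s(1)[of "r n"] by (simp add: q_def)
  have Uq: "(\<lambda>n. (U (s (r n)) - U t1) /\<^sub>R q n) \<longlonglongrightarrow> dU t1"
    using filterlim_compose[OF U_derivative[OF t1, unfolded has_vector_derivative_iff_quotient] sat] by (simp add: q_def)
  have L1: "(\<lambda>n. (Y (s (r n)) *v y (r n)) \<bullet> (((U (s (r n)) - U t1) /\<^sub>R q n) *v z)) \<longlonglongrightarrow> (Y t1 *v z) \<bullet> (dU t1 *v z)"
    by (intro tendsto_inner tendsto_matrix_vector Yl yl Uq tendsto_const)
  have L2: "(Y (s (r n)) *v y (r n)) \<bullet> (((U (s (r n)) - U t1) /\<^sub>R q n) *v z) =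
      ((U (s (r n)) *v y (r n)) /\<^sub>R q n) \<bullet> (Y (s (r n)) *v z)" for n
  proof -
    have "s (r n) \<in> ball t1 d" using s(2)[of "r n"] by (simp add: dist_real_def abs_minus_commute)
    then have sI: "s (r n) \<in> einterval a b" using d(2) by blast
    have "((U (s (r n)) - U t1) /\<^sub>R q n) *v z = (U (s (r n)) *v z) /\<^sub>R q n"
      using Uz by (simp add: scaleR_matrix_vector_assoc[symmetric] matrix_vector_mult_diff_rdistrib)
    then show ?thesis using isotropic[OF sI, of "y (r n)" z] by simp
  qed
  have L3: "(\<lambda>n. ((U (s (r n)) *v y (r n)) /\<^sub>R q n) \<bullet> (Y (s (r n)) *v z)) \<longlonglongrightarrow> 0 \<bullet> (Y t1 *v z)"
  proof (intro tendsto_inner tendsto_matrix_vector Yl tendsto_const)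
    show "(\<lambda>n. (U (s (r n)) *v y (r n)) /\<^sub>R q n) \<longlonglongrightarrow> 0"
    proof (rule Lim_null_comparison[OF always_eventually r0], rule allI)
      fix n
      have "norm ((U (s (r n)) *v y (r n)) /\<^sub>R q n) = norm (U (s (r n)) *v y (r n)) / \<bar>q n\<bar>"
        by (simp add: divide_inverse mult.commute)
      also have "\<dots> \<le> (1 / real (Suc (r n)) * \<bar>q n\<bar>) / \<bar>q n\<bar>"
        using yU[of "r n"] by (intro divide_right_mono) (auto simp: q_def)
      also have "\<dots> = 1 / real (Suc (r n))" using q[of n] by (simp del: of_nat_Suc)
      finally show "norm ((U (s (r n)) *v y (r n)) /\<^sub>R q n) \<le> 1 / real (Suc (r n))" .
    qed
  qed
  have "(Y t1 *v z) \<bullet> (dU t1 *v z) = 0" using LIMSEQ_unique[OF L1[unfolded L2] L3] by simp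
  then have "(P t1 *v (dU t1 *v z)) \<bullet> (dU t1 *v z) = 0" using momentum[OF t1, of z] Uz by simp
  then have "dU t1 *v z = 0" using P_positive[OF bounded t1, of "dU t1 *v z"] by (metis less_irrefl)
  then have "Y t1 *v z = 0" using momentum[OF t1, of z] Uz by simp
  then have "z = 0" by (rule nondegenerate[OF t1 Uz])
  then show False using z1 by simp
qed

definition kernel :: "real \<Rightarrow> (real^'n) set" where
  "kernel t = {x. U t *v x = 0}"

lemma subspace_kernel: "subspace (kernel t)"
  unfolding kernel_def by (auto simp: subspace_def matrix_vector_right_distrib matrix_vector_mult_scaleR)

lemma invertible_U_iff: "invertible (U t) \<longleftrightarrow> kernel t = {0}"
  unfolding kernel_def invertible_left_inverse matrix_left_invertible_ker by auto

lemma invertible_U_near: "t1 \<in> einterval a b \<Longrightarrow> \<forall>\<^sub>F t in at t1. invertible (U t)"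
proof -
  assume t1: "t1 \<in> einterval a b"
  obtain \<kappa> \<delta> where k: "\<kappa> > 0" "\<delta> > 0" "\<And>t x. 0 < \<bar>t - t1\<bar> \<Longrightarrow> \<bar>t - t1\<bar> < \<delta> \<Longrightarrow> \<kappa> * \<bar>t - t1\<bar> * norm x \<le> norm (U t *v x)"
    using pole_order[OF t1] by blast
  have "invertible (U t)" if "t \<noteq> t1" "dist t t1 < \<delta>" for t unfolding invertible_U_iff kernel_def
  proof -
    have "x = 0" if "U t *v x = 0" for x
    proof (rule ccontr)
      assume "x \<noteq> 0"
      have pos: "0 < \<bar>t - t1\<bar>" "\<bar>t - t1\<bar> < \<delta>" using \<open>t \<noteq> t1\<close> \<open>dist t t1 < \<delta>\<close> by (auto simp: dist_real_def)
      have "0 < \<kappa> * \<bar>t - t1\<bar> * norm x" using pos k(1) \<open>x \<noteq> 0\<close> by simp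
      then show False using k(3)[OF pos, of x] that by simp
    qed
    then show "{x. U t *v x = 0} = {0}" by auto
  qed
  then show ?thesis using k(2) unfolding eventually_at by blast
qed

definition conjugate_points :: "real set" where
  "conjugate_points = {t \<in> einterval a b. kernel t \<noteq> {0}}"

lemma finite_conjugate_points:
  assumes pq: "{p..q} \<subseteq> einterval a b"
  shows "finite (conjugate_points \<inter> {p..q})"
proof (rule ccontr)
  assume "infinite (conjugate_points \<inter> {p..q})"
  then obtain t where t: "t \<in> {p..q}" "t islimpt (conjugate_points \<inter> {p..q})"
    using compact_Icc[of p q] unfolding compact_eq_Bolzano_Weierstrass by (metis Int_lower2)
  then have "t \<in> einterval a b" using pq by blast
  from invertible_U_near[OF this] obtain e where e: "0 < e" "\<And>s. s \<noteq> t \<Longrightarrow> dist s t < e \<Longrightarrow> invertible (U s)"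
    unfolding eventually_at by blast
  obtain s where "s \<in> conjugate_points \<inter> {p..q}" "s \<noteq> t" "dist s t < e"
    using t(2) e(1) unfolding islimpt_approachable by blast
  then show False using e(2)[of s] by (auto simp: conjugate_points_def invertible_U_iff)
qed

text \<open>
  As many linear conditions as the dimension of the kernel cut out the range of \<open>U\<close>.
\<close>

lemma range_functionals:
  "\<exists>E. finite E \<and> card E = dim (kernel t) \<and> (\<forall>v. (\<forall>e\<in>E. v \<bullet> e = 0) \<longrightarrow> (\<exists>x. U t *v x = v))"
proof -
  define V where "V = range (\<lambda>x. U t *v x)"
  define K where "K = kernel t"
  have lin: "linear (\<lambda>x. U t *v x)" by (rule matrix_vector_mul_linear)
  have sV: "subspace V" unfolding V_def by (rule linear_subspace_image[OF lin subspace_UNIV])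
  have sK: "subspace K" unfolding K_def by (rule subspace_kernel)
  define K' where "K' = {y \<in> UNIV. \<forall>x\<in>K. orthogonal x y}"
  have sK': "subspace K'" unfolding K'_def subspace_def by (auto simp: orthogonal_def inner_add_right)
  have d1: "dim K' + dim K = CARD('n)"
    using dim_subspace_orthogonal_to_vectors[OF sK subspace_UNIV] by (simp add: K'_def)
  have "V = (\<lambda>x. U t *v x) ` K'"
  proof (intro equalityI subsetI)
    fix v assume "v \<in> V"
    then obtain x where x: "v = U t *v x" by (auto simp: V_def)
    obtain k y where ky: "k \<in> span K" "\<And>w. w \<in> span K \<Longrightarrow> orthogonal y w" "x = k + y"
      using orthogonal_subspace_decomp_exists[of K x] by blast
    have sp: "span K = K" using sK by (simp add: span_eq_iff)
    have "k \<in> K" using ky(1) sp by simp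
    then have "U t *v k = 0" by (simp add: K_def kernel_def)
    then have "v = U t *v y" unfolding x ky(3) by (simp add: matrix_vector_right_distrib)
    moreover have "y \<in> K'" unfolding K'_def using ky(2) sp by (simp add: orthogonal_commute)
    ultimately show "v \<in> (\<lambda>x. U t *v x) ` K'" by blast
  qed (auto simp: V_def)
  moreover have "inj_on (\<lambda>x. U t *v x) (span K')" unfolding linear_injective_on_subspace_0[OF lin subspace_span]
  proof (intro ballI impI)
    fix x assume x: "x \<in> span K'" "U t *v x = 0"
    have "x \<in> K'" using x(1) sK' by (simp add: span_eq_iff[THEN iffD2])
    moreover have "x \<in> K" using x(2) by (simp add: K_def kernel_def)
    ultimately have "orthogonal x x" by (auto simp: K'_def)
    then show "x = 0" by (simp add: orthogonal_self)
  qed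
  ultimately have d2: "dim V = dim K'" using dim_image_eq[OF lin] by simp
  define C where "C = {y \<in> UNIV. \<forall>x\<in>V. orthogonal x y}"
  have d3: "dim C + dim V = CARD('n)"
    using dim_subspace_orthogonal_to_vectors[OF sV subspace_UNIV] by (simp add: C_def)
  obtain E where E: "E \<subseteq> C" "independent E" "C \<subseteq> span E" "card E = dim C" using basis_exists[of C] by blast
  have "finite E" using E(2) by (rule independent_imp_finite)
  moreover have "card E = dim (kernel t)" using E(4) d1 d2 d3 by (simp add: K_def)
  moreover have "\<exists>x. U t *v x = v" if v: "\<forall>e\<in>E. v \<bullet> e = 0" for v
  proof -
    have CV: "C = V\<^sup>\<bottom>" by (auto simp: C_def orthogonal_comp_def)
    have "orthogonal v y" if "y \<in> span E" for y
      using that by (rule orthogonal_to_span) (use v in \<open>auto simp: orthogonal_def\<close>)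
    then have "v \<in> C\<^sup>\<bottom>" using E(3) by (auto simp: orthogonal_comp_def orthogonal_commute)
    then have "v \<in> V" using orthogonal_comp_self[OF sV] CV by simp
    then show ?thesis by (auto simp: V_def)
  qed
  ultimately show ?thesis by blast
qed

end

context conjugate
begin

section \<open>Picone's identity\<close>

text \<open>
  Picone's identity.  With \<open>v = U \<eta>\<close> the form integrand exceeds the derivative of \<open>\<langle>v, Y \<eta>\<rangle>\<close> by
  \<open>\<langle>P U \<eta>', U \<eta>'\<rangle> \<ge> 0\<close>.  At a conjugate point \<open>\<eta>\<close> may be discontinuous; since \<open>v\<close> lies in the range of \<open>U\<close>
  there, the linear lower bound for \<open>U\<close> keeps \<open>\<eta>\<close> bounded, and the isotropy relation makes the boundary
  function \<open>\<langle>v, Y \<eta>\<rangle>\<close> continuous.  Hence the fundamental theorem of calculus holds across the finitely many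
  conjugate points.
\<close>

lemma form_nonneg:
  assumes dv: "\<And>t. (v has_vector_derivative v' t) (at t)" and v': "continuous_on UNIV v'"
    and vt: "v \<in> test_functions a b" and pq: "p < q" "{p..q} \<subseteq> einterval a b"
    and z: "\<And>t. t \<notin> {p<..<q} \<Longrightarrow> v t = 0" "\<And>t. t \<notin> {p<..<q} \<Longrightarrow> v' t = 0"
    and rep: "\<And>t. t \<in> {p..q} \<Longrightarrow> \<exists>x. U t *v x = v t"
  shows "0 \<le> form v v"
proof -
  define \<eta> where "\<eta> t = (SOME x. U t *v x = v t)" for t
  have \<eta>: "U t *v \<eta> t = v t" if "t \<in> {p..q}" for t unfolding \<eta>_def using rep[OF that] by (rule someI_ex)
  define F where "F t = v t \<bullet> (Y t *v \<eta> t)" for t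
  have F_eq: "F t = v t \<bullet> (Y t *v x)" if t: "t \<in> {p..q}" and x: "U t *v x = v t" for t x
  proof -
    have tI: "t \<in> einterval a b" using t pq by blast
    have "v t \<bullet> (Y t *v (\<eta> t - x)) = (Y t *v x) \<bullet> (U t *v (\<eta> t - x))"
      unfolding x[symmetric] using isotropic[OF tI, of x "\<eta> t - x"] by simp
    also have "\<dots> = 0" using \<eta>[OF t] x by (simp add: matrix_vector_mult_diff_distrib)
    finally show ?thesis by (simp add: F_def matrix_vector_mult_diff_distrib inner_diff_right)
  qed
  obtain K where K: "K > 0" "\<And>(A :: real^'n^'n) (x :: real^'n). norm (A *v x) \<le> norm A * norm x * K"
    using bounded_bilinear.pos_bounded[OF bounded_bilinear_matrix_vector] by blast
  have vlim: "(v \<longlongrightarrow> v t) (at t)" for t using has_vector_derivative_continuous[OF dv] by (simp add: isCont_def)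
  have Fcont: "continuous_on {p..q} F" unfolding continuous_on_def
  proof
    fix t1 assume t1: "t1 \<in> {p..q}"
    then have t1I: "t1 \<in> einterval a b" using pq by blast
    define c0 where "c0 = \<eta> t1"
    define r where "r t = v t - U t *v c0" for t
    have r1: "r t1 = 0" using \<eta>[OF t1] by (simp add: r_def c0_def)
    have dr: "(r has_vector_derivative v' t1 - dU t1 *v c0) (at t1)" unfolding r_def
      using has_vector_derivative_diff[OF dv has_vector_derivative_matrix_vector[OF U_derivative[OF t1I] has_vector_derivative_const[of c0]]] by simp
    define M where "M = norm (v' t1 - dU t1 *v c0) + 1"
    have M0: "0 < M" by (simp add: M_def add_nonneg_pos)
    have "((\<lambda>t. norm ((r t - r t1) /\<^sub>R (t - t1))) \<longlongrightarrow> norm (v' t1 - dU t1 *v c0)) (at t1)"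
      by (intro tendsto_norm) (use dr in \<open>simp add: has_vector_derivative_iff_quotient\<close>)
    then have rM: "\<forall>\<^sub>F t in at t1. norm ((r t - r t1) /\<^sub>R (t - t1)) < M" by (rule order_tendstoD(2)) (simp add: M_def)
    obtain \<kappa> \<delta> where k: "\<kappa> > 0" "\<delta> > 0" "\<And>t x. 0 < \<bar>t - t1\<bar> \<Longrightarrow> \<bar>t - t1\<bar> < \<delta> \<Longrightarrow> \<kappa> * \<bar>t - t1\<bar> * norm x \<le> norm (U t *v x)"
      using pole_order[OF t1I] by blast
    have near: "\<forall>\<^sub>F t in at t1. 0 < \<bar>t - t1\<bar> \<and> \<bar>t - t1\<bar> < \<delta>" using k(2) by (auto simp: eventually_at dist_real_def)
    have within: "at t1 within {p..q} \<le> at t1" by (simp add: at_le)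
    have rlim: "(r \<longlongrightarrow> 0) (at t1)" using has_vector_derivative_continuous[OF dr] r1 by (simp add: isCont_def)
    have Ylim: "(Y \<longlongrightarrow> Y t1) (at t1)" by (rule Y_cont_at[OF t1I])
    have bound: "\<forall>\<^sub>F t in at t1 within {p..q}. norm (F t - v t \<bullet> (Y t *v c0)) \<le>
        norm (r t) * (norm (Y t) * (M / \<kappa>) * K + norm (Y t *v c0))"
    proof -
      have ev: "\<forall>\<^sub>F t in at t1 within {p..q}. t \<in> {p..q}" by (simp add: eventually_at_filter)
      show ?thesis using filter_leD[OF within rM] filter_leD[OF within near] ev
      proof eventually_elim
        case (elim t)
        then have 1: "norm ((r t - r t1) /\<^sub>R (t - t1)) < M" and 2: "0 < \<bar>t - t1\<bar>" "\<bar>t - t1\<bar> < \<delta>" and t: "t \<in> {p..q}" by auto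
        have tI: "t \<in> einterval a b" using t pq by blast
        define y where "y = \<eta> t - c0"
        have Uy: "U t *v y = r t" using \<eta>[OF t] by (simp add: y_def r_def matrix_vector_mult_diff_distrib)
        have "norm ((r t - r t1) /\<^sub>R (t - t1)) = norm (r t) / \<bar>t - t1\<bar>" by (simp add: r1 divide_inverse mult.commute)
        then have rb: "norm (r t) \<le> M * \<bar>t - t1\<bar>" using 1 2(1) by (simp add: pos_divide_less_eq)
        have "\<bar>t - t1\<bar> * (\<kappa> * norm y) \<le> \<bar>t - t1\<bar> * M" using k(3)[OF 2, of y] rb unfolding Uy by (simp add: mult_ac)
        then have "\<kappa> * norm y \<le> M" using 2(1) by (rule mult_left_le_imp_le)
        then have yb: "norm y \<le> M / \<kappa>" using k(1) by (simp add: pos_le_divide_eq mult.commute)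
        have "F t - v t \<bullet> (Y t *v c0) = v t \<bullet> (Y t *v y)"
          by (simp add: F_def y_def matrix_vector_mult_diff_distrib inner_diff_right)
        also have "\<dots> = r t \<bullet> (Y t *v y) + (U t *v c0) \<bullet> (Y t *v y)" by (simp add: r_def inner_diff_left)
        also have "(U t *v c0) \<bullet> (Y t *v y) = (Y t *v c0) \<bullet> r t" using isotropic[OF tI, of c0 y] by (simp add: Uy)
        finally have "norm (F t - v t \<bullet> (Y t *v c0)) \<le> \<bar>r t \<bullet> (Y t *v y)\<bar> + \<bar>(Y t *v c0) \<bullet> r t\<bar>" by simp
        also have "\<dots> \<le> norm (r t) * norm (Y t *v y) + norm (Y t *v c0) * norm (r t)"
          by (intro add_mono Cauchy_Schwarz_ineq2)
        also have "\<dots> \<le> norm (r t) * (norm (Y t) * (M / \<kappa>) * K) + norm (Y t *v c0) * norm (r t)"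
        proof -
          have "norm (Y t *v y) \<le> norm (Y t) * norm y * K" by (rule K(2))
          also have "\<dots> \<le> norm (Y t) * (M / \<kappa>) * K" using yb K(1) by (intro mult_right_mono mult_left_mono) auto
          finally show ?thesis by (intro add_right_mono mult_left_mono) auto
        qed
        finally show ?case by (simp add: algebra_simps)
      qed
    qed
    have "((\<lambda>t. F t - v t \<bullet> (Y t *v c0)) \<longlongrightarrow> 0) (at t1 within {p..q})"
    proof (rule Lim_null_comparison[OF bound])
      have "((\<lambda>t. norm (r t) * (norm (Y t) * (M / \<kappa>) * K + norm (Y t *v c0))) \<longlongrightarrow>
          norm (0 :: real^'n) * (norm (Y t1) * (M / \<kappa>) * K + norm (Y t1 *v c0))) (at t1)"
        by (intro tendsto_intros rlim Ylim tendsto_matrix_vector)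
      then show "((\<lambda>t. norm (r t) * (norm (Y t) * (M / \<kappa>) * K + norm (Y t *v c0))) \<longlongrightarrow> 0) (at t1 within {p..q})"
        using tendsto_mono[OF within] by simp
    qed
    moreover have "((\<lambda>t. v t \<bullet> (Y t *v c0)) \<longlongrightarrow> v t1 \<bullet> (Y t1 *v c0)) (at t1 within {p..q})"
      by (rule tendsto_mono[OF within]) (intro tendsto_inner tendsto_matrix_vector vlim Ylim tendsto_const)
    ultimately have "((\<lambda>t. (F t - v t \<bullet> (Y t *v c0)) + v t \<bullet> (Y t *v c0)) \<longlongrightarrow> 0 + v t1 \<bullet> (Y t1 *v c0)) (at t1 within {p..q})"
      by (rule tendsto_add)
    then show "(F \<longlongrightarrow> F t1) (at t1 within {p..q})" by (simp add: F_def[abs_def] c0_def)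
  qed
  define T where "T = conjugate_points \<inter> {p..q}"
  have T: "finite T" unfolding T_def by (rule finite_conjugate_points[OF pq(2)])
  have Fderiv: "\<exists>D. (F has_vector_derivative D) (at t) \<and> D \<le> integrand t (v t) (v' t) (v t) (v' t)"
    if t: "t \<in> {p<..<q} - T" for t
  proof -
    have tpq: "t \<in> {p..q}" using t by auto
    then have tI: "t \<in> einterval a b" using pq by blast
    have inv: "invertible (U t)" using t tI by (auto simp: T_def conjugate_points_def invertible_U_iff)
    have invn: "\<forall>\<^sub>F s in at t. invertible (U s)" by (rule invertible_U_near[OF tI])
    define h where "h s = matrix_inv (U s) *v v s" for s
    obtain Dh where Dh: "(h has_vector_derivative Dh) (at t)"
      unfolding h_def using has_vector_derivative_matrix_vector[OF has_vector_derivative_matrix_inv[OF U_derivative[OF tI] invn inv] dv] by blast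
    obtain e where e: "0 < e" "\<And>s. s \<noteq> t \<Longrightarrow> dist s t < e \<Longrightarrow> invertible (U s)"
      using invn unfolding eventually_at by blast
    have invs: "invertible (U s)" if "s \<in> ball t e" for s
      using e(2)[of s] inv that by (cases "s = t") (auto simp: dist_commute)
    have Uh: "U s *v h s = v s" if "s \<in> ball t e" for s
      by (simp add: h_def matrix_vector_mul_assoc matrix_inv_mult[OF invs[OF that]])
    have tb: "t \<in> ball t e" using e(1) by simp
    define x y where "x = U t *v Dh" and "y = dU t *v h t"
    have "((\<lambda>s. U s *v h s) has_vector_derivative x + y) (at t)"
      unfolding x_def y_def by (rule has_vector_derivative_matrix_vector[OF U_derivative[OF tI] Dh])
    then have "(v has_vector_derivative x + y) (at t)"
      by (rule has_vector_derivative_transform_within_open[OF _ open_ball tb]) (rule Uh)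
    then have v'xy: "v' t = x + y" using dv vector_derivative_unique_at by blast
    have "((\<lambda>s. v s \<bullet> (Y s *v h s)) has_vector_derivative
        v t \<bullet> (Y t *v Dh + (transpose (Q t) ** dU t + R t ** U t) *v h t) + v' t \<bullet> (Y t *v h t)) (at t)"
      by (intro bounded_bilinear.has_vector_derivative[OF bounded_bilinear_inner] dv
        has_vector_derivative_matrix_vector Y_derivative[OF tI] Dh)
    moreover have "open (ball t e \<inter> {p<..<q})" "t \<in> ball t e \<inter> {p<..<q}" using t tb by auto
    moreover have "v s \<bullet> (Y s *v h s) = F s" if "s \<in> ball t e \<inter> {p<..<q}" for s
      using F_eq[of s "h s"] Uh[of s] that by auto
    ultimately have FD: "(F has_vector_derivative
        v t \<bullet> (Y t *v Dh + (transpose (Q t) ** dU t + R t ** U t) *v h t) + v' t \<bullet> (Y t *v h t)) (at t)"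
      by (rule has_vector_derivative_transform_within_open)
    have Uht: "U t *v h t = v t" by (rule Uh[OF tb])
    have Yh: "Y t *v h t = P t *v y + Q t *v v t" using momentum[OF tI, of "h t"] by (simp add: y_def Uht)
    have vY: "v t \<bullet> (Y t *v Dh) = (P t *v y + Q t *v v t) \<bullet> x"
      using isotropic[OF tI, of "h t" Dh] by (simp add: Uht Yh x_def)
    have tr: "v t \<bullet> (transpose (Q t) *v y) = (Q t *v v t) \<bullet> y"
      using transpose_inner[of "Q t" y "v t"] by (simp add: inner_commute)
    have Pxy: "(P t *v x) \<bullet> y = (P t *v y) \<bullet> x"
      using transpose_inner[of "P t" x y] transpose_P[OF tI] by (simp add: inner_commute)
    have D: "v t \<bullet> (Y t *v Dh + (transpose (Q t) ** dU t + R t ** U t) *v h t) + v' t \<bullet> (Y t *v h t) =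
        (P t *v y + Q t *v v t) \<bullet> x + (Q t *v v t) \<bullet> y + v t \<bullet> (R t *v v t) + (x + y) \<bullet> (P t *v y + Q t *v v t)"
      by (simp only: inner_add_right[of "v t"] vY matrix_vector_mult_add_rdistrib matrix_vector_mul_assoc[symmetric]
          y_def[symmetric] Uht tr Yh v'xy add.assoc)
    have "integrand t (v t) (v' t) (v t) (v' t) -
        (v t \<bullet> (Y t *v Dh + (transpose (Q t) ** dU t + R t ** U t) *v h t) + v' t \<bullet> (Y t *v h t)) = (P t *v x) \<bullet> x"
      unfolding D unfolding integrand_def v'xy
      using Pxy by (simp add: matrix_vector_right_distrib inner_add_left inner_add_right inner_commute)
    moreover have "0 \<le> (P t *v x) \<bullet> x" by (rule legendre_nonneg[OF bounded tI])
    ultimately have "v t \<bullet> (Y t *v Dh + (transpose (Q t) ** dU t + R t ** U t) *v h t) + v' t \<bullet> (Y t *v h t)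
        \<le> integrand t (v t) (v' t) (v t) (v' t)" by linarith
    with FD show ?thesis by (rule_tac exI) (rule conjI)
  qed
  then have "\<forall>t\<in>{p<..<q} - T. \<exists>D. (F has_vector_derivative D) (at t) \<and> D \<le> integrand t (v t) (v' t) (v t) (v' t)"
    by (rule ballI)
  from bchoice[OF this] obtain D where D': "\<forall>t\<in>{p<..<q} - T. (F has_vector_derivative D t) (at t) \<and>
      D t \<le> integrand t (v t) (v' t) (v t) (v' t)" by (rule exE)
  have D: "(F has_vector_derivative D t) (at t)" "D t \<le> integrand t (v t) (v' t) (v t) (v' t)"
    if "t \<in> {p<..<q} - T" for t using bspec[OF D' that] by simp_all
  define D' where "D' t = (if t \<in> {p<..<q} - T then D t else integrand t (v t) (v' t) (v t) (v' t))" for t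
  have "(D' has_integral (F q - F p)) {p..q}"
  proof (rule fundamental_theorem_of_calculus_interior_strong[OF T _ _ Fcont])
    show "(F has_vector_derivative D' t) (at t)" if "t \<in> {p<..<q} - T" for t
      unfolding D'_def using D(1)[OF that] that by simp
  qed (use pq in simp)
  moreover have "F q - F p = 0" using z(1)[of p] z(1)[of q] by (simp add: F_def)
  ultimately have D0: "(D' has_integral 0) {p..q}" by simp
  have vc: "continuous_on S v" for S by (meson dv continuous_at_imp_continuous_on has_vector_derivative_continuous)
  have v'c: "continuous_on S v'" for S by (rule continuous_on_subset[OF v']) simp
  have ic: "continuous_on {p..q} (\<lambda>t. integrand t (v t) (v' t) (v t) (v' t))"
    by (intro continuous_integrand pq vc v'c)
  have iI: "integrable lborel (\<lambda>t. integrand t (v t) (v' t) (v t) (v' t))"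
    by (rule compactly_supported_borel(2)[OF ic]) (use z in \<open>auto simp: integrand_linear\<close>)
  have I: "((\<lambda>t. integrand t (v t) (v' t) (v t) (v' t)) has_integral form v v) UNIV"
    unfolding form_eq_integrand[OF vt dv dv v'] by (rule has_integral_integral_lborel[OF iI])
  have E: "(if t \<in> {p..q} then integrand t (v t) (v' t) (v t) (v' t) else 0) = integrand t (v t) (v' t) (v t) (v' t)" for t
  proof (cases "t \<in> {p..q}")
    case False
    then have "v t = 0" "v' t = 0" using z(1)[of t] z(2)[of t] by auto
    then show ?thesis using False by (simp only: integrand_linear if_False)
  qed simp
  have "((\<lambda>t. if t \<in> {p..q} then integrand t (v t) (v' t) (v t) (v' t) else 0) has_integral form v v) UNIV"
    unfolding E by (rule I)
  then have "((\<lambda>t. integrand t (v t) (v' t) (v t) (v' t)) has_integral form v v) {p..q}"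
    by (simp only: has_integral_restrict_UNIV)
  from D0 this show ?thesis
  proof (rule has_integral_le)
    show "D' t \<le> integrand t (v t) (v' t) (v t) (v' t)" for t unfolding D'_def using D(2)[of t] by simp
  qed
qed

end

section \<open>The upper bound for the index\<close>

lemma derivative_vanishes:
  fixes v :: "real \<Rightarrow> 'a::real_normed_vector"
  assumes dv: "\<And>t. (v has_vector_derivative v' t) (at t)" and v': "continuous_on UNIV v'" and pq: "p < q"
    and z: "\<And>t. t \<notin> {p<..<q} \<Longrightarrow> v t = 0" and t: "t \<notin> {p<..<q}"
  shows "v' t = 0"
proof (rule ccontr)
  \<comment> \<open>A nonzero value of the continuous derivative would persist at points where \<open>v\<close> vanishes locally.\<close>
  assume "v' t \<noteq> 0"
  have "(v' \<longlongrightarrow> v' t) (at t)" using v' by (simp add: continuous_on_def)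
  then have "\<forall>\<^sub>F s in at t. v' s \<noteq> 0" by (rule tendsto_imp_eventually_ne) (rule \<open>v' t \<noteq> 0\<close>)
  then obtain e where e: "0 < e" "\<And>s. s \<noteq> t \<Longrightarrow> dist s t < e \<Longrightarrow> v' s \<noteq> 0" unfolding eventually_at by blast
  obtain s where s: "s \<noteq> t" "dist s t < e" "s \<in> - {p..q}"
  proof (cases "t \<le> p")
    case True
    show thesis by (rule that[of "t - e / 2"]) (use True e(1) pq in \<open>auto simp: dist_real_def\<close>)
  next
    case False
    then have "q \<le> t" using t by auto
    show thesis by (rule that[of "t + e / 2"]) (use \<open>q \<le> t\<close> e(1) pq in \<open>auto simp: dist_real_def\<close>)
  qed
  have "(v has_vector_derivative 0) (at s)"
  proof (rule has_vector_derivative_transform_within_open[OF has_vector_derivative_const])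
    show "open (- {p..q})" "s \<in> - {p..q}" using s(3) by (auto simp: open_Compl)
    show "0 = v x" if "x \<in> - {p..q}" for x using z[of x] that by auto
  qed
  from vector_derivative_unique_at[OF this dv] show False using e(2)[OF s(1,2)] by simp
qed

lemma underdetermined_system:
  fixes A :: "'i \<Rightarrow> 'j \<Rightarrow> real"
  assumes "finite J" "finite I" "card J < card I"
  shows "\<exists>c. (\<exists>i\<in>I. c i \<noteq> 0) \<and> (\<forall>j\<in>J. (\<Sum>i\<in>I. c i * A i j) = 0)" using assms
proof (induction J arbitrary: I A rule: finite_induct)
  case empty
  then have "I \<noteq> {}" by auto
  then show ?case by (intro exI[of _ "\<lambda>_. 1"]) auto
next
  case (insert j J)
  show ?case
  proof (cases "\<forall>i\<in>I. A i j = 0")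
    case True
    have "card J < card I" using insert by simp
    from insert.IH[OF insert.prems(1) this, of A] show ?thesis using True by auto
  next
    case False
    then obtain m where m: "m \<in> I" "A m j \<noteq> 0" by blast
    define A' where "A' i l = A i l - A i j / A m j * A m l" for i l
    have "card J < card (I - {m})" using insert m by simp
    from insert.IH[OF _ this, of A'] insert.prems(1) obtain c where c: "\<exists>i\<in>I - {m}. c i \<noteq> 0"
      "\<And>l. l \<in> J \<Longrightarrow> (\<Sum>i\<in>I - {m}. c i * A' i l) = 0" by auto
    define c' where "c' i = (if i = m then - (\<Sum>i\<in>I - {m}. c i * A i j) / A m j else c i)" for i
    have sum: "(\<Sum>i\<in>I. c' i * A i l) = (\<Sum>i\<in>I - {m}. c i * A i l) - (\<Sum>i\<in>I - {m}. c i * A i j) / A m j * A m l" for l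
    proof -
      have "(\<Sum>i\<in>I. c' i * A i l) = c' m * A m l + (\<Sum>i\<in>I - {m}. c' i * A i l)"
        by (rule sum.remove[OF insert.prems(1) m(1)])
      also have "(\<Sum>i\<in>I - {m}. c' i * A i l) = (\<Sum>i\<in>I - {m}. c i * A i l)" by (intro sum.cong) (auto simp: c'_def)
      finally show ?thesis by (simp add: c'_def)
    qed
    have "(\<Sum>i\<in>I. c' i * A i l) = 0" if "l \<in> insert j J" for l
    proof (cases "l = j")
      case True
      then show ?thesis unfolding sum using m(2) by simp
    next
      case False
      have "(\<Sum>i\<in>I - {m}. c i * A' i l) = (\<Sum>i\<in>I - {m}. c i * A i l) - (\<Sum>i\<in>I - {m}. c i * A i j) / A m j * A m l"
        by (simp add: A'_def right_diff_distrib sum_subtractf sum_distrib_right sum_divide_distrib mult.assoc)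
      then show ?thesis unfolding sum using c(2)[of l] that False by simp
    qed
    moreover have "\<exists>i\<in>I. c' i \<noteq> 0" using c(1) by (auto simp: c'_def)
    ultimately show ?thesis by blast
  qed
qed

context sturm_liouville
begin

lemma form_add_scale:
  assumes "u \<in> test_functions a b" "v \<in> test_functions a b" "w \<in> test_functions a b"
  shows "form (\<lambda>t. r *\<^sub>R u t + s *\<^sub>R v t) w = r * form u w + s * form v w"
proof -
  have "integrable lborel (\<lambda>t. sl_expression P Q R u t \<bullet> w t)" "integrable lborel (\<lambda>t. sl_expression P Q R v t \<bullet> w t)"
    using assms by (intro square_integrable_inner test_square_integrable; simp)+
  then show ?thesis unfolding form_def sl_expression_add_scale[OF assms(1,2)] by (simp add: inner_add_left)
qed

lemma test_functions_sum:
  assumes "finite I" "\<And>i. i \<in> I \<Longrightarrow> u i \<in> test_functions a b"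
  shows "(\<lambda>t. \<Sum>i\<in>I. c i *\<^sub>R u i t) \<in> test_functions a b" using assms
proof (induction I rule: finite_induct)
  case empty
  obtain m where "m \<in> einterval a b" using einterval_nonempty[OF ab] by blast
  then show ?case by (simp, intro test_functionsI[of _ m m] smooth_const) auto
next
  case (insert i I)
  then show ?case using test_functions_add_scale[of "u i" "\<lambda>t. \<Sum>i\<in>I. c i *\<^sub>R u i t" "c i" 1] by simp
qed

lemma form_sum_left:
  assumes "finite I" "\<And>i. i \<in> I \<Longrightarrow> u i \<in> test_functions a b" "w \<in> test_functions a b"
  shows "form (\<lambda>t. \<Sum>i\<in>I. c i *\<^sub>R u i t) w = (\<Sum>i\<in>I. c i * form (u i) w)" using assms
proof (induction I rule: finite_induct)
  case empty
  have "form (\<lambda>t. 0 *\<^sub>R w t + 0 *\<^sub>R w t) w = 0" using form_add_scale[OF assms(3,3,3), of 0 0] by simp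
  then show ?case by simp
next
  case (insert i I)
  then show ?case
    using form_add_scale[of "u i" "\<lambda>t. \<Sum>i\<in>I. c i *\<^sub>R u i t" w "c i" 1] test_functions_sum[of I u c] by simp
qed

lemma form_sum:
  assumes "finite I" "\<And>i. i \<in> I \<Longrightarrow> u i \<in> test_functions a b"
  shows "form (\<lambda>t. \<Sum>i\<in>I. c i *\<^sub>R u i t) (\<lambda>t. \<Sum>i\<in>I. c i *\<^sub>R u i t) = (\<Sum>i\<in>I. \<Sum>j\<in>I. c i * c j * form (u i) (u j))"
proof -
  let ?v = "\<lambda>t. \<Sum>i\<in>I. c i *\<^sub>R u i t"
  have v: "?v \<in> test_functions a b" by (rule test_functions_sum[OF assms])
  have H: "form (u i) ?v = (\<Sum>j\<in>I. c j * form (u i) (u j))" if i: "i \<in> I" for i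
  proof -
    have "form (u i) ?v = form ?v (u i)" by (rule form_sym[OF assms(2)[OF i] v])
    also have "\<dots> = (\<Sum>j\<in>I. c j * form (u j) (u i))" by (rule form_sum_left[OF assms assms(2)[OF i]])
    also have "\<dots> = (\<Sum>j\<in>I. c j * form (u i) (u j))"
    proof (rule sum.cong[OF refl])
      fix j assume "j \<in> I"
      show "c j * form (u j) (u i) = c j * form (u i) (u j)" using form_sym[OF assms(2)[OF \<open>j \<in> I\<close>] assms(2)[OF i]] by simp
    qed
    finally show ?thesis .
  qed
  have "form ?v ?v = (\<Sum>i\<in>I. c i * form (u i) ?v)" by (rule form_sum_left[OF assms v])
  also have "\<dots> = (\<Sum>i\<in>I. \<Sum>j\<in>I. c i * c j * form (u i) (u j))"
  proof (rule sum.cong[OF refl])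
    fix i assume "i \<in> I"
    show "c i * form (u i) ?v = (\<Sum>j\<in>I. c i * c j * form (u i) (u j))"
      unfolding H[OF \<open>i \<in> I\<close>] by (simp add: sum_distrib_left mult.assoc)
  qed
  finally show ?thesis .
qed

end

context conjugate
begin

text \<open>
  A family larger than the number of conditions at the conjugate points in its support has a nontrivial
  combination that satisfies the hypothesis of Picone's identity at all of these points, so that its form value
  is nonnegative.
\<close>

lemma index_upper_bound:
  assumes u: "\<And>i. i < k \<Longrightarrow> u i \<in> test_functions a b"
    and neg: "negative_definite {..<k} (\<lambda>i j. form (u i) (u j))"
  shows "\<exists>T. finite T \<and> T \<subseteq> conjugate_points \<and> k \<le> (\<Sum>t\<in>T. dim (kernel t))"
proof (cases "k = 0")
  case True
  then show ?thesis by (intro exI[of _ "{}"]) simp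
next
  case False
  have "\<forall>i. \<exists>p q. i < k \<longrightarrow> p < q \<and> {p..q} \<subseteq> einterval a b \<and> (\<forall>t. t \<notin> {p<..<q} \<longrightarrow> u i t = 0)"
    using test_functionsE[OF u ab] by metis
  then obtain p0 q0 where pq0: "\<And>i. i < k \<Longrightarrow> p0 i < q0 i" "\<And>i. i < k \<Longrightarrow> {p0 i..q0 i} \<subseteq> einterval a b"
    "\<And>i t. i < k \<Longrightarrow> t \<notin> {p0 i<..<q0 i} \<Longrightarrow> u i t = 0" by metis
  define p where "p = Min (p0 ` {..<k})"
  define q where "q = Max (q0 ` {..<k})"
  have ne: "{..<k} \<noteq> {}" using False by auto
  have p: "p \<le> p0 i" "q0 i \<le> q" if "i < k" for i using that by (auto simp: p_def q_def)
  have pI: "p \<in> einterval a b"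
  proof -
    have "p \<in> p0 ` {..<k}" unfolding p_def using ne by (intro Min_in) auto
    then show ?thesis using pq0(1,2) by fastforce
  qed
  have qI: "q \<in> einterval a b"
  proof -
    have "q \<in> q0 ` {..<k}" unfolding q_def using ne by (intro Max_in) auto
    then show ?thesis using pq0(1,2) by fastforce
  qed
  have pq: "p < q" using p[of 0] pq0(1)[of 0] False by simp
  have pqI: "{p..q} \<subseteq> einterval a b" by (rule einterval_Icc[OF pI qI])
  define T where "T = conjugate_points \<inter> {p..q}"
  have T: "finite T" unfolding T_def by (rule finite_conjugate_points[OF pqI])
  have "\<forall>t. \<exists>E. finite E \<and> card E = dim (kernel t) \<and> (\<forall>v. (\<forall>e\<in>E. v \<bullet> e = 0) \<longrightarrow> (\<exists>x. U t *v x = v))"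
    using range_functionals by blast
  then obtain E where E: "\<And>t. finite (E t)" "\<And>t. card (E t) = dim (kernel t)"
    "\<And>t v. (\<And>e. e \<in> E t \<Longrightarrow> v \<bullet> e = 0) \<Longrightarrow> \<exists>x. U t *v x = v" by metis
  have "k \<le> (\<Sum>t\<in>T. dim (kernel t))"
  proof (rule ccontr)
    assume "\<not> ?thesis"
    then have "card (Sigma T E) < card {..<k}" by (simp add: card_SigmaI T E)
    from underdetermined_system[OF _ _ this, of "\<lambda>i (t, e). u i t \<bullet> e"] T E(1)
    obtain c where c: "\<exists>i\<in>{..<k}. c i \<noteq> 0"
      "\<And>t e. t \<in> T \<Longrightarrow> e \<in> E t \<Longrightarrow> (\<Sum>i<k. c i * (u i t \<bullet> e)) = 0" by fastforce
    define v where "v t = (\<Sum>i<k. c i *\<^sub>R u i t)" for t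
    have vt: "v \<in> test_functions a b" unfolding v_def by (rule test_functions_sum) (use u in auto)
    obtain v' where v': "smooth v'" "\<And>t. (v has_vector_derivative v' t) (at t)"
      using smooth_derivative[OF smooth_test_function[OF vt]] by blast
    have z: "v t = 0" if "t \<notin> {p<..<q}" for t
    proof -
      have "u i t = 0" if "i < k" for i using p[OF that] \<open>t \<notin> {p<..<q}\<close> by (intro pq0(3)[OF that]) auto
      then show ?thesis by (simp add: v_def)
    qed
    have z': "v' t = 0" if t: "t \<notin> {p<..<q}" for t
      by (rule derivative_vanishes[OF v'(2) smooth_continuous[OF v'(1)] pq z t])
    have "0 \<le> form v v"
    proof (rule form_nonneg[OF v'(2) smooth_continuous[OF v'(1)] vt pq pqI z z'])
      fix t assume t: "t \<in> {p..q}"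
      show "\<exists>x. U t *v x = v t"
      proof (cases "t \<in> T")
        case True
        show ?thesis
        proof (rule E(3))
          fix e assume "e \<in> E t"
          from c(2)[OF True this] show "v t \<bullet> e = 0" by (simp add: v_def inner_sum_left)
        qed
      next
        case False
        then have "invertible (U t)" using t pqI by (auto simp: T_def conjugate_points_def invertible_U_iff)
        then have "U t *v (matrix_inv (U t) *v v t) = v t" by (simp add: matrix_vector_mul_assoc matrix_inv_mult)
        then show ?thesis by blast
      qed
    qed
    moreover have "form v v = (\<Sum>i<k. \<Sum>j<k. c i * c j * form (u i) (u j))"
      unfolding v_def by (rule form_sum) (use u in auto)
    moreover have "\<dots> < 0" using neg c(1) unfolding negative_definite_def by blast
    ultimately show False by simp
  qed
  then show ?thesis using T by (intro exI[of _ T]) (auto simp: T_def)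
qed

end

section \<open>Limits of the quadratic form\<close>

lemma smooth_bump:
  assumes "0 < d"
  shows "\<exists>\<psi> :: real \<Rightarrow> real. smooth \<psi> \<and> \<psi> t = 1 \<and> (\<forall>s. d \<le> \<bar>s - t\<bar> \<longrightarrow> \<psi> s = 0)"
proof -
  obtain k :: nat where k: "1 < real k * d" using reals_Archimedean3[OF assms] by blast
  define z where "z = cutoff (t - d) (t + d) k t"
  have z: "z \<noteq> 0" unfolding z_def using cutoff_pos[of k t "t - d" "t + d"] k by simp
  have s0: "cutoff (t - d) (t + d) k s = 0" if s: "d \<le> \<bar>s - t\<bar>" for s
  proof (rule ccontr)
    assume "cutoff (t - d) (t + d) k s \<noteq> 0"
    from cutoff_support[OF this] have "0 < real k * (s - (t - d))" "0 < real k * (t + d - s)" by simp_all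
    then have "0 < s - (t - d)" "0 < t + d - s" by (simp_all add: zero_less_mult_iff)
    then show False using s by linarith
  qed
  have "smooth (\<lambda>s. inverse z * cutoff (t - d) (t + d) k s)" by (intro smooth_mult smooth_const smooth_cutoff)
  then show ?thesis using z s0 by (intro exI[of _ "\<lambda>s. inverse z * cutoff (t - d) (t + d) k s"]) (simp add: z_def)
qed

lemma integral_by_primitive:
  fixes h F :: "real \<Rightarrow> real"
  assumes cd: "c < d" and F: "continuous_on {c..d} F"
    and d: "\<And>t. t \<in> {c<..<d} \<Longrightarrow> (F has_vector_derivative h t) (at t)"
    and z: "\<And>t. t \<notin> {c<..<d} \<Longrightarrow> h t = 0" and i: "integrable lborel h"
  shows "(LINT t|lborel. h t) = F d - F c"
proof -
  have "(h has_integral (F d - F c)) {c..d}" by (rule fundamental_theorem_of_calculus_interior) (use cd F d in auto)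
  then have "((\<lambda>t. if t \<in> {c..d} then h t else 0) has_integral (F d - F c)) UNIV"
    by (simp only: has_integral_restrict_UNIV)
  moreover have "(if t \<in> {c..d} then h t else 0) = h t" for t using z[of t] by auto
  ultimately have "(h has_integral (F d - F c)) UNIV" by simp
  from has_integral_unique[OF has_integral_integral_lborel[OF i] this] show ?thesis .
qed

context sturm_liouville
begin

lemma integrable_integrand:
  assumes u: "u \<in> test_functions a b" and du: "\<And>t. (u has_vector_derivative u' t) (at t)"
    and f: "\<And>t. (f has_vector_derivative f' t) (at t)" "continuous_on UNIV f'"
  shows "integrable lborel (\<lambda>t. integrand t (u t) (u' t) (f t) (f' t))"
proof -
  obtain v p q where v: "smooth v" "\<And>t. (u has_vector_derivative v t) (at t)"
    "p < q" "{p..q} \<subseteq> einterval a b" "\<And>t. t \<notin> {p<..<q} \<Longrightarrow> u t = 0" "\<And>t. t \<notin> {p<..<q} \<Longrightarrow> v t = 0"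
    using test_functionsE[OF u ab] by metis
  have vu: "u' = v" using v(2) du vector_derivative_unique_at by blast
  have uc: "continuous_on S u" for S by (meson du continuous_at_imp_continuous_on has_vector_derivative_continuous)
  have fc: "continuous_on S f" for S by (meson f(1) continuous_at_imp_continuous_on has_vector_derivative_continuous)
  have f'c: "continuous_on S f'" for S by (rule continuous_on_subset[OF f(2)]) simp
  have ic: "continuous_on {p..q} (\<lambda>t. integrand t (u t) (v t) (f t) (f' t))"
    by (intro continuous_integrand v uc smooth_continuous[OF v(1)] fc f'c)
  show ?thesis unfolding vu
  proof (rule compactly_supported_borel(2)[OF ic])
    show "integrand t (u t) (v t) (f t) (f' t) = 0" if "t \<notin> {p..q}" for t
    proof -
      have "u t = 0" "v t = 0" using v(5)[of t] v(6)[of t] that by auto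
      then show ?thesis by (simp only: integrand_linear)
    qed
  qed simp
qed

lemma form_tendsto:
  assumes cd: "{c<..<d} \<subseteq> einterval a b"
    and M: "\<And>t. t \<in> {c<..<d} \<Longrightarrow> norm (P t) \<le> M \<and> norm (Q t) \<le> M \<and> norm (R t) \<le> M"
    and u: "\<And>k. u k \<in> test_functions a b" "\<And>k t. (u k has_vector_derivative u' k t) (at t)"
      "\<And>k t. t \<notin> {c<..<d} \<Longrightarrow> u k t = 0" "\<And>k t. t \<notin> {c<..<d} \<Longrightarrow> u' k t = 0"
    and f: "\<And>k t. (f k has_vector_derivative f' k t) (at t)" "\<And>k. continuous_on UNIV (f' k)"
    and K: "\<And>k t. norm (u k t) \<le> K" "\<And>k t. norm (u' k t) \<le> K"
      "\<And>k t. t \<in> {c<..<d} \<Longrightarrow> norm (f k t) \<le> K" "\<And>k t. t \<in> {c<..<d} \<Longrightarrow> norm (f' k t) \<le> K"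
    and lim: "\<And>t. (\<lambda>k. u k t) \<longlonglongrightarrow> x t" "\<And>t. (\<lambda>k. u' k t) \<longlonglongrightarrow> x' t"
      "\<And>t. (\<lambda>k. f k t) \<longlonglongrightarrow> y t" "\<And>t. (\<lambda>k. f' k t) \<longlonglongrightarrow> y' t"
  shows "integrable lborel (\<lambda>t. integrand t (x t) (x' t) (y t) (y' t))"
    and "(\<lambda>k. form (u k) (f k)) \<longlonglongrightarrow> (LINT t|lborel. integrand t (x t) (x' t) (y t) (y' t))"
proof -
  define s where "s k t = integrand t (u k t) (u' k t) (f k t) (f' k t)" for k t
  define l where "l t = integrand t (x t) (x' t) (y t) (y' t)" for t
  have si: "integrable lborel (s k)" for k unfolding s_def by (rule integrable_integrand[OF u(1,2) f])
  have sl: "(\<lambda>k. s k t) \<longlonglongrightarrow> l t" for t unfolding s_def l_def integrand_def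
    by (intro tendsto_add tendsto_inner tendsto_matrix_vector tendsto_const lim)
  obtain B where B: "B > 0" "\<And>(A :: real^'n^'n) (x :: real^'n). norm (A *v x) \<le> norm A * norm x * B"
    using bounded_bilinear.pos_bounded[OF bounded_bilinear_matrix_vector] by blast
  have sb: "norm (s k t) \<le> indicator {c<..<d} t * (4 * (M * K * B * K))" for k t
  proof (cases "t \<in> {c<..<d}")
    case False
    then have "s k t = 0" using u(3,4)[OF False] by (simp only: s_def integrand_linear)
    then show ?thesis using False by simp
  next
    case True
    have M0: "0 \<le> M" using M[OF True] order_trans[OF norm_ge_zero] by blast
    have K0: "0 \<le> K" using K(1)[of 0 t] order_trans[OF norm_ge_zero] by blast
    have mv: "norm (A *v z) \<le> M * K * B" if "norm A \<le> M" "norm z \<le> K" for A :: "real^'n^'n" and z :: "real^'n"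
      using order_trans[OF B(2) mult_right_mono[OF mult_mono[OF that M0 norm_ge_zero] less_imp_le[OF B(1)]]] .
    have ip: "\<bar>z \<bullet> z'\<bar> \<le> M * K * B * K" if "norm z \<le> M * K * B" "norm z' \<le> K" for z z' :: "real^'n"
      using order_trans[OF Cauchy_Schwarz_ineq2 mult_mono[OF that _ norm_ge_zero]] M0 K0 B(1) by simp
    note m = M[OF True]
    have "\<bar>(P t *v u' k t) \<bullet> f' k t\<bar> \<le> M * K * B * K" "\<bar>(Q t *v u k t) \<bullet> f' k t\<bar> \<le> M * K * B * K"
      "\<bar>(Q t *v f k t) \<bullet> u' k t\<bar> \<le> M * K * B * K" "\<bar>(R t *v u k t) \<bullet> f k t\<bar> \<le> M * K * B * K"
      using m K(1)[of k t] K(2)[of k t] K(3,4)[OF True, of k] by (intro ip mv; simp)+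
    then have "norm (s k t) \<le> 4 * (M * K * B * K)"
      unfolding s_def integrand_def real_norm_def inner_add_left inner_commute[of "u' k t" "Q t *v f k t"] by linarith
    then show ?thesis using True by simp
  qed
  have wi: "integrable lborel (\<lambda>t. indicator {c<..<d} t * (4 * (M * K * B * K)))"
    by (intro integrable_mult_left integrable_real_indicator emeasure_bounded_finite) auto
  have sm: "s k \<in> borel_measurable lborel" for k using si by (rule borel_measurable_integrable)
  have lm: "l \<in> borel_measurable lborel" by (rule borel_measurable_LIMSEQ_real[OF sl sm])
  show "integrable lborel (\<lambda>t. integrand t (x t) (x' t) (y t) (y' t))" unfolding l_def[symmetric, abs_def]
    by (rule integrable_dominated_convergence[where s=s, OF lm sm wi]) (use sl sb in auto)
  have "(\<lambda>k. LINT t|lborel. s k t) \<longlonglongrightarrow> (LINT t|lborel. l t)"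
    by (rule integral_dominated_convergence[where s=s, OF lm sm wi]) (use sl sb in auto)
  moreover have "form (u k) (f k) = (LINT t|lborel. s k t)" for k
    unfolding s_def by (rule form_eq_integrand[OF u(1,2) f])
  ultimately show "(\<lambda>k. form (u k) (f k)) \<longlonglongrightarrow> (LINT t|lborel. integrand t (x t) (x' t) (y t) (y' t))"
    by (simp add: l_def)
qed

end

context jacobi
begin

text \<open>
  This is where regularity of the endpoint enters: the coefficients extend continuously to \<open>t0\<close> and are
  bounded on segments starting there.
\<close>

lemma bounded_near_base_point:
  fixes f :: "real \<Rightarrow> 'c::real_normed_vector"
  assumes f: "continuous_on (einterval a b) f" and L: "(f \<longlongrightarrow> L) (at t0 within einterval a b)" and t: "t \<in> einterval a b"
  shows "\<exists>C. \<forall>s\<in>closed_segment t0 t - {t0}. norm (f s) \<le> C"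
proof -
  define F where "F s = (if s = t0 then L else f s)" for s
  let ?S = "closed_segment t0 t"
  have "continuous_on ?S F" unfolding continuous_on_def
  proof
    fix x assume x: "x \<in> ?S"
    have eq: "(F \<longlongrightarrow> l) (at y within A)" if "(f \<longlongrightarrow> l) (at y within A)" "t0 \<notin> A" for l y A
      using that(1) by (rule Lim_transform_eventually) (use that(2) in \<open>auto simp: F_def eventually_at_filter\<close>)
    have at: "at t0 within ?S = at t0 within (?S - {t0})" by (simp add: at_within_def)
    show "(F \<longlongrightarrow> F x) (at x within ?S)"
    proof (cases "x = t0")
      case True
      have "(f \<longlongrightarrow> L) (at t0 within (?S - {t0}))" by (rule tendsto_within_subset[OF L segment_subset(1)[OF t]])
      then have "(F \<longlongrightarrow> L) (at t0 within (?S - {t0}))" by (rule eq) simp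
      then show ?thesis unfolding True at by (simp add: F_def)
    next
      case False
      then have xI: "x \<in> einterval a b" using x segment_subset(1)[OF t] by blast
      have t0I: "t0 \<notin> einterval a b" using segment_subset(2) by blast
      have "(f \<longlongrightarrow> f x) (at x within einterval a b)" using f xI by (simp add: continuous_on_def)
      then have "(F \<longlongrightarrow> f x) (at x within einterval a b)" by (rule eq) (rule t0I)
      then have "(F \<longlongrightarrow> f x) (at x)" unfolding at_within_open[OF xI open_einterval] .
      then have "(F \<longlongrightarrow> f x) (at x within ?S)" by (rule tendsto_within_subset) (rule subset_UNIV)
      moreover have "F x = f x" using False by (simp add: F_def)
      ultimately show ?thesis by (simp only:)
    qed
  qed
  then have "compact (F ` ?S)" by (rule compact_continuous_image) simp
  then have "bounded (F ` ?S)" by (rule compact_imp_bounded)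
  then obtain C where C: "\<forall>y\<in>F ` ?S. norm y \<le> C" unfolding bounded_iff by (rule exE)
  have "norm (f s) \<le> C" if "s \<in> ?S - {t0}" for s
  proof -
    have "F s = f s" using that by (simp add: F_def)
    then show ?thesis using bspec[OF C imageI[of s ?S F]] that by simp
  qed
  then show ?thesis by blast
qed

end

context sturm_liouville
begin

lemma form_add_scale_both:
  assumes t: "u \<in> test_functions a b" "v \<in> test_functions a b" "u2 \<in> test_functions a b" "v2 \<in> test_functions a b"
  shows "form (\<lambda>t. p *\<^sub>R u t + q *\<^sub>R v t) (\<lambda>t. p *\<^sub>R u2 t + q *\<^sub>R v2 t) =
    p * p * form u u2 + p * q * (form u v2 + form u2 v) + q * q * form v v2"
proof -
  let ?z = "\<lambda>t. p *\<^sub>R u2 t + q *\<^sub>R v2 t"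
  have z: "?z \<in> test_functions a b" by (rule test_functions_add_scale[OF t(3,4)])
  have r: "form w ?z = p * form w u2 + q * form w v2" if w: "w \<in> test_functions a b" for w
    unfolding form_sym[OF w z] form_add_scale[OF t(3,4) w] form_sym[OF t(3) w] form_sym[OF t(4) w] ..
  show ?thesis unfolding form_add_scale[OF t(1,2) z] r[OF t(1)] r[OF t(2)] form_sym[OF t(3) t(2)]
    by (simp add: algebra_simps)
qed

end

context conjugate
begin

section \<open>The lower bound for the index\<close>

definition lower :: "real \<Rightarrow> real" where "lower t = min t0 t"
definition upper :: "real \<Rightarrow> real" where "upper t = max t0 t"
abbreviation "stretch t \<equiv> {lower t<..<upper t}"
abbreviation "regular \<equiv> regular_along P Q R (at t0 within einterval a b)"
text \<open>
  The sign of \<open>t - t0\<close> on the interval.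
\<close>

definition orientation :: real where "orientation = (if a = ereal t0 then 1 else - 1)"

lemma segment:
  fixes F :: "real \<Rightarrow> real"
  assumes t: "t \<in> einterval a b"
  shows "lower t < upper t" "{lower t..upper t} = closed_segment t0 t" "stretch t \<subseteq> closed_segment t0 t - {t0}"
    "stretch t \<subseteq> einterval a b" "F (upper t) - F (lower t) = orientation * (F t - F t0)"
proof -
  have or: "orientation = (if t0 < t then 1 else - 1)"
  proof (cases "a = ereal t0")
    case True
    then have "orientation = 1" unfolding orientation_def by simp
    moreover have "t0 < t" using t True by (simp add: einterval_iff)
    ultimately show ?thesis by simp
  next
    case False
    then have "b = ereal t0" using endpoint by blast
    then have "\<not> t0 < t" using t by (auto simp: einterval_iff)
    then show ?thesis using False by (simp add: orientation_def)
  qed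
  show lu: "lower t < upper t" using segment_subset(2)[OF t] by (auto simp: lower_def upper_def)
  show "{lower t..upper t} = closed_segment t0 t" by (auto simp: lower_def upper_def closed_segment_eq_real_ivl)
  show sub: "stretch t \<subseteq> closed_segment t0 t - {t0}" by (auto simp: lower_def upper_def closed_segment_eq_real_ivl)
  show "stretch t \<subseteq> einterval a b" using sub segment_subset(1)[OF t] by blast
  show "F (upper t) - F (lower t) = orientation * (F t - F t0)"
    unfolding or using segment_subset(2)[OF t] by (auto simp: lower_def upper_def min_def max_def)
qed

lemma segments_nested:
  assumes "t \<in> einterval a b" "t' \<in> einterval a b"
  shows "stretch t \<subseteq> stretch t' \<or> stretch t' \<subseteq> stretch t"
proof -
  have "t0 < t \<longleftrightarrow> t0 < t'" using endpoint assms by (auto simp: einterval_iff)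
  then show ?thesis using segment_subset(2)[OF assms(1)] segment_subset(2)[OF assms(2)]
    by (cases "t \<le> t'"; cases "t0 < t") (auto simp: lower_def upper_def)
qed

text \<open>
  A solution integrates against any function to a boundary term, since the momentum \<open>Y e\<close> absorbs the form
  integrand.
\<close>

lemma greens_formula:
  assumes t: "t \<in> einterval a b"
    and x: "\<And>s. s \<in> stretch t \<Longrightarrow> x s = U s *v e" "\<And>s. s \<in> stretch t \<Longrightarrow> x' s = dU s *v e"
      "\<And>s. s \<notin> stretch t \<Longrightarrow> x s = 0" "\<And>s. s \<notin> stretch t \<Longrightarrow> x' s = 0"
    and g: "continuous_on {lower t..upper t} g"
      "\<And>s. s \<in> stretch t \<Longrightarrow> (g has_vector_derivative y' s) (at s)"
      "\<And>s. s \<in> stretch t \<Longrightarrow> y s = g s"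
    and i: "integrable lborel (\<lambda>s. integrand s (x s) (x' s) (y s) (y' s))"
  shows "(LINT s|lborel. integrand s (x s) (x' s) (y s) (y' s)) = orientation * ((Y t *v e) \<bullet> g t - e \<bullet> g t0)"
proof -
  have "(LINT s|lborel. integrand s (x s) (x' s) (y s) (y' s)) =
      (Y (upper t) *v e) \<bullet> g (upper t) - (Y (lower t) *v e) \<bullet> g (lower t)"
  proof (rule integral_by_primitive[OF segment(1)[OF t] _ _ _ i])
    have "{lower t..upper t} \<subseteq> insert t0 (einterval a b)"
      unfolding segment(2)[OF t] using segment_subset(1)[OF t] by blast
    then show "continuous_on {lower t..upper t} (\<lambda>s. (Y s *v e) \<bullet> g s)"
      by (intro continuous_on_inner continuous_on_matrix_vector continuous_on_const g(1) continuous_on_subset[OF Y_cont])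
    fix s
    {
      assume s: "s \<in> stretch t"
      have sI: "s \<in> einterval a b" using s segment(4)[OF t] by blast
      have dY: "((\<lambda>s. Y s *v e) has_vector_derivative (transpose (Q s) ** dU s + R s ** U s) *v e) (at s)"
        using has_vector_derivative_matrix_vector[OF Y_derivative[OF sI] has_vector_derivative_const[of e]] by simp
      have "(Y s *v e) \<bullet> y' s + ((transpose (Q s) ** dU s + R s ** U s) *v e) \<bullet> g s =
          integrand s (x s) (x' s) (y s) (y' s)"
        unfolding x(1)[OF s] x(2)[OF s] g(3)[OF s] integrand_def momentum[OF sI]
          matrix_vector_mult_add_rdistrib matrix_vector_mul_assoc[symmetric] inner_add_left transpose_inner by simp
      then show "((\<lambda>s. (Y s *v e) \<bullet> g s) has_vector_derivative integrand s (x s) (x' s) (y s) (y' s)) (at s)"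
        using bounded_bilinear.has_vector_derivative[OF bounded_bilinear_inner dY g(2)[OF s]] by (simp only:)
    }
    assume "s \<notin> stretch t"
    from x(3,4)[OF this] show "integrand s (x s) (x' s) (y s) (y' s) = 0" by (simp only: integrand_linear)
  qed
  also have "\<dots> = orientation * ((Y t *v e) \<bullet> g t - (Y t0 *v e) \<bullet> g t0)"
    by (rule segment(5)[OF t, of "\<lambda>s. (Y s *v e) \<bullet> g s"])
  finally show ?thesis by (simp only: init matrix_vector_mul_lid)
qed

lemma regular_bounds:
  assumes reg: regular and t: "t \<in> einterval a b"
  shows "\<exists>M. \<forall>s\<in>stretch t. norm (P s) \<le> M \<and> norm (Q s) \<le> M \<and> norm (R s) \<le> M"
    and "\<exists>G. \<forall>s\<in>stretch t. norm (dU s *v e) \<le> G"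
proof -
  obtain P0 Q0 R0 where L: "invertible P0" "(P \<longlongrightarrow> P0) (at t0 within einterval a b)"
    "(Q \<longlongrightarrow> Q0) (at t0 within einterval a b)" "(R \<longlongrightarrow> R0) (at t0 within einterval a b)"
    using reg unfolding regular_along_def by blast
  obtain C1 where C1: "\<forall>s\<in>closed_segment t0 t - {t0}. norm (P s) \<le> C1" using bounded_near_base_point[OF continuous_P L(2) t] by blast
  obtain C2 where C2: "\<forall>s\<in>closed_segment t0 t - {t0}. norm (Q s) \<le> C2" using bounded_near_base_point[OF continuous_Q L(3) t] by blast
  obtain C3 where C3: "\<forall>s\<in>closed_segment t0 t - {t0}. norm (R s) \<le> C3" using bounded_near_base_point[OF continuous_R L(4) t] by blast
  have "norm (P s) \<le> max C1 (max C2 C3) \<and> norm (Q s) \<le> max C1 (max C2 C3) \<and> norm (R s) \<le> max C1 (max C2 C3)"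
    if "s \<in> stretch t" for s
  proof -
    have s: "s \<in> closed_segment t0 t - {t0}" using that segment(3)[OF t] by blast
    show ?thesis using bspec[OF C1 s] bspec[OF C2 s] bspec[OF C3 s] by (simp add: le_max_iff_disj)
  qed
  then show "\<exists>M. \<forall>s\<in>stretch t. norm (P s) \<le> M \<and> norm (Q s) \<le> M \<and> norm (R s) \<le> M" by blast
  have inv: "\<forall>\<^sub>F s in at t0 within einterval a b. invertible (P s)"
    unfolding eventually_at_filter using invertible_P by (simp add: always_eventually)
  have sub: "at t0 within einterval a b \<le> at t0 within insert t0 (einterval a b)" by (rule at_le) blast
  have YL: "(Y \<longlongrightarrow> Y t0) (at t0 within einterval a b)" and UL: "(U \<longlongrightarrow> U t0) (at t0 within einterval a b)"
    using Y_cont U_cont by (auto simp: continuous_on_def intro: tendsto_mono[OF sub])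
  have "((\<lambda>s. dU s *v e) \<longlongrightarrow> (matrix_inv P0 ** (Y t0 - Q0 ** U t0)) *v e) (at t0 within einterval a b)" unfolding dU_def
    by (intro tendsto_matrix_vector tendsto_matrix_matrix tendsto_diff tendsto_const YL UL L tendsto_matrix_inv inv)
  moreover have "continuous_on (einterval a b) (\<lambda>s. dU s *v e)" unfolding dU_def
    by (intro continuous_on_matrix_vector continuous_on_matrix_matrix continuous_on_diff continuous_on_const
      continuous_W continuous_Q continuous_on_subset[OF Y_cont] continuous_on_subset[OF U_cont] subset_insertI)
  ultimately obtain G where "\<forall>s\<in>closed_segment t0 t - {t0}. norm (dU s *v e) \<le> G"
    using bounded_near_base_point[OF _ _ t] by blast
  then show "\<exists>G. \<forall>s\<in>stretch t. norm (dU s *v e) \<le> G" using segment(3)[OF t] by blast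
qed

text \<open>
  The sequence \<open>u\<close> of test functions approximates the broken solution that equals \<open>U e\<close> between \<open>t0\<close> and \<open>t\<close>
  and vanishes elsewhere.
\<close>

definition approximates :: "real \<Rightarrow> real^'n \<Rightarrow> (nat \<Rightarrow> real \<Rightarrow> real^'n) \<Rightarrow> (nat \<Rightarrow> real \<Rightarrow> real^'n) \<Rightarrow> real \<Rightarrow> bool" where
  "approximates t e u u' K \<longleftrightarrow>
     (\<forall>k. u k \<in> test_functions a b \<and> continuous_on UNIV (u' k)) \<and>
     (\<forall>k s. (u k has_vector_derivative u' k s) (at s) \<and> norm (u k s) \<le> K \<and> norm (u' k s) \<le> K) \<and>
     (\<forall>k. \<forall>s. s \<notin> stretch t \<longrightarrow> u k s = 0 \<and> u' k s = 0) \<and>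
     (\<forall>s. (\<lambda>k. u k s) \<longlonglongrightarrow> (if s \<in> stretch t then U s *v e else 0)) \<and>
     (\<forall>s. (\<lambda>k. u' k s) \<longlonglongrightarrow> (if s \<in> stretch t then dU s *v e else 0))"

lemma approximants:
  assumes reg: regular and t: "t \<in> einterval a b" and e: "e \<in> kernel t"
  shows "\<exists>u u' K. approximates t e u u' K"
proof -
  obtain G where G: "\<forall>s\<in>stretch t. norm (dU s *v e) \<le> G" using regular_bounds(2)[OF reg t] by blast
  have sub: "{lower t..upper t} \<subseteq> insert t0 (einterval a b)"
    unfolding segment(2)[OF t] using segment_subset(1)[OF t] by blast
  have Uc: "continuous_on {lower t..upper t} (\<lambda>s. U s *v e)"
    by (intro continuous_on_matrix_vector continuous_on_const continuous_on_subset[OF U_cont sub])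
  have z: "U (lower t) *v e = 0" "U (upper t) *v e = 0"
    using e init by (simp_all add: lower_def upper_def min_def max_def kernel_def matrix_vector_mult_0)
  have d: "((\<lambda>s. U s *v e) has_vector_derivative dU s *v e) (at s)" if "s \<in> stretch t" for s
  proof -
    have "s \<in> einterval a b" using that segment(4)[OF t] by blast
    from has_vector_derivative_matrix_vector[OF U_derivative[OF this] has_vector_derivative_const[of e]] show ?thesis by simp
  qed
  have dc: "continuous_on (stretch t) (\<lambda>s. dU s *v e)" unfolding dU_def
    by (intro continuous_on_matrix_vector continuous_on_matrix_matrix continuous_on_diff continuous_on_const
      continuous_on_subset[OF continuous_W segment(4)[OF t]] continuous_on_subset[OF continuous_Q segment(4)[OF t]]
      continuous_on_subset[OF Y_cont order_trans[OF segment(4)[OF t] subset_insertI]]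
      continuous_on_subset[OF U_cont order_trans[OF segment(4)[OF t] subset_insertI]])
  have G': "norm (dU s *v e) \<le> G" if "s \<in> stretch t" for s using G that by blast
  from smooth_approximation[OF segment(1)[OF t] Uc z d dc G'] obtain u u' K where
    u: "\<And>k. smooth (u k)" "\<And>k s. (u k has_vector_derivative u' k s) (at s)"
      "\<And>k. \<exists>e>0. \<forall>s. s \<notin> {lower t + e..upper t - e} \<longrightarrow> u k s = 0"
    and K: "\<And>k s. norm (u k s) \<le> K \<and> norm (u' k s) \<le> K"
    and lim: "\<And>s. (\<lambda>k. u k s) \<longlonglongrightarrow> (if s \<in> stretch t then U s *v e else 0)"
      "\<And>s. (\<lambda>k. u' k s) \<longlonglongrightarrow> (if s \<in> stretch t then dU s *v e else 0)" by blast
  have u'c: "continuous_on UNIV (u' k)" for k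
  proof -
    obtain w where w: "smooth w" "\<And>s. (u k has_vector_derivative w s) (at s)" using smooth_derivative[OF u(1)] by blast
    have "u' k = w" using vector_derivative_unique_at[OF u(2) w(2)] by blast
    then show ?thesis using smooth_continuous[OF w(1)] by simp
  qed
  have z0: "u k s = 0" if "s \<notin> stretch t" for k s
  proof -
    obtain e where e: "0 < e" "\<forall>s. s \<notin> {lower t + e..upper t - e} \<longrightarrow> u k s = 0" using u(3) by blast
    then show ?thesis using that by auto
  qed
  have z1: "u' k s = 0" if "s \<notin> stretch t" for k s by (rule derivative_vanishes[OF u(2) u'c segment(1)[OF t] z0 that])
  have tf: "u k \<in> test_functions a b" for k
  proof -
    obtain e where e: "0 < e" "\<forall>s. s \<notin> {lower t + e..upper t - e} \<longrightarrow> u k s = 0" using u(3) by blast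
    show ?thesis
    proof (rule test_functionsI[OF u(1)])
      have "{lower t + e..upper t - e} \<subseteq> stretch t" using e(1) by auto
      then show "{lower t + e..upper t - e} \<subseteq> einterval a b" using segment(4)[OF t] by blast
      show "u k s = 0" if "s \<notin> {lower t + e..upper t - e}" for s using e(2) that by blast
    qed
  qed
  have "approximates t e u u' K" unfolding approximates_def using tf u'c u(2) K z0 z1 lim by blast
  then show ?thesis by blast
qed

lemma form_approximants_tendsto:
  assumes reg: regular and t: "t \<in> einterval a b"
    and u: "approximates t e u u' K"
    and f: "\<And>k s. (f k has_vector_derivative f' k s) (at s)" "\<And>k. continuous_on UNIV (f' k)"
    and N: "\<And>k s. s \<in> stretch t \<Longrightarrow> norm (f k s) \<le> N" "\<And>k s. s \<in> stretch t \<Longrightarrow> norm (f' k s) \<le> N"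
    and lim: "\<And>s. (\<lambda>k. f k s) \<longlonglongrightarrow> y s" "\<And>s. (\<lambda>k. f' k s) \<longlonglongrightarrow> y' s"
    and g: "continuous_on {lower t..upper t} g"
      "\<And>s. s \<in> stretch t \<Longrightarrow> (g has_vector_derivative y' s) (at s)"
      "\<And>s. s \<in> stretch t \<Longrightarrow> y s = g s"
  shows "(\<lambda>k. form (u k) (f k)) \<longlonglongrightarrow> orientation * ((Y t *v e) \<bullet> g t - e \<bullet> g t0)"
proof -
  obtain M where M: "\<forall>s\<in>stretch t. norm (P s) \<le> M \<and> norm (Q s) \<le> M \<and> norm (R s) \<le> M"
    using regular_bounds(1)[OF reg t] by blast
  define x where "x s = (if s \<in> stretch t then U s *v e else 0)" for s
  define x' where "x' s = (if s \<in> stretch t then dU s *v e else 0)" for s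
  have u1: "u k \<in> test_functions a b" "(u k has_vector_derivative u' k s) (at s)"
      "norm (u k s) \<le> max K N" "norm (u' k s) \<le> max K N" 
    and u2: "s \<notin> stretch t \<Longrightarrow> u k s = 0" "s \<notin> stretch t \<Longrightarrow> u' k s = 0"
    and u3: "(\<lambda>k. u k s) \<longlonglongrightarrow> x s" "(\<lambda>k. u' k s) \<longlonglongrightarrow> x' s" for k s
    using u unfolding approximates_def x_def x'_def by (auto simp: le_max_iff_disj)
  have N': "norm (f k s) \<le> max K N" "norm (f' k s) \<le> max K N" if "s \<in> stretch t" for k s
    using N[OF that, of k] by (simp_all add: le_max_iff_disj)
  note A = form_tendsto[OF segment(4)[OF t] bspec[OF M] u1(1,2) u2 f u1(3,4) N' u3 lim]
  have "(LINT s|lborel. integrand s (x s) (x' s) (y s) (y' s)) = orientation * ((Y t *v e) \<bullet> g t - e \<bullet> g t0)"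
    by (rule greens_formula[OF t _ _ _ _ g A(1)]) (auto simp: x_def x'_def)
  then show ?thesis using A(2) by simp
qed

text \<open>
  Segments from \<open>t0\<close> are nested, and on the shorter one both functions are solutions.  Green's formula leaves
  a boundary term that vanishes at \<open>t0\<close> by the initial condition and at the other end because one of the two
  vectors lies in the kernel there.
\<close>

lemma form_approximants_orthogonal:
  assumes reg: regular
    and t: "t \<in> einterval a b" "t' \<in> einterval a b" and e: "e \<in> kernel t" "e' \<in> kernel t'"
    and u: "approximates t e u u' K" and v: "approximates t' e' v v' K'"
  shows "(\<lambda>k. form (u k) (v k)) \<longlonglongrightarrow> 0"
proof -
  have *: "(\<lambda>k. form (u k) (v k)) \<longlonglongrightarrow> 0"
    if t: "t \<in> einterval a b" "t' \<in> einterval a b" and e: "e \<in> kernel t" 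
      and sub: "stretch t \<subseteq> stretch t'"
      and u: "approximates t e u u' K" and v: "approximates t' e' v v' K'" for t t' e e' u u' v v' K K'
  proof -
    have v1: "(v k has_vector_derivative v' k s) (at s)" "continuous_on UNIV (v' k)" "norm (v k s) \<le> K'" "norm (v' k s) \<le> K'"
      and vl: "(\<lambda>k. v k s) \<longlonglongrightarrow> (if s \<in> stretch t' then U s *v e' else 0)"
        "(\<lambda>k. v' k s) \<longlonglongrightarrow> (if s \<in> stretch t' then dU s *v e' else 0)" for k s
      using v unfolding approximates_def by blast+
    have "(\<lambda>k. form (u k) (v k)) \<longlonglongrightarrow> orientation * ((Y t *v e) \<bullet> (U t *v e') - e \<bullet> (U t0 *v e'))"
    proof (rule form_approximants_tendsto[OF reg t(1) u v1(1,2) v1(3) v1(4) vl])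
      have "{lower t..upper t} \<subseteq> insert t0 (einterval a b)"
        unfolding segment(2)[OF t(1)] using segment_subset(1)[OF t(1)] by blast
      then show "continuous_on {lower t..upper t} (\<lambda>s. U s *v e')"
        by (intro continuous_on_matrix_vector continuous_on_const continuous_on_subset[OF U_cont])
      fix s assume s: "s \<in> stretch t"
      then have s': "s \<in> stretch t'" and sI: "s \<in> einterval a b" using sub segment(4)[OF t(1)] by blast+
      show "((\<lambda>s. U s *v e') has_vector_derivative (if s \<in> stretch t' then dU s *v e' else 0)) (at s)"
        using has_vector_derivative_matrix_vector[OF U_derivative[OF sI] has_vector_derivative_const[of e']] s' by simp
      show "(if s \<in> stretch t' then U s *v e' else 0) = U s *v e'" using s' by simp
    qed
    moreover have "(Y t *v e) \<bullet> (U t *v e') = 0" using isotropic[OF t(1), of e e'] e by (simp add: kernel_def)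
    ultimately show ?thesis by (simp add: init)
  qed
  from segments_nested[OF t] show ?thesis
  proof
    assume "stretch t \<subseteq> stretch t'"
    from *[OF t e(1) this u v] show ?thesis .
  next
    assume "stretch t' \<subseteq> stretch t"
    from *[OF t(2,1) e(2) this v u] have "(\<lambda>k. form (v k) (u k)) \<longlonglongrightarrow> 0" .
    moreover have "form (v k) (u k) = form (u k) (v k)" for k
      using u v by (intro form_sym) (auto simp: approximates_def)
    ultimately show ?thesis by simp
  qed
qed

end

lemma negative_definite_scale:
  fixes M :: "'i \<Rightarrow> 'i \<Rightarrow> real"
  assumes "0 < r" "negative_definite I (\<lambda>i j. r * M i j)" shows "negative_definite I M"
  unfolding negative_definite_def
proof (intro allI impI)
  fix c :: "'i \<Rightarrow> real" assume c: "\<exists>i\<in>I. c i \<noteq> 0"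
  have "(\<Sum>i\<in>I. \<Sum>j\<in>I. c i * c j * (r * M i j)) = r * (\<Sum>i\<in>I. \<Sum>j\<in>I. c i * c j * M i j)"
    by (simp add: sum_distrib_left mult_ac)
  moreover have "(\<Sum>i\<in>I. \<Sum>j\<in>I. c i * c j * (r * M i j)) < 0" using assms(2) c unfolding negative_definite_def by blast
  ultimately show "(\<Sum>i\<in>I. \<Sum>j\<in>I. c i * c j * M i j) < 0" using assms(1) by (simp add: mult_less_0_iff)
qed

context conjugate
begin

text \<open>
  The form pairs the broken solution for \<open>(t, e)\<close> with a bump at \<open>t'\<close> in the direction of the momentum of
  \<open>(t', e')\<close> in this matrix, up to the sign of the orientation.
\<close>

definition gram :: "real \<times> (real^'n) \<Rightarrow> real \<times> (real^'n) \<Rightarrow> real" where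
  "gram i j = (if fst i = fst j then (Y (fst i) *v snd i) \<bullet> (Y (fst i) *v snd j) else 0)"

text \<open>
  On each kernel the momentum map \<open>Y t\<close> is injective.
\<close>

lemma gram_negative_definite:
  assumes T: "finite T" "T \<subseteq> einterval a b"
    and B: "\<And>t. finite (B t)" "\<And>t. B t \<subseteq> kernel t" "\<And>t. independent (B t)"
  shows "negative_definite (Sigma T B) (\<lambda>i j. - 2 * gram i j)" unfolding negative_definite_def
proof (intro allI impI)
  fix c :: "real \<times> (real^'n) \<Rightarrow> real" assume c: "\<exists>i\<in>Sigma T B. c i \<noteq> 0"
  define x where "x t = (\<Sum>e\<in>B t. c (t, e) *\<^sub>R e)" for t
  have Yx: "Y t *v x t = (\<Sum>e\<in>B t. c (t, e) *\<^sub>R (Y t *v e))" for t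
    unfolding x_def by (simp add: matrix_vector_mult_scaleR linear_sum[OF matrix_vector_mul_linear])
  have SG: "(\<Sum>i\<in>Sigma T B. h i) = (\<Sum>t\<in>T. \<Sum>e\<in>B t. h (t, e))" for h :: "real \<times> (real^'n) \<Rightarrow> real"
    using sum.Sigma[of T B "\<lambda>t e. h (t, e)"] T(1) B(1) by simp
  have "(\<Sum>i\<in>Sigma T B. \<Sum>j\<in>Sigma T B. c i * c j * gram i j) = (\<Sum>t\<in>T. (Y t *v x t) \<bullet> (Y t *v x t))"
  proof -
    have "(\<Sum>i\<in>Sigma T B. \<Sum>j\<in>Sigma T B. c i * c j * gram i j) =
        (\<Sum>t\<in>T. \<Sum>e\<in>B t. \<Sum>t'\<in>T. \<Sum>e'\<in>B t'. c (t, e) * c (t', e') * gram (t, e) (t', e'))" unfolding SG ..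
    also have "\<dots> = (\<Sum>t\<in>T. (Y t *v x t) \<bullet> (Y t *v x t))"
    proof (rule sum.cong[OF refl])
      fix t assume t: "t \<in> T"
      have "(\<Sum>t'\<in>T. \<Sum>e'\<in>B t'. c (t, e) * c (t', e') * gram (t, e) (t', e')) =
          (\<Sum>e'\<in>B t. c (t, e) * c (t, e') * ((Y t *v e) \<bullet> (Y t *v e')))" for e
      proof -
        have "(\<Sum>t'\<in>T. \<Sum>e'\<in>B t'. c (t, e) * c (t', e') * gram (t, e) (t', e')) =
            (\<Sum>t'\<in>T. if t = t' then \<Sum>e'\<in>B t. c (t, e) * c (t, e') * ((Y t *v e) \<bullet> (Y t *v e')) else 0)"
          by (rule sum.cong) (auto simp: gram_def)
        then show ?thesis using t T(1) by simp
      qed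
      then show "(\<Sum>e\<in>B t. \<Sum>t'\<in>T. \<Sum>e'\<in>B t'. c (t, e) * c (t', e') * gram (t, e) (t', e')) = (Y t *v x t) \<bullet> (Y t *v x t)"
        unfolding Yx inner_sum_left unfolding inner_sum_right by (simp add: mult_ac)
    qed
    finally show ?thesis .
  qed
  moreover have "(\<Sum>i\<in>Sigma T B. \<Sum>j\<in>Sigma T B. c i * c j * (- 2 * gram i j)) =
      - 2 * (\<Sum>i\<in>Sigma T B. \<Sum>j\<in>Sigma T B. c i * c j * gram i j)" by (simp add: sum_distrib_left mult_ac)
  moreover have "0 < (\<Sum>t\<in>T. (Y t *v x t) \<bullet> (Y t *v x t))"
  proof -
    obtain t e where te: "t \<in> T" "e \<in> B t" "c (t, e) \<noteq> 0" using c by auto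
    have xk: "x t \<in> kernel t"
      unfolding x_def by (intro subspace_sum subspace_kernel subspace_scale) (use B(2) in blast)
    have "x t \<noteq> 0"
    proof
      assume "x t = 0"
      then have "c (t, e) = 0" using independentD[OF B(3) B(1) order_refl _ te(2), of "\<lambda>e. c (t, e)"] by (simp add: x_def)
      then show False using te(3) by simp
    qed
    moreover have "t \<in> einterval a b" using te(1) T(2) by blast
    ultimately have "Y t *v x t \<noteq> 0" using nondegenerate[of t "x t"] xk unfolding kernel_def by blast
    then have "0 < (Y t *v x t) \<bullet> (Y t *v x t)" by simp
    then show ?thesis by (intro sum_pos2[OF T(1) te(1)]) auto
  qed
  ultimately show "(\<Sum>i\<in>Sigma T B. \<Sum>j\<in>Sigma T B. c i * c j * (- 2 * gram i j)) < 0" by simp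
qed

lemma bump_fields:
  assumes T: "finite T" "T \<subseteq> einterval a b"
  shows "\<exists>\<psi>. \<forall>t\<in>T. smooth (\<psi> t) \<and> \<psi> t t = (1::real) \<and> (\<forall>t'\<in>T. t' \<noteq> t \<longrightarrow> \<psi> t t' = 0) \<and> \<psi> t t0 = 0 \<and>
    (\<forall>x::real^'n. (\<lambda>s. \<psi> t s *\<^sub>R x) \<in> test_functions a b)"
proof (rule bchoice, rule ballI)
  fix t assume "t \<in> T"
  then have t: "t \<in> einterval a b" using T by blast
  obtain r where r: "0 < r" "cball t r \<subseteq> einterval a b" using open_contains_cball[of "einterval a b"] t by auto
  obtain d where d: "0 < d" "\<forall>t'\<in>T. t' \<noteq> t \<longrightarrow> d \<le> \<bar>t' - t\<bar>"
    using finite_set_avoid[OF T(1), of t] by (auto simp: dist_real_def abs_minus_commute)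
  obtain \<psi> :: "real \<Rightarrow> real" where p: "smooth \<psi>" "\<psi> t = 1" "\<forall>s. min d r \<le> \<bar>s - t\<bar> \<longrightarrow> \<psi> s = 0"
    using smooth_bump[of "min d r" t] d r by auto
  have I: "{t - r..t + r} \<subseteq> einterval a b" using r(2) by (simp add: cball_eq_atLeastAtMost)
  have "t0 \<notin> einterval a b" using segment_subset(2) by blast
  then have "t0 \<notin> {t - r..t + r}" using I by blast
  then have "\<psi> t0 = 0" using p(3) by auto
  moreover have "\<forall>t'\<in>T. t' \<noteq> t \<longrightarrow> \<psi> t' = 0" using d(2) p(3) by (simp add: min_le_iff_disj)
  moreover have "(\<lambda>s. \<psi> s *\<^sub>R x) \<in> test_functions a b" for x :: "real^'n"
  proof (rule test_functionsI[OF _ I])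
    show "smooth (\<lambda>s. \<psi> s *\<^sub>R x)" by (intro smooth_scaleR p(1) smooth_const)
    show "\<psi> s *\<^sub>R x = 0" if "s \<notin> {t - r..t + r}" for s
    proof -
      have "min d r \<le> \<bar>s - t\<bar>" using that by (auto simp: min_le_iff_disj)
      then show ?thesis using p(3) by simp
    qed
  qed
  ultimately show "\<exists>\<psi>. smooth \<psi> \<and> \<psi> t = (1::real) \<and> (\<forall>t'\<in>T. t' \<noteq> t \<longrightarrow> \<psi> t' = 0) \<and> \<psi> t0 = 0 \<and>
      (\<forall>x::real^'n. (\<lambda>s. \<psi> s *\<^sub>R x) \<in> test_functions a b)" using p(1,2) by blast
qed

lemma form_bump_tendsto:
  assumes reg: regular and t: "t \<in> einterval a b"
    and u: "approximates t e u u' K" and f: "f \<in> test_functions a b" and f0: "f t0 = 0"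
  shows "(\<lambda>k. form (u k) f) \<longlonglongrightarrow> orientation * ((Y t *v e) \<bullet> f t)"
proof -
  obtain f' where f': "smooth f'" "\<And>s. (f has_vector_derivative f' s) (at s)"
    using smooth_derivative[OF smooth_test_function[OF f]] by blast
  have c: "continuous_on {lower t..upper t} f" "continuous_on {lower t..upper t} f'"
    by (rule smooth_continuous[OF smooth_test_function[OF f]], rule smooth_continuous[OF f'(1)])
  have "\<exists>N. \<forall>s\<in>{lower t..upper t}. norm (h s) \<le> N" if "continuous_on {lower t..upper t} h" for h :: "real \<Rightarrow> real^'n"
  proof -
    have "bounded (h ` {lower t..upper t})" by (rule compact_imp_bounded[OF compact_continuous_image[OF that compact_Icc]])
    then obtain N where "\<forall>y\<in>h ` {lower t..upper t}. norm y \<le> N" unfolding bounded_iff by (rule exE)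
    then show ?thesis by blast
  qed
  from this[OF c(1)] this[OF c(2)] obtain N1 N2 where
    N: "\<forall>s\<in>{lower t..upper t}. norm (f s) \<le> N1" "\<forall>s\<in>{lower t..upper t}. norm (f' s) \<le> N2" by blast
  have N': "norm (f s) \<le> max N1 N2" "norm (f' s) \<le> max N1 N2" if "s \<in> stretch t" for s
  proof -
    have s: "s \<in> {lower t..upper t}" using that by auto
    show "norm (f s) \<le> max N1 N2" using bspec[OF N(1) s] by simp
    show "norm (f' s) \<le> max N1 N2" using bspec[OF N(2) s] by simp
  qed
  have "(\<lambda>k. form (u k) f) \<longlonglongrightarrow> orientation * ((Y t *v e) \<bullet> f t - e \<bullet> f t0)"
    by (rule form_approximants_tendsto[OF reg t u f'(2) smooth_continuous[OF f'(1)] N' tendsto_const tendsto_const c(1) f'(2) refl])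
  then show ?thesis by (simp add: f0)
qed

end

context conjugate
begin

text \<open>
  The broken solutions span a space on which the form vanishes.  Adding suitably signed \<open>\<epsilon>\<close>-multiples of bumps in
  the direction of their momentum jumps changes the form by \<open>-2 \<epsilon>\<close> times the Gram matrix to first order, which is negative
  definite.  Approximation by test functions preserves this.
\<close>

lemma index_lower_bound:
  assumes reg: regular and T: "finite T" "T \<subseteq> einterval a b"
  shows "\<exists>u. (\<forall>i < (\<Sum>t\<in>T. dim (kernel t)). u i \<in> test_functions a b) \<and>
    negative_definite {..<(\<Sum>t\<in>T. dim (kernel t))} (\<lambda>i j. form (u i) (u j))"
proof -
  define basis where "basis t B \<longleftrightarrow> finite B \<and> B \<subseteq> kernel t \<and> independent B \<and> card B = dim (kernel t)" for t B
  have ex: "\<exists>B. basis t B" for t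
  proof -
    obtain B where B: "B \<subseteq> kernel t" "independent B" "kernel t \<subseteq> span B" "card B = dim (kernel t)" by (rule basis_exists)
    have "basis t B" unfolding basis_def by (intro conjI independent_imp_finite[OF B(2)] B)
    then show ?thesis by (rule exI)
  qed
  define B where "B t = (SOME C. basis t C)" for t
  have "basis t (B t)" for t unfolding B_def by (rule someI_ex[OF ex])
  then have B: "finite (B t)" "B t \<subseteq> kernel t" "independent (B t)" "card (B t) = dim (kernel t)" for t
    unfolding basis_def by simp_all
  define I where "I = Sigma T B"
  have I: "finite I" unfolding I_def using T B(1) by blast
  have cardI: "card I = (\<Sum>t\<in>T. dim (kernel t))" unfolding I_def using T B(1,4) by (simp add: card_SigmaI)
  have It: "fst i \<in> T" "fst i \<in> einterval a b" "snd i \<in> kernel (fst i)" if i: "i \<in> I" for i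
  proof -
    obtain t e where te: "i = (t, e)" "t \<in> T" "e \<in> B t" using i unfolding I_def by blast
    show "fst i \<in> T" using te by simp
    then show "fst i \<in> einterval a b" by (rule subsetD[OF T(2)])
    show "snd i \<in> kernel (fst i)" unfolding te(1) fst_conv snd_conv by (rule subsetD[OF B(2) te(3)])
  qed
  have "\<forall>i\<in>I. \<exists>u. \<exists>u' K. approximates (fst i) (snd i) u u' K" by (rule ballI) (rule approximants[OF reg It(2,3)])
  from bchoice[OF this] obtain w where "\<forall>i\<in>I. \<exists>u' K. approximates (fst i) (snd i) (w i) u' K" by (rule exE)
  then have w: "\<exists>u' K. approximates (fst i) (snd i) (w i) u' K" if "i \<in> I" for i using that by (rule bspec)
  have wt: "w i k \<in> test_functions a b" if "i \<in> I" for i k using w[OF that] unfolding approximates_def by blast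
  from bump_fields[OF T] obtain \<psi> where bump: "\<forall>t\<in>T. smooth (\<psi> t) \<and> \<psi> t t = (1::real) \<and> (\<forall>t'\<in>T. t' \<noteq> t \<longrightarrow> \<psi> t t' = 0) \<and>
      \<psi> t t0 = 0 \<and> (\<forall>x::real^'n. (\<lambda>s. \<psi> t s *\<^sub>R x) \<in> test_functions a b)" by (rule exE)
  have \<psi>: "\<psi> t t = 1" "\<psi> t t0 = 0" "(\<lambda>s. \<psi> t s *\<^sub>R (x :: real^'n)) \<in> test_functions a b" if "t \<in> T" for t x
    using bspec[OF bump that] by simp_all
  have \<psi>0: "\<psi> t t' = 0" if "t \<in> T" "t' \<in> T" "t' \<noteq> t" for t t' using bspec[OF bump that(1)] that(2,3) by simp
  define \<phi> where "\<phi> i s = \<psi> (fst i) s *\<^sub>R (Y (fst i) *v snd i)" for i :: "real \<times> (real^'n)" and s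
  have pt: "\<phi> i \<in> test_functions a b" if "i \<in> I" for i unfolding \<phi>_def[abs_def] by (rule \<psi>(3)[OF It(1)[OF that]])
  have ww: "(\<lambda>k. form (w i k) (w j k)) \<longlonglongrightarrow> 0" if ij: "i \<in> I" "j \<in> I" for i j
  proof -
    obtain u K where u: "approximates (fst i) (snd i) (w i) u K" using w[OF ij(1)] by (elim exE)
    obtain v K' where v: "approximates (fst j) (snd j) (w j) v K'" using w[OF ij(2)] by (elim exE)
    show ?thesis
      by (rule form_approximants_orthogonal[OF reg It(2)[OF ij(1)] It(2)[OF ij(2)] It(3)[OF ij(1)] It(3)[OF ij(2)] u v])
  qed
  have wp: "(\<lambda>k. form (w i k) (\<phi> j)) \<longlonglongrightarrow> orientation * gram i j" if ij: "i \<in> I" "j \<in> I" for i j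
  proof -
    have g: "(Y (fst i) *v snd i) \<bullet> \<phi> j (fst i) = gram i j"
      unfolding gram_def \<phi>_def using \<psi>(1)[OF It(1)[OF ij(2)]] \<psi>0[OF It(1)[OF ij(2)] It(1)[OF ij(1)]] by (cases "fst i = fst j") simp_all
    have z: "\<phi> j t0 = 0" unfolding \<phi>_def using \<psi>(2)[OF It(1)[OF ij(2)]] by simp
    obtain u' K where u: "approximates (fst i) (snd i) (w i) u' K" using w[OF ij(1)] by (elim exE)
    have "(\<lambda>k. form (w i k) (\<phi> j)) \<longlonglongrightarrow> orientation * ((Y (fst i) *v snd i) \<bullet> \<phi> j (fst i))"
      by (rule form_bump_tendsto[OF reg It(2)[OF ij(1)] u pt[OF ij(2)]]) (rule z)
    then show ?thesis by (simp only: g)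
  qed
  have oo: "orientation * orientation = 1" by (simp add: orientation_def)
  have gsym: "gram i j = gram j i" for i j by (simp add: gram_def inner_commute)
  \<comment> \<open>The second order term of the perturbation is negligible for small \<open>\<epsilon>\<close>.\<close>
  have "((\<lambda>\<epsilon>. - 2 * gram i j + \<epsilon> * form (\<phi> i) (\<phi> j)) \<longlongrightarrow> - 2 * gram i j + 0 * form (\<phi> i) (\<phi> j)) (at_right 0)" for i j
    by (intro tendsto_intros)
  then have "\<forall>\<^sub>F \<epsilon> in at_right 0. negative_definite I (\<lambda>i j. - 2 * gram i j + \<epsilon> * form (\<phi> i) (\<phi> j))"
    by (intro negative_definite_perturb[where N = "\<lambda>\<epsilon> i j. - 2 * gram i j + \<epsilon> * form (\<phi> i) (\<phi> j)",
          OF I gram_negative_definite[OF T B(1-3), folded I_def]]) simp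
  moreover have "\<forall>\<^sub>F \<epsilon>::real in at_right 0. 0 < \<epsilon>" by (rule eventually_at_right_less)
  ultimately have "\<forall>\<^sub>F \<epsilon> in at_right 0. negative_definite I (\<lambda>i j. - 2 * gram i j + \<epsilon> * form (\<phi> i) (\<phi> j)) \<and> 0 < \<epsilon>"
    by (rule eventually_conj)
  from eventually_happens'[OF trivial_limit_at_right_real this]
  obtain \<epsilon> :: real where \<epsilon>: "0 < \<epsilon>" "negative_definite I (\<lambda>i j. - 2 * gram i j + \<epsilon> * form (\<phi> i) (\<phi> j))" by blast
  define z where "z k i s = 1 *\<^sub>R w i k s + (- (\<epsilon> * orientation)) *\<^sub>R \<phi> i s" for k i s
  have zt: "z k i \<in> test_functions a b" if "i \<in> I" for k i
    unfolding z_def[abs_def] by (rule test_functions_add_scale[OF wt[OF that] pt[OF that]])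
  have lim: "(\<lambda>k. 1 / \<epsilon> * form (z k i) (z k j)) \<longlonglongrightarrow> - 2 * gram i j + \<epsilon> * form (\<phi> i) (\<phi> j)" if ij: "i \<in> I" "j \<in> I" for i j
  proof -
    have eq: "1 / \<epsilon> * form (z k i) (z k j) = 1 / \<epsilon> * form (w i k) (w j k) -
        orientation * (form (w i k) (\<phi> j) + form (w j k) (\<phi> i)) + \<epsilon> * (orientation * orientation) * form (\<phi> i) (\<phi> j)" for k
    proof -
      have *: "form (z k i) (z k j) = 1 * 1 * form (w i k) (w j k) +
          1 * (- (\<epsilon> * orientation)) * (form (w i k) (\<phi> j) + form (w j k) (\<phi> i)) +
          (- (\<epsilon> * orientation)) * (- (\<epsilon> * orientation)) * form (\<phi> i) (\<phi> j)"
        unfolding z_def[abs_def] by (rule form_add_scale_both[OF wt[OF ij(1)] pt[OF ij(1)] wt[OF ij(2)] pt[OF ij(2)]])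
      show ?thesis unfolding * using \<epsilon>(1) by (simp add: field_simps)
    qed
    have "(\<lambda>k. 1 / \<epsilon> * form (w i k) (w j k) -
        orientation * (form (w i k) (\<phi> j) + form (w j k) (\<phi> i)) + \<epsilon> * (orientation * orientation) * form (\<phi> i) (\<phi> j)) \<longlonglongrightarrow>
      1 / \<epsilon> * 0 - orientation * (orientation * gram i j + orientation * gram j i) + \<epsilon> * (orientation * orientation) * form (\<phi> i) (\<phi> j)"
      by (intro tendsto_intros ww wp ij)
    moreover have "1 / \<epsilon> * 0 - orientation * (orientation * gram i j + orientation * gram j i) +
        \<epsilon> * (orientation * orientation) * form (\<phi> i) (\<phi> j) = - 2 * gram i j + \<epsilon> * form (\<phi> i) (\<phi> j)"
      unfolding gsym[of j i] distrib_left[symmetric] using oo by (simp add: algebra_simps)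
    ultimately show ?thesis unfolding eq by (simp only:)
  qed
  have "\<forall>\<^sub>F k in sequentially. negative_definite I (\<lambda>i j. 1 / \<epsilon> * form (z k i) (z k j))"
    by (rule negative_definite_perturb[where N = "\<lambda>k i j. 1 / \<epsilon> * form (z k i) (z k j)", OF I \<epsilon>(2) lim])
  from eventually_happens'[OF sequentially_bot this]
  obtain k where k: "negative_definite I (\<lambda>i j. 1 / \<epsilon> * form (z k i) (z k j))" by (rule exE)
  have "0 < 1 / \<epsilon>" using \<epsilon>(1) by simp
  from negative_definite_scale[where M = "\<lambda>i j. form (z k i) (z k j)", OF this k]
  have neg: "negative_definite I (\<lambda>i j. form (z k i) (z k j))" .
  obtain f where f: "bij_betw f {..<card I} I" using ex_bij_betw_nat_finite[OF I] by (auto simp: lessThan_atLeast0)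
  show ?thesis unfolding cardI[symmetric]
  proof (intro exI[of _ "\<lambda>i. z k (f i)"] conjI allI impI)
    show "z k (f i) \<in> test_functions a b" if "i < card I" for i using zt[of "f i"] bij_betwE[OF f] that by blast
    show "negative_definite {..<card I} (\<lambda>i j. form (z k (f i)) (z k (f j)))" by (rule negative_definite_reindex[OF f neg])
  qed
qed

end

section \<open>Exhaustion by subintervals\<close>

abbreviation "sl_form P Q R \<equiv> sturm_liouville.form P Q R"

lemma test_functions_subset: "einterval c d \<subseteq> einterval a b \<Longrightarrow> test_functions c d \<subseteq> test_functions a b"
  unfolding test_functions_def by blast

lemma sturm_liouville_subinterval:
  assumes "sturm_liouville a b P Q R" "c < d" "einterval c d \<subseteq> einterval a b"
  shows "sturm_liouville c d P Q R"
proof (rule sturm_liouville.intro[OF assms(2)])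
  have "sl_coefficients a b P Q R" using assms(1) by (rule sturm_liouville.coefficients)
  then show "sl_coefficients c d P Q R" using assms(3) unfolding sl_coefficients_def
    by (auto intro: C1_differentiable_on_subset continuous_on_subset)
qed

definition attained :: "(real \<Rightarrow> real^'n^'n) \<Rightarrow> (real \<Rightarrow> real^'n^'n) \<Rightarrow> (real \<Rightarrow> real^'n^'n) \<Rightarrow> ereal \<Rightarrow> ereal \<Rightarrow> nat set" where
  "attained P Q R c d = {k. \<exists>u. (\<forall>i<k. u i \<in> test_functions c d) \<and> negative_definite {..<k} (\<lambda>i j. sl_form P Q R (u i) (u j))}"

lemma sl_morse_index_subinterval:
  assumes "sturm_liouville a b P Q R" "sl_form_bounded_below P Q R a b" "c < d" "einterval c d \<subseteq> einterval a b"
  shows "sl_morse_index P Q R c d = (SUP k\<in>attained P Q R c d. enat k)"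
proof -
  have "sl_form_bounded_below P Q R c d"
    using assms(2) test_functions_subset[OF assms(4)] unfolding sl_form_bounded_below_def by blast
  from sturm_liouville.sl_morse_index_eq[OF sturm_liouville_subinterval[OF assms(1,3,4)] this]
  show ?thesis unfolding attained_def .
qed

lemma tendsto_SUP_exhaustion:
  fixes N :: "'a \<Rightarrow> nat set" and L :: "nat set"
  assumes le: "\<forall>\<^sub>F x in F. N x \<subseteq> L" and ex: "\<And>k. k \<in> L \<Longrightarrow> \<forall>\<^sub>F x in F. k \<in> N x"
  shows "((\<lambda>x. SUP k\<in>N x. enat k) \<longlongrightarrow> (SUP k\<in>L. enat k)) F"
proof (rule order_tendstoI)
  fix y assume "y < (SUP k\<in>L. enat k)"
  then obtain k where k: "k \<in> L" "y < enat k" unfolding less_SUP_iff by blast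
  from ex[OF k(1)] show "\<forall>\<^sub>F x in F. y < (SUP k\<in>N x. enat k)"
  proof eventually_elim
    case (elim x)
    then show ?case using less_le_trans[OF k(2) SUP_upper[of k "N x" enat]] by blast
  qed
next
  fix y assume y: "(SUP k\<in>L. enat k) < y"
  from le show "\<forall>\<^sub>F x in F. (SUP k\<in>N x. enat k) < y"
  proof eventually_elim
    case (elim x)
    from le_less_trans[OF SUP_subset_mono[OF elim order_refl] y] show ?case .
  qed
qed

text \<open>
  Finitely many test functions have supports in a common compact subinterval.
\<close>

lemma uniform_support:
  assumes "a < b" "\<And>i. i < (k::nat) \<Longrightarrow> u i \<in> test_functions a b"
  obtains p q where "a < ereal p" "ereal p < ereal q" "ereal q < b"
    "\<And>c d i. c < ereal p \<Longrightarrow> ereal q < d \<Longrightarrow> i < k \<Longrightarrow> u i \<in> test_functions c d"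
proof -
  have "\<exists>p q. a < ereal p \<and> ereal p < ereal q \<and> ereal q < b \<and>
      (\<forall>c d i. c < ereal p \<longrightarrow> ereal q < d \<longrightarrow> i < k \<longrightarrow> u i \<in> test_functions c d)" using assms(2)
  proof (induction k)
    case 0
    obtain p where p: "a < ereal p" "ereal p < b" using ereal_dense2[OF assms(1)] by blast
    obtain q where "ereal p < ereal q" "ereal q < b" using ereal_dense2[OF p(2)] by blast
    then show ?case using p by (intro exI[of _ p] exI[of _ q]) simp
  next
    case (Suc k)
    then obtain p q where pq: "a < ereal p" "ereal p < ereal q" "ereal q < b"
      "\<forall>c d i. c < ereal p \<longrightarrow> ereal q < d \<longrightarrow> i < k \<longrightarrow> u i \<in> test_functions c d" by (metis less_SucI)
    have uk: "u k \<in> test_functions a b" using Suc.prems by simp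
    obtain v p' q' where v: "p' < q'" "{p'..q'} \<subseteq> einterval a b" "\<And>t. t \<notin> {p'<..<q'} \<Longrightarrow> u k t = 0"
      using test_functionsE[OF uk assms(1)] by metis
    have "p' \<in> einterval a b" "q' \<in> einterval a b" using v(1) by (auto intro!: subsetD[OF v(2)])
    then have p': "a < ereal p'" "ereal q' < b" by (simp_all add: einterval_iff)
    have "u i \<in> test_functions c d" if cd: "c < ereal (min p p')" "ereal (max q q') < d" and i: "i < Suc k" for c d i
    proof (cases "i < k")
      case True
      have "c < ereal p" by (rule less_le_trans[OF cd(1)]) simp
      moreover have "ereal q < d" by (rule le_less_trans[OF _ cd(2)]) simp
      ultimately
      show ?thesis using pq(4) True by blast
    next
      case False
      then have ik: "i = k" using i by simp
      have c1: "c < ereal p'" by (rule less_le_trans[OF cd(1)]) simp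
      have c2: "ereal q' < d" by (rule le_less_trans[OF _ cd(2)]) simp
      note c = c1 c2
      have smooth: "smooth (u k)" using uk by (auto simp: test_functions_def smooth_def)
      show ?thesis unfolding ik
      proof (rule test_functionsI[OF smooth])
        have "ereal p' < ereal q'" using v(1) by simp
        then have "ereal p' < d" "c < ereal q'" using less_trans[OF _ c2] less_trans[OF c1] by blast+
        then show "{p'..q'} \<subseteq> einterval c d" using c by (intro einterval_Icc) (auto simp: einterval_iff)
        show "u k t = 0" if "t \<notin> {p'..q'}" for t using v(3)[of t] that by auto
      qed
    qed
    moreover have "a < ereal (min p p')" "ereal (min p p') < ereal (max q q')" "ereal (max q q') < b"
      using pq(1,2,3) p' v(1) by (auto simp: min_def max_def)
    ultimately show ?case by (intro exI[of _ "min p p'"] exI[of _ "max q q'"]) blast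
  qed
  then show thesis using that by blast
qed

lemma einterval_mono: "a \<le> c \<Longrightarrow> d \<le> b \<Longrightarrow> einterval c d \<subseteq> einterval a b"
  by (auto simp: einterval_iff intro: le_less_trans less_le_trans)

lemma attained_mono: "einterval c d \<subseteq> einterval a b \<Longrightarrow> attained P Q R c d \<subseteq> attained P Q R a b"
  unfolding attained_def using test_functions_subset by blast

lemma sl_morse_index_exhaustion:
  assumes sl: "sturm_liouville a b P Q R" and bounded: "sl_form_bounded_below P Q R a b"
    and sub: "\<forall>\<^sub>F x in F. a \<le> c x \<and> c x < d x \<and> d x \<le> b"
    and ex: "\<And>p q. a < ereal p \<Longrightarrow> ereal q < b \<Longrightarrow> \<forall>\<^sub>F x in F. c x < ereal p \<and> ereal q < d x"
  shows "((\<lambda>x. sl_morse_index P Q R (c x) (d x)) \<longlongrightarrow> sl_morse_index P Q R a b) F"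
proof -
  have ab: "a < b" by (rule sturm_liouville.ab[OF sl])
  note index = sl_morse_index_subinterval[OF sl bounded]
  have "((\<lambda>x. SUP k\<in>attained P Q R (c x) (d x). enat k) \<longlongrightarrow> sl_morse_index P Q R a b) F"
    unfolding index[OF ab order_refl]
  proof (rule tendsto_SUP_exhaustion)
    from sub show "\<forall>\<^sub>F x in F. attained P Q R (c x) (d x) \<subseteq> attained P Q R a b"
    proof eventually_elim
      case (elim x)
      then have le: "a \<le> c x" "d x \<le> b" by simp_all
      show ?case by (rule attained_mono[OF einterval_mono[OF le]])
    qed
    fix k assume "k \<in> attained P Q R a b"
    then obtain u where u: "\<And>i. i < k \<Longrightarrow> u i \<in> test_functions a b" "negative_definite {..<k} (\<lambda>i j. sl_form P Q R (u i) (u j))"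
      unfolding attained_def by blast
    obtain p q where pq: "a < ereal p" "ereal p < ereal q" "ereal q < b"
      "\<And>c d i. c < ereal p \<Longrightarrow> ereal q < d \<Longrightarrow> i < k \<Longrightarrow> u i \<in> test_functions c d"
      by (rule uniform_support[OF ab, of k u]) (use u(1) in auto)
    from ex[OF pq(1,3)] show "\<forall>\<^sub>F x in F. k \<in> attained P Q R (c x) (d x)"
    proof eventually_elim
      case (elim x)
      have "\<forall>i<k. u i \<in> test_functions (c x) (d x)" using pq(4)[OF conjunct1[OF elim] conjunct2[OF elim]] by simp
      then show ?case unfolding attained_def using u(2) by (intro CollectI exI[of _ u] conjI)
    qed
  qed
  moreover from sub have "\<forall>\<^sub>F x in F. (SUP k\<in>attained P Q R (c x) (d x). enat k) = sl_morse_index P Q R (c x) (d x)"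
  proof eventually_elim
    case (elim x)
    show ?case by (rule index[symmetric, OF _ einterval_mono]) (simp_all add: elim)
  qed
  ultimately show ?thesis by (rule Lim_transform_eventually)
qed

section \<open>Crossings of the fundamental solution\<close>

text \<open>
  With \<open>Inl\<close> and \<open>Inr\<close> as arguments these are the four blocks of a matrix on the phase space.
\<close>

definition block :: "('n \<Rightarrow> 'm) \<Rightarrow> ('n \<Rightarrow> 'm) \<Rightarrow> real^'m^'m \<Rightarrow> real^'n^'n" where
  "block r c A = (\<chi> i j. A $ r i $ c j)"

lemma bounded_linear_block: "bounded_linear (block r c :: real^'m^'m \<Rightarrow> real^'n^'n)"
  unfolding linear_conv_bounded_linear[symmetric] by (rule linearI) (simp_all add: block_def vec_eq_iff)

lemma sum_UNIV_plus:
  fixes f :: "'n::finite + 'n \<Rightarrow> 'b::comm_monoid_add"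
  shows "sum f UNIV = (\<Sum>i\<in>UNIV. f (Inl i)) + (\<Sum>i\<in>UNIV. f (Inr i))"
  unfolding UNIV_Plus_UNIV[symmetric] by (simp add: sum.Plus del: UNIV_Plus_UNIV)

lemma block_mult:
  fixes A B :: "real^('n + 'n)^('n::finite + 'n)"
  shows "block r c (A ** B) = block r Inl A ** block Inl c B + block r Inr A ** block Inr c B"
  by (simp add: block_def matrix_matrix_mult_def vec_eq_iff sum_UNIV_plus)

lemma block_hamiltonian:
  "block Inl Inl (hamiltonian_matrix P Q R t) = transpose (Q t) ** matrix_inv (P t)"
  "block Inl Inr (hamiltonian_matrix P Q R t) = R t - transpose (Q t) ** matrix_inv (P t) ** Q t"
  "block Inr Inl (hamiltonian_matrix P Q R t) = matrix_inv (P t)"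
  "block Inr Inr (hamiltonian_matrix P Q R t) = - (matrix_inv (P t) ** Q t)"
  by (simp_all add: block_def hamiltonian_matrix_def block_matrix_def Let_def vec_eq_iff)

lemma block_mat_1:
  "block Inl Inl (mat 1 :: real^('n::finite + 'n)^('n + 'n)) = mat 1" "block Inr Inl (mat 1 :: real^('n + 'n)^('n + 'n)) = 0"
  "block Inr Inr (mat 1 :: real^('n + 'n)^('n + 'n)) = mat 1" by (simp_all add: block_def mat_def vec_eq_iff)

definition dirichlet_vector :: "real^'n \<Rightarrow> real^('n::finite + 'n)" where
  "dirichlet_vector x = (\<chi> k. case k of Inl i \<Rightarrow> x $ i | Inr i \<Rightarrow> 0)"

lemma dirichlet_subspace_eq: "dirichlet_subspace = range dirichlet_vector"
proof (intro equalityI subsetI)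
  fix v :: "real^('n::finite + 'n)" assume v: "v \<in> dirichlet_subspace"
  have "v = dirichlet_vector (\<chi> i. v $ Inl i)" unfolding vec_eq_iff
  proof
    fix k show "v $ k = dirichlet_vector (\<chi> i. v $ Inl i) $ k"
      using v by (cases k) (simp_all add: dirichlet_vector_def dirichlet_subspace_def)
  qed
  then show "v \<in> range dirichlet_vector" by blast
qed (auto simp: dirichlet_subspace_def dirichlet_vector_def)

lemma dirichlet_vector_nth [simp]: "dirichlet_vector x $ Inl i = x $ i" "dirichlet_vector x $ Inr i = 0"
  by (simp_all add: dirichlet_vector_def)

lemma mult_dirichlet_vector:
  "(A *v dirichlet_vector x) $ Inl i = (block Inl Inl A *v x) $ i"
  "(A *v dirichlet_vector x) $ Inr i = (block Inr Inl A *v x) $ i"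
  by (simp_all add: matrix_vector_mult_def sum_UNIV_plus dirichlet_vector_def block_def)

context conjugate
begin

text \<open>
  The first block column of the fundamental solution maps the kernel of \<open>U t\<close> isomorphically onto the
  intersection of the Dirichlet subspace with its image.
\<close>

lemma dim_crossing:
  assumes t: "t \<in> einterval a b" and A: "block Inl Inl A = Y t" "block Inr Inl A = U t"
  shows "dim ((\<lambda>v. A *v v) ` dirichlet_subspace \<inter> dirichlet_subspace) = dim (kernel t)"
proof -
  define f where "f x = dirichlet_vector (Y t *v x)" for x
  have lin: "linear f"
  proof (rule linearI)
    show "f (x + y) = f x + f y" for x y unfolding vec_eq_iff
    proof
      fix k show "f (x + y) $ k = (f x + f y) $ k" by (cases k) (simp_all add: f_def matrix_vector_right_distrib)
    qed
    show "f (r *\<^sub>R x) = r *\<^sub>R f x" for r x unfolding vec_eq_iff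
    proof
      fix k show "f (r *\<^sub>R x) $ k = (r *\<^sub>R f x) $ k" by (cases k) (simp_all add: f_def matrix_vector_mult_scaleR)
    qed
  qed
  have mem: "A *v dirichlet_vector x \<in> dirichlet_subspace \<longleftrightarrow> x \<in> kernel t" for x
    by (simp add: dirichlet_subspace_def mult_dirichlet_vector A kernel_def vec_eq_iff)
  have val: "A *v dirichlet_vector x = f x" if x: "x \<in> kernel t" for x unfolding vec_eq_iff
  proof
    fix k
    have "U t *v x = 0" using x by (simp add: kernel_def)
    then show "(A *v dirichlet_vector x) $ k = f x $ k" by (cases k) (simp_all add: mult_dirichlet_vector A f_def)
  qed
  have "(\<lambda>v. A *v v) ` dirichlet_subspace \<inter> dirichlet_subspace = f ` kernel t"
  proof (intro equalityI subsetI)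
    fix y assume y: "y \<in> (\<lambda>v. A *v v) ` dirichlet_subspace \<inter> dirichlet_subspace"
    then obtain x where x: "y = A *v dirichlet_vector x" unfolding dirichlet_subspace_eq by blast
    have "x \<in> kernel t" using y unfolding x mem[symmetric] by blast
    then show "y \<in> f ` kernel t" unfolding x val[OF \<open>x \<in> kernel t\<close>] by (rule imageI)
  next
    fix y assume "y \<in> f ` kernel t"
    then obtain x where x: "x \<in> kernel t" "y = f x" by blast
    have "dirichlet_vector x \<in> dirichlet_subspace" unfolding dirichlet_subspace_eq by (rule rangeI)
    then have "A *v dirichlet_vector x \<in> (\<lambda>v. A *v v) ` dirichlet_subspace" by (rule imageI)
    moreover have "A *v dirichlet_vector x \<in> dirichlet_subspace" using x(1) by (simp only: mem)
    ultimately show "y \<in> (\<lambda>v. A *v v) ` dirichlet_subspace \<inter> dirichlet_subspace"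
      unfolding x(2) val[OF x(1), symmetric] by (rule IntI)
  qed
  moreover have "inj_on f (span (kernel t))" unfolding linear_injective_on_subspace_0[OF lin subspace_span]
  proof (intro ballI impI)
    fix x assume x: "x \<in> span (kernel t)" "f x = 0"
    have k: "x \<in> kernel t" using x(1) subspace_kernel by (simp add: span_eq_iff[THEN iffD2])
    have "Y t *v x = 0" unfolding vec_eq_iff
    proof
      fix i
      have "f x $ Inl i = 0" using x(2) by simp
      then show "(Y t *v x) $ i = 0 $ i" by (simp add: f_def)
    qed
    then show "x = 0" using nondegenerate[OF t] k by (simp add: kernel_def)
  qed
  ultimately show ?thesis using dim_image_eq[OF lin] by simp
qed

lemma index_eq_kernel_sum:
  assumes reg: regular
  shows "sl_morse_index P Q R a b = (\<Sum>\<^sub>\<infinity>t\<in>einterval a b. enat (dim (kernel t)))"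
proof -
  let ?N = "{k::nat. \<exists>u. (\<forall>i<k. u i \<in> test_functions a b) \<and> negative_definite {..<k} (\<lambda>i j. form (u i) (u j))}"
  let ?S = "(SUP T\<in>{T. finite T \<and> T \<subseteq> einterval a b}. \<Sum>t\<in>T. enat (dim (kernel t)))"
  have "sl_morse_index P Q R a b = ?S" unfolding sl_morse_index_eq[OF bounded]
  proof (rule antisym)
    show "(SUP k\<in>?N. enat k) \<le> ?S"
    proof (rule SUP_least)
      fix k :: nat assume "k \<in> ?N"
      then obtain u where u: "\<And>i. i < k \<Longrightarrow> u i \<in> test_functions a b" "negative_definite {..<k} (\<lambda>i j. form (u i) (u j))" by blast
      have "\<exists>T. finite T \<and> T \<subseteq> conjugate_points \<and> k \<le> (\<Sum>t\<in>T. dim (kernel t))"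
        by (rule index_upper_bound[of k u]) (use u in auto)
      then obtain T where T: "finite T" "T \<subseteq> conjugate_points" "k \<le> (\<Sum>t\<in>T. dim (kernel t))" by blast
      have T': "T \<in> {T. finite T \<and> T \<subseteq> einterval a b}" using T(1,2) by (auto simp: conjugate_points_def)
      have "enat k \<le> (\<Sum>t\<in>T. enat (dim (kernel t)))"
        using T(3) by (simp add: of_nat_eq_enat[symmetric] of_nat_sum[symmetric] del: of_nat_sum)
      then show "enat k \<le> ?S" by (rule order_trans) (rule SUP_upper[OF T'])
    qed
    show "?S \<le>
        (SUP k\<in>?N. enat k)"
    proof (rule SUP_least)
      fix T assume "T \<in> {T. finite T \<and> T \<subseteq> einterval a b}"
      then have T: "finite T" "T \<subseteq> einterval a b" by auto
      have "(\<Sum>t\<in>T. enat (dim (kernel t))) = enat (\<Sum>t\<in>T. dim (kernel t))" by (simp add: of_nat_eq_enat[symmetric])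
      also have "\<dots> \<le> (SUP k\<in>?N. enat k)" by (rule SUP_upper, rule CollectI, rule index_lower_bound[OF reg T])
      finally show "(\<Sum>t\<in>T. enat (dim (kernel t))) \<le>
        (SUP k\<in>?N. enat k)" .
    qed
  qed
  also have "\<dots> = (\<Sum>\<^sub>\<infinity>t\<in>einterval a b. enat (dim (kernel t)))" by (rule nonneg_infsum_complete[symmetric]) simp
  finally show ?thesis .
qed

end

lemma index_eq_crossing_sum:
  assumes sl: "sturm_liouville a b P Q R" and bounded: "sl_form_bounded_below P Q R a b"
    and endpoint: "a = ereal t0 \<or> b = ereal t0" and reg: "regular_along P Q R (at t0 within einterval a b)"
    and \<gamma>: "fundamental_solution P Q R a b t0 \<gamma>"
  shows "sl_morse_index P Q R a b = crossing_sum a b \<gamma>"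
proof -
  have jac: "jacobi a b P Q R t0" by (intro jacobi.intro jacobi_axioms.intro sl endpoint)
  have g1: "\<gamma> t0 = mat 1" and gc: "continuous_on (insert t0 (einterval a b)) \<gamma>"
    and gd: "\<And>t. t \<in> einterval a b \<Longrightarrow> (\<gamma> has_vector_derivative hamiltonian_matrix P Q R t ** \<gamma> t) (at t)"
    using \<gamma> unfolding fundamental_solution_def by blast+
  have sol: "jacobi.solution a b P Q R t0 (\<lambda>t. block Inl c (\<gamma> t)) (\<lambda>t. block Inr c (\<gamma> t))" for c
    unfolding jacobi.solution_def[OF jac]
  proof (intro conjI ballI)
    show "continuous_on (insert t0 (einterval a b)) (\<lambda>t. block Inl c (\<gamma> t))"
      "continuous_on (insert t0 (einterval a b)) (\<lambda>t. block Inr c (\<gamma> t))"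
      by (rule bounded_linear.continuous_on[OF bounded_linear_block gc])+
    fix t assume t: "t \<in> einterval a b"
    let ?y = "block Inl c (\<gamma> t)" and ?u = "block Inr c (\<gamma> t)" and ?W = "matrix_inv (P t)"
    have "?W ** ?y + (- (?W ** Q t)) ** ?u = ?W ** (?y - Q t ** ?u)"
      by (simp add: bounded_bilinear.diff_right[OF bounded_bilinear_matrix_matrix]
          bounded_bilinear.minus_left[OF bounded_bilinear_matrix_matrix] matrix_mul_assoc)
    then show "((\<lambda>t. block Inr c (\<gamma> t)) has_vector_derivative ?W ** (?y - Q t ** ?u)) (at t)"
      using bounded_linear.has_vector_derivative[OF bounded_linear_block[of Inr c] gd[OF t]]
      by (simp add: block_mult block_hamiltonian)
    have "(transpose (Q t) ** ?W) ** ?y + (R t - transpose (Q t) ** ?W ** Q t) ** ?u =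
        transpose (Q t) ** (?W ** (?y - Q t ** ?u)) + R t ** ?u"
      by (simp add: bounded_bilinear.diff_right[OF bounded_bilinear_matrix_matrix]
          bounded_bilinear.diff_left[OF bounded_bilinear_matrix_matrix] matrix_mul_assoc)
    then show "((\<lambda>t. block Inl c (\<gamma> t)) has_vector_derivative transpose (Q t) ** (?W ** (?y - Q t ** ?u)) + R t ** ?u) (at t)"
      using bounded_linear.has_vector_derivative[OF bounded_linear_block[of Inl c] gd[OF t]]
      by (simp add: block_mult block_hamiltonian)
  qed
  interpret conjugate a b P Q R t0 "\<lambda>t. block Inl Inl (\<gamma> t)" "\<lambda>t. block Inr Inl (\<gamma> t)"
    "\<lambda>t. block Inl Inr (\<gamma> t)" "\<lambda>t. block Inr Inr (\<gamma> t)"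
    by (intro conjugate.intro conjugate_axioms.intro jac sol bounded) (simp_all add: g1 block_mat_1)
  have "sl_morse_index P Q R a b = (\<Sum>\<^sub>\<infinity>t\<in>einterval a b. enat (dim (kernel t)))" by (rule index_eq_kernel_sum[OF reg])
  also have "\<dots> = crossing_sum a b \<gamma>" unfolding crossing_sum_def by (rule infsum_cong) (simp add: dim_crossing)
  finally show ?thesis .
qed

lemma regular_along_mono:
  assumes "G \<le> F" "regular_along P Q R F" shows "regular_along P Q R G"
proof -
  obtain P0 Q0 R0 where "invertible P0" "(P \<longlongrightarrow> P0) F" "(Q \<longlongrightarrow> Q0) F" "(R \<longlongrightarrow> R0) F"
    using assms(2) unfolding regular_along_def by blast
  then show ?thesis unfolding regular_along_def
    by (intro exI[of _ P0] exI[of _ Q0] exI[of _ R0] conjI tendsto_mono[OF assms(1)])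
qed

theorem theorem3:
  fixes a b :: ereal and P Q R :: "real \<Rightarrow> real^'n^'n"
  assumes "a < b"
    and "sl_coefficients a b P Q R"
    and "sl_form_bounded_below P Q R a b"
  shows "(regular_left_endpoint P Q R a \<longrightarrow>
            ((\<lambda>\<sigma>. sl_morse_index P Q R a \<sigma>) \<longlongrightarrow> sl_morse_index P Q R a b) (at_left b) \<and>
            (\<forall>\<gamma>. fundamental_solution P Q R a b (real_of_ereal a) \<gamma> \<longrightarrow>
               sl_morse_index P Q R a b = crossing_sum a b \<gamma>)) \<and>
         (regular_right_endpoint P Q R b \<longrightarrow>
            ((\<lambda>\<sigma>. sl_morse_index P Q R \<sigma> b) \<longlongrightarrow> sl_morse_index P Q R a b) (at_right a) \<and>
            (\<forall>\<gamma>. fundamental_solution P Q R a b (real_of_ereal b) \<gamma> \<longrightarrow>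
               sl_morse_index P Q R a b = crossing_sum a b \<gamma>))"
proof (intro conjI impI allI)
  have sl: "sturm_liouville a b P Q R" by (rule sturm_liouville.intro[OF assms(1,2)])
  show "((\<lambda>\<sigma>. sl_morse_index P Q R a \<sigma>) \<longlongrightarrow> sl_morse_index P Q R a b) (at_left b)"
  proof (rule sl_morse_index_exhaustion[OF sl assms(3)])
    show "\<forall>\<^sub>F \<sigma> in at_left b. a \<le> a \<and> a < \<sigma> \<and> \<sigma> \<le> b"
      unfolding eventually_at_left[OF assms(1)] by (intro exI[of _ a]) (auto simp: assms(1) intro: less_imp_le)
    show "\<forall>\<^sub>F \<sigma> in at_left b. a < ereal p \<and> ereal q < \<sigma>" if "a < ereal p" "ereal q < b" for p q
      unfolding eventually_at_left[OF assms(1)] using that by blast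
  qed
  show "((\<lambda>\<sigma>. sl_morse_index P Q R \<sigma> b) \<longlongrightarrow> sl_morse_index P Q R a b) (at_right a)"
  proof (rule sl_morse_index_exhaustion[OF sl assms(3)])
    show "\<forall>\<^sub>F \<sigma> in at_right a. a \<le> \<sigma> \<and> \<sigma> < b \<and> b \<le> b"
      unfolding eventually_at_right[OF assms(1)] by (intro exI[of _ b]) (auto simp: assms(1) intro: less_imp_le)
    show "\<forall>\<^sub>F \<sigma> in at_right a. \<sigma> < ereal p \<and> ereal q < b" if "a < ereal p" "ereal q < b" for p q
      unfolding eventually_at_right[OF assms(1)] using that by blast
  qed
  fix \<gamma> :: "real \<Rightarrow> real^('n + 'n)^('n + 'n)"
  {
    assume reg: "regular_left_endpoint P Q R a" and \<gamma>: "fundamental_solution P Q R a b (real_of_ereal a) \<gamma>"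
    let ?t = "real_of_ereal a"
    have a: "a = ereal ?t" using reg by (simp add: regular_left_endpoint_def ereal_real)
    have "einterval a b \<subseteq> {?t<..}" by (subst a) (auto simp: einterval_iff)
    then have "at ?t within einterval a b \<le> at_right ?t" by (rule at_le)
    moreover have "regular_along P Q R (at_right ?t)" using reg by (simp add: regular_left_endpoint_def)
    ultimately have "regular_along P Q R (at ?t within einterval a b)" by (rule regular_along_mono)
    from index_eq_crossing_sum[OF sl assms(3) disjI1[OF a] this \<gamma>]
    show "sl_morse_index P Q R a b = crossing_sum a b \<gamma>" .
  next
    assume reg: "regular_right_endpoint P Q R b" and \<gamma>: "fundamental_solution P Q R a b (real_of_ereal b) \<gamma>"
    let ?t = "real_of_ereal b"
    have b: "b = ereal ?t" using reg by (simp add: regular_right_endpoint_def ereal_real)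
    have "einterval a b \<subseteq> {..<?t}" by (subst b) (auto simp: einterval_iff)
    then have "at ?t within einterval a b \<le> at_left ?t" by (rule at_le)
    moreover have "regular_along P Q R (at_left ?t)" using reg by (simp add: regular_right_endpoint_def)
    ultimately have "regular_along P Q R (at ?t within einterval a b)" by (rule regular_along_mono)
    from index_eq_crossing_sum[OF sl assms(3) disjI2[OF b] this \<gamma>]
    show "sl_morse_index P Q R a b = crossing_sum a b \<gamma>" .
  }
qed

end
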